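(* Let $\Omega\subset\mathbb{R}^d$ be a bounded open domain. For every real $p>d$ let $g_p\in W^{1,p}(\Omega)\cap C(\overline\Omega)$ and let $u_p\in W^{1,p}(\Omega)\cap C(\overline\Omega)$ be the solution of $\Delta_p u=0$ in $\Omega$, $u=g_p$ on $\partial\Omega$. Let $g_\infty\in W^{1,\infty}(\Omega)\cap C(\overline\Omega)$ with $g_\infty|_{\partial\Omega}$ Lipschitz continuous, and let $u_\infty\in W^{1,\infty}(\Omega)\cap C(\overline\Omega)$ be the solution of $\Delta_\infty u=0$ in $\Omega$, $u=g_\infty$ on $\partial\Omega$. Assume that for every $p>d$ one has $u_p\in C^{0,\alpha_p}(\overline\Omega)$ for some $\alpha_p\in[1-\tfrac dp,1]$, and that $$\mathsf H:=\limsup_{p\to\infty}\,[u_p]_{0,\alpha_p}<\infty .$$ Then there exists a constant $C=C(\Omega,\mathsf H,\|u_\infty\|_{0,1})\in(0,\infty)$, depending only on $\Omega$, $\mathsf H$ and $\|u_\infty\|_{0,1}$, such that for all sufficiently large $p>d$ $$\|u_p-u_\infty\|_\infty\le C\left(\frac{d-1}{p-1}\right)^{\frac{\alpha_p}{2\alpha_p+2}}+\max_{\partial\Omega}|g_p-g_\infty| .$$ If moreover $\gamma:=\operatorname{ess\,inf}_\Omega|\nabla u_\infty|>0$, then there is a constant $C=C(\Omega,\mathsf H,\|u_\infty\|_{0,1})\in(0,\infty)$, depending only on the same quantities, such that for all sufficiently large $p>d$ $$\|u_p-u_\infty\|_\infty\le \frac{C}{\gamma^2}\left(\frac{d-1}{p-1}\right)^{\frac{\alpha_p}{2}}+\max_{\partial\Omega}|g_p-g_\infty|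 .$$
   Context: No regularity of $\partial\Omega$ is assumed. Norms: $\|u\|_\infty:=\sup_{\overline\Omega}|u|$; for $\alpha\in(0,1]$, $[u]_{0,\alpha}:=\sup\{|u(x)-u(y)|/|x-y|^\alpha : x,y\in\overline\Omega,\ x\ne y\}$ and $\|u\|_{0,\alpha}:=\|u\|_\infty+[u]_{0,\alpha}$; $C^{0,\alpha}(\overline\Omega)$ is the space of continuous functions on $\overline\Omega$ with $\|u\|_{0,\alpha}<\infty$. $W^{1,p}_0(\Omega)$ is the closure of the compactly supported smooth functions on $\Omega$ in the $W^{1,p}$ norm. Solution of the $p$-Laplace problem ($p>d$): given $g_p\in W^{1,p}(\Omega)\cap C(\overline\Omega)$, a function $u_p\in W^{1,p}(\Omega)\cap C(\overline\Omega)$ solves $\Delta_p u=0$ in $\Omega$, $u=g_p$ on $\partial\Omega$ (where formally $\Delta_p u=\operatorname{div}(|\nabla u|^{p-2}\nabla u)$) if $u_p=g_p$ on $\partial\Omega$ and $\int_\Omega|\nabla u_p|^p\,dx\le\int_\Omega|\nabla v|^p\,dx$ for all $v\in W^{1,p}(\Omega)$ with $v-g_p\in W^{1,p}_0(\Omega)$. Solution of the infinity-Laplace problem: a function $u_\infty\in C(\overline\Omega)$ solves $\Delta_\infty u=0$ in $\Omega$, $u=g_\infty$ on $\partial\Omega$ if $u_\infty$ is a viscosity solution of $\Delta_\infty u:=\langle\nabla u,D^2u\,\nabla u\rangle=0$ in $\Omega$ and $u_\infty=g_\infty$ on $\partial\Omega$. *)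

theory Defs
  imports "HOL-Analysis.Analysis" "HOL-Probability.Essential_Supremum"
begin

text \<open>
  Functions on \<open>\<Omega>\<close> or on its closure are represented by total functions \<open>'a \<Rightarrow> real\<close>; all notions
  below only look at the values on the relevant set. Norms and seminorms that may be infinite take
  values in \<^typ>\<open>ereal\<close>.
\<close>

subsection \<open>Smooth functions\<close>

definition gradient :: "('a::euclidean_space \<Rightarrow> real) \<Rightarrow> 'a \<Rightarrow> 'a" where
  "gradient f x = (THE D. GDERIV f x :> D)"

text \<open>The class \<open>C\<^sup>k(S)\<close>, for open \<open>S\<close>, by iterated directional derivatives.\<close>

fun Ck_on :: "nat \<Rightarrow> 'a::euclidean_space set \<Rightarrow> ('a \<Rightarrow> real) \<Rightarrow> bool" where
  "Ck_on 0 S f \<longleftrightarrow> continuous_on S f"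
| "Ck_on (Suc k) S f \<longleftrightarrow>
     (\<forall>x\<in>S. f differentiable at x) \<and>
     (\<forall>v. Ck_on k S (\<lambda>x. frechet_derivative f (at x) v))"

definition test_function :: "'a::euclidean_space set \<Rightarrow> ('a \<Rightarrow> real) \<Rightarrow> bool" where
  "test_function \<Omega> \<phi> \<longleftrightarrow>
     (\<forall>k. Ck_on k UNIV \<phi>) \<and> compact (closure {x. \<phi> x \<noteq> 0}) \<and> closure {x. \<phi> x \<noteq> 0} \<subseteq> \<Omega>"

subsection \<open>Sobolev spaces\<close>

definition in_Lp :: "'a::euclidean_space set \<Rightarrow> real \<Rightarrow> ('a \<Rightarrow> 'b::euclidean_space) \<Rightarrow> bool" where
  "in_Lp \<Omega> p f \<longleftrightarrow>
     f \<in> borel_measurable (lebesgue_on \<Omega>) \<and>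
     integrable (lebesgue_on \<Omega>) (\<lambda>x. norm (f x) powr p)"

definition in_Linfty :: "'a::euclidean_space set \<Rightarrow> ('a \<Rightarrow> 'b::euclidean_space) \<Rightarrow> bool" where
  "in_Linfty \<Omega> f \<longleftrightarrow>
     f \<in> borel_measurable (lebesgue_on \<Omega>) \<and>
     esssup (lebesgue_on \<Omega>) (\<lambda>x. ereal (norm (f x))) < \<infinity>"

definition locally_integrable ::
    "'a::euclidean_space set \<Rightarrow> ('a \<Rightarrow> 'b::euclidean_space) \<Rightarrow> bool" where
  "locally_integrable \<Omega> f \<longleftrightarrow> (\<forall>K. compact K \<and> K \<subseteq> \<Omega> \<longrightarrow> integrable (lebesgue_on K) f)"

definition has_weak_gradient ::
    "'a::euclidean_space set \<Rightarrow> ('a \<Rightarrow> real) \<Rightarrow> ('a \<Rightarrow> 'a) \<Rightarrow> bool" where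
  "has_weak_gradient \<Omega> u G \<longleftrightarrow>
     locally_integrable \<Omega> u \<and> locally_integrable \<Omega> G \<and>
     (\<forall>\<phi>. test_function \<Omega> \<phi> \<longrightarrow>
        (LINT x|lebesgue_on \<Omega>. u x *\<^sub>R gradient \<phi> x) = - (LINT x|lebesgue_on \<Omega>. \<phi> x *\<^sub>R G x))"

text \<open>A representative; weak gradients are unique up to null sets.\<close>

definition weak_gradient :: "'a::euclidean_space set \<Rightarrow> ('a \<Rightarrow> real) \<Rightarrow> 'a \<Rightarrow> 'a" where
  "weak_gradient \<Omega> u = (SOME G. has_weak_gradient \<Omega> u G)"

definition in_W1p :: "'a::euclidean_space set \<Rightarrow> real \<Rightarrow> ('a \<Rightarrow> real) \<Rightarrow> bool" where
  "in_W1p \<Omega> p u \<longleftrightarrow> in_Lp \<Omega> p u \<and> (\<exists>G. has_weak_gradient \<Omega> u G \<and> in_Lp \<Omega> p G)"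

definition in_W1infty :: "'a::euclidean_space set \<Rightarrow> ('a \<Rightarrow> real) \<Rightarrow> bool" where
  "in_W1infty \<Omega> u \<longleftrightarrow> in_Linfty \<Omega> u \<and> (\<exists>G. has_weak_gradient \<Omega> u G \<and> in_Linfty \<Omega> G)"

definition p_energy :: "'a::euclidean_space set \<Rightarrow> real \<Rightarrow> ('a \<Rightarrow> real) \<Rightarrow> real" where
  "p_energy \<Omega> p u = (LINT x|lebesgue_on \<Omega>. norm (weak_gradient \<Omega> u x) powr p)"

definition W1p_norm :: "'a::euclidean_space set \<Rightarrow> real \<Rightarrow> ('a \<Rightarrow> real) \<Rightarrow> real" where
  "W1p_norm \<Omega> p u =
     ((LINT x|lebesgue_on \<Omega>. \<bar>u x\<bar> powr p) + p_energy \<Omega> p u) powr (1 / p)"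

definition in_W1p0 :: "'a::euclidean_space set \<Rightarrow> real \<Rightarrow> ('a \<Rightarrow> real) \<Rightarrow> bool" where
  "in_W1p0 \<Omega> p u \<longleftrightarrow>
     in_W1p \<Omega> p u \<and>
     (\<forall>e>0. \<exists>\<phi>. test_function \<Omega> \<phi> \<and> W1p_norm \<Omega> p (\<lambda>x. u x - \<phi> x) < e)"

definition ess_inf_on :: "'a::euclidean_space set \<Rightarrow> ('a \<Rightarrow> real) \<Rightarrow> ereal" where
  "ess_inf_on \<Omega> f = - esssup (lebesgue_on \<Omega>) (\<lambda>x. - ereal (f x))"

subsection \<open>Supremum and Hoelder norms\<close>

definition sup_norm_on :: "'a set \<Rightarrow> ('a \<Rightarrow> real) \<Rightarrow> ereal" where
  "sup_norm_on S u = (SUP x\<in>S. ereal \<bar>u x\<bar>)"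

definition holder_seminorm :: "'a::euclidean_space set \<Rightarrow> real \<Rightarrow> ('a \<Rightarrow> real) \<Rightarrow> ereal" where
  "holder_seminorm S \<alpha> u =
     (SUP (x, y)\<in>{(x, y). x \<in> S \<and> y \<in> S \<and> x \<noteq> y}. ereal (\<bar>u x - u y\<bar> / norm (x - y) powr \<alpha>))"

definition holder_norm :: "'a::euclidean_space set \<Rightarrow> real \<Rightarrow> ('a \<Rightarrow> real) \<Rightarrow> ereal" where
  "holder_norm S \<alpha> u = sup_norm_on S u + holder_seminorm S \<alpha> u"

definition in_holder_space :: "'a::euclidean_space set \<Rightarrow> real \<Rightarrow> ('a \<Rightarrow> real) \<Rightarrow> bool" where
  "in_holder_space S \<alpha> u \<longleftrightarrow> continuous_on S u \<and> holder_norm S \<alpha> u < \<infinity>"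

subsection \<open>The p-Laplace and infinity-Laplace problems\<close>

definition solves_p_laplace ::
    "'a::euclidean_space set \<Rightarrow> real \<Rightarrow> ('a \<Rightarrow> real) \<Rightarrow> ('a \<Rightarrow> real) \<Rightarrow> bool" where
  "solves_p_laplace \<Omega> p g u \<longleftrightarrow>
     in_W1p \<Omega> p u \<and> continuous_on (closure \<Omega>) u \<and>
     (\<forall>x\<in>frontier \<Omega>. u x = g x) \<and>
     (\<forall>v. in_W1p \<Omega> p v \<and> in_W1p0 \<Omega> p (\<lambda>x. v x - g x) \<longrightarrow> p_energy \<Omega> p u \<le> p_energy \<Omega> p v)"

text \<open>\<open>\<langle>\<nabla>\<phi>, D\<^sup>2\<phi> \<nabla>\<phi>\<rangle>\<close>, where \<open>D\<^sup>2\<phi>\<close> is the derivative of the gradient.\<close>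

definition inf_laplacian :: "('a::euclidean_space \<Rightarrow> real) \<Rightarrow> 'a \<Rightarrow> real" where
  "inf_laplacian \<phi> x =
     gradient \<phi> x \<bullet> frechet_derivative (gradient \<phi>) (at x) (gradient \<phi> x)"

definition viscosity_subsolution :: "'a::euclidean_space set \<Rightarrow> ('a \<Rightarrow> real) \<Rightarrow> bool" where
  "viscosity_subsolution \<Omega> u \<longleftrightarrow>
     (\<forall>\<phi>. \<forall>x\<in>\<Omega>. Ck_on 2 \<Omega> \<phi> \<and> (\<forall>\<^sub>F y in nhds x. u y - \<phi> y \<le> u x - \<phi> x)
        \<longrightarrow> inf_laplacian \<phi> x \<ge> 0)"

definition viscosity_supersolution :: "'a::euclidean_space set \<Rightarrow> ('a \<Rightarrow> real) \<Rightarrow> bool" where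
  "viscosity_supersolution \<Omega> u \<longleftrightarrow>
     (\<forall>\<phi>. \<forall>x\<in>\<Omega>. Ck_on 2 \<Omega> \<phi> \<and> (\<forall>\<^sub>F y in nhds x. u y - \<phi> y \<ge> u x - \<phi> x)
        \<longrightarrow> inf_laplacian \<phi> x \<le> 0)"

definition solves_inf_laplace ::
    "'a::euclidean_space set \<Rightarrow> ('a \<Rightarrow> real) \<Rightarrow> ('a \<Rightarrow> real) \<Rightarrow> bool" where
  "solves_inf_laplace \<Omega> g u \<longleftrightarrow>
     continuous_on (closure \<Omega>) u \<and>
     viscosity_subsolution \<Omega> u \<and> viscosity_supersolution \<Omega> u \<and>
     (\<forall>x\<in>frontier \<Omega>. u x = g x)"

end

theory Submission
  imports Defs "HOL-Real_Asymp.Real_Asymp"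
begin

text \<open>
  Write \<open>d\<close> for the dimension and \<open>\<tau> = (d - 1) / (p - 1)\<close>. The functions \<open>|x|\<^sup>\<beta>\<close> with \<open>\<beta> = 1 - \<tau>\<close> are
  \<open>p\<close>-harmonic off the origin, so \<open>u\<^sub>p\<close> satisfies a comparison principle with them, while \<open>u\<^sub>\<infinity>\<close>
  satisfies comparison with cones, the case \<open>\<beta> = 1\<close>. Let \<open>U\<close> be the supremum of \<open>u\<^sub>p\<close> and \<open>V\<close> the infimum of
  \<open>u\<^sub>\<infinity>\<close> over balls of radius \<open>\<epsilon>\<close>. Then \<open>V\<close> is a supersolution of the discrete equation
  \<open>max V + min V = 2 V\<close> on \<open>\<epsilon>\<close>-balls, and \<open>U\<close> a subsolution up to an error of order \<open>\<tau> \<epsilon>\<^sup>\<alpha>\<close>. If the slope of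
  \<open>V\<close> is at least \<open>\<gamma>\<close>, then \<open>V - \<delta> V\<^sup>2\<close> is a supersolution with a margin \<open>\<delta> \<gamma>\<^sup>2 \<epsilon>\<^sup>2\<close>, and the discrete maximum
  principle gives \<open>u\<^sub>p - u\<^sub>\<infinity> \<le> max |g\<^sub>p - g\<^sub>\<infinity>| + C (\<epsilon>\<^sup>\<alpha> + \<delta>)\<close> as soon as the margin beats the error.
  With a gradient bounded below one takes \<open>\<epsilon> = \<tau>\<^sup>1\<^sup>/\<^sup>2\<close>; in general \<open>V\<close> is first modified, at a cost of order
  \<open>\<gamma>\<close>, so as to have slope at least \<open>\<gamma> = \<epsilon>\<^sup>\<alpha>\<close>, and the balance is \<open>\<epsilon>\<^sup>2\<^sup>\<alpha>\<^sup>+\<^sup>2 = \<tau>\<close>.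
\<close>

subsection \<open>Functions of class \<open>C\<^sup>k\<close>\<close>

text \<open>Two obstacles shape the proof. The p-problem is posed as energy minimality within a
  closure of test functions, over a domain with arbitrary boundary. Hence much of the work goes into
  showing that a continuous perturbation vanishing on the frontier is admissible: flatten its small
  values, then mollify. No Euler-Lagrange equation is derived; minimality is tested against a single
  truncation, and convexity of the energy does the rest. Secondly, there are no barriers at the
  boundary. Close to it both functions are compared with their values at a nearby frontier point by
  the Hoelder and Lipschitz bounds. This costs a multiple of \<epsilon>^\<alpha>, so \<delta> is
  taken of that order too. The error of \<open>U\<close> stems from
  \<open>2 - 2 powr \<beta> \<le> 2 * \<tau>\<close>: a power |x|^\<beta> is not quite linear
  between the radii \<epsilon> and 2 \<epsilon>. Subtracting \<delta> V^2 helps because a strictly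
  concave function of something with slope has a strictly negative second difference. Only upper
  bounds for u_p - u_inf are argued; changing both signs gives the lower ones.\<close>

lemma Ck_on_SucD: "Ck_on (Suc k) S f \<Longrightarrow> Ck_on k S f"
proof (induction k arbitrary: f)
  case 0
  then show ?case
    by (auto intro!: differentiable_imp_continuous_within continuous_at_imp_continuous_on)
next
  case (Suc k)
  then show ?case by (metis Ck_on.simps(2))
qed

lemma Ck_on_subset: "Ck_on k S f \<Longrightarrow> T \<subseteq> S \<Longrightarrow> Ck_on k T f"
  by (induction k arbitrary: f) (auto intro: continuous_on_subset)

text \<open>Replaces the chosen \<open>frechet_derivative\<close> by an explicit derivative, so that
  the closure properties below become inductions that differentiate once.\<close>

lemma Ck_on_SucI:
  assumes "\<And>x. (f has_derivative f' x) (at x)" and "\<And>v. Ck_on k UNIV (\<lambda>x. f' x v)"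
  shows "Ck_on (Suc k) UNIV f"
proof -
  have "frechet_derivative f (at x) = f' x" for x
    using frechet_derivative_at[OF assms(1)[of x]] by simp
  then show ?thesis using assms by (auto simp: differentiable_def)
qed

lemma Ck_on_UNIV_SucD:
  assumes "Ck_on (Suc k) UNIV f"
  shows "(f has_derivative frechet_derivative f (at x)) (at x)"
    and "Ck_on k UNIV (\<lambda>x. frechet_derivative f (at x) v)"
  using assms by (auto simp: frechet_derivative_works)

lemma Ck_on_const: "Ck_on k UNIV (\<lambda>x. c)"
  by (induction k arbitrary: c) (auto intro!: Ck_on_SucI derivative_eq_intros)

lemma Ck_on_add: "Ck_on k UNIV f \<Longrightarrow> Ck_on k UNIV g \<Longrightarrow> Ck_on k UNIV (\<lambda>x. f x + g x)"
proof (induction k arbitrary: f g)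
  case 0
  then show ?case by (simp add: continuous_intros)
next
  case (Suc k)
  show ?case
    by (rule Ck_on_SucI[OF has_derivative_add[OF Ck_on_UNIV_SucD(1) Ck_on_UNIV_SucD(1)]])
      (use Suc.prems in \<open>auto intro!: Suc.IH Ck_on_UNIV_SucD(2) simp del: Ck_on.simps\<close>)
qed

lemma Ck_on_mult: "Ck_on k UNIV f \<Longrightarrow> Ck_on k UNIV g \<Longrightarrow> Ck_on k UNIV (\<lambda>x. f x * g x)"
proof (induction k arbitrary: f g)
  case 0
  then show ?case by (simp add: continuous_intros)
next
  case (Suc k)
  show ?case
    by (rule Ck_on_SucI[OF has_derivative_mult[OF Ck_on_UNIV_SucD(1) Ck_on_UNIV_SucD(1)]])
      (use Suc.prems in \<open>auto intro!: Ck_on_add Suc.IH Ck_on_UNIV_SucD(2) simp del: Ck_on.simps dest: Ck_on_SucD\<close>)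
qed

lemma Ck_on_inner: "Ck_on k UNIV (\<lambda>x. (x - z) \<bullet> v)"
proof (cases k)
  case 0
  then show ?thesis by (simp add: continuous_intros)
next
  case (Suc k)
  have "((\<lambda>x. (x - z) \<bullet> v) has_derivative (\<lambda>h. h \<bullet> v)) (at x)" for x
    by (auto intro!: derivative_eq_intros)
  then show ?thesis unfolding Suc by (rule Ck_on_SucI) (rule Ck_on_const)
qed

lemma Ck_on_norm_sq: "Ck_on k UNIV (\<lambda>x::'a::euclidean_space. (x - z) \<bullet> (x - z))"
proof (cases k)
  case 0
  then show ?thesis by (simp add: continuous_intros)
next
  case (Suc k)
  have "((\<lambda>x. (x - z) \<bullet> (x - z)) has_derivative (\<lambda>h. (x - z) \<bullet> h + h \<bullet> (x - z))) (at x)" for x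
    by (auto intro!: derivative_eq_intros)
  then show ?thesis unfolding Suc
    by (rule Ck_on_SucI) (intro Ck_on_add Ck_on_inner, subst inner_commute, intro Ck_on_inner)
qed

text \<open>The family \<open>exp (-1/t) / t ^ m\<close>, extended by zero, spans a space closed under
  differentiation; \<open>m = 0\<close> is the usual flat function.\<close>

definition flat_exp :: "nat \<Rightarrow> real \<Rightarrow> real" where
  "flat_exp m t = (if t > 0 then exp (- 1 / t) / t ^ m else 0)"

lemma flat_exp_tendsto_0: "(flat_exp m \<longlongrightarrow> 0) (at_right 0)"
proof -
  have "((\<lambda>t. inverse t ^ m / exp (inverse t)) \<longlongrightarrow> (0::real)) (at_right 0)"
    using filterlim_compose[OF tendsto_power_div_exp_0 filterlim_inverse_at_top_right] .
  moreover have "\<forall>\<^sub>F t in at_right 0. inverse t ^ m / exp (inverse t) = flat_exp m t"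
    unfolding eventually_at_right_field
    by (intro exI[of _ 1]) (auto simp: flat_exp_def exp_minus field_simps power_inverse)
  ultimately show ?thesis by (rule Lim_transform_eventually)
qed

lemma flat_exp_deriv:
  "(flat_exp m has_real_derivative (- real m * flat_exp (m + 1) t + flat_exp (m + 2) t)) (at t)"
proof -
  consider "t > 0" | "t < 0" | "t = 0" by linarith
  then show ?thesis
  proof cases
    case 1
    have "((\<lambda>t. exp (- 1 / t) / t ^ m) has_real_derivative
       (- real m * flat_exp (m + 1) t + flat_exp (m + 2) t)) (at t)"
    proof (cases m)
      case 0
      then show ?thesis using 1
        by (auto intro!: derivative_eq_intros simp: flat_exp_def field_simps power2_eq_square)
    next
      case (Suc n)
      show ?thesis using 1 unfolding Suc
        by (auto intro!: derivative_eq_intros simp: flat_exp_def divide_simps)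
           (cases n; simp add: algebra_simps)
    qed
    then show ?thesis
      by (rule has_field_derivative_transform_within_open[where S="{0<..}"])
         (use 1 in \<open>auto simp: flat_exp_def\<close>)
  next
    case 2
    have "((\<lambda>t. 0) has_real_derivative (- real m * flat_exp (m + 1) t + flat_exp (m + 2) t)) (at t)"
      using 2 by (simp add: flat_exp_def)
    then show ?thesis
      by (rule has_field_derivative_transform_within_open[where S="{..<0}"])
         (use 2 in \<open>auto simp: flat_exp_def\<close>)
  next
    case 3
    \<comment> \<open>For \<open>h > 0\<close> the difference quotient at the origin is
      \<open>flat_exp (Suc m) h\<close>, which is already known to tend to 0.\<close>
    have r: "((\<lambda>h. flat_exp m h / h) \<longlongrightarrow> 0) (at_right 0)"
      using flat_exp_tendsto_0[of "Suc m"]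
      by (rule Lim_transform_eventually) (auto simp: eventually_at_right_field flat_exp_def mult.commute intro!: exI[of _ 1])
    have l: "((\<lambda>h. flat_exp m h / h) \<longlongrightarrow> 0) (at_left 0)"
      by (rule tendsto_eventually) (auto simp: eventually_at_left_field flat_exp_def intro!: exI[of _ "-1"])
    show ?thesis using filterlim_split_at[OF l r]
      unfolding 3 DERIV_def by (simp add: flat_exp_def)
  qed
qed

text \<open>The induction runs over all \<open>m\<close> at once, because each derivative raises
  \<open>m\<close> by one or two and multiplies by an affine function.\<close>

lemma Ck_on_flat_exp:
  "Ck_on k UNIV (\<lambda>x::'a::euclidean_space. flat_exp m (c - (x - z) \<bullet> (x - z)))"
proof (induction k arbitrary: m)
  case 0
  have "continuous_on UNIV (flat_exp m)"
    using flat_exp_deriv by (meson DERIV_isCont continuous_at_imp_continuous_on)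
  then show ?case
    by (auto intro!: continuous_on_compose2[where f="\<lambda>x. c - (x - z) \<bullet> (x - z)"] continuous_intros)
next
  case (Suc k)
  let ?d = "\<lambda>t. - real m * flat_exp (m + 1) t + flat_exp (m + 2) t"
  have "((\<lambda>x. flat_exp m (c - (x - z) \<bullet> (x - z))) has_derivative
      (\<lambda>h. ((-1) * ((x - z) \<bullet> h + (x - z) \<bullet> h)) * ?d (c - (x - z) \<bullet> (x - z)))) (at x)" for x :: 'a
  proof (rule DERIV_compose_FDERIV[OF flat_exp_deriv])
    have "((\<lambda>x. (x - z) \<bullet> (x - z)) has_derivative (\<lambda>h. (x - z) \<bullet> h + h \<bullet> (x - z))) (at x)"
      by (auto intro!: derivative_eq_intros)
    from has_derivative_diff[OF has_derivative_const[of c] this]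
    show "((\<lambda>x. c - (x - z) \<bullet> (x - z)) has_derivative
        (\<lambda>h. (- 1) * ((x - z) \<bullet> h + (x - z) \<bullet> h))) (at x)"
      by (simp add: inner_commute)
  qed
  then show ?case
    by (rule Ck_on_SucI) (intro Ck_on_mult Ck_on_add Ck_on_inner Ck_on_const Suc)
qed

subsection \<open>Gradients\<close>

lemma gradient_eqI: "GDERIV f x :> D \<Longrightarrow> gradient f x = D"
proof -
  assume D: "GDERIV f x :> D"
  have "D' = D" if "GDERIV f x :> D'" for D'
  proof -
    have "(\<lambda>h. h \<bullet> D') = (\<lambda>h. h \<bullet> D)"
      using that D has_derivative_unique unfolding gderiv_def by blast
    then have "(D' - D) \<bullet> D' = (D' - D) \<bullet> D" by (rule fun_cong)
    then have "(D' - D) \<bullet> (D' - D) = 0" by (simp add: inner_diff_right)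
    then show ?thesis by simp
  qed
  then show ?thesis unfolding gradient_def using D by blast
qed

lemma has_derivative_imp_GDERIV:
  fixes f :: "'a::euclidean_space \<Rightarrow> real"
  assumes "(f has_derivative f') (at x)"
  shows "GDERIV f x :> (\<Sum>b\<in>Basis. f' b *\<^sub>R b)"
proof -
  interpret bounded_linear f' using assms by (rule has_derivative_bounded_linear)
  have "f' = (\<lambda>h. h \<bullet> (\<Sum>b\<in>Basis. f' b *\<^sub>R b))"
  proof
    fix h
    have "f' h = f' (\<Sum>b\<in>Basis. (h \<bullet> b) *\<^sub>R b)" by (simp add: euclidean_representation)
    also have "\<dots> = h \<bullet> (\<Sum>b\<in>Basis. f' b *\<^sub>R b)"
      by (simp add: sum scaleR inner_sum_right mult.commute)
    finally show "f' h = h \<bullet> (\<Sum>b\<in>Basis. f' b *\<^sub>R b)" .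
  qed
  then show ?thesis using assms unfolding gderiv_def by simp
qed

text \<open>Global C^1 with the gradient carried as data. The truncations, barriers and cut-offs of
  the comparison argument are only C^1, so the calculus of \<open>Ck_on\<close> for all
  \<open>k\<close> does not cover them.\<close>

definition C1_grad :: "('a::euclidean_space \<Rightarrow> real) \<Rightarrow> ('a \<Rightarrow> 'a) \<Rightarrow> bool" where
  "C1_grad f F \<longleftrightarrow> (\<forall>x. GDERIV f x :> F x) \<and> continuous_on UNIV F"

lemma C1_gradD:
  assumes "C1_grad f F"
  shows "GDERIV f x :> F x" "gradient f = F" "continuous_on S f" "continuous_on S F"
    "(f has_derivative (\<lambda>h. h \<bullet> F x)) (at x)"
proof -
  show "GDERIV f x :> F x" for x using assms by (auto simp: C1_grad_def)
  then show *: "(f has_derivative (\<lambda>h. h \<bullet> F x)) (at x)" for x by (simp add: gderiv_def)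
  show "gradient f = F" using assms by (auto simp: C1_grad_def intro: gradient_eqI)
  show "continuous_on S F" using assms by (auto simp: C1_grad_def intro: continuous_on_subset)
  show "continuous_on S f" using * by (meson continuous_at_imp_continuous_on has_derivative_continuous)
qed

lemma Ck_on_Suc0_C1_grad: 
  assumes "Ck_on (Suc 0) UNIV f" shows "C1_grad f (gradient f)"
proof -
  have "GDERIV f x :> (\<Sum>b\<in>Basis. frechet_derivative f (at x) b *\<^sub>R b)" for x
    using assms by (intro has_derivative_imp_GDERIV Ck_on_UNIV_SucD(1))
  moreover from this have "gradient f = (\<lambda>x. \<Sum>b\<in>Basis. frechet_derivative f (at x) b *\<^sub>R b)"
    by (auto intro: gradient_eqI)
  moreover have "continuous_on UNIV (\<lambda>x. \<Sum>b\<in>Basis. frechet_derivative f (at x) b *\<^sub>R b)"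
    using assms by (auto intro!: continuous_intros)
  ultimately show ?thesis unfolding C1_grad_def by simp
qed

lemma C1_grad_test_function: "test_function \<Omega> f \<Longrightarrow> C1_grad f (gradient f)"
  by (auto simp: test_function_def intro: Ck_on_Suc0_C1_grad)

lemma C1_grad_const: "C1_grad (\<lambda>x. c) (\<lambda>x. 0)"
  by (auto simp: C1_grad_def GDERIV_const)

lemma C1_grad_add: "C1_grad f F \<Longrightarrow> C1_grad g G \<Longrightarrow> C1_grad (\<lambda>x. f x + g x) (\<lambda>x. F x + G x)"
  by (simp add: C1_grad_def GDERIV_add continuous_on_add)

lemma C1_grad_mult:
  assumes "C1_grad f F" "C1_grad g G"
  shows "C1_grad (\<lambda>x. f x * g x) (\<lambda>x. f x *\<^sub>R G x + g x *\<^sub>R F x)"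
  using assms C1_gradD(3)[OF assms(1), of UNIV] C1_gradD(3)[OF assms(2), of UNIV]
  by (simp add: C1_grad_def GDERIV_mult continuous_intros)

lemma C1_grad_compose:
  assumes "C1_grad f F" "\<And>s. (T has_real_derivative T' s) (at s)" "continuous_on UNIV T'"
  shows "C1_grad (\<lambda>x. T (f x)) (\<lambda>x. T' (f x) *\<^sub>R F x)"
  unfolding C1_grad_def
proof (intro conjI allI)
  show "GDERIV (\<lambda>x. T (f x)) x :> T' (f x) *\<^sub>R F x" for x
    by (rule GDERIV_DERIV_compose[OF C1_gradD(1)[OF assms(1)] assms(2)])
  show "continuous_on UNIV (\<lambda>x. T' (f x) *\<^sub>R F x)"
    by (intro continuous_on_scaleR continuous_on_compose2[OF assms(3)] C1_gradD(3,4)[OF assms(1)]) simp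
qed

lemma C1_grad_inner: "C1_grad (\<lambda>x. (x - z) \<bullet> v) (\<lambda>x. v)"
  by (auto simp: C1_grad_def gderiv_def intro!: derivative_eq_intros)

lemma C1_grad_norm_sq: "C1_grad (\<lambda>x. (x - z) \<bullet> (x - z)) (\<lambda>x. 2 *\<^sub>R (x - z))"
proof -
  have "((\<lambda>x. (x - z) \<bullet> (x - z)) has_derivative (\<lambda>h. (x - z) \<bullet> h + h \<bullet> (x - z))) (at x)" for x :: 'a
    by (auto intro!: derivative_eq_intros)
  moreover have "(\<lambda>h. (x - z) \<bullet> h + h \<bullet> (x - z)) = (\<lambda>h. h \<bullet> 2 *\<^sub>R (x - z))" for x :: 'a
    by (simp add: inner_commute fun_eq_iff)
  ultimately show ?thesis by (simp add: C1_grad_def gderiv_def continuous_intros)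
qed

subsection \<open>Mollification\<close>

lemma continuous_imp_lebesgue_measurable:
  "continuous_on UNIV f \<Longrightarrow> f \<in> borel_measurable lebesgue"
  by (simp add: borel_measurable_continuous_onI measurable_completion)

lemma integrable_lebesgue_bounded_scaleR:
  fixes f :: "'a::euclidean_space \<Rightarrow> 'b::euclidean_space" and g :: "'a \<Rightarrow> real"
  assumes "g \<in> borel_measurable M" "\<And>x. \<bar>g x\<bar> \<le> B" "integrable M f"
  shows "integrable M (\<lambda>x. g x *\<^sub>R f x)"
proof (rule Bochner_Integration.integrable_bound)
  show "integrable M (\<lambda>x. B *\<^sub>R f x)" using assms(3) by simp
  show "(\<lambda>x. g x *\<^sub>R f x) \<in> borel_measurable M" using assms by simp
  have "B \<ge> 0" using assms(2)[of undefined] by linarith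
  then show "AE x in M. norm (g x *\<^sub>R f x) \<le> norm (B *\<^sub>R f x)"
    using assms(2) by (auto intro!: mult_right_mono)
qed

lemma continuous_zero_off_ball_bounded:
  fixes f :: "'a::euclidean_space \<Rightarrow> 'b::euclidean_space"
  assumes "continuous_on UNIV f" "\<And>x. norm x > R \<Longrightarrow> f x = 0"
  obtains B where "B > 0" "\<And>x. norm (f x) \<le> B"
proof -
  have "compact (f ` cball 0 R)"
    using assms(1) by (auto intro!: compact_continuous_image continuous_on_subset[of UNIV])
  then obtain B where B: "B > 0" "\<And>x. x \<in> cball 0 R \<Longrightarrow> norm (f x) \<le> B"
    using compact_imp_bounded bounded_pos by (metis image_eqI)
  have "norm (f x) \<le> B" for x
    using assms(2)[of x] B by (cases "norm x \<le> R") auto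
  then show ?thesis using that B by blast
qed

lemma continuous_zero_off_ball_uniformly:
  fixes f :: "'a::euclidean_space \<Rightarrow> 'b::euclidean_space"
  assumes "continuous_on UNIV f" "\<And>x. norm x > R \<Longrightarrow> f x = 0" "e > 0"
  obtains d where "d > 0" "\<And>x y. dist x y \<le> d \<Longrightarrow> dist (f x) (f y) < e"
proof -
  have "uniformly_continuous_on (cball 0 (R + 1)) f"
    using assms(1) by (auto intro!: compact_uniformly_continuous continuous_on_subset[of UNIV])
  then obtain d where d: "d > 0" 
    "\<And>x y. x \<in> cball 0 (R+1) \<Longrightarrow> y \<in> cball 0 (R+1) \<Longrightarrow> dist y x < d \<Longrightarrow> dist (f y) (f x) < e"
    unfolding uniformly_continuous_on_def using assms(3) by metis
  show ?thesis
  proof (rule that[of "min (d/2) 1"])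
    show "0 < min (d/2) 1" using d by simp
    fix x y :: 'a assume xy: "dist x y \<le> min (d/2) 1"
    show "dist (f x) (f y) < e"
    proof (cases "x \<in> cball 0 (R+1) \<and> y \<in> cball 0 (R+1)")
      case True
      then show ?thesis using d(2)[of y x] xy d(1) by (auto simp: dist_commute)
    next
      case False
      have "norm x \<le> norm y + 1" "norm y \<le> norm x + 1"
        using xy norm_triangle_ineq2[of x y] norm_triangle_ineq2[of y x]
        by (auto simp: dist_norm norm_minus_commute)
      then have "norm x > R" "norm y > R" using False by auto
      then show ?thesis using assms by simp
    qed
  qed
qed

lemma integrable_continuous_zero_off_ball:
  fixes f :: "'a::euclidean_space \<Rightarrow> 'b::euclidean_space"
  assumes "continuous_on UNIV f" "\<And>x. norm x > R \<Longrightarrow> f x = 0"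
  shows "integrable lborel f" "integrable lebesgue f"
proof -
  have "integrable lborel (\<lambda>x. indicator (cball 0 R) x *\<^sub>R f x)"
    using assms(1) by (intro borel_integrable_compact) (auto intro: continuous_on_subset)
  moreover have "(\<lambda>x. indicator (cball 0 R) x *\<^sub>R f x) = f"
    using assms(2) by (force simp: indicator_def fun_eq_iff)
  ultimately show *: "integrable lborel f" by simp
  show "integrable lebesgue f"
    using * assms(1) by (simp add: integrable_completion borel_measurable_continuous_onI)
qed

lemma lborel_integral_translation:
  fixes f :: "'a::euclidean_space \<Rightarrow> 'b::euclidean_space"
  assumes [measurable]: "f \<in> borel_measurable borel"
  shows "(LINT x|lborel. f (x + c)) = (LINT x|lborel. f x)"
proof -
  have "(LINT x|lborel. f x) = (LINT x|distr lborel borel ((+) c). f x)"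
    by (simp add: lborel_distr_plus)
  also have "\<dots> = (LINT x|lborel. f (c + x))" by (rule integral_distr) auto
  finally show ?thesis by (simp add: add.commute)
qed

section \<open>Normalised bump functions\<close>

definition moll :: "real \<Rightarrow> 'a::euclidean_space \<Rightarrow> real" where
  "moll r x = flat_exp 0 (r\<^sup>2 - x \<bullet> x) / (LINT x|lborel. flat_exp 0 (r\<^sup>2 - (x::'a) \<bullet> x))"

lemma flat_exp_nonneg: "flat_exp m t \<ge> 0"
  by (simp add: flat_exp_def)

lemma flat_exp_ball_continuous: "continuous_on UNIV (\<lambda>x::'a::euclidean_space. flat_exp m (c - x \<bullet> x))"
  using Ck_on_flat_exp[of 0 m c 0] by simp

lemma flat_exp_ball_zero: "r > 0 \<Longrightarrow> norm x \<ge> r \<Longrightarrow> flat_exp m (r\<^sup>2 - x \<bullet> x) = 0"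
proof -
  assume "r > 0" "norm x \<ge> r"
  then have "r\<^sup>2 \<le> x \<bullet> x" unfolding dot_square_norm by (intro power_mono) auto
  then show ?thesis by (simp add: flat_exp_def)
qed

text \<open>A zero integral would force the nonnegative integrand to vanish almost everywhere, but
  it is positive on \<open>ball 0 r\<close>, a set of positive measure. This justifies the division
  in \<open>moll\<close>.\<close>

lemma flat_exp_ball_integral_pos:
  assumes "r > 0" shows "(LINT x|lborel. flat_exp 0 (r\<^sup>2 - (x::'a::euclidean_space) \<bullet> x)) > 0"
proof -
  let ?f = "\<lambda>x::'a. flat_exp 0 (r\<^sup>2 - x \<bullet> x)"
  have int: "integrable lborel ?f"
    by (rule integrable_continuous_zero_off_ball(1)[where R=r])
       (auto simp: flat_exp_ball_continuous flat_exp_ball_zero assms)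
  have "(LINT x|lborel. ?f x) \<noteq> 0"
  proof
    assume "(LINT x|lborel. ?f x) = 0"
    then have "AE x in lborel. ?f x = 0"
      using integral_nonneg_eq_0_iff_AE[OF int] by (simp add: flat_exp_nonneg)
    then have "AE x in lborel. x \<notin> ball (0::'a) r"
    proof eventually_elim
      case (elim x)
      then show ?case
        using power_strict_mono[of "norm x" r 2] by (auto simp: flat_exp_def dot_square_norm split: if_splits)
    qed
    then have "emeasure lborel (ball (0::'a) r) = 0"
      by (subst (asm) AE_iff_measurable[where N="ball 0 r"]) auto
    then show False using content_ball_pos[OF assms, of "0::'a"] by (simp add: measure_def)
  qed
  moreover have "(LINT x|lborel. ?f x) \<ge> 0" by (simp add: flat_exp_nonneg)
  ultimately show ?thesis by simp
qed

context
  fixes r :: real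
  assumes r: "r > 0"
begin

lemma moll_nonneg: "moll r x \<ge> 0"
  by (simp add: moll_def flat_exp_nonneg)

lemma moll_zero: "norm x \<ge> r \<Longrightarrow> moll r x = 0"
  using r by (simp add: moll_def flat_exp_ball_zero)

lemma moll_minus: "moll r (- x) = moll r x"
  by (simp add: moll_def)

lemma moll_commute: "moll r (x - y) = moll r (y - x)"
  by (metis moll_minus minus_diff_eq)

lemma Ck_on_moll: "Ck_on k UNIV (\<lambda>x. moll r (x - z))"
  unfolding moll_def divide_inverse by (intro Ck_on_mult Ck_on_flat_exp Ck_on_const)

lemma continuous_moll: "continuous_on UNIV (moll r)"
  using Ck_on_moll[of 0 0] by simp

lemma integral_moll: "(LINT x|lborel. moll r (x::'a::euclidean_space)) = 1"
  using flat_exp_ball_integral_pos[OF r, where ?'a='a] by (simp add: moll_def)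

lemma borel_measurable_moll [measurable]: "moll r \<in> borel_measurable borel"
  using continuous_moll by (rule borel_measurable_continuous_onI)

lemma integral_moll_translate: "(LINT x|lborel. moll r (x - z)) = 1" "(LINT x|lborel. moll r (z - x)) = 1"
  using lborel_integral_translation[of "moll r" "- z"] by (simp_all add: integral_moll moll_commute[of z])

lemma integrable_moll_translate: "integrable lborel (\<lambda>x. moll r (x - z))" "integrable lborel (\<lambda>x. moll r (z - x))"
proof -
  have z: "moll r (x - z) = 0" if "norm x > norm z + r" for x
    using that norm_triangle_ineq2[of x z] by (intro moll_zero) auto
  show "integrable lborel (\<lambda>x. moll r (x - z))"
    by (rule integrable_continuous_zero_off_ball(1)[OF _ z])
       (use Ck_on_moll[of 0 z] in auto)
  then show "integrable lborel (\<lambda>x. moll r (z - x))" by (simp add: moll_commute[of z])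
qed

lemma test_function_moll:
  assumes "cball z r \<subseteq> \<Omega>" shows "test_function \<Omega> (\<lambda>x. moll r (x - z))"
proof -
  have "{x. moll r (x - z) \<noteq> 0} \<subseteq> cball z r"
    using moll_zero by (force simp: dist_norm norm_minus_commute not_le)
  then have "closure {x. moll r (x - z) \<noteq> 0} \<subseteq> cball z r"
    by (simp add: closure_minimal)
  moreover from this have "compact (closure {x. moll r (x - z) \<noteq> 0})"
    by (simp add: compact_eq_bounded_closed bounded_subset[OF bounded_cball])
  ultimately show ?thesis unfolding test_function_def using assms Ck_on_moll by blast
qed

end

text \<open>Vector values are allowed so that a function and its weak gradient are smoothed by one
  operator. The measure is \<open>lebesgue\<close> because Sobolev functions are only Lebesgue
  measurable; functions given on a subset enter through their extension by zero.\<close>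

definition conv :: "real \<Rightarrow> ('a::euclidean_space \<Rightarrow> 'b::euclidean_space) \<Rightarrow> 'a \<Rightarrow> 'b" where
  "conv r f x = (LINT y|lebesgue. moll r (x - y) *\<^sub>R f y)"

lemma borel_measurable_lebesgue_translate:
  "continuous_on UNIV g \<Longrightarrow> (\<lambda>y::'a::euclidean_space. g (x - y)) \<in> borel_measurable lebesgue"
  by (rule continuous_imp_lebesgue_measurable)
     (auto intro!: continuous_on_compose2[of UNIV g] continuous_intros)

text \<open>A modulus of continuity of \<open>F\<close> that is uniform in space gives a first-order
  Taylor remainder uniform in the base point \<open>a\<close>. This is what allows differentiation
  under the convolution integral.\<close>

lemma C1_increment_bound:
  fixes \<psi> :: "'a::euclidean_space \<Rightarrow> real"
  assumes "C1_grad \<psi> F" "\<And>x y. dist x y \<le> d \<Longrightarrow> dist (F x) (F y) < e" "norm h \<le> d"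
  shows "\<bar>\<psi> (a + h) - \<psi> a - h \<bullet> F a\<bar> \<le> norm h * e"
proof -
  have "norm (\<psi> (a + h) - \<psi> a - (\<lambda>v. v \<bullet> F a) ((a + h) - a)) \<le> norm ((a + h) - a) * e"
  proof (rule differentiable_bound_linearization[where S="cball a (norm h)" and f'="\<lambda>x v. v \<bullet> F x"])
    show "a + t *\<^sub>R (a + h - a) \<in> cball a (norm h)" if "t \<in> {0..1}" for t
      using that by (auto simp: dist_norm mult_left_le_one_le)
    show "(\<psi> has_derivative (\<lambda>v. v \<bullet> F x)) (at x within cball a (norm h))" for x
      using C1_gradD(5)[OF assms(1)] by (rule has_derivative_at_withinI)
    fix x assume x: "x \<in> cball a (norm h)"
    have "dist (F x) (F a) < e" using x assms(3) by (intro assms(2)) (simp add: dist_commute)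
    then have "norm (F x - F a) \<le> e" by (simp add: dist_norm)
    then show "onorm ((\<lambda>v. v \<bullet> F x) - (\<lambda>v. v \<bullet> F a)) \<le> e"
    proof (intro onorm_le)
      fix v
      have "norm (((\<lambda>v. v \<bullet> F x) - (\<lambda>v. v \<bullet> F a)) v) = \<bar>v \<bullet> (F x - F a)\<bar>"
        by (simp add: inner_diff_right)
      also have "\<dots> \<le> norm v * norm (F x - F a)" by (rule Cauchy_Schwarz_ineq2)
      also have "\<dots> \<le> norm v * e" using \<open>norm (F x - F a) \<le> e\<close> by (rule mult_left_mono) simp
      finally show "norm (((\<lambda>v. v \<bullet> F x) - (\<lambda>v. v \<bullet> F a)) v) \<le> e * norm v" by (simp add: mult.commute)
    qed
  qed simp
  then show ?thesis by simp
qed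

lemma convolution_has_derivative:
  fixes f :: "'a::euclidean_space \<Rightarrow> 'b::euclidean_space"
  assumes \<psi>: "C1_grad \<psi> F" "\<And>x. norm x > R \<Longrightarrow> \<psi> x = 0" "\<And>x. norm x > R \<Longrightarrow> F x = 0"
    and f: "integrable lebesgue f"
  shows "((\<lambda>x. LINT y|lebesgue. \<psi> (x - y) *\<^sub>R f y) has_derivative
           (\<lambda>h. LINT y|lebesgue. (h \<bullet> F (x - y)) *\<^sub>R f y)) (at x)"
proof -
  have cF: "continuous_on UNIV F" and c\<psi>: "continuous_on UNIV \<psi>" using C1_gradD \<psi>(1) by blast+
  obtain B1 where B1: "\<And>x. norm (\<psi> x) \<le> B1"
    using continuous_zero_off_ball_bounded[OF c\<psi> \<psi>(2)] by metis
  obtain B2 where B2: "\<And>x. norm (F x) \<le> B2" "B2 > 0"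
    using continuous_zero_off_ball_bounded[OF cF \<psi>(3)] by metis
  have i1: "integrable lebesgue (\<lambda>y. \<psi> (x - y) *\<^sub>R f y)" for x
    by (rule integrable_lebesgue_bounded_scaleR[where B=B1, OF _ _ f])
       (use B1 borel_measurable_lebesgue_translate[OF c\<psi>] in auto)
  have inn: "\<bar>h \<bullet> F z\<bar> \<le> norm h * B2" for h z
    using Cauchy_Schwarz_ineq2[of h "F z"] B2(1)[of z]
    by (meson mult_left_mono norm_ge_zero order_trans)
  have i2: "integrable lebesgue (\<lambda>y. (h \<bullet> F (x - y)) *\<^sub>R f y)" for x h
    by (rule integrable_lebesgue_bounded_scaleR[where B="norm h * B2", OF _ inn f])
       (intro borel_measurable_lebesgue_translate[where g="\<lambda>z. h \<bullet> F z"] continuous_intros cF)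
  \<comment> \<open>The summand 1 keeps the division by \<open>A\<close> legitimate when
    \<open>f\<close> vanishes almost everywhere.\<close>
  define A where "A = (LINT y|lebesgue. norm (f y)) + 1"
  have A: "A > 0" unfolding A_def by (simp add: add_nonneg_pos)
  have bl: "bounded_linear (\<lambda>h. LINT y|lebesgue. (h \<bullet> F (x - y)) *\<^sub>R f y)"
  proof (rule bounded_linear_intro[where K="B2 * A"])
    show "(LINT y|lebesgue. ((h + k) \<bullet> F (x - y)) *\<^sub>R f y) =
      (LINT y|lebesgue. (h \<bullet> F (x - y)) *\<^sub>R f y) + (LINT y|lebesgue. (k \<bullet> F (x - y)) *\<^sub>R f y)" for h k
      by (simp add: inner_add_left scaleR_add_left i2)
    show "(LINT y|lebesgue. ((s *\<^sub>R h) \<bullet> F (x - y)) *\<^sub>R f y) =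
      s *\<^sub>R (LINT y|lebesgue. (h \<bullet> F (x - y)) *\<^sub>R f y)" for s h
      by (simp flip: integral_scaleR_right scaleR_scaleR)
    show "norm (LINT y|lebesgue. (h \<bullet> F (x - y)) *\<^sub>R f y) \<le> norm h * (B2 * A)" for h
    proof -
      have "norm (LINT y|lebesgue. (h \<bullet> F (x - y)) *\<^sub>R f y) \<le> (LINT y|lebesgue. (norm h * B2) * norm (f y))"
        by (rule Bochner_Integration.integral_norm_bound_integral[OF i2]) (use f inn in \<open>auto intro!: mult_right_mono\<close>)
      also have "\<dots> \<le> (norm h * B2) * A" unfolding A_def
        using B2(2) by (simp add: mult_left_mono)
      finally show ?thesis by (simp add: mult.assoc)
    qed
  qed
  show ?thesis unfolding has_derivative_at_alt
  proof (intro conjI allI impI bl)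
    fix e :: real assume "e > 0"
    then have "e / A > 0" using A by simp
    then obtain d where d: "d > 0" "\<And>x y. dist x y \<le> d \<Longrightarrow> dist (F x) (F y) < e / A"
      using continuous_zero_off_ball_uniformly[OF cF \<psi>(3)] by metis
    show "\<exists>d>0. \<forall>x'. norm (x' - x) < d \<longrightarrow>
       norm ((LINT y|lebesgue. \<psi> (x' - y) *\<^sub>R f y) - (LINT y|lebesgue. \<psi> (x - y) *\<^sub>R f y)
          - (LINT y|lebesgue. ((x' - x) \<bullet> F (x - y)) *\<^sub>R f y)) \<le> e * norm (x' - x)"
    proof (intro exI[of _ d] conjI allI impI d(1))
      fix x' assume x': "norm (x' - x) < d"
      have "(LINT y|lebesgue. \<psi> (x' - y) *\<^sub>R f y) - (LINT y|lebesgue. \<psi> (x - y) *\<^sub>R f y)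
          - (LINT y|lebesgue. ((x' - x) \<bullet> F (x - y)) *\<^sub>R f y) =
        (LINT y|lebesgue. (\<psi> (x' - y) - \<psi> (x - y) - (x' - x) \<bullet> F (x - y)) *\<^sub>R f y)"
        by (simp add: scaleR_diff_left i1 i2)
      also have "norm \<dots> \<le> (LINT y|lebesgue. (norm (x' - x) * (e / A)) * norm (f y))"
      proof (rule Bochner_Integration.integral_norm_bound_integral)
        show "integrable lebesgue (\<lambda>y. (\<psi> (x' - y) - \<psi> (x - y) - (x' - x) \<bullet> F (x - y)) *\<^sub>R f y)"
          by (simp add: scaleR_diff_left i1 i2)
        show "integrable lebesgue (\<lambda>y. (norm (x' - x) * (e / A)) * norm (f y))" using f by simp
        fix y
        have "\<bar>\<psi> ((x - y) + (x' - x)) - \<psi> (x - y) - (x' - x) \<bullet> F (x - y)\<bar> \<le> norm (x' - x) * (e / A)"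
          by (rule C1_increment_bound[OF \<psi>(1) d(2)]) (use x' in auto)
        then show "norm ((\<psi> (x' - y) - \<psi> (x - y) - (x' - x) \<bullet> F (x - y)) *\<^sub>R f y)
            \<le> (norm (x' - x) * (e / A)) * norm (f y)"
          unfolding norm_scaleR real_norm_def by (intro mult_right_mono) (simp_all add: diff_add_eq)
      qed
      also have "\<dots> = (norm (x' - x) * (e / A)) * (LINT y|lebesgue. norm (f y))" by simp
      also have "\<dots> \<le> (norm (x' - x) * (e / A)) * A"
        using A \<open>e > 0\<close> by (intro mult_left_mono) (auto simp: A_def)
      also have "\<dots> = e * norm (x' - x)" using A by simp
      finally show "norm ((LINT y|lebesgue. \<psi> (x' - y) *\<^sub>R f y) - (LINT y|lebesgue. \<psi> (x - y) *\<^sub>R f y)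
          - (LINT y|lebesgue. ((x' - x) \<bullet> F (x - y)) *\<^sub>R f y)) \<le> e * norm (x' - x)" .
    qed
  qed
qed

lemma gradient_zero_off_ball:
  assumes "C1_grad \<psi> F" "\<And>x. norm x > R \<Longrightarrow> \<psi> x = 0" "norm x > R"
  shows "F x = 0"
proof -
  have "open {y::'a. norm y > R}" by (simp add: open_Collect_less continuous_intros)
  then have "(\<psi> has_derivative (\<lambda>h. 0)) (at x)"
    using has_derivative_transform_within_open[of "\<lambda>x. 0" "\<lambda>h. 0" x UNIV "{y. norm y > R}" \<psi>] assms by auto
  then have "GDERIV \<psi> x :> 0" by (simp add: gderiv_def)
  then show ?thesis using gradient_eqI C1_gradD(1)[OF assms(1)] by metis
qed

text \<open>All derivatives fall on the kernel: a directional derivative of the convolution is the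
  convolution with a directional derivative of \<open>\<psi>\<close>, again smooth and zero off the
  same ball. The induction therefore quantifies over all kernels.\<close>

lemma Ck_on_convolution:
  fixes f :: "'a::euclidean_space \<Rightarrow> real"
  assumes "\<And>k. Ck_on k UNIV \<psi>" "\<And>x. norm x > R \<Longrightarrow> \<psi> x = 0" and f: "integrable lebesgue f"
  shows "Ck_on k UNIV (\<lambda>x. LINT y|lebesgue. \<psi> (x - y) *\<^sub>R f y)"
proof -
  have *: "Ck_on (Suc k) UNIV (\<lambda>x. LINT y|lebesgue. \<psi> (x - y) *\<^sub>R f y)"
    if IH: "\<And>\<psi>. (\<And>k. Ck_on k UNIV \<psi>) \<Longrightarrow> (\<And>x. norm x > R \<Longrightarrow> \<psi> x = 0) \<Longrightarrow>
        Ck_on k UNIV (\<lambda>x. LINT y|lebesgue. \<psi> (x - y) *\<^sub>R f y)"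
      and \<psi>: "\<And>k. Ck_on k UNIV \<psi>" "\<And>x. norm x > R \<Longrightarrow> \<psi> x = 0" for k \<psi>
  proof -
    have C1: "C1_grad \<psi> (gradient \<psi>)" using \<psi>(1) by (intro Ck_on_Suc0_C1_grad)
    have z: "gradient \<psi> x = 0" if "norm x > R" for x
      using gradient_zero_off_ball[OF C1 \<psi>(2) that] .
    have fd: "frechet_derivative \<psi> (at x) h = h \<bullet> gradient \<psi> x" for x h
      using frechet_derivative_at[OF C1_gradD(5)[OF C1], of x] by (simp add: fun_eq_iff)
    show ?thesis
    proof (rule Ck_on_SucI[OF convolution_has_derivative[OF C1 \<psi>(2) z f]])
      fix v
      have "Ck_on k UNIV (\<lambda>x. frechet_derivative \<psi> (at x) v)" for k
        using \<psi>(1)[of "Suc k"] by (rule Ck_on_UNIV_SucD(2))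
      then show "Ck_on k UNIV (\<lambda>x. LINT y|lebesgue. (v \<bullet> gradient \<psi> (x - y)) *\<^sub>R f y)"
        by (intro IH) (use z in \<open>auto simp: fd\<close>)
    qed auto
  qed
  have "Ck_on 0 UNIV (\<lambda>x. LINT y|lebesgue. \<psi> (x - y) *\<^sub>R f y)"
    if \<psi>: "\<And>k. Ck_on k UNIV \<psi>" "\<And>x. norm x > R \<Longrightarrow> \<psi> x = 0" for \<psi>
  proof -
    have C1: "C1_grad \<psi> (gradient \<psi>)" using \<psi>(1) by (intro Ck_on_Suc0_C1_grad)
    have "isCont (\<lambda>x. LINT y|lebesgue. \<psi> (x - y) *\<^sub>R f y) x" for x
      by (rule has_derivative_continuous,
          rule convolution_has_derivative[OF C1 \<psi>(2) gradient_zero_off_ball[OF C1 \<psi>(2)] f])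
    then show ?thesis by (simp add: continuous_at_imp_continuous_on)
  qed
  then have "\<forall>\<psi>. (\<forall>k. Ck_on k UNIV \<psi>) \<longrightarrow> (\<forall>x. norm x > R \<longrightarrow> \<psi> x = 0) \<longrightarrow> 
     Ck_on k UNIV (\<lambda>x. LINT y|lebesgue. \<psi> (x - y) *\<^sub>R f y)"
    using * by (induction k) blast+
  then show ?thesis using assms by blast
qed

lemma C1_grad_moll: "r > 0 \<Longrightarrow> C1_grad (moll r) (gradient (moll r))"
  using Ck_on_Suc0_C1_grad[OF Ck_on_moll[of r "Suc 0" 0]] by simp

lemma gradient_moll_zero: "r > 0 \<Longrightarrow> norm x > r \<Longrightarrow> gradient (moll r) x = 0"
  by (rule gradient_zero_off_ball[OF C1_grad_moll]) (auto intro: moll_zero)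

lemma Ck_on_conv:
  fixes f :: "'a::euclidean_space \<Rightarrow> real"
  assumes "r > 0" "integrable lebesgue f"
  shows "Ck_on k UNIV (conv r f)"
  unfolding conv_def
  by (rule Ck_on_convolution[where R=r]) (use assms Ck_on_moll[of r _ 0] in \<open>auto intro: moll_zero\<close>)

lemma gradient_conv:
  fixes f :: "'a::euclidean_space \<Rightarrow> real"
  assumes "r > 0" "integrable lebesgue f"
  shows "h \<bullet> gradient (conv r f) x = (LINT y|lebesgue. (h \<bullet> gradient (moll r) (x - y)) *\<^sub>R f y)"
proof -
  have "(conv r f has_derivative (\<lambda>h. LINT y|lebesgue. (h \<bullet> gradient (moll r) (x - y)) *\<^sub>R f y)) (at x)"
    unfolding conv_def
    by (rule convolution_has_derivative[where R=r])
       (use assms in \<open>auto intro: moll_zero C1_grad_moll gradient_moll_zero\<close>)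
  from has_derivative_unique[OF this C1_gradD(5)[OF Ck_on_Suc0_C1_grad[OF Ck_on_conv[OF assms]]]]
  show ?thesis by (simp add: fun_eq_iff)
qed

lemma integrable_moll_scaleR:
  assumes "r > 0" "integrable lebesgue f"
  shows "integrable lebesgue (\<lambda>y. moll r (x - y) *\<^sub>R (f y :: 'b::euclidean_space))"
proof -
  obtain B where "\<And>z::'a. norm (moll r z) \<le> B"
    using continuous_zero_off_ball_bounded[OF continuous_moll[OF assms(1)], of r] moll_zero[OF assms(1)]
    by (metis less_imp_le)
  then show ?thesis
    by (intro integrable_lebesgue_bounded_scaleR[where B=B, OF _ _ assms(2)]
         borel_measurable_lebesgue_translate continuous_moll assms) auto
qed

lemma conv_diff:
  assumes "r > 0" "integrable lebesgue f" "integrable lebesgue g"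
  shows "conv r (\<lambda>x. f x - g x) x = conv r f x - conv r g x"
  unfolding conv_def
  by (simp add: scaleR_diff_right integrable_moll_scaleR assms)

lemma conv_cong_AE:
  assumes "r > 0" "AE x in lebesgue. f x = g x" "f \<in> borel_measurable lebesgue" "g \<in> borel_measurable lebesgue"
  shows "conv r f x = conv r g x"
  unfolding conv_def
  by (rule integral_cong_AE)
    (use assms borel_measurable_lebesgue_translate[OF continuous_moll[OF assms(1)], of x] in auto)

text \<open>The kernel is nonnegative, has mass one and lives in a ball of radius \<open>r\<close>,
  so \<open>conv r f x\<close> is an average of nearby values of \<open>f\<close>. Different choices
  of \<open>c\<close> and \<open>e\<close> yield sup bounds, supports, pointwise convergence and
  Lipschitz bounds.\<close>

lemma conv_dist_bound:
  fixes f :: "'a::euclidean_space \<Rightarrow> 'b::euclidean_space"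
  assumes "r > 0" "integrable lebesgue f" "\<And>y. dist x y < r \<Longrightarrow> norm (f y - c) \<le> e"
  shows "norm (conv r f x - c) \<le> e"
proof -
  have m: "integrable lebesgue (\<lambda>y. moll r (x - y))" "(LINT y|lebesgue. moll r (x - y)) = 1"
    using integral_moll_translate(2)[OF assms(1), of x] integrable_moll_translate(2)[OF assms(1), of x]
    by (auto simp: integral_completion integrable_completion)
  have "conv r f x - c = (LINT y|lebesgue. moll r (x - y) *\<^sub>R f y - moll r (x - y) *\<^sub>R c)"
    unfolding conv_def using m
    by (subst Bochner_Integration.integral_diff) (auto simp: integrable_moll_scaleR assms)
  also have "norm \<dots> \<le> (LINT y|lebesgue. moll r (x - y) * e)"
  proof (rule Bochner_Integration.integral_norm_bound_integral)
    show "integrable lebesgue (\<lambda>y. moll r (x - y) *\<^sub>R f y - moll r (x - y) *\<^sub>R c)"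
      using m by (auto simp: integrable_moll_scaleR assms)
    fix y
    show "norm (moll r (x - y) *\<^sub>R f y - moll r (x - y) *\<^sub>R c) \<le> moll r (x - y) * e"
    proof (cases "dist x y < r")
      case True
      then show ?thesis using assms(3)[OF True] moll_nonneg[OF assms(1), of "x - y"]
        by (simp flip: scaleR_diff_right add: mult_left_mono)
    next
      case False
      then show ?thesis using moll_zero[OF assms(1), of "x - y"] by (simp add: dist_norm)
    qed
  qed (use m in simp)
  also have "\<dots> = e" using m by simp
  finally show ?thesis .
qed

section \<open>Density of continuous functions and convergence of mollifications in L^p\<close>

lemma integrable_indicator_cball: "integrable lebesgue (indicat_real (cball (a::'a::euclidean_space) R))"
  using emeasure_lborel_cball_finite[of a R] by (simp add: less_top)

text \<open>A crude stand-in for Minkowski's inequality. The factor \<open>2 powr p\<close> is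
  harmless, since \<open>p\<close> stays fixed while the approximation errors tend to zero.\<close>

lemma powr_add_le:
  fixes a b p :: real
  assumes "a \<ge> 0" "b \<ge> 0" "p \<ge> 0"
  shows "(a + b) powr p \<le> 2 powr p * (a powr p + b powr p)"
proof -
  have "(a + b) powr p \<le> (2 * max a b) powr p"
    using assms by (intro powr_mono2) auto
  also have "\<dots> = 2 powr p * max a b powr p" using assms by (simp add: powr_mult)
  also have "\<dots> \<le> 2 powr p * (a powr p + b powr p)"
    by (intro mult_left_mono) (auto simp: max_def)
  finally show ?thesis .
qed

lemma norm_diff_powr_le:
  assumes "p \<ge> 0"
  shows "norm (a - c) powr p \<le> 2 powr p * (norm (a - b) powr p + norm (b - c) powr p)"
proof -
  have "norm (a - c) powr p \<le> (norm (a - b) + norm (b - c)) powr p"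
    using assms norm_triangle_ineq[of "a - b" "b - c"] by (intro powr_mono2) auto
  also have "\<dots> \<le> 2 powr p * (norm (a - b) powr p + norm (b - c) powr p)"
    using assms by (intro powr_add_le) auto
  finally show ?thesis .
qed

text \<open>Convexity in tangent form. It serves twice: as the core of Jensen's inequality for
  mollifications, and as the source of the convexity of the p-energy density.\<close>

lemma powr_above_tangent:
  fixes s t p :: real
  assumes "s > 0" "t \<ge> 0" "p \<ge> 1"
  shows "t powr p \<ge> s powr p + p * s powr (p - 1) * (t - s)"
proof (cases "t = 0")
  case True
  have "s powr (p - 1) * s = s powr p" using assms powr_mult_base[of s "p - 1"] by (simp add: mult.commute)
  then have "s powr p + p * s powr (p - 1) * (t - s) = (1 - p) * s powr p"
    using True by (simp add: algebra_simps)
  also have "\<dots> \<le> 0" using assms by (simp add: mult_nonpos_nonneg)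
  finally show ?thesis using True by simp
next
  case False
  have "t powr p - s powr p \<ge> (p * s powr (p - 1)) * (t - s)"
  proof (rule convex_on_imp_above_tangent[where A="{0<..}"])
    show "convex_on {0<..} (\<lambda>x. x powr p)" using assms(3) by (rule powr_convex)
    show "((\<lambda>x. x powr p) has_real_derivative p * s powr (p - 1)) (at s within {0<..})"
      using has_real_derivative_powr[OF assms(1), of p] by (rule has_field_derivative_at_within)
  qed (use assms False in \<open>auto simp: interior_open\<close>)
  then show ?thesis by simp
qed

text \<open>Tonelli is applied on \<open>lborel\<close>, where the integrand
  \<open>moll r (x - y) * norm (g y) powr p\<close> has to be jointly Borel measurable. A Lebesgue
  measurable \<open>f\<close> is first replaced by such a \<open>g\<close>; convolutions do not
  notice the change.\<close>

lemma lebesgue_AE_borel_representative: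
  fixes f :: "'a::euclidean_space \<Rightarrow> 'b::euclidean_space"
  assumes "f \<in> borel_measurable lebesgue"
  obtains g where "g \<in> borel_measurable borel" "AE x in lebesgue. f x = g x"
proof -
  have "\<exists>g\<in>borel_measurable lborel. AE x in lborel. f x \<bullet> b = g x" for b
    using assms by (intro completion_ex_borel_measurable_real) simp
  then obtain g where g: "\<And>b. g b \<in> borel_measurable lborel" "\<And>b. AE x in lborel. f x \<bullet> b = g b x"
    by metis
  show ?thesis
  proof (rule that[of "\<lambda>x. \<Sum>b\<in>Basis. g b x *\<^sub>R b"])
    show "(\<lambda>x. \<Sum>b\<in>Basis. g b x *\<^sub>R b) \<in> borel_measurable borel" using g(1) by simp
    have "AE x in lborel. \<forall>b\<in>Basis. f x \<bullet> b = g b x"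
      using g(2) by (intro AE_finite_allI) auto
    then have "AE x in lborel. f x = (\<Sum>b\<in>Basis. g b x *\<^sub>R b)"
    proof eventually_elim
      case (elim x)
      then show ?case using euclidean_representation[of "f x"] by simp
    qed
    then show "AE x in lebesgue. f x = (\<Sum>b\<in>Basis. g b x *\<^sub>R b)" by (rule AE_completion)
  qed
qed

lemma integrable_Lp_zero_off_ball:
  fixes f :: "'a::euclidean_space \<Rightarrow> 'b::euclidean_space"
  assumes "f \<in> borel_measurable lebesgue" "\<And>x. norm x > R \<Longrightarrow> f x = 0"
    "integrable lebesgue (\<lambda>x. norm (f x) powr p)" "p \<ge> 1"
  shows "integrable lebesgue f"
proof (rule Bochner_Integration.integrable_bound)
  show "integrable lebesgue (\<lambda>x. indicator (cball 0 R) x + norm (f x) powr p)"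
    using assms(3) emeasure_lborel_cball_finite[of 0 R]
    by (intro Bochner_Integration.integrable_add) (auto simp: less_top)
  show "AE x in lebesgue. norm (f x) \<le> norm (indicator (cball 0 R) x + norm (f x) powr p)"
  proof (rule AE_I2)
    fix x
    have "norm (f x) \<le> 1 + norm (f x) powr p"
    proof (cases "norm (f x) \<le> 1")
      case False
      then have "norm (f x) powr 1 \<le> norm (f x) powr p" using assms(4) by (intro powr_mono) auto
      then show ?thesis using False by simp
    qed (simp add: add_increasing2)
    then show "norm (f x) \<le> norm (indicator (cball 0 R) x + norm (f x) powr p)"
      using assms(2)[of x] by (cases "norm x \<le> R") auto
  qed
qed (use assms in auto)

lemma Lp_dense_bounded:
  fixes f :: "'a::euclidean_space \<Rightarrow> 'b::euclidean_space"
  assumes "f \<in> borel_measurable lebesgue" "integrable lebesgue (\<lambda>x. norm (f x) powr p)" "p > 0" "e > 0"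
  obtains N :: nat where "N > 0" "(LINT x|lebesgue. norm (f x - (if norm (f x) \<le> real N then f x else 0)) powr p) < e"
proof -
  let ?f = "\<lambda>N x. if norm (f x) \<le> real N then f x else 0"
  have "(\<lambda>N. LINT x|lebesgue. norm (f x - ?f N x) powr p) \<longlonglongrightarrow> (LINT x::'a|lebesgue. 0)"
  proof (rule Bochner_Integration.integral_dominated_convergence[OF _ _ assms(2)])
    show "AE x in lebesgue. (\<lambda>N. norm (f x - ?f N x) powr p) \<longlonglongrightarrow> 0"
    proof (rule AE_I2)
      fix x
      obtain M :: nat where M: "norm (f x) \<le> M" using real_arch_simple by blast
      show "(\<lambda>N. norm (f x - ?f N x) powr p) \<longlonglongrightarrow> 0"
        by (rule tendsto_eventually) (use M in \<open>auto simp: eventually_sequentially intro!: exI[of _ M]\<close>)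
    qed
    show "AE x in lebesgue. norm (norm (f x - ?f N x) powr p) \<le> norm (f x) powr p" for N
      by (rule AE_I2) simp
    show "(\<lambda>x. norm (f x - ?f N x) powr p) \<in> borel_measurable lebesgue" for N
      using assms(1) by measurable
  qed simp
  then have "\<forall>\<^sub>F N in sequentially. (LINT x|lebesgue. norm (f x - ?f N x) powr p) < e"
    using assms(4) by (intro order_tendstoD(2)[where y=0]) auto
  then obtain N where "\<forall>n\<ge>N. (LINT x|lebesgue. norm (f x - ?f n x) powr p) < e"
    unfolding eventually_sequentially by blast
  then have "(LINT x|lebesgue. norm (f x - ?f (Suc N) x) powr p) < e" by (metis le_SucI order_refl)
  then show ?thesis using that[of "Suc N"] by blast
qed

definition clip :: "real \<Rightarrow> 'b::euclidean_space \<Rightarrow> 'b" where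
  "clip N v = (N / max N (norm v)) *\<^sub>R v"

lemma clip:
  assumes "N > 0"
  shows "continuous_on S (clip N)" "norm (clip N v) \<le> N" "norm v \<le> N \<Longrightarrow> clip N v = v"
proof -
  show "continuous_on S (clip N)"
    unfolding clip_def using assms by (intro continuous_intros) auto
  show "norm v \<le> N \<Longrightarrow> clip N v = v" using assms by (simp add: clip_def max_absorb1)
  have "N * norm v \<le> N * max N (norm v)" using assms by (intro mult_left_mono) auto
  then show "norm (clip N v) \<le> N" using assms by (simp add: clip_def divide_simps)
qed

lemma Lp_dense_continuous_aux:
  fixes f :: "'a::euclidean_space \<Rightarrow> 'b::euclidean_space"
  assumes f: "f \<in> borel_measurable lebesgue" "\<And>x. norm x > R \<Longrightarrow> f x = 0"
    and N: "\<And>x. norm (f x) \<le> N" "N > 0" and p: "p > 0" and e: "e > 0"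
  obtains g where "continuous_on UNIV g" "\<And>x. norm x > R + 1 \<Longrightarrow> g x = 0"
    "(LINT x|lebesgue. norm (f x - g x) powr p) < e"
proof -
  have "f measurable_on UNIV" using f(1) by (intro lebesgue_measurable_imp_measurable_on) auto
  then obtain Z g where Z: "negligible Z" and g: "\<And>n. continuous_on UNIV (g n)"
    "\<And>x. x \<notin> Z \<Longrightarrow> (\<lambda>n. g n x) \<longlonglongrightarrow> f x"
    unfolding measurable_on_def by auto
  \<comment> \<open>The continuous approximants converge almost everywhere, but without any bound.
    Clipping at \<open>N\<close> and cutting off beyond radius \<open>R + 1\<close> does not alter
    the limit, because \<open>f\<close> obeys both restrictions, and it supplies an integrable
    majorant.\<close>
  define \<eta> :: "'a \<Rightarrow> real" where "\<eta> x = max 0 (min 1 (R + 1 - norm x))" for x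
  define h where "h n x = \<eta> x *\<^sub>R clip N (g n x)" for n x
  have ch: "continuous_on UNIV (h n)" for n
    unfolding h_def \<eta>_def
    by (intro continuous_intros continuous_on_compose2[OF clip(1)[OF N(2), of UNIV]] g) auto
  have h0: "h n x = 0" if "norm x > R + 1" for n x using that by (simp add: h_def \<eta>_def)
  have hN: "norm (h n x) \<le> N" for n x
  proof -
    have "norm (h n x) \<le> 1 * norm (clip N (g n x))"
      unfolding h_def norm_scaleR by (intro mult_right_mono) (auto simp: \<eta>_def)
    then show ?thesis using clip(2)[OF N(2), of "g n x"] by linarith
  qed
  have "(\<lambda>n. LINT x|lebesgue. norm (f x - h n x) powr p) \<longlonglongrightarrow> (LINT x::'a|lebesgue. 0)"
  proof (rule Bochner_Integration.integral_dominated_convergence)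
    show "integrable lebesgue (\<lambda>x::'a. (2 * N) powr p * indicator (cball 0 (R + 1)) x)"
      using emeasure_lborel_cball_finite[of 0 "R+1"] by (auto simp: less_top)
    show "(\<lambda>x. norm (f x - h n x) powr p) \<in> borel_measurable lebesgue" for n
      using f(1) continuous_imp_lebesgue_measurable[OF ch] by measurable
    show "AE x in lebesgue. (\<lambda>n. norm (f x - h n x) powr p) \<longlonglongrightarrow> 0"
    proof (rule AE_I')
      show "Z \<in> null_sets lebesgue" using Z by (simp add: negligible_iff_null_sets)
      show "{x \<in> space lebesgue. \<not> (\<lambda>n. norm (f x - h n x) powr p) \<longlonglongrightarrow> 0} \<subseteq> Z"
      proof (rule subsetI, rule ccontr)
        fix x assume x: "x \<in> {x \<in> space lebesgue. \<not> (\<lambda>n. norm (f x - h n x) powr p) \<longlonglongrightarrow> 0}" "x \<notin> Z"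
        have "(\<lambda>n. clip N (g n x)) \<longlonglongrightarrow> clip N (f x)"
          by (rule continuous_on_tendsto_compose[OF clip(1)[OF N(2), of UNIV] g(2)[OF x(2)]]) auto
        then have "(\<lambda>n. h n x) \<longlonglongrightarrow> \<eta> x *\<^sub>R clip N (f x)"
          unfolding h_def by (intro tendsto_intros)
        also have "\<eta> x *\<^sub>R clip N (f x) = f x"
          using clip(3)[OF N(2) N(1), of x] f(2)[of x] by (cases "norm x \<le> R") (auto simp: \<eta>_def)
        finally have "(\<lambda>n. norm (f x - h n x)) \<longlonglongrightarrow> 0"
          using LIM_zero_iff tendsto_norm_zero by (subst norm_minus_commute) blast
        then have "(\<lambda>n. norm (f x - h n x) powr p) \<longlonglongrightarrow> 0 powr p"
          by (rule tendsto_powr2) (use p in \<open>auto\<close>)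
        then show False using x by simp
      qed
    qed
    show "AE x in lebesgue. norm (norm (f x - h n x) powr p) \<le> (2 * N) powr p * indicator (cball 0 (R + 1)) x" for n
    proof (rule AE_I2)
      fix x
      have "norm (f x - h n x) powr p \<le> (2 * N) powr p"
        using norm_triangle_ineq4[of "f x" "h n x"] N(1)[of x] hN[of n x] p by (intro powr_mono2) auto
      then show "norm (norm (f x - h n x) powr p) \<le> (2 * N) powr p * indicator (cball 0 (R + 1)) x"
        using f(2)[of x] h0[of x n] by (cases "norm x \<le> R + 1") (auto simp: indicator_def)
    qed
  qed simp
  then have "\<forall>\<^sub>F n in sequentially. (LINT x|lebesgue. norm (f x - h n x) powr p) < e"
    using e by (intro order_tendstoD(2)[where y=0]) auto
  then obtain n where "(LINT x|lebesgue. norm (f x - h n x) powr p) < e"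
    using eventually_happens[of _ sequentially] by auto
  then show ?thesis using that ch h0 by blast
qed

lemma integrable_diff_powr:
  fixes f g :: "'a \<Rightarrow> 'b::euclidean_space"
  assumes "f \<in> borel_measurable M" "g \<in> borel_measurable M" "p \<ge> 0"
    "integrable M (\<lambda>x. norm (f x) powr p)" "integrable M (\<lambda>x. norm (g x) powr p)"
  shows "integrable M (\<lambda>x. norm (f x - g x) powr p)"
proof (rule Bochner_Integration.integrable_bound)
  show "integrable M (\<lambda>x. 2 powr p * (norm (f x) powr p + norm (g x) powr p))" using assms by simp
  show "AE x in M. norm (norm (f x - g x) powr p) \<le> norm (2 powr p * (norm (f x) powr p + norm (g x) powr p))"
    using norm_diff_powr_le[OF assms(3), of "f _" "g _" 0] by (intro AE_I2) (auto simp: abs_of_nonneg)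
qed (use assms in measurable)

lemma integrable_diff_powr_trans:
  fixes f g h :: "'a \<Rightarrow> 'b::euclidean_space"
  assumes "f \<in> borel_measurable M" "h \<in> borel_measurable M" "p \<ge> 0"
    "integrable M (\<lambda>x. norm (f x - g x) powr p)" "integrable M (\<lambda>x. norm (g x - h x) powr p)"
  shows "integrable M (\<lambda>x. norm (f x - h x) powr p)"
    "(LINT x|M. norm (f x - h x) powr p) \<le> 
      2 powr p * ((LINT x|M. norm (f x - g x) powr p) + (LINT x|M. norm (g x - h x) powr p))"
proof -
  have i: "integrable M (\<lambda>x. 2 powr p * (norm (f x - g x) powr p + norm (g x - h x) powr p))"
    using assms by simp
  show j: "integrable M (\<lambda>x. norm (f x - h x) powr p)"
    using i
    by (rule Bochner_Integration.integrable_bound)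
      (use assms norm_diff_powr_le[OF assms(3), of "f _" "h _" "g _"] in \<open>auto simp: abs_of_nonneg\<close>)
  have "(LINT x|M. norm (f x - h x) powr p) \<le> (LINT x|M. 2 powr p * (norm (f x - g x) powr p + norm (g x - h x) powr p))"
    by (rule integral_mono[OF j i norm_diff_powr_le[OF assms(3)]])
  then show "(LINT x|M. norm (f x - h x) powr p) \<le> 
      2 powr p * ((LINT x|M. norm (f x - g x) powr p) + (LINT x|M. norm (g x - h x) powr p))"
    using assms by simp
qed

lemma Lp_dense_continuous:
  fixes f :: "'a::euclidean_space \<Rightarrow> 'b::euclidean_space"
  assumes f: "f \<in> borel_measurable lebesgue" "\<And>x. norm x > R \<Longrightarrow> f x = 0"
    "integrable lebesgue (\<lambda>x. norm (f x) powr p)" and p: "p > 0" and e: "e > 0"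
  obtains g where "continuous_on UNIV g" "\<And>x. norm x > R + 1 \<Longrightarrow> g x = 0"
    "(LINT x|lebesgue. norm (f x - g x) powr p) < e"
proof -
  define e' where "e' = e / (2 * 2 powr p)"
  have e': "e' > 0" using e by (simp add: e'_def)
  obtain N :: nat where N: "N > 0"
    "(LINT x|lebesgue. norm (f x - (if norm (f x) \<le> real N then f x else 0)) powr p) < e'"
    using Lp_dense_bounded[OF f(1,3) p e'] by blast
  define fN where "fN x = (if norm (f x) \<le> real N then f x else 0)" for x
  have fN: "fN \<in> borel_measurable lebesgue" unfolding fN_def using f(1) by measurable
  obtain g where g: "continuous_on UNIV g" "\<And>x. norm x > R + 1 \<Longrightarrow> g x = 0"
    "(LINT x|lebesgue. norm (fN x - g x) powr p) < e'"
    by (rule Lp_dense_continuous_aux[OF fN, of R "real N" p e'])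
       (use f(2) N p e' in \<open>auto simp: fN_def\<close>)
  have cg: "continuous_on UNIV (\<lambda>x. norm (g x) powr p)" 
    using p g(1) by (intro continuous_intros continuous_on_powr') auto
  have ig: "integrable lebesgue (\<lambda>x. norm (g x) powr p)"
    by (rule integrable_continuous_zero_off_ball(2)[OF cg, of "R+1"]) (simp add: g(2))
  have ifN: "integrable lebesgue (\<lambda>x. norm (fN x) powr p)"
    by (rule Bochner_Integration.integrable_bound[OF f(3)]) (use fN in \<open>measurable, auto simp: fN_def\<close>)
  note mg = continuous_imp_lebesgue_measurable[OF g(1)]
  have "(LINT x|lebesgue. norm (f x - g x) powr p) \<le>
      2 powr p * ((LINT x|lebesgue. norm (f x - fN x) powr p) + (LINT x|lebesgue. norm (fN x - g x) powr p))"
    using p by (intro integrable_diff_powr_trans(2) integrable_diff_powr f fN mg ifN ig) auto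
  also have "\<dots> < 2 powr p * (e' + e')"
    using N g(3) by (intro mult_strict_left_mono add_strict_mono) (auto simp: fN_def)
  also have "\<dots> = e" by (simp add: e'_def)
  finally show ?thesis using that g by blast
qed

lemma continuous_conv:
  fixes f :: "'a::euclidean_space \<Rightarrow> 'b::euclidean_space"
  assumes "r > 0" "integrable lebesgue f"
  shows "continuous_on S (conv r f)"
proof -
  have "isCont (conv r f) x" for x
    unfolding conv_def
    by (rule has_derivative_continuous,
        rule convolution_has_derivative[OF C1_grad_moll[OF assms(1)] _ gradient_moll_zero[OF assms(1)] assms(2), where R=r])
       (auto intro: moll_zero assms)
  then show ?thesis by (simp add: continuous_at_imp_continuous_on)
qed

text \<open>Jensen's inequality for the probability density \<open>moll r (x - y)\<close>: integrate
  the tangent inequality at the mean \<open>s\<close> of \<open>norm f\<close>. The tangent requires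
  \<open>s > 0\<close>; for \<open>s = 0\<close> the left side vanishes.\<close>

lemma norm_conv_powr_le:
  fixes f :: "'a::euclidean_space \<Rightarrow> 'b::euclidean_space"
  assumes r: "r > 0" and f: "integrable lebesgue f" "integrable lebesgue (\<lambda>x. norm (f x) powr p)" and p: "p \<ge> 1"
  shows "norm (conv r f x) powr p \<le> (LINT y|lebesgue. moll r (x - y) * norm (f y) powr p)"
proof -
  have m: "integrable lebesgue (\<lambda>y. moll r (x - y))" "(LINT y|lebesgue. moll r (x - y)) = 1"
    using integral_moll_translate(2)[OF r, of x] integrable_moll_translate(2)[OF r, of x] r
    by (auto simp: integral_completion integrable_completion)
  have i1: "integrable lebesgue (\<lambda>y. moll r (x - y) * norm (f y))"
    using integrable_moll_scaleR[OF r, of "\<lambda>y. norm (f y)" x] f(1) by simp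
  have ip: "integrable lebesgue (\<lambda>y. moll r (x - y) * norm (f y) powr p)"
    using integrable_moll_scaleR[OF r, of "\<lambda>y. norm (f y) powr p" x] f(2) by simp
  define s where "s = (LINT y|lebesgue. moll r (x - y) * norm (f y))"
  have "norm (conv r f x) \<le> s"
    unfolding conv_def s_def
    by (rule Bochner_Integration.integral_norm_bound_integral)
       (use i1 integrable_moll_scaleR[OF r f(1)] in \<open>auto simp: abs_of_nonneg[OF moll_nonneg[OF r]]\<close>)
  then have "norm (conv r f x) powr p \<le> s powr p" using p by (intro powr_mono2) auto
  also have "s powr p \<le> (LINT y|lebesgue. moll r (x - y) * norm (f y) powr p)"
  proof (cases "s > 0")
    case True
    define c where "c = p * s powr (p - 1)"
    have "s powr p = (LINT y|lebesgue. (s powr p - c * s) * moll r (x - y) + c * (moll r (x - y) * norm (f y)))"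
      using m i1 by (simp add: s_def)
    also have "\<dots> \<le> (LINT y|lebesgue. moll r (x - y) * norm (f y) powr p)"
    proof (rule integral_mono[OF _ ip])
      fix y
      have "s powr p + c * (norm (f y) - s) \<le> norm (f y) powr p"
        unfolding c_def using True p by (intro powr_above_tangent) auto
      then have "moll r (x - y) * (s powr p + c * (norm (f y) - s)) \<le> moll r (x - y) * norm (f y) powr p"
        using moll_nonneg[OF r] by (rule mult_left_mono)
      then show "(s powr p - c * s) * moll r (x - y) + c * (moll r (x - y) * norm (f y)) \<le> moll r (x - y) * norm (f y) powr p"
        by (simp add: algebra_simps)
    qed (use m i1 in simp)
    finally show ?thesis .
  next
    case False
    have "s \<ge> 0" unfolding s_def by (simp add: moll_nonneg[OF r] Bochner_Integration.integral_nonneg)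
    then have "s = 0" using False by simp
    then show ?thesis using p by (auto intro!: Bochner_Integration.integral_nonneg simp: moll_nonneg[OF r])
  qed
  finally show ?thesis .
qed

text \<open>Young's inequality for a kernel of mass one: the pointwise Jensen bound, then Tonelli
  and integration of the kernel in the other variable.\<close>

lemma conv_Lp_bound:
  fixes f :: "'a::euclidean_space \<Rightarrow> 'b::euclidean_space"
  assumes r: "r > 0" and f: "integrable lebesgue f" "integrable lebesgue (\<lambda>x. norm (f x) powr p)" and p: "p \<ge> 1"
  shows "integrable lebesgue (\<lambda>x. norm (conv r f x) powr p)"
    "(LINT x|lebesgue. norm (conv r f x) powr p) \<le> (LINT x|lebesgue. norm (f x) powr p)"
proof -
  obtain g where g [measurable]: "g \<in> borel_measurable borel" and fg: "AE x in lebesgue. f x = g x"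
    using lebesgue_AE_borel_representative[of f] f(1) by auto
  have g' [measurable]: "g \<in> borel_measurable lebesgue" using g by (simp add: measurable_completion)
  have ig: "integrable lebesgue g" using f(1) fg
    by (subst integrable_cong_AE[of _ _ f]) (auto elim: eventually_mono)
  have igp: "integrable lebesgue (\<lambda>x. norm (g x) powr p)" using f fg
    by (subst integrable_cong_AE[of _ _ "\<lambda>x. norm (f x) powr p"]) (auto elim: eventually_mono)
  have eq: "(LINT x|lebesgue. norm (f x) powr p) = (LINT x|lebesgue. norm (g x) powr p)"
    by (rule integral_cong_AE) (use f fg in \<open>auto elim: eventually_mono\<close>)
  have cfg: "conv r f x = conv r g x" for x by (rule conv_cong_AE[OF r fg]) (use f g' in auto)
  have mc: "conv r g \<in> borel_measurable borel"
    by (intro borel_measurable_continuous_onI continuous_conv r ig)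
  have mm [measurable]: "moll r \<in> borel_measurable borel" using r by (rule borel_measurable_moll)
  have igp': "integrable lborel (\<lambda>x. norm (g x) powr p)" using igp by (simp add: integrable_completion)
  have "(\<integral>\<^sup>+x. ennreal (norm (conv r g x) powr p) \<partial>lborel)
      \<le> (\<integral>\<^sup>+x. (\<integral>\<^sup>+y. ennreal (moll r (x - y) * norm (g y) powr p) \<partial>lborel) \<partial>lborel)"
  proof (rule nn_integral_mono)
    fix x
    have ip: "integrable lebesgue (\<lambda>y. moll r (x - y) * norm (g y) powr p)"
      using integrable_moll_scaleR[OF r, of "\<lambda>y. norm (g y) powr p" x] igp by simp
    have "ennreal (norm (conv r g x) powr p) \<le> ennreal (LINT y|lebesgue. moll r (x - y) * norm (g y) powr p)"
      using norm_conv_powr_le[OF r ig igp p, of x] by (rule ennreal_leI)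
    also have "\<dots> = (\<integral>\<^sup>+y. ennreal (moll r (x - y) * norm (g y) powr p) \<partial>lebesgue)"
      using ip by (intro nn_integral_eq_integral[symmetric]) (auto simp: moll_nonneg[OF r])
    also have "\<dots> = (\<integral>\<^sup>+y. ennreal (moll r (x - y) * norm (g y) powr p) \<partial>lborel)"
      by (rule nn_integral_completion)
    finally show "ennreal (norm (conv r g x) powr p) \<le> (\<integral>\<^sup>+y. ennreal (moll r (x - y) * norm (g y) powr p) \<partial>lborel)" .
  qed
  also have "\<dots> = (\<integral>\<^sup>+y. (\<integral>\<^sup>+x. ennreal (moll r (x - y) * norm (g y) powr p) \<partial>lborel) \<partial>lborel)"
    by (rule lborel_pair.Fubini'[symmetric]) measurable
  also have "\<dots> = (\<integral>\<^sup>+y. ennreal (norm (g y) powr p) \<partial>lborel)"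
  proof (rule nn_integral_cong)
    fix y
    have "(\<integral>\<^sup>+x. ennreal (moll r (x - y) * norm (g y) powr p) \<partial>lborel)
        = (\<integral>\<^sup>+x. ennreal (norm (g y) powr p * moll r (x - y)) \<partial>lborel)" by (simp add: mult.commute)
    also have "\<dots> = ennreal (LINT x|lborel. norm (g y) powr p * moll r (x - y))"
      using integrable_moll_translate(1)[OF r, of y]
      by (intro nn_integral_eq_integral) (auto simp: moll_nonneg[OF r])
    also have "(LINT x|lborel. norm (g y) powr p * moll r (x - y)) = norm (g y) powr p"
      using integral_moll_translate(1)[OF r, of y] by simp
    finally show "(\<integral>\<^sup>+x. ennreal (moll r (x - y) * norm (g y) powr p) \<partial>lborel) = ennreal (norm (g y) powr p)" .
  qed
  also have "\<dots> = ennreal (LINT y|lborel. norm (g y) powr p)"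
    using igp' by (intro nn_integral_eq_integral) auto
  finally have le: "(\<integral>\<^sup>+x. ennreal (norm (conv r g x) powr p) \<partial>lborel) \<le> ennreal (LINT y|lborel. norm (g y) powr p)" .
  have ic: "integrable lborel (\<lambda>x. norm (conv r g x) powr p)"
    by (rule integrableI_bounded) (use mc le in \<open>auto intro: order_le_less_trans\<close>)
  have "ennreal (LINT x|lborel. norm (conv r g x) powr p) \<le> ennreal (LINT y|lborel. norm (g y) powr p)"
    using le ic by (subst nn_integral_eq_integral[symmetric]) auto
  then have "(LINT x|lborel. norm (conv r g x) powr p) \<le> (LINT y|lborel. norm (g y) powr p)"
    by (subst (asm) ennreal_le_iff) (auto intro!: Bochner_Integration.integral_nonneg)
  then show "(LINT x|lebesgue. norm (conv r f x) powr p) \<le> (LINT x|lebesgue. norm (f x) powr p)"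
    unfolding eq cfg using mc by (simp add: integral_completion)
  show "integrable lebesgue (\<lambda>x. norm (conv r f x) powr p)"
    unfolding cfg using mc ic by (simp add: integrable_completion)
qed

lemma conv_zero_off_ball:
  fixes f :: "'a::euclidean_space \<Rightarrow> 'b::euclidean_space"
  assumes "0 < r" "integrable lebesgue f" "\<And>x. norm x > R \<Longrightarrow> f x = 0" "norm x > R + r"
  shows "conv r f x = 0"
proof -
  have "norm (conv r f x - 0) \<le> 0"
  proof (rule conv_dist_bound[OF assms(1,2)])
    fix y assume "dist x y < r"
    then have "norm y > R" using assms(4) norm_triangle_ineq2[of x y] by (simp add: dist_norm)
    then show "norm (f y - 0) \<le> 0" using assms(3) by simp
  qed
  then show ?thesis by simp
qed

lemma conv_uniform:
  fixes g :: "'a::euclidean_space \<Rightarrow> 'b::euclidean_space"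
  assumes "continuous_on UNIV g" "\<And>x. norm x > R \<Longrightarrow> g x = 0" "e > 0"
  shows "\<forall>\<^sub>F r in at_right 0. \<forall>x. norm (conv r g x - g x) \<le> e"
proof -
  obtain d where d: "d > 0" "\<And>x y. dist x y \<le> d \<Longrightarrow> dist (g x) (g y) < e"
    using continuous_zero_off_ball_uniformly[OF assms] by metis
  have ig: "integrable lebesgue g" using integrable_continuous_zero_off_ball(2)[OF assms(1,2)] .
  show ?thesis unfolding eventually_at_right_field
  proof (intro exI[of _ d] conjI allI impI d(1))
    fix r x assume r: "0 < r" "r < d"
    show "norm (conv r g x - g x) \<le> e"
      by (rule conv_dist_bound[OF r(1) ig]) (use d(2)[of x] r in \<open>auto simp: dist_norm norm_minus_commute less_imp_le\<close>)
  qed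
qed

text \<open>A density argument: mollification does not increase the L^p distance of \<open>f\<close>
  to a continuous \<open>g\<close>, and \<open>conv r g\<close> tends to \<open>g\<close> uniformly
  while both vanish off one ball.\<close>

theorem conv_tendsto_Lp:
  fixes f :: "'a::euclidean_space \<Rightarrow> 'b::euclidean_space"
  assumes f: "f \<in> borel_measurable lebesgue" "\<And>x. norm x > R \<Longrightarrow> f x = 0"
    "integrable lebesgue (\<lambda>x. norm (f x) powr p)" and p: "p \<ge> 1"
  shows "\<And>r. r > 0 \<Longrightarrow> integrable lebesgue (\<lambda>x. norm (conv r f x - f x) powr p)"
    "((\<lambda>r. LINT x|lebesgue. norm (conv r f x - f x) powr p) \<longlongrightarrow> 0) (at_right 0)"
proof -
  have i1: "integrable lebesgue f" using integrable_Lp_zero_off_ball[OF f p] .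
  show int: "integrable lebesgue (\<lambda>x. norm (conv r f x - f x) powr p)" if "r > 0" for r
    by (intro integrable_diff_powr continuous_imp_lebesgue_measurable continuous_conv f conv_Lp_bound i1 that p)
      (use p in auto)
  show "((\<lambda>r. LINT x|lebesgue. norm (conv r f x - f x) powr p) \<longlongrightarrow> 0) (at_right 0)"
  proof (rule tendstoI)
    fix e :: real assume "e > 0"
    define M where "M = measure lborel (cball (0::'a) (R + 2)) + 1"
    have M: "M > 0" by (simp add: M_def add_nonneg_pos)
    \<comment> \<open>Two applications of the crude triangle inequality turn three errors of at most
      \<open>e1\<close> into less than \<open>3 * (2 powr p * 2 powr p * e1)\<close>, which is three
      quarters of \<open>e\<close>.\<close>
    define e1 where "e1 = e / (4 * 2 powr p * 2 powr p)"
    have e1: "e1 > 0" using \<open>e > 0\<close> by (simp add: e1_def)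
    obtain g where g: "continuous_on UNIV g" "\<And>x. norm x > R + 1 \<Longrightarrow> g x = 0"
      "(LINT x|lebesgue. norm (f x - g x) powr p) < e1"
      using Lp_dense_continuous[OF f _ e1] p by force
    have ig: "integrable lebesgue g" using integrable_continuous_zero_off_ball(2)[OF g(1,2)] .
    note mg = continuous_imp_lebesgue_measurable[OF g(1)]
    have cg: "continuous_on UNIV (\<lambda>x. norm (g x) powr p)" 
      using p g(1) by (intro continuous_intros continuous_on_powr') auto
    have igp: "integrable lebesgue (\<lambda>x. norm (g x) powr p)"
      by (rule integrable_continuous_zero_off_ball(2)[OF cg, of "R+1"]) (simp add: g(2))
    have ifgp: "integrable lebesgue (\<lambda>x. norm (f x - g x) powr p)"
      using p by (intro integrable_diff_powr f mg igp) auto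
    \<comment> \<open>A uniform error \<open>e2\<close> contributes at most
      \<open>e2 powr p * M = e1\<close> to the integral, as \<open>M\<close> exceeds the measure of
      the ball carrying both functions.\<close>
    define e2 where "e2 = (e1 / M) powr (1 / p)"
    have e2: "e2 > 0" "e2 powr p = e1 / M" using e1 M p by (auto simp: e2_def powr_powr)
    have "\<forall>\<^sub>F r in at_right 0. \<forall>x. norm (conv r g x - g x) \<le> e2"
      by (rule conv_uniform[OF g(1,2) e2(1)])
    moreover have "\<forall>\<^sub>F r in at_right (0::real). 0 < r \<and> r < 1"
      by (auto simp: eventually_at_right_field intro!: exI[of _ 1])
    ultimately show "\<forall>\<^sub>F r in at_right 0. dist (LINT x|lebesgue. norm (conv r f x - f x) powr p) 0 < e"
    proof eventually_elim
      case (elim r)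
      then have r: "0 < r" "r < 1" and u: "\<And>x. norm (conv r g x - g x) \<le> e2" by auto
      have mc: "conv r g \<in> borel_measurable lebesgue" "conv r f \<in> borel_measurable lebesgue"
        by (intro continuous_imp_lebesgue_measurable continuous_conv r ig i1)+
      have 1: "integrable lebesgue (\<lambda>x. norm (conv r f x - conv r g x) powr p)"
         "(LINT x|lebesgue. norm (conv r f x - conv r g x) powr p) \<le> (LINT x|lebesgue. norm (f x - g x) powr p)"
        using conv_Lp_bound[OF r(1) _ ifgp p] i1 ig by (simp_all add: conv_diff r)
      have icg: "integrable lebesgue (\<lambda>x. norm (conv r g x - g x) powr p)"
        using p by (intro integrable_diff_powr mc mg conv_Lp_bound r ig igp) auto
      have "(LINT x|lebesgue. norm (conv r g x - g x) powr p) \<le> (LINT x|lebesgue. (e1 / M) * indicator (cball (0::'a) (R + 2)) x)"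
      proof (rule integral_mono[OF icg])
        show "integrable lebesgue (\<lambda>x. (e1 / M) * indicator (cball (0::'a) (R + 2)) x)"
          by (rule integrable_mult_right[OF integrable_indicator_cball])
        fix x :: 'a
        have "conv r g x = 0" "g x = 0" if "norm x > R + 2"
          using conv_zero_off_ball[OF r(1) ig g(2), where x=x] g(2)[of x] that r by auto
        moreover have "norm (conv r g x - g x) powr p \<le> e1 / M"
          using u[of x] p powr_mono2[of p "norm (conv r g x - g x)" e2] by (simp add: e2(2))
        ultimately show "norm (conv r g x - g x) powr p \<le> (e1 / M) * indicator (cball (0::'a) (R + 2)) x"
          by (cases "norm x \<le> R + 2") (auto simp: indicator_def)
      qed
      also have "\<dots> = (e1 / M) * measure lborel (cball (0::'a) (R + 2))"
        by simp
      also have "\<dots> \<le> (e1 / M) * M" using e1 M by (intro mult_left_mono) (auto simp: M_def)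
      also have "\<dots> = e1" using M by simp
      finally have 2: "(LINT x|lebesgue. norm (conv r g x - g x) powr p) \<le> e1" .
      have igf: "integrable lebesgue (\<lambda>x. norm (g x - f x) powr p)" 
        using ifgp by (simp add: norm_minus_commute)
      have i3: "integrable lebesgue (\<lambda>x. norm (conv r g x - f x) powr p)"
        "(LINT x|lebesgue. norm (conv r g x - f x) powr p) \<le>
          2 powr p * ((LINT x|lebesgue. norm (conv r g x - g x) powr p) + (LINT x|lebesgue. norm (g x - f x) powr p))"
        using p by (intro integrable_diff_powr_trans[OF _ _ _ icg igf] mc f; simp)+
      have i4: "(LINT x|lebesgue. norm (conv r f x - f x) powr p) \<le>
          2 powr p * ((LINT x|lebesgue. norm (conv r f x - conv r g x) powr p) + (LINT x|lebesgue. norm (conv r g x - f x) powr p))"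
        using p by (intro integrable_diff_powr_trans(2)[OF _ _ _ 1(1) i3(1)] mc f) simp
      have g3: "(LINT x|lebesgue. norm (g x - f x) powr p) < e1" using g(3) by (simp add: norm_minus_commute)
      have P: "2 powr p \<ge> (1::real)" using p by (intro ge_one_powr_ge_zero) auto
      have "(LINT x|lebesgue. norm (conv r g x - f x) powr p) \<le> 2 powr p * (e1 + e1)"
        using i3(2) 2 g3 by (elim order_trans) (intro mult_left_mono, auto)
      moreover have "e1 \<le> 2 powr p * e1" using P e1 mult_right_mono[OF P, of e1] by simp
      ultimately have "(LINT x|lebesgue. norm (conv r f x - conv r g x) powr p) + (LINT x|lebesgue. norm (conv r g x - f x) powr p)
         < 2 powr p * e1 + 2 powr p * (e1 + e1)" using 1(2) g(3) by linarith
      then have "2 powr p * ((LINT x|lebesgue. norm (conv r f x - conv r g x) powr p) + (LINT x|lebesgue. norm (conv r g x - f x) powr p))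
         < 2 powr p * (2 powr p * e1 + 2 powr p * (e1 + e1))" by simp
      also have "\<dots> = 3 * (2 powr p * 2 powr p * e1)" by (simp add: algebra_simps)
      also have "\<dots> < e" using \<open>e > 0\<close> by (simp add: e1_def)
      finally have "(LINT x|lebesgue. norm (conv r f x - f x) powr p) < e" using i4 by linarith
      then show ?case by (simp add: abs_of_nonneg Bochner_Integration.integral_nonneg)
    qed
  qed
qed

subsection \<open>Weak gradients\<close>

definition ext :: "'a set \<Rightarrow> ('a \<Rightarrow> 'b::zero) \<Rightarrow> 'a \<Rightarrow> 'b" where
  "ext K f x = (if x \<in> K then f x else 0)"

lemma ext_in [simp]: "x \<in> K \<Longrightarrow> ext K f x = f x" and ext_notin [simp]: "x \<notin> K \<Longrightarrow> ext K f x = 0"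
  by (simp_all add: ext_def)

lemma integral_lebesgue_on_ext:
  fixes f :: "'a::euclidean_space \<Rightarrow> 'b::euclidean_space"
  assumes "S \<in> sets lebesgue"
  shows "(LINT x|lebesgue_on S. f x) = (LINT x|lebesgue. ext S f x)"
    "integrable (lebesgue_on S) f \<longleftrightarrow> integrable lebesgue (ext S f)"
    "f \<in> borel_measurable (lebesgue_on S) \<longleftrightarrow> ext S f \<in> borel_measurable lebesgue"
  using Lebesgue_Measure.integral_restrict_UNIV[OF assms, of f]
    Lebesgue_Measure.integrable_restrict_UNIV[OF assms, of f] borel_measurable_if[OF assms, of f]
  by (simp_all add: ext_def[abs_def])

lemma integrable_ext_locally_integrable:
  fixes f :: "'a::euclidean_space \<Rightarrow> 'b::euclidean_space"
  assumes "locally_integrable \<Omega> f" "compact K" "K \<subseteq> \<Omega>"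
  shows "integrable lebesgue (ext K f)"
  using assms integral_lebesgue_on_ext(2)[of K f] unfolding locally_integrable_def
  by (simp add: lmeasurable_compact fmeasurableD)

text \<open>Leaves room of width \<open>s\<close> around a support: mollifying there at a scale
  below \<open>s\<close> reads values in the compact \<open>K\<close> only, where
  \<open>locally_integrable\<close> gives integrability.\<close>

lemma compact_neighbourhood_obtain:
  fixes S :: "'a::euclidean_space set"
  assumes "compact S" "open \<Omega>" "S \<subseteq> \<Omega>"
  obtains K s where "s > 0" "compact K" "K \<subseteq> \<Omega>" "S \<subseteq> K" "\<And>x. x \<in> S \<Longrightarrow> cball x s \<subseteq> K"
proof (cases "S = {}")
  case True
  then show ?thesis using that[of 1 "{}"] by simp
next
  case False
  obtain e where e: "e > 0" "{x. infdist x S \<le> e} \<subseteq> \<Omega>"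
    using compact_in_open_separated[OF False assms] by blast
  show ?thesis
  proof (rule that[OF e(1)])
    show "compact {x. infdist x S \<le> e}" using compact_infdist_le[OF False assms(1) e(1)] .
    show "{x. infdist x S \<le> e} \<subseteq> \<Omega>" using e by auto
    show "S \<subseteq> {x. infdist x S \<le> e}" using e(1) by auto
    show "cball x e \<subseteq> {x. infdist x S \<le> e}" if x: "x \<in> S" for x
    proof
      fix y assume "y \<in> cball x e"
      then show "y \<in> {x. infdist x S \<le> e}" using infdist_le[OF x, of y] by (simp add: dist_commute)
    qed
  qed
qed

lemma C1_grad_reflect:
  assumes "C1_grad f F"
  shows "C1_grad (\<lambda>y. f (x - y)) (\<lambda>y. - F (x - y))"
  unfolding C1_grad_def
proof (intro conjI allI)
  fix y
  have "((\<lambda>y. x - y) has_derivative (\<lambda>h. - h)) (at y)" by (auto intro!: derivative_eq_intros)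
  from has_derivative_compose[OF this C1_gradD(5)[OF assms]]
  show "GDERIV (\<lambda>y. f (x - y)) y :> - F (x - y)" by (simp add: gderiv_def)
  show "continuous_on UNIV (\<lambda>y. - F (x - y))"
    using C1_gradD(4)[OF assms, of UNIV] by (intro continuous_on_minus) (auto intro!: continuous_on_compose2[of UNIV F] continuous_intros)
qed

lemma gradient_zero_off_closed:
  assumes "C1_grad \<psi> F" "closed S" "\<And>x. x \<notin> S \<Longrightarrow> \<psi> x = 0" "x \<notin> S"
  shows "F x = 0"
proof -
  have "(\<psi> has_derivative (\<lambda>h. 0)) (at x)"
    using has_derivative_transform_within_open[of "\<lambda>x. 0" "\<lambda>h. 0" x UNIV "- S" \<psi>] assms by (auto simp: open_Compl)
  then have "GDERIV \<psi> x :> 0" by (simp add: gderiv_def)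
  from gradient_eqI[OF this] gradient_eqI[OF C1_gradD(1)[OF assms(1)]] show ?thesis by simp
qed

text \<open>Differentiating \<open>x \<mapsto> \<integral> \<psi> (y - x) dy\<close>, which is constant, at \<open>0\<close>.\<close>

lemma integral_gradient_eq_0:
  assumes \<psi>: "C1_grad \<psi> F" "\<And>x. norm x > R \<Longrightarrow> \<psi> x = 0"
  shows "(LINT x|lebesgue. F x) = (0::'a::euclidean_space)"
proof -
  let ?g = "indicator (cball (0::'a) (R + 1)) :: 'a \<Rightarrow> real"
  have F0: "F x = 0" if "norm x > R" for x using gradient_zero_off_ball[OF \<psi> that] .
  have \<psi>m: "\<psi> \<in> borel_measurable borel" using C1_gradD(3)[OF \<psi>(1)] by (rule borel_measurable_continuous_onI)
  have r: "C1_grad (\<lambda>y. \<psi> (0 - y)) (\<lambda>y. - F (0 - y))" using C1_grad_reflect[OF \<psi>(1)] .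
  have "((\<lambda>x. LINT y|lebesgue. \<psi> (0 - (x - y)) *\<^sub>R ?g y) has_derivative
           (\<lambda>h. LINT y|lebesgue. (h \<bullet> (- F (0 - (0 - y)))) *\<^sub>R ?g y)) (at 0)"
    by (rule convolution_has_derivative[OF r _ _ integrable_indicator_cball, where R=R]) (auto simp: \<psi>(2) F0)
  then have d: "((\<lambda>x. LINT y|lebesgue. \<psi> (y - x) *\<^sub>R ?g y) has_derivative
           (\<lambda>h. LINT y|lebesgue. (h \<bullet> (- F y)) *\<^sub>R ?g y)) (at 0)" by simp
  have "(LINT y|lebesgue. \<psi> (y - x) *\<^sub>R ?g y) = (LINT y|lborel. \<psi> y)" if "x \<in> ball 0 1" for x
  proof -
    have "\<psi> (y - x) *\<^sub>R ?g y = \<psi> (y - x)" for y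
    proof (cases "norm y \<le> R + 1")
      case False
      then have "norm (y - x) > R" using that norm_triangle_ineq2[of y x] by (simp add: dist_norm)
      then show ?thesis using \<psi>(2) by simp
    qed simp
    then have "(LINT y|lebesgue. \<psi> (y - x) *\<^sub>R ?g y) = (LINT y|lebesgue. \<psi> (y + (- x)))"
      by (simp only: diff_conv_add_uminus)
    also have "\<dots> = (LINT y|lborel. \<psi> (y + (- x)))" using \<psi>m by (intro integral_completion) simp
    also have "\<dots> = (LINT y|lborel. \<psi> y)" by (rule lborel_integral_translation[OF \<psi>m])
    finally show ?thesis .
  qed
  then have "((\<lambda>x. LINT y|lebesgue. \<psi> (y - x) *\<^sub>R ?g y) has_derivative (\<lambda>h. 0)) (at 0)"
    using has_derivative_transform_within_open[of "\<lambda>x. LINT y|lborel. \<psi> y" "\<lambda>h. 0" 0 UNIV "ball 0 1"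
        "\<lambda>x. LINT y|lebesgue. \<psi> (y - x) *\<^sub>R ?g y"] by auto
  from has_derivative_unique[OF d this]
  have *: "(LINT y|lebesgue. (h \<bullet> (- F y)) *\<^sub>R ?g y) = 0" for h by (simp add: fun_eq_iff)
  have eq: "(h \<bullet> (- F y)) *\<^sub>R ?g y = - (h \<bullet> F y)" for h y
    using F0[of y] by (cases "norm y \<le> R + 1") auto
  have "(LINT y|lebesgue. h \<bullet> F y) = 0" for h
    using *[of h] unfolding eq by simp
  moreover have iF: "integrable lebesgue F"
    using integrable_continuous_zero_off_ball(2)[OF C1_gradD(4)[OF \<psi>(1)] F0] .
  ultimately have "h \<bullet> (LINT y|lebesgue. F y) = 0" for h by simp
  from this[of "LINT y|lebesgue. F y"] show ?thesis by simp
qed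

text \<open>The reflected kernel \<open>\<lambda>y. moll r (x - y)\<close> is itself an admissible
  test function, since its support lies in \<open>K\<close>. Inserting it into the definition of the
  weak gradient moves the derivative from the kernel to \<open>u\<close>.\<close>

lemma gradient_conv_weak_gradient:
  fixes u :: "'a::euclidean_space \<Rightarrow> real"
  assumes w: "has_weak_gradient \<Omega> u G" "open \<Omega>" and K: "compact K" "K \<subseteq> \<Omega>" "cball x r \<subseteq> K" and r: "r > 0"
  shows "gradient (conv r (ext K u)) x = conv r (ext K G) x"
proof -
  have lu: "integrable lebesgue (ext K u)" and lG: "integrable lebesgue (ext K G)"
    using w K by (auto simp: has_weak_gradient_def intro: integrable_ext_locally_integrable)
  have \<Omega>: "\<Omega> \<in> sets lebesgue" using w(2) by simp
  let ?D = "gradient (moll r :: 'a \<Rightarrow> real)"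
  let ?\<phi> = "\<lambda>y. moll r (x - y)"
  have test: "test_function \<Omega> ?\<phi>"
    using test_function_moll[OF r, of x \<Omega>] K by (simp add: moll_commute[OF r, of x])
  have gr: "gradient ?\<phi> = (\<lambda>y. - ?D (x - y))"
    using C1_gradD(2)[OF C1_grad_reflect[OF C1_grad_moll[OF r]]] .
  have out: "?D (x - y) = 0" "moll r (x - y) = 0" if "y \<notin> K" for y
  proof -
    have "norm (x - y) > r" using K(3) that by (force simp: dist_norm)
    then show "?D (x - y) = 0" "moll r (x - y) = 0" by (simp_all add: gradient_moll_zero[OF r] moll_zero[OF r])
  qed
  have "(LINT y|lebesgue_on \<Omega>. u y *\<^sub>R gradient ?\<phi> y) = - (LINT y|lebesgue_on \<Omega>. ?\<phi> y *\<^sub>R G y)"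
    using w(1) test unfolding has_weak_gradient_def by blast
  moreover have "ext \<Omega> (\<lambda>y. u y *\<^sub>R gradient ?\<phi> y) = (\<lambda>y. - (ext K u y *\<^sub>R ?D (x - y)))"
    using K(2) out(1) by (auto simp: ext_def gr fun_eq_iff)
  moreover have "ext \<Omega> (\<lambda>y. ?\<phi> y *\<^sub>R G y) = (\<lambda>y. ?\<phi> y *\<^sub>R ext K G y)"
    using K(2) out(2) by (auto simp: ext_def fun_eq_iff)
  ultimately have eq: "(LINT y|lebesgue. ext K u y *\<^sub>R ?D (x - y)) = conv r (ext K G) x"
    using \<Omega> by (simp add: integral_lebesgue_on_ext(1) conv_def)
  have cD: "continuous_on UNIV ?D" using C1_gradD(4)[OF C1_grad_moll[OF r]] .
  obtain B where B: "\<And>z. norm (?D z) \<le> B"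
    using continuous_zero_off_ball_bounded[OF cD gradient_moll_zero[OF r]] by blast
  have i: "integrable lebesgue (\<lambda>y. ext K u y *\<^sub>R ?D (x - y))"
  proof (rule Bochner_Integration.integrable_bound)
    show "integrable lebesgue (\<lambda>y. B * ext K u y)" using lu by simp
    show "(\<lambda>y. ext K u y *\<^sub>R ?D (x - y)) \<in> borel_measurable lebesgue"
      using lu borel_measurable_lebesgue_translate[OF cD, of x] by simp
    have "norm (?D (x - y)) \<le> \<bar>B\<bar>" for y using B[of "x - y"] by simp
    then show "AE y in lebesgue. norm (ext K u y *\<^sub>R ?D (x - y)) \<le> norm (B * ext K u y)"
      by (intro AE_I2) (simp add: abs_mult mult.commute[of "\<bar>B\<bar>"] mult_left_mono)
  qed
  have "h \<bullet> gradient (conv r (ext K u)) x = h \<bullet> conv r (ext K G) x" for h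
  proof -
    have "h \<bullet> gradient (conv r (ext K u)) x = (LINT y|lebesgue. h \<bullet> (ext K u y *\<^sub>R ?D (x - y)))"
      by (simp add: gradient_conv[OF r lu] mult.commute)
    also have "\<dots> = h \<bullet> conv r (ext K G) x" using i by (simp only: integral_inner_right eq)
    finally show ?thesis .
  qed
  then show ?thesis using vector_eq_ldot by blast
qed

section \<open>Chain rule, and C^1 test functions for weak gradients\<close>

lemma conv_tendsto_L1:
  fixes f :: "'a::euclidean_space \<Rightarrow> 'b::euclidean_space"
  assumes "integrable lebesgue f" "bounded {x. f x \<noteq> 0}"
  shows "\<And>r. r > 0 \<Longrightarrow> integrable lebesgue (\<lambda>x. norm (conv r f x - f x))"
    "((\<lambda>r. LINT x|lebesgue. norm (conv r f x - f x)) \<longlongrightarrow> 0) (at_right 0)"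
proof -
  obtain R where "\<And>x. f x \<noteq> 0 \<Longrightarrow> norm x \<le> R" using assms(2) by (auto simp: bounded_iff)
  then have R: "\<And>x. norm x > R \<Longrightarrow> f x = 0" by force
  have "f \<in> borel_measurable lebesgue" "integrable lebesgue (\<lambda>x. norm (f x) powr 1)" using assms(1) by simp_all
  from conv_tendsto_Lp[OF this(1) R this(2)]
  show "\<And>r. r > 0 \<Longrightarrow> integrable lebesgue (\<lambda>x. norm (conv r f x - f x))"
    "((\<lambda>r. LINT x|lebesgue. norm (conv r f x - f x)) \<longlongrightarrow> 0) (at_right 0)" by simp_all
qed

lemma bounded_ext: "bounded K \<Longrightarrow> bounded {x. ext K f x \<noteq> 0}"
  by (rule bounded_subset[of K]) (auto simp: ext_def)

lemma conv_tendsto_pointwise: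
  fixes f :: "'a::euclidean_space \<Rightarrow> 'b::euclidean_space"
  assumes f: "integrable lebesgue (ext K f)" and K: "continuous_on K f" "cball x s \<subseteq> K" "s > 0"
  shows "((\<lambda>r. conv r (ext K f) x) \<longlongrightarrow> f x) (at_right 0)"
proof (rule tendstoI)
  fix e :: real assume e: "e > 0"
  have x: "x \<in> K" using K by auto
  obtain d where d: "d > 0" "\<And>y. y \<in> K \<Longrightarrow> dist y x < d \<Longrightarrow> dist (f y) (f x) < e / 2"
    using K(1)[unfolded continuous_on_iff, rule_format, OF x, of "e/2"] e by auto
  show "\<forall>\<^sub>F r in at_right 0. dist (conv r (ext K f) x) (f x) < e"
    unfolding eventually_at_right_field
  proof (intro exI[of _ "min d s"] conjI allI impI)
    fix r assume r: "0 < r" "r < min d s"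
    have "norm (conv r (ext K f) x - f x) \<le> e / 2"
    proof (rule conv_dist_bound[OF r(1) f])
      fix y assume y: "dist x y < r"
      then have "y \<in> K" using r K(2) by auto
      then show "norm (ext K f y - f x) \<le> e / 2"
        using d(2)[of y] y r by (simp add: dist_norm norm_minus_commute less_imp_le)
    qed
    then show "dist (conv r (ext K f) x) (f x) < e" using e by (simp add: dist_norm)
  qed (use d K in auto)
qed

text \<open>Two extensions in one: \<open>T\<close> the identity enlarges the test class from smooth
  to C^1, and smooth \<open>\<zeta>\<close> gives the chain rule. For the mollified \<open>w\<close>
  the identity says that the gradient of a compactly supported product integrates to zero; then the
  scale tends to zero.\<close>

lemma weak_gradient_compose_C1_test:
  fixes w :: "'a::euclidean_space \<Rightarrow> real"
  assumes \<Omega>: "open \<Omega>" and w: "has_weak_gradient \<Omega> w G" "continuous_on \<Omega> w"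
    and T: "\<And>s. (T has_real_derivative T' s) (at s)" "continuous_on UNIV T'"
    and \<zeta>: "C1_grad \<zeta> X" and S: "compact S" "S \<subseteq> \<Omega>" "\<And>x. x \<notin> S \<Longrightarrow> \<zeta> x = 0"
  shows "(LINT x|lebesgue_on \<Omega>. T (w x) *\<^sub>R X x) = - (LINT x|lebesgue_on \<Omega>. \<zeta> x *\<^sub>R (T' (w x) *\<^sub>R G x))"
proof -
  have \<Omega>m: "\<Omega> \<in> sets lebesgue" using \<Omega> by simp
  obtain K s where K: "s > 0" "compact K" "K \<subseteq> \<Omega>" "S \<subseteq> K" "\<And>x. x \<in> S \<Longrightarrow> cball x s \<subseteq> K"
    by (rule compact_neighbourhood_obtain[OF S(1) \<Omega> S(2)]) (rule that)
  have X0: "X x = 0" if "x \<notin> S" for x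
    using gradient_zero_off_closed[OF \<zeta> compact_imp_closed[OF S(1)] S(3) that] .
  define f where "f = ext K w"
  define g where "g = ext K G"
  have f: "integrable lebesgue f" and g: "integrable lebesgue g"
    using w K by (auto simp: f_def g_def has_weak_gradient_def intro: integrable_ext_locally_integrable)
  have wK: "continuous_on K w" using w(2) K(3) by (rule continuous_on_subset)
  obtain R where R: "\<And>x. x \<in> S \<Longrightarrow> norm x \<le> R" using compact_imp_bounded[OF S(1)] by (auto simp: bounded_iff)
  have Soff: "x \<notin> S" if "norm x > R" for x using R[of x] that by force
  have cT: "continuous_on A T" for A using T(1) by (meson DERIV_isCont continuous_at_imp_continuous_on)
  have "compact (w ` K)" using wK K(2) by (rule compact_continuous_image)
  then obtain B where "B > 0" "\<forall>y\<in>w ` K. norm y \<le> B" using compact_imp_bounded bounded_pos by blast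
  then have B: "\<And>x. x \<in> K \<Longrightarrow> \<bar>w x\<bar> \<le> B" "B > 0" by auto
  have fB: "norm (f x - 0) \<le> B" for x using B by (cases "x \<in> K") (auto simp: f_def)
  have cB: "\<bar>conv r f x\<bar> \<le> B" if "r > 0" for r x using conv_dist_bound[OF that f fB] by simp
  have "compact (T ` {-B..B})" "compact (T' ` {-B..B})"
    using cT continuous_on_subset[OF T(2)] by (auto intro!: compact_continuous_image)
  then have "bounded (T ` {-B..B})" "bounded (T' ` {-B..B})" by (simp_all add: compact_imp_bounded)
  then obtain B1 B2 where B': "\<forall>y\<in>T ` {-B..B}. norm y \<le> B1" "\<forall>y\<in>T' ` {-B..B}. norm y \<le> B2"
    unfolding bounded_iff by blast
  have B1: "\<bar>T s\<bar> \<le> B1" and B2: "\<bar>T' s\<bar> \<le> B2" if "\<bar>s\<bar> \<le> B" for s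
  proof -
    have "s \<in> {-B..B}" using that by auto
    then show "\<bar>T s\<bar> \<le> B1" "\<bar>T' s\<bar> \<le> B2" using B' by auto
  qed
  have c\<zeta>: "continuous_on UNIV \<zeta>" and cX: "continuous_on UNIV X" using C1_gradD(3,4)[OF \<zeta>] by blast+
  obtain B3 where B3: "\<And>x. norm (\<zeta> x) \<le> B3" "B3 > 0"
    by (rule continuous_zero_off_ball_bounded[OF c\<zeta>, of R]) (auto simp: S(3) Soff that)
  have iX: "integrable lebesgue X" using integrable_continuous_zero_off_ball(2)[OF cX X0[OF Soff]] .
  \<comment> \<open>The shift by 2 keeps every \<open>r n\<close> strictly below \<open>s\<close>,
    already at \<open>n = 0\<close>, so that mollifications at points of \<open>S\<close> see only
    \<open>K\<close>.\<close>
  define r where "r n = s / (real n + 2)" for n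
  have r: "r n > 0" "r n < s" for n using K(1) by (auto simp: r_def field_simps intro: add_pos_nonneg)
  have rlim: "filterlim r (at_right 0) sequentially"
    unfolding r_def using K(1) by real_asymp
  define wn where "wn n = conv (r n) f" for n
  define gn where "gn n = conv (r n) g" for n
  have cwn: "continuous_on UNIV (wn n)" and cgn: "continuous_on UNIV (gn n)" for n
    unfolding wn_def gn_def by (intro continuous_conv r f g)+
  have mw: "(\<lambda>x. T (wn n x)) \<in> borel_measurable lebesgue" "(\<lambda>x. T' (wn n x)) \<in> borel_measurable lebesgue" for n
    using continuous_on_compose2[OF cT[of UNIV] cwn] continuous_on_compose2[OF T(2) cwn]
    by (auto intro!: continuous_imp_lebesgue_measurable)
  have mf: "f \<in> borel_measurable lebesgue" using f by simp
  have cT': "T \<in> borel_measurable borel" "T' \<in> borel_measurable borel" using cT T(2) by (auto intro: borel_measurable_continuous_onI)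
  have mf2: "(\<lambda>x. T (f x)) \<in> borel_measurable lebesgue" "(\<lambda>x. T' (f x)) \<in> borel_measurable lebesgue"
    using measurable_compose[OF mf cT'(1)] measurable_compose[OF mf cT'(2)] by auto
  have m\<zeta>: "\<zeta> \<in> borel_measurable lebesgue" using c\<zeta> by (rule continuous_imp_lebesgue_measurable)
  have wnB: "\<bar>wn n x\<bar> \<le> B" for n x unfolding wn_def by (rule cB[OF r(1)])
  have bnd: "norm (\<zeta> x *\<^sub>R (T' (wn n x) *\<^sub>R v)) \<le> B3 * (B2 * norm v)" for n x and v :: 'a
  proof -
    have "norm (T' (wn n x) *\<^sub>R v) \<le> B2 * norm v"
      unfolding norm_scaleR by (intro mult_right_mono B2 wnB) simp
    then show ?thesis
      unfolding norm_scaleR[of "\<zeta> x"] using B3(1)[of x] by (intro mult_mono) auto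
  qed
  \<comment> \<open>Continuity of \<open>w\<close> yields convergence at every point of
    \<open>S\<close>. The nonlinear factors therefore pass to the limit by bounded convergence, and
    only the gradients have to be handled in L^1.\<close>
  have lim: "(\<lambda>n. wn n x) \<longlonglongrightarrow> f x" if "x \<in> S" for x
  proof -
    have "((\<lambda>r. conv r f x) \<longlongrightarrow> w x) (at_right 0)"
      unfolding f_def by (rule conv_tendsto_pointwise[OF f[unfolded f_def] wK K(5)[OF that] K(1)])
    from filterlim_compose[OF this rlim] show ?thesis using that K(4) by (auto simp: wn_def f_def)
  qed
  have limT: "(\<lambda>n. T (wn n x)) \<longlonglongrightarrow> T (f x)" "(\<lambda>n. T' (wn n x)) \<longlonglongrightarrow> T' (f x)" if "x \<in> S" for x
    by (rule continuous_on_tendsto_compose[OF cT[of UNIV] lim[OF that]]; simp)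
       (rule continuous_on_tendsto_compose[OF T(2) lim[OF that]]; simp)
  have A: "(\<lambda>n. LINT x|lebesgue. T (wn n x) *\<^sub>R X x) \<longlonglongrightarrow> (LINT x|lebesgue. T (f x) *\<^sub>R X x)"
  proof (rule Bochner_Integration.integral_dominated_convergence)
    show "integrable lebesgue (\<lambda>x. B1 * norm (X x))" using iX by simp
    show "AE x in lebesgue. (\<lambda>n. T (wn n x) *\<^sub>R X x) \<longlonglongrightarrow> T (f x) *\<^sub>R X x"
    proof (rule AE_I2)
      fix x show "(\<lambda>n. T (wn n x) *\<^sub>R X x) \<longlonglongrightarrow> T (f x) *\<^sub>R X x"
        by (cases "x \<in> S") (auto simp: X0 intro!: tendsto_intros limT)
    qed
    show "AE x in lebesgue. norm (T (wn n x) *\<^sub>R X x) \<le> B1 * norm (X x)" for n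
      by (auto intro!: mult_right_mono B1 wnB)
  qed (use mw mf2 iX in auto)
  have C: "(\<lambda>n. LINT x|lebesgue. \<zeta> x *\<^sub>R (T' (wn n x) *\<^sub>R g x)) \<longlonglongrightarrow> (LINT x|lebesgue. \<zeta> x *\<^sub>R (T' (f x) *\<^sub>R g x))"
  proof (rule Bochner_Integration.integral_dominated_convergence)
    show "integrable lebesgue (\<lambda>x. B3 * (B2 * norm (g x)))" using g by simp
    show "AE x in lebesgue. (\<lambda>n. \<zeta> x *\<^sub>R (T' (wn n x) *\<^sub>R g x)) \<longlonglongrightarrow> \<zeta> x *\<^sub>R (T' (f x) *\<^sub>R g x)"
    proof (rule AE_I2)
      fix x show "(\<lambda>n. \<zeta> x *\<^sub>R (T' (wn n x) *\<^sub>R g x)) \<longlonglongrightarrow> \<zeta> x *\<^sub>R (T' (f x) *\<^sub>R g x)"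
        by (cases "x \<in> S") (auto simp: S(3) intro!: tendsto_intros limT)
    qed
    show "AE x in lebesgue. norm (\<zeta> x *\<^sub>R (T' (wn n x) *\<^sub>R g x)) \<le> B3 * (B2 * norm (g x))" for n
      using bnd by (intro AE_I2)
  qed (use m\<zeta> mw mf2 g in auto)
  have iC: "integrable lebesgue (\<lambda>x. \<zeta> x *\<^sub>R (T' (wn n x) *\<^sub>R g x))" for n
    by (rule Bochner_Integration.integrable_bound[where f="\<lambda>x. B3 * (B2 * norm (g x))"])
       (use m\<zeta> mw g in \<open>auto intro!: AE_I2 order_trans[OF bnd abs_ge_self] simp del: norm_scaleR scaleR_scaleR\<close>)
  have lg: "((\<lambda>r. LINT x|lebesgue. norm (conv r g x - g x)) \<longlongrightarrow> 0) (at_right 0)"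
    and ig: "\<And>r. r > 0 \<Longrightarrow> integrable lebesgue (\<lambda>x. norm (conv r g x - g x))"
    using conv_tendsto_L1[OF g] bounded_ext[OF compact_imp_bounded[OF K(2)]] by (auto simp: g_def)
  have D0: "(\<lambda>n. LINT x|lebesgue. norm (gn n x - g x)) \<longlonglongrightarrow> 0"
    using filterlim_compose[OF lg rlim] by (simp add: gn_def)
  have mg: "gn n \<in> borel_measurable lebesgue" for n using cgn by (rule continuous_imp_lebesgue_measurable)
  have iD: "integrable lebesgue (\<lambda>x. \<zeta> x *\<^sub>R (T' (wn n x) *\<^sub>R (gn n x - g x)))"
    and bD: "norm (LINT x|lebesgue. \<zeta> x *\<^sub>R (T' (wn n x) *\<^sub>R (gn n x - g x))) \<le> B3 * B2 * (LINT x|lebesgue. norm (gn n x - g x))" for n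
  proof -
    have i: "integrable lebesgue (\<lambda>x. B3 * (B2 * norm (gn n x - g x)))" using ig[OF r(1)[of n]] by (simp add: gn_def)
    have b: "norm (\<zeta> x *\<^sub>R (T' (wn n x) *\<^sub>R (gn n x - g x))) \<le> B3 * (B2 * norm (gn n x - g x))" for x
      by (rule bnd)
    show j: "integrable lebesgue (\<lambda>x. \<zeta> x *\<^sub>R (T' (wn n x) *\<^sub>R (gn n x - g x)))"
      by (rule Bochner_Integration.integrable_bound[OF i])
        (use m\<zeta> mw mg g b in \<open>auto intro!: AE_I2 order_trans[OF b abs_ge_self] simp del: norm_scaleR scaleR_scaleR\<close>)
    have "norm (LINT x|lebesgue. \<zeta> x *\<^sub>R (T' (wn n x) *\<^sub>R (gn n x - g x))) \<le> (LINT x|lebesgue. B3 * (B2 * norm (gn n x - g x)))"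
      by (rule Bochner_Integration.integral_norm_bound_integral[OF j i b])
    then show "norm (LINT x|lebesgue. \<zeta> x *\<^sub>R (T' (wn n x) *\<^sub>R (gn n x - g x))) \<le> B3 * B2 * (LINT x|lebesgue. norm (gn n x - g x))"
      by simp
  qed
  have D: "(\<lambda>n. LINT x|lebesgue. \<zeta> x *\<^sub>R (T' (wn n x) *\<^sub>R (gn n x - g x))) \<longlonglongrightarrow> 0"
  proof (rule Lim_null_comparison)
    show "\<forall>\<^sub>F n in sequentially. norm (LINT x|lebesgue. \<zeta> x *\<^sub>R (T' (wn n x) *\<^sub>R (gn n x - g x))) \<le> B3 * B2 * (LINT x|lebesgue. norm (gn n x - g x))"
      using bD by simp
    show "(\<lambda>n. B3 * B2 * (LINT x|lebesgue. norm (gn n x - g x))) \<longlonglongrightarrow> 0"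
      using tendsto_mult_left[OF D0, of "B3 * B2"] by simp
  qed
  \<comment> \<open>The mollified gradient is written as \<open>g x + (gn n x - g x)\<close>: the
    first part converges by domination, the second is small in L^1 against bounded factors.\<close>
  have E: "(LINT x|lebesgue. T (wn n x) *\<^sub>R X x) = 
      - ((LINT x|lebesgue. \<zeta> x *\<^sub>R (T' (wn n x) *\<^sub>R g x)) + (LINT x|lebesgue. \<zeta> x *\<^sub>R (T' (wn n x) *\<^sub>R (gn n x - g x))))" for n
  proof -
    have cw: "C1_grad (wn n) (gradient (wn n))"
      unfolding wn_def by (intro Ck_on_Suc0_C1_grad Ck_on_conv r f)
    have P: "C1_grad (\<lambda>x. T (wn n x) * \<zeta> x) (\<lambda>x. T (wn n x) *\<^sub>R X x + \<zeta> x *\<^sub>R (T' (wn n x) *\<^sub>R gradient (wn n) x))"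
      by (rule C1_grad_mult[OF C1_grad_compose[OF cw T] \<zeta>])
    have "(LINT x|lebesgue. T (wn n x) *\<^sub>R X x + \<zeta> x *\<^sub>R (T' (wn n x) *\<^sub>R gradient (wn n) x)) = 0"
      by (rule integral_gradient_eq_0[OF P, of R]) (use S(3) Soff in auto)
    moreover have "\<zeta> x *\<^sub>R (T' (wn n x) *\<^sub>R gradient (wn n) x) = \<zeta> x *\<^sub>R (T' (wn n x) *\<^sub>R g x) + \<zeta> x *\<^sub>R (T' (wn n x) *\<^sub>R (gn n x - g x))" for x
    proof (cases "x \<in> S")
      case True
      have "cball x (r n) \<subseteq> K" using K(5)[OF True] r(2)[of n] by (meson less_imp_le order_trans subset_cball)
      then have "gradient (wn n) x = gn n x"
        unfolding wn_def gn_def f_def g_def by (rule gradient_conv_weak_gradient[OF w(1) \<Omega> K(2,3) _ r(1)])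
      then show ?thesis by (simp flip: scaleR_add_right)
    qed (simp add: S(3))
    ultimately have "(LINT x|lebesgue. T (wn n x) *\<^sub>R X x + (\<zeta> x *\<^sub>R (T' (wn n x) *\<^sub>R g x) + \<zeta> x *\<^sub>R (T' (wn n x) *\<^sub>R (gn n x - g x)))) = 0"
      by simp
    moreover have "integrable lebesgue (\<lambda>x. T (wn n x) *\<^sub>R X x)"
      by (rule integrable_lebesgue_bounded_scaleR[OF mw(1) _ iX, of _ B1, OF B1[OF wnB]])
    ultimately show ?thesis using iC[of n] iD[of n]
      by (simp only: Bochner_Integration.integral_add Bochner_Integration.integrable_add eq_neg_iff_add_eq_0)
  qed
  have "(\<lambda>n. LINT x|lebesgue. T (wn n x) *\<^sub>R X x) \<longlonglongrightarrow> - ((LINT x|lebesgue. \<zeta> x *\<^sub>R (T' (f x) *\<^sub>R g x)) + 0)"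
    unfolding E by (intro tendsto_intros C D)
  from LIMSEQ_unique[OF A this]
  have "(LINT x|lebesgue. T (f x) *\<^sub>R X x) = - (LINT x|lebesgue. \<zeta> x *\<^sub>R (T' (f x) *\<^sub>R g x))" by simp
  moreover have "ext \<Omega> (\<lambda>x. T (w x) *\<^sub>R X x) = (\<lambda>x. T (f x) *\<^sub>R X x)"
    using K(3,4) X0 by (force simp: ext_def f_def fun_eq_iff)
  moreover have "ext \<Omega> (\<lambda>x. \<zeta> x *\<^sub>R (T' (w x) *\<^sub>R G x)) = (\<lambda>x. \<zeta> x *\<^sub>R (T' (f x) *\<^sub>R g x))"
    using K(3,4) S(3) by (force simp: ext_def f_def g_def fun_eq_iff)
  ultimately show ?thesis using \<Omega>m by (simp add: integral_lebesgue_on_ext(1))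
qed

lemma test_functionD:
  assumes "test_function \<Omega> \<phi>"
  obtains S where "compact S" "S \<subseteq> \<Omega>" "\<And>x. x \<notin> S \<Longrightarrow> \<phi> x = 0" "\<And>x. x \<notin> S \<Longrightarrow> gradient \<phi> x = 0"
proof -
  let ?S = "closure {x. \<phi> x \<noteq> 0}"
  have S: "compact ?S" "?S \<subseteq> \<Omega>" using assms by (auto simp: test_function_def)
  have z: "\<phi> x = 0" if "x \<notin> ?S" for x using that closure_subset[of "{x. \<phi> x \<noteq> 0}"] by auto
  show ?thesis
    by (rule that[OF S z]) (auto intro: gradient_zero_off_closed[OF C1_grad_test_function[OF assms] _ z])
qed

lemma compact_lebesgue_sets: "compact (K::'a::euclidean_space set) \<Longrightarrow> K \<in> sets lebesgue"
  by (simp add: lmeasurable_compact fmeasurableD)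

lemma compact_zero_off_ball:
  fixes S :: "'a::euclidean_space set"
  assumes "compact S" obtains R where "\<And>x. norm x > R \<Longrightarrow> x \<notin> S"
proof -
  obtain R where "\<And>x. x \<in> S \<Longrightarrow> norm x \<le> R" using compact_imp_bounded[OF assms] by (auto simp: bounded_iff)
  then have "x \<notin> S" if "norm x > R" for x using that by force
  then show ?thesis using that by blast
qed

lemma integrable_test_pairing:
  fixes f :: "'a::euclidean_space \<Rightarrow> 'b::euclidean_space"
  assumes f: "locally_integrable \<Omega> f" and \<Omega>: "open \<Omega>" and S: "compact S" "S \<subseteq> \<Omega>"
    and X: "continuous_on UNIV X" "\<And>x. x \<notin> S \<Longrightarrow> X x = (0::real)"
  shows "integrable (lebesgue_on \<Omega>) (\<lambda>x. X x *\<^sub>R f x)"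
proof -
  obtain R where R: "\<And>x. norm x > R \<Longrightarrow> x \<notin> S" by (rule compact_zero_off_ball[OF S(1)]) (rule that)
  obtain B where B: "\<And>x. norm (X x) \<le> B"
    by (rule continuous_zero_off_ball_bounded[OF X(1), of R]) (auto simp: X R that)
  have eq: "ext \<Omega> (\<lambda>x. X x *\<^sub>R f x) = (\<lambda>x. X x *\<^sub>R ext S f x)"
    using X(2) S(2) by (force simp: ext_def fun_eq_iff)
  have "integrable lebesgue (\<lambda>x. X x *\<^sub>R ext S f x)"
    by (rule integrable_lebesgue_bounded_scaleR[where B=B])
       (use B continuous_imp_lebesgue_measurable[OF X(1)] integrable_ext_locally_integrable[OF f S] in auto)
  then show ?thesis using \<Omega> by (simp add: integral_lebesgue_on_ext(2) eq)
qed

lemma integrable_test_pairing_vector: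
  fixes X :: "'a::euclidean_space \<Rightarrow> 'b::euclidean_space"
  assumes f: "locally_integrable \<Omega> f" and \<Omega>: "open \<Omega>" and S: "compact S" "S \<subseteq> \<Omega>"
    and X: "continuous_on UNIV X" "\<And>x. x \<notin> S \<Longrightarrow> X x = 0"
  shows "integrable (lebesgue_on \<Omega>) (\<lambda>x. f x *\<^sub>R X x)"
proof -
  obtain R where R: "\<And>x. norm x > R \<Longrightarrow> x \<notin> S" by (rule compact_zero_off_ball[OF S(1)]) (rule that)
  obtain B where B: "\<And>x. norm (X x) \<le> B" "B > 0"
    by (rule continuous_zero_off_ball_bounded[OF X(1), of R]) (auto simp: X R that)
  have eq: "ext \<Omega> (\<lambda>x. f x *\<^sub>R X x) = (\<lambda>x. ext S f x *\<^sub>R X x)"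
    using X(2) S(2) by (force simp: ext_def fun_eq_iff)
  have i: "integrable lebesgue (ext S f)" using integrable_ext_locally_integrable[OF f S] .
  have "integrable lebesgue (\<lambda>x. ext S f x *\<^sub>R X x)"
  proof (rule Bochner_Integration.integrable_bound)
    show "integrable lebesgue (\<lambda>y. B * ext S f y)" using i by simp
    show "(\<lambda>y. ext S f y *\<^sub>R X y) \<in> borel_measurable lebesgue"
      using i continuous_imp_lebesgue_measurable[OF X(1)] by simp
    show "AE y in lebesgue. norm (ext S f y *\<^sub>R X y) \<le> norm (B * ext S f y)"
      using B by (intro AE_I2) (simp add: abs_mult mult.commute[of B] mult_left_mono)
  qed
  then show ?thesis using \<Omega> by (simp add: integral_lebesgue_on_ext(2) eq)
qed

lemma locally_integrable_continuous:
  fixes f :: "'a::euclidean_space \<Rightarrow> 'b::euclidean_space"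
  assumes "continuous_on \<Omega> f"
  shows "locally_integrable \<Omega> f"
  unfolding locally_integrable_def
proof (intro allI impI)
  fix K assume K: "compact K \<and> K \<subseteq> \<Omega>"
  then have c: "continuous_on K f" using assms continuous_on_subset by blast
  have "integrable lborel (\<lambda>x. indicator K x *\<^sub>R f x)" using K c by (intro borel_integrable_compact) auto
  moreover have "(\<lambda>x. indicator K x *\<^sub>R f x) = ext K f" by (auto simp: ext_def fun_eq_iff)
  ultimately have "integrable lborel (ext K f)" by simp
  then have "integrable lebesgue (ext K f)" by (simp add: integrable_completion)
  then show "integrable (lebesgue_on K) f" using K by (simp add: integral_lebesgue_on_ext(2) compact_lebesgue_sets)
qed

lemma locally_integrable_continuous_scaleR:
  fixes G :: "'a::euclidean_space \<Rightarrow> 'b::euclidean_space"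
  assumes "continuous_on \<Omega> f" "locally_integrable \<Omega> G"
  shows "locally_integrable \<Omega> (\<lambda>x. f x *\<^sub>R G x)"
  unfolding locally_integrable_def
proof (intro allI impI)
  fix K assume K: "compact K \<and> K \<subseteq> \<Omega>"
  then have c: "continuous_on K f" using assms continuous_on_subset by blast
  then have "bounded (f ` K)" using K by (auto intro!: compact_imp_bounded compact_continuous_image)
  then obtain B where B: "B > 0" "\<And>x. x \<in> K \<Longrightarrow> norm (f x) \<le> B" by (auto simp: bounded_pos)
  have i: "integrable lebesgue (ext K f)"
    using integrable_ext_locally_integrable[OF locally_integrable_continuous[OF assms(1)]] K by blast
  have "integrable lebesgue (\<lambda>x. ext K f x *\<^sub>R ext K G x)"
  proof (rule integrable_lebesgue_bounded_scaleR[where B=B])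
    show "\<bar>ext K f x\<bar> \<le> B" for x using B by (cases "x \<in> K") auto
  qed (use i integrable_ext_locally_integrable[OF assms(2)] K in auto)
  moreover have "(\<lambda>x. ext K f x *\<^sub>R ext K G x) = ext K (\<lambda>x. f x *\<^sub>R G x)" by (auto simp: ext_def fun_eq_iff)
  ultimately show "integrable (lebesgue_on K) (\<lambda>x. f x *\<^sub>R G x)"
    using K by (simp add: integral_lebesgue_on_ext(2) compact_lebesgue_sets)
qed

lemma has_weak_gradient_compose:
  assumes "open \<Omega>" "has_weak_gradient \<Omega> w G" "continuous_on \<Omega> w"
    and T: "\<And>s. (T has_real_derivative T' s) (at s)" "continuous_on UNIV T'"
  shows "has_weak_gradient \<Omega> (\<lambda>x. T (w x)) (\<lambda>x. T' (w x) *\<^sub>R G x)"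
  unfolding has_weak_gradient_def
proof (intro conjI allI impI)
  have cT: "continuous_on UNIV T" using T(1) by (meson DERIV_isCont continuous_at_imp_continuous_on)
  show "locally_integrable \<Omega> (\<lambda>x. T (w x))"
    by (intro locally_integrable_continuous continuous_on_compose2[OF cT assms(3)]) simp
  show "locally_integrable \<Omega> (\<lambda>x. T' (w x) *\<^sub>R G x)"
    using assms(2) unfolding has_weak_gradient_def
    by (intro locally_integrable_continuous_scaleR continuous_on_compose2[OF T(2) assms(3)]) auto
  fix \<phi> assume \<phi>: "test_function \<Omega> \<phi>"
  obtain S where S: "compact S" "S \<subseteq> \<Omega>" "\<And>x. x \<notin> S \<Longrightarrow> \<phi> x = 0"
    by (rule test_functionD[OF \<phi>]) (rule that)
  show "(LINT x|lebesgue_on \<Omega>. T (w x) *\<^sub>R gradient \<phi> x) = - (LINT x|lebesgue_on \<Omega>. \<phi> x *\<^sub>R (T' (w x) *\<^sub>R G x))"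
    by (rule weak_gradient_compose_C1_test[OF assms(1-3) T C1_grad_test_function[OF \<phi>] S])
qed

lemma weak_gradient_C1_test:
  assumes "open \<Omega>" "has_weak_gradient \<Omega> w G" "continuous_on \<Omega> w"
    "C1_grad \<zeta> X" "compact S" "S \<subseteq> \<Omega>" "\<And>x. x \<notin> S \<Longrightarrow> \<zeta> x = 0"
  shows "(LINT x|lebesgue_on \<Omega>. w x *\<^sub>R X x) = - (LINT x|lebesgue_on \<Omega>. \<zeta> x *\<^sub>R G x)"
  using weak_gradient_compose_C1_test[OF assms(1-3), of "\<lambda>s. s" "\<lambda>s. 1" \<zeta> X S] assms(4-) by simp

section \<open>Linearity, uniqueness and Lipschitz bounds for weak gradients\<close>

lemma locally_integrable_add:
  fixes f g :: "'a::euclidean_space \<Rightarrow> 'b::euclidean_space"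
  shows "locally_integrable \<Omega> f \<Longrightarrow> locally_integrable \<Omega> g \<Longrightarrow> locally_integrable \<Omega> (\<lambda>x. f x + g x)"
  unfolding locally_integrable_def by simp

lemma locally_integrable_minus:
  fixes f :: "'a::euclidean_space \<Rightarrow> 'b::euclidean_space"
  shows "locally_integrable \<Omega> f \<Longrightarrow> locally_integrable \<Omega> (\<lambda>x. - f x)"
  unfolding locally_integrable_def by simp

lemma has_weak_gradient_minus:
  "has_weak_gradient \<Omega> u G \<Longrightarrow> has_weak_gradient \<Omega> (\<lambda>x. - u x) (\<lambda>x. - G x)"
  unfolding has_weak_gradient_def by (simp add: locally_integrable_minus)

lemma has_weak_gradient_add:
  assumes "open \<Omega>" "has_weak_gradient \<Omega> u G" "has_weak_gradient \<Omega> v H"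
  shows "has_weak_gradient \<Omega> (\<lambda>x. u x + v x) (\<lambda>x. G x + H x)"
proof -
  have l: "locally_integrable \<Omega> u" "locally_integrable \<Omega> G" "locally_integrable \<Omega> v" "locally_integrable \<Omega> H"
    using assms by (auto simp: has_weak_gradient_def)
  have "(LINT x|lebesgue_on \<Omega>. (u x + v x) *\<^sub>R gradient \<phi> x) = - (LINT x|lebesgue_on \<Omega>. \<phi> x *\<^sub>R (G x + H x))"
    if \<phi>: "test_function \<Omega> \<phi>" for \<phi>
  proof -
    obtain S where S: "compact S" "S \<subseteq> \<Omega>" "\<And>x. x \<notin> S \<Longrightarrow> \<phi> x = 0" "\<And>x. x \<notin> S \<Longrightarrow> gradient \<phi> x = 0"
      by (rule test_functionD[OF \<phi>]) (rule that)
    note c = C1_gradD(3,4)[OF C1_grad_test_function[OF \<phi>], of UNIV]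
    have i: "integrable (lebesgue_on \<Omega>) (\<lambda>x. u x *\<^sub>R gradient \<phi> x)" "integrable (lebesgue_on \<Omega>) (\<lambda>x. v x *\<^sub>R gradient \<phi> x)"
      by (rule integrable_test_pairing_vector[OF l(1) assms(1) S(1,2) c(2) S(4)]; simp)
         (rule integrable_test_pairing_vector[OF l(3) assms(1) S(1,2) c(2) S(4)]; simp)
    have j: "integrable (lebesgue_on \<Omega>) (\<lambda>x. \<phi> x *\<^sub>R G x)" "integrable (lebesgue_on \<Omega>) (\<lambda>x. \<phi> x *\<^sub>R H x)"
      by (rule integrable_test_pairing[OF l(2) assms(1) S(1,2) c(1) S(3)]; simp)
         (rule integrable_test_pairing[OF l(4) assms(1) S(1,2) c(1) S(3)]; simp)
    show ?thesis
      using i j assms(2,3) \<phi> unfolding has_weak_gradient_def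
      by (simp add: scaleR_add_left scaleR_add_right)
  qed
  then show ?thesis using l unfolding has_weak_gradient_def by (simp add: locally_integrable_add)
qed

lemma has_weak_gradient_diff:
  assumes "open \<Omega>" "has_weak_gradient \<Omega> u G" "has_weak_gradient \<Omega> v H"
  shows "has_weak_gradient \<Omega> (\<lambda>x. u x - v x) (\<lambda>x. G x - H x)"
  using has_weak_gradient_add[OF assms(1,2) has_weak_gradient_minus[OF assms(3)]] by simp

lemma has_weak_gradient_C1:
  assumes "open \<Omega>" "C1_grad f F"
  shows "has_weak_gradient \<Omega> f F"
  unfolding has_weak_gradient_def
proof (intro conjI allI impI)
  note c = C1_gradD(3,4)[OF assms(2)]
  show l: "locally_integrable \<Omega> f" "locally_integrable \<Omega> F" by (intro locally_integrable_continuous c)+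
  fix \<phi> assume \<phi>: "test_function \<Omega> \<phi>"
  obtain S where S: "compact S" "S \<subseteq> \<Omega>" "\<And>x. x \<notin> S \<Longrightarrow> \<phi> x = 0" "\<And>x. x \<notin> S \<Longrightarrow> gradient \<phi> x = 0"
    by (rule test_functionD[OF \<phi>]) (rule that)
  note c' = C1_gradD(3,4)[OF C1_grad_test_function[OF \<phi>], of UNIV]
  obtain R where R: "\<And>x. norm x > R \<Longrightarrow> x \<notin> S" by (rule compact_zero_off_ball[OF S(1)]) (rule that)
  have "(LINT x|lebesgue. f x *\<^sub>R gradient \<phi> x + \<phi> x *\<^sub>R F x) = 0"
    by (rule integral_gradient_eq_0[OF C1_grad_mult[OF assms(2) C1_grad_test_function[OF \<phi>]], of R])
       (simp add: S(3) R)
  moreover have "ext \<Omega> (\<lambda>x. f x *\<^sub>R gradient \<phi> x) = (\<lambda>x. f x *\<^sub>R gradient \<phi> x)"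
    "ext \<Omega> (\<lambda>x. \<phi> x *\<^sub>R F x) = (\<lambda>x. \<phi> x *\<^sub>R F x)"
    using S(2-4) by (force simp: ext_def fun_eq_iff)+
  moreover have "integrable (lebesgue_on \<Omega>) (\<lambda>x. f x *\<^sub>R gradient \<phi> x)"
    by (rule integrable_test_pairing_vector[OF l(1) assms(1) S(1,2) c'(2) S(4)])
  moreover have "integrable (lebesgue_on \<Omega>) (\<lambda>x. \<phi> x *\<^sub>R F x)"
    by (rule integrable_test_pairing[OF l(2) assms(1) S(1,2) c'(1) S(3)])
  ultimately show "(LINT x|lebesgue_on \<Omega>. f x *\<^sub>R gradient \<phi> x) = - (LINT x|lebesgue_on \<Omega>. \<phi> x *\<^sub>R F x)"
    using assms(1) by (simp add: integral_lebesgue_on_ext eq_neg_iff_add_eq_0)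
qed

text \<open>On \<open>A\<close> the excess of \<open>norm (f x)\<close> over \<open>L\<close> is at
  most \<open>norm (conv r f x - f x)\<close>, whose integral tends to zero with \<open>r\<close>.
  The integral of the excess is thus zero; no almost everywhere convergence of mollifications is
  involved.\<close>

lemma AE_norm_le_of_conv:
  fixes f :: "'a::euclidean_space \<Rightarrow> 'b::euclidean_space"
  assumes f: "integrable lebesgue f" "bounded {x. f x \<noteq> 0}" and A: "A \<in> sets lebesgue"
    and L: "s > 0" "\<And>r x. 0 < r \<Longrightarrow> r < s \<Longrightarrow> x \<in> A \<Longrightarrow> norm (conv r f x) \<le> L"
  shows "AE x in lebesgue. x \<in> A \<longrightarrow> norm (f x) \<le> L"
proof -
  let ?h = "\<lambda>x. indicator A x * max 0 (norm (f x) - L)"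
  have mh: "?h \<in> borel_measurable lebesgue" using f(1) A by measurable
  have le: "?h x \<le> norm (conv r f x - f x)" if "0 < r" "r < s" for r x
  proof (cases "x \<in> A")
    case True
    then show ?thesis using L(2)[OF that True] norm_triangle_ineq3[of "f x" "conv r f x"]
      by (simp add: norm_minus_commute)
  qed simp
  have ih: "integrable lebesgue ?h"
  proof (rule Bochner_Integration.integrable_bound[OF _ mh])
    show "integrable lebesgue (\<lambda>x. norm (conv (s/2) f x - f x))" using conv_tendsto_L1(1)[OF f] L(1) by simp
    show "AE x in lebesgue. norm (?h x) \<le> norm (norm (conv (s/2) f x - f x))"
      using le[of "s/2"] L(1) by (intro AE_I2) simp
  qed
  have "(LINT x|lebesgue. ?h x) \<le> 0"
  proof (rule tendsto_lowerbound[OF conv_tendsto_L1(2)[OF f]])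
    show "\<forall>\<^sub>F r in at_right 0. (LINT x|lebesgue. ?h x) \<le> (LINT x|lebesgue. norm (conv r f x - f x))"
      unfolding eventually_at_right_field
      by (intro exI[of _ s] conjI allI impI L(1) integral_mono ih conv_tendsto_L1(1)[OF f] le)
  qed simp
  moreover have "(LINT x|lebesgue. ?h x) \<ge> 0" by (intro Bochner_Integration.integral_nonneg) simp
  ultimately have "(LINT x|lebesgue. ?h x) = 0" by simp
  then have "AE x in lebesgue. ?h x = 0"
    using integral_nonneg_eq_0_iff_AE[OF ih] by simp
  then show ?thesis by eventually_elim (auto simp: indicator_def max_def split: if_splits)
qed

lemma AE_lebesgue_iff_negligible: "(AE x in lebesgue. P x) \<longleftrightarrow> negligible {x::'a::euclidean_space. \<not> P x}"
proof
  assume "AE x in lebesgue. P x"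
  then obtain N where "N \<in> null_sets lebesgue" "{x. \<not> P x} \<subseteq> N"
    unfolding eventually_ae_filter by auto
  then show "negligible {x. \<not> P x}" using negligible_iff_null_sets negligible_subset by blast
next
  assume "negligible {x. \<not> P x}"
  then have "{x. \<not> P x} \<in> null_sets lebesgue" by (simp add: negligible_iff_null_sets)
  from AE_not_in[OF this] show "AE x in lebesgue. P x" by simp
qed

lemma AE_lebesgue_on_iff_negligible:
  "S \<in> sets lebesgue \<Longrightarrow> (AE x in lebesgue_on S. P x) \<longleftrightarrow> negligible {x::'a::euclidean_space. x \<in> S \<and> \<not> P x}"
  by (simp add: AE_restrict_space_iff AE_lebesgue_iff_negligible)

lemma AE_lebesgue_on_local:
  fixes \<Omega> :: "'a::euclidean_space set"
  assumes "open \<Omega>" "\<And>x. x \<in> \<Omega> \<Longrightarrow> \<exists>s>0. AE y in lebesgue. y \<in> ball x s \<longrightarrow> y \<in> \<Omega> \<longrightarrow> P y"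
  shows "AE x in lebesgue_on \<Omega>. P x"
proof -
  have "negligible {x. x \<in> \<Omega> \<and> \<not> P x}" unfolding locally_negligible_alt[of "{x. x \<in> \<Omega> \<and> \<not> P x}"]
  proof
    fix x assume x: "x \<in> {x. x \<in> \<Omega> \<and> \<not> P x}"
    then obtain s where s: "s > 0" "AE y in lebesgue. y \<in> ball x s \<longrightarrow> y \<in> \<Omega> \<longrightarrow> P y" using assms(2) by blast
    then have "negligible {y. \<not> (y \<in> ball x s \<longrightarrow> y \<in> \<Omega> \<longrightarrow> P y)}" by (simp only: AE_lebesgue_iff_negligible)
    then have "negligible ({x. x \<in> \<Omega> \<and> \<not> P x} \<inter> ball x s)" by (rule negligible_subset) auto
    then show "\<exists>U. openin (top_of_set {x. x \<in> \<Omega> \<and> \<not> P x}) U \<and> x \<in> U \<and> negligible U"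
      using x s(1) by (intro exI[of _ "{x. x \<in> \<Omega> \<and> \<not> P x} \<inter> ball x s"]) (auto simp: openin_open)
  qed
  then show ?thesis using assms(1) by (simp add: AE_lebesgue_on_iff_negligible)
qed

text \<open>Locally the mollifications of \<open>G\<close> and \<open>H\<close> are both the
  gradient of the same mollified \<open>u\<close>. So \<open>conv r\<close> annihilates their
  difference, and the preceding criterion applies with the bound 0.\<close>

theorem weak_gradient_unique:
  assumes \<Omega>: "open \<Omega>" and G: "has_weak_gradient \<Omega> u G" "has_weak_gradient \<Omega> u H"
  shows "AE x in lebesgue_on \<Omega>. G x = H x"
proof (rule AE_lebesgue_on_local[OF \<Omega>])
  fix x0 assume "x0 \<in> \<Omega>"
  then obtain e where e: "e > 0" "cball x0 e \<subseteq> \<Omega>" using \<Omega> open_contains_cball by blast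
  let ?K = "cball x0 e" let ?s = "e / 2"
  let ?f = "\<lambda>x. ext ?K G x - ext ?K H x"
  have i: "integrable lebesgue (ext ?K G)" "integrable lebesgue (ext ?K H)"
    using G e(2) by (auto simp: has_weak_gradient_def intro: integrable_ext_locally_integrable)
  have "AE x in lebesgue. x \<in> ball x0 ?s \<longrightarrow> norm (?f x) \<le> 0"
  proof (rule AE_norm_le_of_conv[where s="?s"])
    show "integrable lebesgue ?f" using i by simp
    show "bounded {x. ?f x \<noteq> 0}" by (rule bounded_subset[OF bounded_cball[of x0 e]]) (auto simp: ext_def)
    fix r x assume r: "0 < r" "r < ?s" and x: "x \<in> ball x0 ?s"
    have "cball x r \<subseteq> ?K"
    proof
      fix y assume "y \<in> cball x r"
      then show "y \<in> ?K" using dist_triangle[of x0 y x] r x by auto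
    qed
    then have "conv r (ext ?K G) x = conv r (ext ?K H) x"
      using gradient_conv_weak_gradient[OF G(1) \<Omega> _ e(2) _ r(1)] gradient_conv_weak_gradient[OF G(2) \<Omega> _ e(2) _ r(1)]
      by (metis compact_cball)
    then show "norm (conv r ?f x) \<le> 0" by (simp add: conv_diff[OF r(1) i])
  qed (use e in auto)
  then have "AE x in lebesgue. x \<in> ball x0 ?s \<longrightarrow> x \<in> \<Omega> \<longrightarrow> G x = H x"
  proof eventually_elim
    case (elim x)
    have "x \<in> ball x0 ?s \<Longrightarrow> x \<in> ?K" using e(1) by (simp add: less_imp_le)
    then show ?case using elim by auto
  qed
  then show "\<exists>s>0. AE x in lebesgue. x \<in> ball x0 s \<longrightarrow> x \<in> \<Omega> \<longrightarrow> G x = H x" using e(1) by (intro exI[of _ ?s]) simp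
qed

lemma weak_gradient_AE:
  assumes "open \<Omega>" "has_weak_gradient \<Omega> u G"
  shows "has_weak_gradient \<Omega> u (weak_gradient \<Omega> u)" "AE x in lebesgue_on \<Omega>. weak_gradient \<Omega> u x = G x"
proof -
  show 1: "has_weak_gradient \<Omega> u (weak_gradient \<Omega> u)"
    unfolding weak_gradient_def by (rule someI[of "has_weak_gradient \<Omega> u"]) (rule assms(2))
  show "AE x in lebesgue_on \<Omega>. weak_gradient \<Omega> u x = G x" by (rule weak_gradient_unique[OF assms(1) 1 assms(2)])
qed

lemma norm_gradient_le_of_Lipschitz:
  fixes f :: "'a::euclidean_space \<Rightarrow> real"
  assumes D: "GDERIV f x :> D" and d: "d > 0" "\<And>h. norm h < d \<Longrightarrow> \<bar>f (x + h) - f x\<bar> \<le> L * norm h"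
  shows "norm D \<le> L"
proof (cases "D = 0")
  case True
  obtain b :: 'a where b: "norm b = d / 2" using vector_choose_size[of "d/2"] d(1) by auto
  have "0 \<le> L * norm b" by (rule order_trans[OF abs_ge_zero d(2)]) (use b d(1) in simp)
  then show ?thesis using True b d(1) by (simp add: zero_le_mult_iff)
next
  case False
  show ?thesis
  proof (rule field_le_epsilon)
    fix e :: real assume e: "e > 0"
    have "\<exists>d>0. \<forall>y. norm (y - x) < d \<longrightarrow> norm (f y - f x - (y - x) \<bullet> D) \<le> e * norm (y - x)"
      using D e unfolding gderiv_def has_derivative_at_alt by simp
    then obtain d' where d': "d' > 0" "\<And>y. norm (y - x) < d' \<Longrightarrow> norm (f y - f x - (y - x) \<bullet> D) \<le> e * norm (y - x)"
      by blast
    define t where "t = min d d' / (2 * norm D)"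
    have t: "t > 0" "norm (t *\<^sub>R D) < d" "norm (t *\<^sub>R D) < d'"
      using d(1) d'(1) False by (auto simp: t_def)
    have "\<bar>f (x + t *\<^sub>R D) - f x - (t *\<^sub>R D) \<bullet> D\<bar> \<le> e * norm (t *\<^sub>R D)" using d'(2)[of "x + t *\<^sub>R D"] t(3) by simp
    moreover have "\<bar>f (x + t *\<^sub>R D) - f x\<bar> \<le> L * norm (t *\<^sub>R D)" using d(2)[OF t(2)] .
    ultimately have "(t *\<^sub>R D) \<bullet> D \<le> (L + e) * norm (t *\<^sub>R D)" by (simp add: algebra_simps abs_le_iff)
    then have "t * (norm D * norm D) \<le> t * ((L + e) * norm D)" using t(1)
      by (simp add: dot_square_norm power2_eq_square algebra_simps)
    then show "norm D \<le> L + e" using t(1) False by simp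
  qed
qed

text \<open>Convolution commutes with translations, so mollifications inherit the Lipschitz constant
  and their classical gradients are bounded by \<open>L\<close>. The radius \<open>3 * s\<close>
  adds up the distance to the centre, the kernel radius and the increment, each below
  \<open>s\<close>.\<close>

lemma weak_gradient_Lipschitz_bound:
  assumes \<Omega>: "open \<Omega>" and G: "has_weak_gradient \<Omega> u G" and s: "s > 0" "cball x0 (3 * s) \<subseteq> \<Omega>"
    and L: "\<And>y z. y \<in> cball x0 (3 * s) \<Longrightarrow> z \<in> cball x0 (3 * s) \<Longrightarrow> \<bar>u y - u z\<bar> \<le> L * norm (y - z)"
  shows "AE x in lebesgue. x \<in> ball x0 s \<longrightarrow> norm (G x) \<le> L"
proof -
  let ?K = "cball x0 (3 * s)"
  let ?f = "ext ?K u"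
  have i: "integrable lebesgue (ext ?K u)" "integrable lebesgue (ext ?K G)"
    using G s(2) by (auto simp: has_weak_gradient_def intro: integrable_ext_locally_integrable)
  have L0: "L \<ge> 0"
  proof -
    obtain b :: 'a where b: "norm b = s" using vector_choose_size[of s] s(1) by auto
    have "0 \<le> L * norm (x0 + b - x0)"
      by (rule order_trans[OF abs_ge_zero L]) (use b s(1) in \<open>auto simp: dist_norm\<close>)
    then have "0 \<le> L * norm b" by simp
    then show ?thesis using b s(1) by (simp add: zero_le_mult_iff)
  qed
  have "continuous_on ?K u"
    unfolding continuous_on_iff
  proof (intro ballI allI impI)
    fix x e assume x: "x \<in> ?K" and e: "(e::real) > 0"
    show "\<exists>d>0. \<forall>x'\<in>?K. dist x' x < d \<longrightarrow> dist (u x') (u x) < e"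
    proof (intro exI[of _ "e / (L + 1)"] conjI ballI impI)
      show "e / (L + 1) > 0" using e L0 by simp
      fix x' assume x': "x' \<in> ?K" "dist x' x < e / (L + 1)"
      have "\<bar>u x' - u x\<bar> \<le> L * norm (x' - x)" using L x x' by blast
      also have "\<dots> \<le> (L + 1) * norm (x' - x)" by (intro mult_right_mono) auto
      also have "\<dots> < e" using x'(2) L0 by (simp add: dist_norm pos_less_divide_eq mult.commute)
      finally show "dist (u x') (u x) < e" by (simp add: dist_real_def)
    qed
  qed
  then have mf [measurable]: "?f \<in> borel_measurable borel"
    unfolding ext_def by (intro borel_measurable_continuous_on_if) auto
  have lip: "\<bar>conv r ?f (x + h) - conv r ?f x\<bar> \<le> L * norm h"
    if r: "0 < r" "r < s" and x: "x \<in> ball x0 s" and h: "norm h < s" for r x h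
  proof -
    have mm [measurable]: "moll r \<in> borel_measurable borel" using r(1) by (rule borel_measurable_moll)
    have ib: "integrable lborel ?f" using i(1) by (simp add: integrable_completion)
    have ish: "integrable lebesgue (\<lambda>y. ?f (y + h))"
    proof -
      have "integrable (distr lborel borel ((+) h)) ?f" using ib by (simp add: lborel_distr_plus)
      then have "integrable lborel (\<lambda>y. ?f (h + y))" by (subst (asm) integrable_distr_eq) auto
      then show ?thesis by (simp add: integrable_completion add.commute)
    qed
    have "conv r ?f (x + h) = (LINT y|lborel. moll r (x + h - y) *\<^sub>R ?f y)"
      unfolding conv_def by (intro integral_completion) measurable
    also have "\<dots> = (LINT y|lborel. moll r (x + h - (y + h)) *\<^sub>R ?f (y + h))"
      by (rule lborel_integral_translation[symmetric, where f="\<lambda>y. moll r (x + h - y) *\<^sub>R ?f y"]) measurable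
    also have "\<dots> = (LINT y|lborel. moll r (x - y) *\<^sub>R ?f (y + h))" by simp
    also have "\<dots> = conv r (\<lambda>y. ?f (y + h)) x"
      unfolding conv_def by (intro integral_completion[symmetric]) measurable
    finally have "conv r ?f (x + h) - conv r ?f x = conv r (\<lambda>y. ?f (y + h) - ?f y) x - 0"
      by (simp add: conv_diff[OF r(1) ish i(1)])
    also have "norm \<dots> \<le> L * norm h"
    proof (rule conv_dist_bound[OF r(1)])
      show "integrable lebesgue (\<lambda>y. ?f (y + h) - ?f y)" using ish i(1) by simp
      fix y assume y: "dist x y < r"
      have "dist x0 y \<le> dist x0 x + dist x y" by (rule dist_triangle)
      then have y1: "dist x0 y < 2 * s" using x y r by simp
      have "dist x0 (y + h) \<le> dist x0 y + norm h" using dist_triangle[of x0 "y + h" y] by (simp add: dist_norm)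
      then have "dist x0 (y + h) < 3 * s" using y1 h by simp
      then show "norm (?f (y + h) - ?f y - 0) \<le> L * norm h"
        using L[of "y + h" y] y1 s(1) by simp
    qed
    finally show ?thesis by simp
  qed
  have "AE x in lebesgue. x \<in> ball x0 s \<longrightarrow> norm (ext ?K G x) \<le> L"
  proof (rule AE_norm_le_of_conv[OF i(2) bounded_ext[OF bounded_cball] _ s(1)])
    fix r x assume r: "0 < r" "r < s" and x: "x \<in> ball x0 s"
    have "cball x r \<subseteq> ?K"
    proof
      fix y assume "y \<in> cball x r"
      then show "y \<in> ?K" using dist_triangle[of x0 y x] r x s(1) by auto
    qed
    then have "conv r (ext ?K G) x = gradient (conv r ?f) x"
      using gradient_conv_weak_gradient[OF G \<Omega> compact_cball s(2) _ r(1)] by simp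
    moreover have "norm (gradient (conv r ?f) x) \<le> L"
      by (rule norm_gradient_le_of_Lipschitz[OF C1_gradD(1)[OF Ck_on_Suc0_C1_grad[OF Ck_on_conv[OF r(1) i(1)]]] s(1) lip[OF r x]])
    ultimately show "norm (conv r (ext ?K G) x) \<le> L" by simp
  qed simp
  then show ?thesis
  proof eventually_elim
    case (elim x)
    then show ?case using s(1) by (auto simp: ext_def split: if_splits)
  qed
qed

subsection \<open>Truncation and \<open>W\<^sup>1\<^sup>,\<^sup>p\<^sub>0\<close>\<close>

text \<open>A C^1 function vanishing on the negative half-line: raw material for the truncations
  here and for the barrier and cut-off in the comparison argument.\<close>

definition sqp :: "real \<Rightarrow> real" where "sqp x = (max 0 x)\<^sup>2"

lemma sqp_deriv: "(sqp has_real_derivative 2 * max 0 x) (at x)"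
proof -
  consider "x > 0" | "x < 0" | "x = 0" by linarith
  then show ?thesis
  proof cases
    case 1
    have "((\<lambda>x. x\<^sup>2) has_real_derivative 2 * max 0 x) (at x)"
      using 1 by (auto intro!: derivative_eq_intros)
    then show ?thesis
      by (rule has_field_derivative_transform_within_open[where S="{0<..}"]) (use 1 in \<open>auto simp: sqp_def\<close>)
  next
    case 2
    have "((\<lambda>x. 0) has_real_derivative 2 * max 0 x) (at x)" using 2 by auto
    then show ?thesis
      by (rule has_field_derivative_transform_within_open[where S="{..<0}"]) (use 2 in \<open>auto simp: sqp_def\<close>)
  next
    case 3
    have "((\<lambda>h. \<bar>h\<bar>) \<longlongrightarrow> 0) (at (0::real))" by (auto intro!: tendsto_eq_intros)
    then have "((\<lambda>h. sqp h / h) \<longlongrightarrow> 0) (at 0)"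
      by (rule Lim_null_comparison[rotated]) (auto simp: sqp_def max_def power2_eq_square intro!: always_eventually)
    then show ?thesis unfolding 3 DERIV_def by (simp add: sqp_def)
  qed
qed

text \<open>\<open>soft d\<close> is a \<open>C\<^sup>1\<close> substitute for \<open>s \<mapsto> max 0 (s - d)\<close>, namely \<open>sqrt (t\<^sup>2 + d\<^sup>2) - d\<close> at \<open>t = max 0 (s - d)\<close>.\<close>

definition soft :: "real \<Rightarrow> real \<Rightarrow> real" where
  "soft d s = sqrt (sqp (s - d) + d\<^sup>2) - d"

definition soft' :: "real \<Rightarrow> real \<Rightarrow> real" where
  "soft' d s = max 0 (s - d) / sqrt (sqp (s - d) + d\<^sup>2)"

lemma sqp_nonneg: "sqp x \<ge> 0" by (simp add: sqp_def)

lemma continuous_on_sqp: "continuous_on A f \<Longrightarrow> continuous_on A (\<lambda>x. sqp (f x))"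
  unfolding sqp_def by (intro continuous_intros)

context
  fixes d :: real assumes d: "d > 0"
begin

lemma soft_den_pos: "sqp (s - d) + d\<^sup>2 > 0"
  using d sqp_nonneg[of "s - d"] by (simp add: add_nonneg_pos)

lemma soft_deriv: "(soft d has_real_derivative soft' d s) (at s)"
proof -
  have 1: "((\<lambda>s. sqp (s - d) + d\<^sup>2) has_real_derivative 2 * max 0 (s - d)) (at s)"
    by (rule derivative_eq_intros DERIV_chain2[OF sqp_deriv] refl)+ simp
  show ?thesis
    unfolding soft_def soft'_def
    by (rule DERIV_cong[OF DERIV_diff[OF DERIV_chain2[OF DERIV_real_sqrt[OF soft_den_pos] 1] DERIV_const]])
       (simp add: field_simps)
qed

lemma soft'_continuous: "continuous_on A (soft' d)"
  unfolding soft'_def by (intro continuous_intros continuous_on_sqp) (use soft_den_pos in \<open>auto simp: less_imp_neq[THEN not_sym]\<close>)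

lemma soft_zero: "s \<le> d \<Longrightarrow> soft d s = 0" "s \<le> d \<Longrightarrow> soft' d s = 0"
  using d by (auto simp: soft_def soft'_def sqp_def max_def)

lemma soft_pos: "s > d \<Longrightarrow> soft d s > 0"
proof -
  assume "s > d"
  then have "sqrt (d\<^sup>2) < sqrt (sqp (s - d) + d\<^sup>2)" by (intro real_sqrt_less_mono) (simp add: sqp_def)
  then show ?thesis using d by (simp add: soft_def)
qed

lemma soft_nonneg: "soft d s \<ge> 0"
  using soft_zero(1)[of s] soft_pos[of s] by (cases "s \<le> d") auto

lemma soft'_bounds: "0 \<le> soft' d s" "soft' d s \<le> 1"
proof -
  show "0 \<le> soft' d s" using soft_den_pos[of s] by (simp add: soft'_def)
  have "sqrt ((max 0 (s - d))\<^sup>2) \<le> sqrt (sqp (s - d) + d\<^sup>2)" by (intro real_sqrt_le_mono) (simp add: sqp_def)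
  then have "max 0 (s - d) \<le> sqrt (sqp (s - d) + d\<^sup>2)" by simp
  then show "soft' d s \<le> 1" using soft_den_pos[of s] by (simp add: soft'_def)
qed

lemma soft_pos_part: "soft d s \<le> max 0 s" "max 0 s - 2 * d \<le> soft d s"
proof -
  have "soft d s \<le> max 0 s \<and> max 0 s - 2 * d \<le> soft d s"
  proof (cases "s \<le> d")
    case True
    then show ?thesis using d by (auto simp: soft_zero)
  next
    case False
    then have "sqp (s - d) + d\<^sup>2 \<le> s\<^sup>2" using d by (simp add: sqp_def power2_eq_square algebra_simps)
    then have "sqrt (sqp (s - d) + d\<^sup>2) \<le> sqrt (s\<^sup>2)" by (rule real_sqrt_le_mono)
    moreover have "sqrt ((s - d)\<^sup>2) \<le> sqrt (sqp (s - d) + d\<^sup>2)" using False by (intro real_sqrt_le_mono) (simp add: sqp_def)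
    ultimately show ?thesis using False d by (simp add: soft_def)
  qed
  then show "soft d s \<le> max 0 s" "max 0 s - 2 * d \<le> soft d s" by auto
qed

end

text \<open>The odd version of \<open>soft\<close>. It erases values of modulus at most
  \<open>d\<close> and moves all others by at most \<open>2 * d\<close>, so a continuous function
  that vanishes on the frontier of a bounded open set becomes compactly supported inside.\<close>

definition thr :: "real \<Rightarrow> real \<Rightarrow> real" where "thr d s = soft d s - soft d (- s)"
definition thr' :: "real \<Rightarrow> real \<Rightarrow> real" where "thr' d s = soft' d s + soft' d (- s)"

lemma thr:
  assumes "d > 0"
  shows "(thr d has_real_derivative thr' d s) (at s)" "continuous_on A (thr' d)"
    "\<bar>s\<bar> \<le> d \<Longrightarrow> thr d s = 0" "\<bar>s\<bar> \<le> d \<Longrightarrow> thr' d s = 0" "0 \<le> thr' d s" "thr' d s \<le> 1"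
    "\<bar>thr d s - s\<bar> \<le> 2 * d" "\<bar>thr d s\<bar> \<le> \<bar>s\<bar>"
proof -
  have "((\<lambda>s. soft d (- s)) has_real_derivative - soft' d (- s)) (at s)"
    using DERIV_chain2[OF soft_deriv[OF assms] DERIV_minus[OF DERIV_ident], of s] by simp
  from DERIV_diff[OF soft_deriv[OF assms] this] show "(thr d has_real_derivative thr' d s) (at s)"
    unfolding thr_def thr'_def by simp
  show "continuous_on A (thr' d)" unfolding thr'_def
    by (intro continuous_intros continuous_on_compose2[OF soft'_continuous[OF assms, of UNIV]]) auto
  show "\<bar>s\<bar> \<le> d \<Longrightarrow> thr d s = 0" "\<bar>s\<bar> \<le> d \<Longrightarrow> thr' d s = 0"
    using soft_zero[OF assms, of s] soft_zero[OF assms, of "-s"] by (auto simp: thr_def thr'_def)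
  show "0 \<le> thr' d s" using soft'_bounds(1)[OF assms] by (simp add: thr'_def)
  show "thr' d s \<le> 1" using soft'_bounds(2)[OF assms] soft_zero(2)[OF assms, of s] soft_zero(2)[OF assms, of "- s"] assms
    by (cases "s \<le> 0") (auto simp: thr'_def)
  show "\<bar>thr d s - s\<bar> \<le> 2 * d" "\<bar>thr d s\<bar> \<le> \<bar>s\<bar>"
    using soft_pos_part[OF assms, of s] soft_pos_part[OF assms, of "- s"] soft_zero(1)[OF assms, of s]
      soft_zero(1)[OF assms, of "- s"] soft_nonneg[OF assms, of s] soft_nonneg[OF assms, of "- s"] assms
    by (cases "s \<le> 0"; auto simp: thr_def)+
qed

lemma thr_limits:
  "(\<lambda>n. thr (1 / real (Suc n)) s) \<longlonglongrightarrow> s"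
  "(\<lambda>n. thr' (1 / real (Suc n)) s) \<longlonglongrightarrow> (if s = 0 then 0 else 1)"
proof -
  have lim0: "(\<lambda>n. 1 / real (Suc n)) \<longlonglongrightarrow> 0" by real_asymp
  show "(\<lambda>n. thr (1 / real (Suc n)) s) \<longlonglongrightarrow> s"
  proof (rule LIM_zero_cancel, rule Lim_null_comparison)
    show "\<forall>\<^sub>F n in sequentially. norm (thr (1 / real (Suc n)) s - s) \<le> 2 * (1 / real (Suc n))"
      using thr(7)[of "1 / real (Suc _)" s] by (intro always_eventually) auto
    show "(\<lambda>n. 2 * (1 / real (Suc n))) \<longlonglongrightarrow> 0" using tendsto_mult_left[OF lim0, of 2] by simp
  qed
  have S: "(\<lambda>n. soft' (1 / real (Suc n)) s) \<longlonglongrightarrow> (if s \<le> 0 then 0 else 1)" for s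
  proof (cases "s \<le> 0")
    case True
    then have "soft' (1 / real (Suc n)) s = 0" for n by (intro soft_zero) (auto intro: order_trans[OF True])
    then show ?thesis using True by simp
  next
    case False
    have "(\<lambda>n. max 0 (s - 1 / real (Suc n)) / sqrt ((max 0 (s - 1 / real (Suc n)))\<^sup>2 + (1 / real (Suc n))\<^sup>2)) \<longlonglongrightarrow>
        max 0 (s - 0) / sqrt ((max 0 (s - 0))\<^sup>2 + 0\<^sup>2)"
      by (intro tendsto_intros lim0) (use False in auto)
    then show ?thesis using False by (simp add: soft'_def sqp_def)
  qed
  show "(\<lambda>n. thr' (1 / real (Suc n)) s) \<longlonglongrightarrow> (if s = 0 then 0 else 1)"
    using tendsto_add[OF S[of s] S[of "- s"]] unfolding thr'_def by (auto split: if_splits)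
qed

text \<open>As \<open>d\<close> tends to zero, \<open>thr d w\<close> tends to \<open>w\<close>,
  while its gradient tends to \<open>G\<close> off the zero set and to 0 on it. Hence
  \<open>G\<close> multiplied by the indicator of \<open>w \<noteq> 0\<close> is a weak gradient of
  \<open>w\<close> as well, and uniqueness forces \<open>G\<close> to vanish on the zero
  set.\<close>

lemma weak_gradient_zero_on_level:
  assumes \<Omega>: "open \<Omega>" and w: "has_weak_gradient \<Omega> w G" "continuous_on \<Omega> w"
  shows "AE x in lebesgue_on \<Omega>. w x = 0 \<longrightarrow> G x = 0"
proof -
  let ?H = "\<lambda>x. if w x = 0 then 0 else G x"
  have l: "locally_integrable \<Omega> w" "locally_integrable \<Omega> G" using w by (auto simp: has_weak_gradient_def)
  have "has_weak_gradient \<Omega> w ?H"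
    unfolding has_weak_gradient_def
  proof (intro conjI allI impI l)
    show "locally_integrable \<Omega> ?H" unfolding locally_integrable_def
    proof (intro allI impI)
      fix K assume K: "compact K \<and> K \<subseteq> \<Omega>"
      then have i: "integrable (lebesgue_on K) G" "integrable (lebesgue_on K) w" using l by (auto simp: locally_integrable_def)
      then have [measurable]: "w \<in> borel_measurable (lebesgue_on K)" "G \<in> borel_measurable (lebesgue_on K)" by auto
      show "integrable (lebesgue_on K) ?H"
      proof (rule Bochner_Integration.integrable_bound[OF i(1)])
        have "w -` {0} \<inter> space (lebesgue_on K) \<in> sets (lebesgue_on K)"
          using measurable_sets[of w "lebesgue_on K" borel "{0}"] by auto
        moreover have "w -` {0} \<inter> space (lebesgue_on K) = {x \<in> space (lebesgue_on K). w x = 0}" by auto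
        ultimately show "?H \<in> borel_measurable (lebesgue_on K)" by (intro measurable_If) auto
      qed auto
    qed
    fix \<phi> assume \<phi>: "test_function \<Omega> \<phi>"
    obtain S where S: "compact S" "S \<subseteq> \<Omega>" "\<And>x. x \<notin> S \<Longrightarrow> \<phi> x = 0" "\<And>x. x \<notin> S \<Longrightarrow> gradient \<phi> x = 0"
      by (rule test_functionD[OF \<phi>]) (rule that)
    note c = C1_gradD(3,4)[OF C1_grad_test_function[OF \<phi>], of UNIV]
    have i: "integrable (lebesgue_on \<Omega>) (\<lambda>x. w x *\<^sub>R gradient \<phi> x)"
      by (rule integrable_test_pairing_vector[OF l(1) \<Omega> S(1,2) c(2) S(4)])
    have j: "integrable (lebesgue_on \<Omega>) (\<lambda>x. \<phi> x *\<^sub>R G x)"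
      by (rule integrable_test_pairing[OF l(2) \<Omega> S(1,2) c(1) S(3)])
    let ?d = "\<lambda>n. 1 / real (Suc n)"
    have d: "?d n > 0" for n by simp
    have wn: "has_weak_gradient \<Omega> (\<lambda>x. thr (?d n) (w x)) (\<lambda>x. thr' (?d n) (w x) *\<^sub>R G x)" for n
      by (rule has_weak_gradient_compose[OF \<Omega> w thr(1,2)[OF d]])
    have ln: "locally_integrable \<Omega> (\<lambda>x. thr (?d n) (w x))" "locally_integrable \<Omega> (\<lambda>x. thr' (?d n) (w x) *\<^sub>R G x)" for n
      using wn by (auto simp: has_weak_gradient_def)
    have m1: "(\<lambda>x. thr (?d n) (w x) *\<^sub>R gradient \<phi> x) \<in> borel_measurable (lebesgue_on \<Omega>)" for n
      using integrable_test_pairing_vector[OF ln(1) \<Omega> S(1,2) c(2) S(4)] by (rule borel_measurable_integrable)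
    have m2: "(\<lambda>x. \<phi> x *\<^sub>R (thr' (?d n) (w x) *\<^sub>R G x)) \<in> borel_measurable (lebesgue_on \<Omega>)" for n
      using integrable_test_pairing[OF ln(2) \<Omega> S(1,2) c(1) S(3)] by (rule borel_measurable_integrable)
    have A: "(\<lambda>n. LINT x|lebesgue_on \<Omega>. thr (?d n) (w x) *\<^sub>R gradient \<phi> x) \<longlonglongrightarrow> (LINT x|lebesgue_on \<Omega>. w x *\<^sub>R gradient \<phi> x)"
    proof (rule Bochner_Integration.integral_dominated_convergence[OF _ m1 integrable_norm[OF i]])
      show "AE x in lebesgue_on \<Omega>. (\<lambda>n. thr (?d n) (w x) *\<^sub>R gradient \<phi> x) \<longlonglongrightarrow> w x *\<^sub>R gradient \<phi> x"
        by (intro AE_I2 tendsto_intros thr_limits)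
      show "AE x in lebesgue_on \<Omega>. norm (thr (?d n) (w x) *\<^sub>R gradient \<phi> x) \<le> norm (w x *\<^sub>R gradient \<phi> x)" for n
        using thr(8)[OF d] by (intro AE_I2) (auto intro!: mult_right_mono)
    qed (use i in auto)
    have eq: "\<phi> x *\<^sub>R (if w x = 0 then 0 else G x) = (if w x = 0 then 0 else 1) *\<^sub>R (\<phi> x *\<^sub>R G x)" for x by simp
    have B0: "(\<lambda>n. \<phi> x *\<^sub>R (thr' (?d n) (w x) *\<^sub>R G x)) \<longlonglongrightarrow> \<phi> x *\<^sub>R ?H x" for x
    proof -
      have "(\<lambda>n. \<phi> x *\<^sub>R (thr' (?d n) (w x) *\<^sub>R G x)) \<longlonglongrightarrow> \<phi> x *\<^sub>R ((if w x = 0 then 0 else 1) *\<^sub>R G x)"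
        by (intro tendsto_intros thr_limits)
      then show ?thesis by (cases "w x = 0") auto
    qed
    have B: "(\<lambda>n. LINT x|lebesgue_on \<Omega>. \<phi> x *\<^sub>R (thr' (?d n) (w x) *\<^sub>R G x)) \<longlonglongrightarrow> (LINT x|lebesgue_on \<Omega>. \<phi> x *\<^sub>R ?H x)"
    proof (rule Bochner_Integration.integral_dominated_convergence[OF _ m2 integrable_norm[OF j]])
      show "(\<lambda>x. \<phi> x *\<^sub>R ?H x) \<in> borel_measurable (lebesgue_on \<Omega>)"
        by (rule borel_measurable_LIMSEQ_metric[OF m2 B0])
      show "AE x in lebesgue_on \<Omega>. (\<lambda>n. \<phi> x *\<^sub>R (thr' (?d n) (w x) *\<^sub>R G x)) \<longlonglongrightarrow> \<phi> x *\<^sub>R ?H x"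
        using B0 by (intro AE_I2)
      show "AE x in lebesgue_on \<Omega>. norm (\<phi> x *\<^sub>R (thr' (?d n) (w x) *\<^sub>R G x)) \<le> norm (\<phi> x *\<^sub>R G x)" for n
        using thr(5,6)[OF d] unfolding norm_scaleR
        by (intro AE_I2 mult_left_mono) (auto intro!: mult_left_le_one_le)
    qed
    have "(\<lambda>n. LINT x|lebesgue_on \<Omega>. thr (?d n) (w x) *\<^sub>R gradient \<phi> x) \<longlonglongrightarrow> - (LINT x|lebesgue_on \<Omega>. \<phi> x *\<^sub>R ?H x)"
      using tendsto_minus[OF B] wn \<phi> unfolding has_weak_gradient_def by simp
    from LIMSEQ_unique[OF A this]
    show "(LINT x|lebesgue_on \<Omega>. w x *\<^sub>R gradient \<phi> x) = - (LINT x|lebesgue_on \<Omega>. \<phi> x *\<^sub>R ?H x)" .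
  qed
  from weak_gradient_unique[OF \<Omega> w(1) this] show ?thesis by eventually_elim (auto split: if_splits)
qed

section \<open>The energy, and membership in the closure of the test functions\<close>

lemma borel_measurable_lebesgue_on_AE_cong:
  fixes f g :: "'a::euclidean_space \<Rightarrow> 'b::euclidean_space"
  assumes "S \<in> sets lebesgue" "f \<in> borel_measurable (lebesgue_on S)" "AE x in lebesgue_on S. g x = f x"
  shows "g \<in> borel_measurable (lebesgue_on S)"
proof -
  have "negligible {x. x \<in> S \<and> g x \<noteq> f x}" using assms(1,3) by (simp add: AE_lebesgue_on_iff_negligible)
  moreover have "f measurable_on S" using assms by (simp add: measurable_on_iff_borel_measurable)
  ultimately have "g measurable_on S"
    by (intro measurable_on_spike[of f S "{x. x \<in> S \<and> g x \<noteq> f x}" g]) auto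
  then show ?thesis using assms by (simp add: measurable_on_iff_borel_measurable)
qed

text \<open>Frees the energy from the choice made in \<open>weak_gradient\<close>, so that it can be
  computed from the explicit gradient that each competitor carries.\<close>

lemma p_energy_eq:
  assumes "open \<Omega>" "has_weak_gradient \<Omega> u G" "G \<in> borel_measurable (lebesgue_on \<Omega>)"
  shows "p_energy \<Omega> p u = (LINT x|lebesgue_on \<Omega>. norm (G x) powr p)"
  unfolding p_energy_def
proof (rule integral_cong_AE)
  have AE: "AE x in lebesgue_on \<Omega>. weak_gradient \<Omega> u x = G x" by (rule weak_gradient_AE(2)[OF assms(1,2)])
  then have [measurable]: "weak_gradient \<Omega> u \<in> borel_measurable (lebesgue_on \<Omega>)"
    using assms by (intro borel_measurable_lebesgue_on_AE_cong[OF _ assms(3)]) auto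
  show "(\<lambda>x. norm (weak_gradient \<Omega> u x) powr p) \<in> borel_measurable (lebesgue_on \<Omega>)" by measurable
  show "(\<lambda>x. norm (G x) powr p) \<in> borel_measurable (lebesgue_on \<Omega>)" using assms(3) by measurable
  show "AE x in lebesgue_on \<Omega>. norm (weak_gradient \<Omega> u x) powr p = norm (G x) powr p"
    using AE by eventually_elim simp
qed

lemma in_Lp_diff: "p \<ge> 0 \<Longrightarrow> in_Lp \<Omega> p f \<Longrightarrow> in_Lp \<Omega> p g \<Longrightarrow> in_Lp \<Omega> p (\<lambda>x. f x - g x)"
  unfolding in_Lp_def by (auto intro: integrable_diff_powr)

lemma in_Lp_minus: "in_Lp \<Omega> p f \<Longrightarrow> in_Lp \<Omega> p (\<lambda>x. - f x)"
  unfolding in_Lp_def by auto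

lemma in_Lp_add: "p \<ge> 0 \<Longrightarrow> in_Lp \<Omega> p f \<Longrightarrow> in_Lp \<Omega> p g \<Longrightarrow> in_Lp \<Omega> p (\<lambda>x. f x + g x)"
  using in_Lp_diff[of p \<Omega> f "\<lambda>x. - g x"] in_Lp_minus[of \<Omega> p g] by simp

lemma bounded_open_finite_measure:
  fixes \<Omega> :: "'a::euclidean_space set"
  assumes "bounded \<Omega>" "open \<Omega>" shows "finite_measure (lebesgue_on \<Omega>)"
  using assms by (simp add: finite_measure_lebesgue_on bounded_set_imp_lmeasurable)

lemma in_Lp_bounded:
  fixes f :: "'a::euclidean_space \<Rightarrow> 'b::euclidean_space"
  assumes "bounded \<Omega>" "open \<Omega>" "p \<ge> 0" "f \<in> borel_measurable (lebesgue_on \<Omega>)" "\<And>x. x \<in> \<Omega> \<Longrightarrow> norm (f x) \<le> B"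
  shows "in_Lp \<Omega> p f"
proof -
  interpret finite_measure "lebesgue_on \<Omega>" using bounded_open_finite_measure[OF assms(1,2)] .
  have "integrable (lebesgue_on \<Omega>) (\<lambda>x. norm (f x) powr p)"
    by (rule integrable_const_bound[where B="B powr p"])
       (use assms in \<open>auto intro!: AE_I2 powr_mono2\<close>)
  then show ?thesis using assms(4) by (simp add: in_Lp_def)
qed

lemma continuous_on_lebesgue_on_measurable:
  fixes f :: "'a::euclidean_space \<Rightarrow> 'b::euclidean_space"
  assumes "open \<Omega>" "continuous_on \<Omega> f" shows "f \<in> borel_measurable (lebesgue_on \<Omega>)"
  using assms by (intro continuous_imp_measurable_on_sets_lebesgue) auto

lemma in_Lp_continuous:
  fixes f :: "'a::euclidean_space \<Rightarrow> 'b::euclidean_space"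
  assumes "bounded \<Omega>" "open \<Omega>" "p \<ge> 0" "continuous_on (closure \<Omega>) f"
  shows "in_Lp \<Omega> p f"
proof -
  have "compact (f ` closure \<Omega>)" using assms by (intro compact_continuous_image) auto
  then obtain B where "\<forall>y \<in> f ` closure \<Omega>. norm y \<le> B" using compact_imp_bounded bounded_iff by blast
  then have "\<And>x. x \<in> \<Omega> \<Longrightarrow> norm (f x) \<le> B" using closure_subset by blast
  moreover have "f \<in> borel_measurable (lebesgue_on \<Omega>)"
    using assms by (intro continuous_on_lebesgue_on_measurable continuous_on_subset[OF assms(4) closure_subset])
  ultimately show ?thesis using assms by (intro in_Lp_bounded)
qed

lemma integral_lebesgue_on_le:
  fixes f :: "'a::euclidean_space \<Rightarrow> real"
  assumes "\<Omega> \<in> sets lebesgue" "integrable lebesgue f" "\<And>x. f x \<ge> 0"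
  shows "integrable (lebesgue_on \<Omega>) f" "(LINT x|lebesgue_on \<Omega>. f x) \<le> (LINT x|lebesgue. f x)"
proof -
  have m: "ext \<Omega> f \<in> borel_measurable lebesgue"
    using assms(1,2) by (subst integral_lebesgue_on_ext(3)[symmetric]) (auto intro: measurable_restrict_space1)
  have i: "integrable lebesgue (ext \<Omega> f)"
    by (rule Bochner_Integration.integrable_bound[OF assms(2) m]) (simp add: ext_def)
  then show "integrable (lebesgue_on \<Omega>) f" using assms(1) by (simp add: integral_lebesgue_on_ext(2))
  show "(LINT x|lebesgue_on \<Omega>. f x) \<le> (LINT x|lebesgue. f x)"
    unfolding integral_lebesgue_on_ext(1)[OF assms(1)]
    by (rule integral_mono[OF i assms(2)]) (simp add: ext_def assms(3))
qed

text \<open>As \<open>\<psi>\<close> and \<open>G\<close> vanish off the compact \<open>S\<close>,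
  extension by zero from \<Omega> agrees with extension from a compact neighbourhood
  \<open>K\<close>. For small \<open>r\<close> the mollification stays supported in
  \<open>K\<close>, and off the reach of \<open>S\<close> both sides of the gradient identity are
  zero.\<close>

lemma conv_test_function:
  fixes \<psi> :: "'a::euclidean_space \<Rightarrow> real"
  assumes \<Omega>: "open \<Omega>" and \<psi>: "has_weak_gradient \<Omega> \<psi> G"
    and S: "compact S" "S \<subseteq> \<Omega>" "\<And>x. x \<in> \<Omega> \<Longrightarrow> x \<notin> S \<Longrightarrow> \<psi> x = 0" "\<And>x. x \<in> \<Omega> \<Longrightarrow> x \<notin> S \<Longrightarrow> G x = 0"
  shows "\<forall>\<^sub>F r in at_right 0. test_function \<Omega> (conv r (ext \<Omega> \<psi>)) \<and>
    (\<forall>x. gradient (conv r (ext \<Omega> \<psi>)) x = conv r (ext \<Omega> G) x)"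
proof -
  obtain K s where K: "s > 0" "compact K" "K \<subseteq> \<Omega>" "S \<subseteq> K" "\<And>x. x \<in> S \<Longrightarrow> cball x s \<subseteq> K"
    by (rule compact_neighbourhood_obtain[OF S(1) \<Omega> S(2)]) (rule that)
  have eq: "ext \<Omega> \<psi> = ext K \<psi>" "ext \<Omega> G = ext K G"
    using K(3,4) S(3,4) by (force simp: ext_def fun_eq_iff)+
  have i: "integrable lebesgue (ext K \<psi>)" "integrable lebesgue (ext K G)"
    using \<psi> K by (auto simp: has_weak_gradient_def intro: integrable_ext_locally_integrable)
  have z: "ext K \<psi> x = 0" "ext K G x = 0" if "x \<notin> S" for x
    using that K(3) S(3,4) by (auto simp: ext_def)
  show ?thesis
    unfolding eventually_at_right_field eq
  proof (intro exI[of _ "s/2"] conjI allI impI)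
    show "s / 2 > 0" using K by simp
    fix r assume r: "0 < r" "r < s / 2"
    have zc: "conv r (ext K \<psi>) x = 0" "conv r (ext K G) x = 0" if "cball x r \<inter> S = {}" for x
    proof -
      have "norm (conv r (ext K \<psi>) x - 0) \<le> 0"
        by (rule conv_dist_bound[OF r(1) i(1)]) (use that z(1) in \<open>auto simp: disjoint_iff\<close>)
      moreover have "norm (conv r (ext K G) x - 0) \<le> 0"
        by (rule conv_dist_bound[OF r(1) i(2)]) (use that z(2) in \<open>auto simp: disjoint_iff\<close>)
      ultimately show "conv r (ext K \<psi>) x = 0" "conv r (ext K G) x = 0" by auto
    qed
    have sub: "cball x r \<subseteq> K" "x \<in> K" if "cball x r \<inter> S \<noteq> {}" for x
    proof -
      obtain y where y: "y \<in> S" "dist x y \<le> r" using \<open>cball x r \<inter> S \<noteq> {}\<close> by auto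
      have "cball x r \<subseteq> cball y s"
      proof
        fix v assume "v \<in> cball x r"
        then show "v \<in> cball y s" using dist_triangle[of y v x] y(2) r by (simp add: dist_commute)
      qed
      then show "cball x r \<subseteq> K" using K(5)[OF y(1)] by blast
      then show "x \<in> K" using r by auto
    qed
    have supp: "{x. conv r (ext K \<psi>) x \<noteq> 0} \<subseteq> K" using zc sub by blast
    have "closure {x. conv r (ext K \<psi>) x \<noteq> 0} \<subseteq> K"
      by (rule closure_minimal[OF supp compact_imp_closed[OF K(2)]])
    moreover from this have "compact (closure {x. conv r (ext K \<psi>) x \<noteq> 0})"
      using K(2) compact_Int_closed[of K "closure {x. conv r (ext K \<psi>) x \<noteq> 0}"] by (simp add: inf_absorb2)
    ultimately show "test_function \<Omega> (conv r (ext K \<psi>))"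
      unfolding test_function_def using K(3) Ck_on_conv[OF r(1) i(1)] by blast
    fix x
    show "gradient (conv r (ext K \<psi>)) x = conv r (ext K G) x"
    proof (cases "cball x r \<inter> S = {}")
      case True
      have zero: "(h \<bullet> gradient (moll r) (x - y)) *\<^sub>R ext K \<psi> y = 0" for h y
      proof (cases "dist x y \<le> r")
        case y: True
        then have "y \<notin> S" using True by auto
        then show ?thesis using z(1) by simp
      next
        case False
        then show ?thesis by (simp add: gradient_moll_zero[OF r(1)] dist_norm)
      qed
      have "h \<bullet> gradient (conv r (ext K \<psi>)) x = h \<bullet> 0" for h
        unfolding gradient_conv[OF r(1) i(1)] zero by simp
      then have "gradient (conv r (ext K \<psi>)) x = 0" using vector_eq_ldot by blast
      then show ?thesis using zc(2)[OF True] by simp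
    next
      case False
      show ?thesis by (rule gradient_conv_weak_gradient[OF \<psi> \<Omega> K(2,3) sub(1)[OF False] r(1)])
    qed
  qed
qed

lemma integrable_ext_powr:
  fixes f :: "'a::euclidean_space \<Rightarrow> 'b::euclidean_space"
  assumes "\<Omega> \<in> sets lebesgue" "in_Lp \<Omega> p f"
  shows "ext \<Omega> f \<in> borel_measurable lebesgue" "integrable lebesgue (\<lambda>x. norm (ext \<Omega> f x) powr p)"
proof -
  show "ext \<Omega> f \<in> borel_measurable lebesgue" using assms by (simp add: in_Lp_def integral_lebesgue_on_ext(3))
  have "integrable lebesgue (ext \<Omega> (\<lambda>x. norm (f x) powr p))" using assms by (simp add: in_Lp_def integral_lebesgue_on_ext(2))
  moreover have "ext \<Omega> (\<lambda>x. norm (f x) powr p) = (\<lambda>x. norm (ext \<Omega> f x) powr p)" by (auto simp: ext_def fun_eq_iff)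
  ultimately show "integrable lebesgue (\<lambda>x. norm (ext \<Omega> f x) powr p)" by simp
qed

lemma conv_tendsto_Lp_on:
  fixes f :: "'a::euclidean_space \<Rightarrow> 'b::euclidean_space"
  assumes "\<Omega> \<in> sets lebesgue" "bounded \<Omega>" "in_Lp \<Omega> p f" "p \<ge> 1"
  shows "\<And>r. r > 0 \<Longrightarrow> integrable (lebesgue_on \<Omega>) (\<lambda>x. norm (f x - conv r (ext \<Omega> f) x) powr p)"
    "((\<lambda>r. LINT x|lebesgue_on \<Omega>. norm (f x - conv r (ext \<Omega> f) x) powr p) \<longlongrightarrow> 0) (at_right 0)"
proof -
  note e = integrable_ext_powr[OF assms(1,3)]
  obtain R where "\<And>x. x \<in> \<Omega> \<Longrightarrow> norm x \<le> R" using assms(2) by (auto simp: bounded_iff)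
  then have R: "\<And>x. norm x > R \<Longrightarrow> ext \<Omega> f x = 0" by (force simp: ext_def)
  have c1: "integrable lebesgue (\<lambda>x. norm (conv r (ext \<Omega> f) x - ext \<Omega> f x) powr p)" if "r > 0" for r
    by (rule conv_tendsto_Lp(1)[where R=R, OF e(1) _ e(2) assms(4) that]) (rule R)
  have c2: "((\<lambda>r. LINT x|lebesgue. norm (conv r (ext \<Omega> f) x - ext \<Omega> f x) powr p) \<longlongrightarrow> 0) (at_right 0)"
    by (rule conv_tendsto_Lp(2)[where R=R, OF e(1) _ e(2) assms(4)]) (rule R)
  have eq: "(LINT x|lebesgue_on \<Omega>. norm (f x - conv r (ext \<Omega> f) x) powr p)
      = (LINT x|lebesgue_on \<Omega>. norm (conv r (ext \<Omega> f) x - ext \<Omega> f x) powr p)" for r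
    by (rule Bochner_Integration.integral_cong) (auto simp: norm_minus_commute)
  have eq2: "integrable (lebesgue_on \<Omega>) (\<lambda>x. norm (f x - conv r (ext \<Omega> f) x) powr p)
      \<longleftrightarrow> integrable (lebesgue_on \<Omega>) (\<lambda>x. norm (conv r (ext \<Omega> f) x - ext \<Omega> f x) powr p)" for r
    by (rule Bochner_Integration.integrable_cong) (auto simp: norm_minus_commute)
  show "integrable (lebesgue_on \<Omega>) (\<lambda>x. norm (f x - conv r (ext \<Omega> f) x) powr p)" if "r > 0" for r
    unfolding eq2 by (rule integral_lebesgue_on_le(1)[OF assms(1) c1[OF that]]) simp
  show "((\<lambda>r. LINT x|lebesgue_on \<Omega>. norm (f x - conv r (ext \<Omega> f) x) powr p) \<longlongrightarrow> 0) (at_right 0)"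
  proof (rule Lim_null_comparison[OF _ c2])
    show "\<forall>\<^sub>F r in at_right 0. norm (LINT x|lebesgue_on \<Omega>. norm (f x - conv r (ext \<Omega> f) x) powr p)
        \<le> (LINT x|lebesgue. norm (conv r (ext \<Omega> f) x - ext \<Omega> f x) powr p)"
      unfolding eventually_at_right_field
    proof (intro exI[of _ 1] conjI allI impI)
      fix r :: real assume r: "0 < r"
      have "(LINT x|lebesgue_on \<Omega>. norm (f x - conv r (ext \<Omega> f) x) powr p) \<ge> 0"
        by (intro Bochner_Integration.integral_nonneg) simp
      then show "norm (LINT x|lebesgue_on \<Omega>. norm (f x - conv r (ext \<Omega> f) x) powr p)
        \<le> (LINT x|lebesgue. norm (conv r (ext \<Omega> f) x - ext \<Omega> f x) powr p)"
        using integral_lebesgue_on_le(2)[OF assms(1) c1[OF r]] by (simp add: eq)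
    qed simp
  qed
qed

text \<open>Needs nothing of the boundary: by continuity, flattening the small values of
  \<open>w\<close> yields compact support in \<Omega>, and mollifying the result produces test
  functions. Both errors are small in the \<open>W1p_norm\<close>.\<close>

theorem in_W1p0_of_zero_boundary:
  fixes w :: "'a::euclidean_space \<Rightarrow> real"
  assumes \<Omega>: "open \<Omega>" "bounded \<Omega>" and p: "p \<ge> 1"
    and w: "has_weak_gradient \<Omega> w G" "in_Lp \<Omega> p G" "continuous_on (closure \<Omega>) w" "\<And>x. x \<in> frontier \<Omega> \<Longrightarrow> w x = 0"
  shows "in_W1p0 \<Omega> p w"
proof -
  have \<Omega>m: "\<Omega> \<in> sets lebesgue" using \<Omega> by simp
  have Lw: "in_Lp \<Omega> p w" using \<Omega> p w by (intro in_Lp_continuous) auto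
  then have W: "in_W1p \<Omega> p w" using w unfolding in_W1p_def by blast
  have cw: "continuous_on \<Omega> w" using w(3) closure_subset by (rule continuous_on_subset)
  let ?M = "lebesgue_on \<Omega>"
  have [measurable]: "w \<in> borel_measurable ?M" "G \<in> borel_measurable ?M" using Lw w(2) by (auto simp: in_Lp_def)
  have iw: "integrable ?M (\<lambda>x. norm (w x) powr p)" "integrable ?M (\<lambda>x. norm (G x) powr p)" using Lw w(2) by (auto simp: in_Lp_def)
  have "\<exists>\<phi>. test_function \<Omega> \<phi> \<and> W1p_norm \<Omega> p (\<lambda>x. w x - \<phi> x) < e" if e: "e > 0" for e
  proof -
    \<comment> \<open>Truncation and mollification each contribute less than \<open>\<eta>\<close>;
      with the factor of the crude triangle inequality the total stays below
      \<open>e powr p\<close>.\<close>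
    define \<eta> where "\<eta> = e powr p / (2 powr p * 2)"
    have \<eta>: "\<eta> > 0" using e by (simp add: \<eta>_def)
    let ?d = "\<lambda>n. 1 / real (Suc n)"
    have d: "?d n > 0" for n by simp
    let ?\<psi> = "\<lambda>n x. thr (?d n) (w x)" let ?g = "\<lambda>n x. thr' (?d n) (w x) *\<^sub>R G x"
    have cthr: "continuous_on UNIV (thr (?d n))" for n using thr(1)[OF d] by (meson DERIV_isCont continuous_at_imp_continuous_on)
    have m1: "?\<psi> n \<in> borel_measurable ?M" for n
      using \<Omega> by (intro continuous_on_lebesgue_on_measurable continuous_on_compose2[OF cthr cw]) auto
    have "(\<lambda>x. thr' (?d n) (w x)) \<in> borel_measurable ?M" for n
      using \<Omega> by (intro continuous_on_lebesgue_on_measurable continuous_on_compose2[OF thr(2)[OF d, of UNIV] cw]) auto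
    then have m2: "?g n \<in> borel_measurable ?M" for n by measurable
    have A: "(\<lambda>n. LINT x|?M. norm (w x - ?\<psi> n x) powr p) \<longlonglongrightarrow> (LINT x|?M. 0)"
    proof (rule Bochner_Integration.integral_dominated_convergence[OF _ _ iw(1)])
      show "AE x in ?M. (\<lambda>n. norm (w x - ?\<psi> n x) powr p) \<longlonglongrightarrow> 0"
      proof (rule AE_I2)
        fix x
        have "(\<lambda>n. norm (w x - ?\<psi> n x)) \<longlonglongrightarrow> norm (w x - w x)" by (intro tendsto_intros thr_limits)
        then have "(\<lambda>n. norm (w x - ?\<psi> n x) powr p) \<longlonglongrightarrow> norm (w x - w x) powr p"
          by (rule tendsto_powr2) (use p in auto)
        then show "(\<lambda>n. norm (w x - ?\<psi> n x) powr p) \<longlonglongrightarrow> 0" by simp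
      qed
      show "AE x in ?M. norm (norm (w x - ?\<psi> n x) powr p) \<le> norm (w x) powr p" for n
      proof (rule AE_I2)
        fix x
        have "norm (w x - ?\<psi> n x) \<le> norm (w x)"
          using thr(8)[OF d, of n "w x"] thr(7)[OF d, of n "w x"]
            soft_nonneg[OF d, of n "w x"] soft_nonneg[OF d, of n "- w x"] soft_pos_part(1)[OF d, of n "w x"] soft_pos_part(1)[OF d, of n "- w x"]
          by (cases "w x \<le> 0") (auto simp: thr_def)
        then show "norm (norm (w x - ?\<psi> n x) powr p) \<le> norm (w x) powr p" using p by (auto intro: powr_mono2)
      qed
    qed (use m1 in measurable)
    have B: "(\<lambda>n. LINT x|?M. norm (G x - ?g n x) powr p) \<longlonglongrightarrow> (LINT x|?M. 0)"
    proof (rule Bochner_Integration.integral_dominated_convergence[OF _ _ iw(2)])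
      \<comment> \<open>Where \<open>w x = 0\<close> the factor \<open>thr'\<close> tends to 0
        instead of 1, so convergence there relies on \<open>G\<close> vanishing on the zero
        level.\<close>
      show "AE x in ?M. (\<lambda>n. norm (G x - ?g n x) powr p) \<longlonglongrightarrow> 0"
        using weak_gradient_zero_on_level[OF \<Omega>(1) w(1) cw]
      proof eventually_elim
        case (elim x)
        have "(\<lambda>n. norm (G x - ?g n x)) \<longlonglongrightarrow> norm (G x - (if w x = 0 then 0 else 1) *\<^sub>R G x)" by (intro tendsto_intros thr_limits)
        then have "(\<lambda>n. norm (G x - ?g n x) powr p) \<longlonglongrightarrow> norm (G x - (if w x = 0 then 0 else 1) *\<^sub>R G x) powr p"
          by (rule tendsto_powr2) (use p in auto)
        then show "(\<lambda>n. norm (G x - ?g n x) powr p) \<longlonglongrightarrow> 0" using elim by (auto split: if_splits)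
      qed
      show "AE x in ?M. norm (norm (G x - ?g n x) powr p) \<le> norm (G x) powr p" for n
      proof (rule AE_I2)
        fix x
        have "G x - ?g n x = (1 - thr' (?d n) (w x)) *\<^sub>R G x" by (simp add: scaleR_diff_left)
        then have "norm (G x - ?g n x) = (1 - thr' (?d n) (w x)) * norm (G x)"
          using thr(6)[OF d, of n "w x"] by simp
        also have "\<dots> \<le> norm (G x)" using thr(5,6)[OF d, of n "w x"] by (intro mult_left_le_one_le) auto
        finally show "norm (norm (G x - ?g n x) powr p) \<le> norm (G x) powr p" using p by (auto intro: powr_mono2)
      qed
    qed (use m2 in measurable)
    have "\<forall>\<^sub>F n in sequentially. (LINT x|?M. norm (w x - ?\<psi> n x) powr p) + (LINT x|?M. norm (G x - ?g n x) powr p) < \<eta>"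
      using tendsto_add[OF A B] \<eta> by (intro order_tendstoD(2)[where y=0]) auto
    then obtain n where n: "(LINT x|?M. norm (w x - ?\<psi> n x) powr p) + (LINT x|?M. norm (G x - ?g n x) powr p) < \<eta>"
      using eventually_happens[of _ sequentially] by auto
    \<comment> \<open>Outside this set the truncation is zero. It is closed and bounded, and it
      avoids the frontier because \<open>w\<close> vanishes there, hence it is a compact subset of
      \<Omega>.\<close>
    let ?S = "{x \<in> closure \<Omega>. \<bar>w x\<bar> \<ge> ?d n}"
    have "closed ?S" using continuous_closed_preimage[OF continuous_on_rabs[OF w(3)] closed_closure, of "{?d n..}"]
      by (simp add: vimage_def Int_def)
    moreover have "bounded ?S" by (rule bounded_subset[OF bounded_closure[OF \<Omega>(2)]]) auto
    ultimately have S: "compact ?S" by (simp add: compact_eq_bounded_closed)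
    have S\<Omega>: "?S \<subseteq> \<Omega>"
    proof
      fix x assume x: "x \<in> ?S"
      then have "w x \<noteq> 0" using d[of n] by auto
      then have "x \<notin> frontier \<Omega>" using w(4) by blast
      then show "x \<in> \<Omega>" using x \<Omega> by (auto simp: frontier_def interior_open)
    qed
    have Sz: "?\<psi> n x = 0" "?g n x = 0" if "x \<in> \<Omega>" "x \<notin> ?S" for x
      using that closure_subset thr(3,4)[OF d, of "w x" n] by (force+)
    have wg: "has_weak_gradient \<Omega> (?\<psi> n) (?g n)" by (rule has_weak_gradient_compose[OF \<Omega>(1) w(1) cw thr(1,2)[OF d]])
    have ip: "integrable ?M (\<lambda>x. norm (?\<psi> n x) powr p)"
      by (rule Bochner_Integration.integrable_bound[OF iw(1)])
        (use m1 p in \<open>auto intro!: AE_I2 powr_mono2 thr(8)[OF d] simp del: of_nat_Suc\<close>)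
    have "norm (?g n x) \<le> norm (G x)" for x
      using thr(5,6)[OF d, of n "w x"] by (auto intro!: mult_left_le_one_le)
    then have ig: "integrable ?M (\<lambda>x. norm (?g n x) powr p)"
    proof (intro Bochner_Integration.integrable_bound[OF iw(2)])
      show "(\<lambda>x. norm (?g n x) powr p) \<in> borel_measurable ?M" using m2[of n] by measurable
    qed (use p in \<open>auto intro!: AE_I2 powr_mono2 simp del: norm_scaleR\<close>)
    have Lp: "in_Lp \<Omega> p (?\<psi> n)" "in_Lp \<Omega> p (?g n)" using ip ig m1 m2 by (auto simp: in_Lp_def)
    note c1 = conv_tendsto_Lp_on[OF \<Omega>m \<Omega>(2) Lp(1) p] and c2 = conv_tendsto_Lp_on[OF \<Omega>m \<Omega>(2) Lp(2) p]
    have "\<forall>\<^sub>F r in at_right 0. (LINT x|?M. norm (?\<psi> n x - conv r (ext \<Omega> (?\<psi> n)) x) powr p)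
        + (LINT x|?M. norm (?g n x - conv r (ext \<Omega> (?g n)) x) powr p) < \<eta>"
      using tendsto_add[OF c1(2) c2(2)] \<eta> by (intro order_tendstoD(2)[where y="0 + 0"]) auto
    moreover have "\<forall>\<^sub>F r in at_right (0::real). r > 0" by (rule eventually_at_right_less)
    ultimately have "\<forall>\<^sub>F r in at_right 0. ((LINT x|?M. norm (?\<psi> n x - conv r (ext \<Omega> (?\<psi> n)) x) powr p)
        + (LINT x|?M. norm (?g n x - conv r (ext \<Omega> (?g n)) x) powr p) < \<eta> \<and> r > 0) \<and> 
        (test_function \<Omega> (conv r (ext \<Omega> (?\<psi> n))) \<and>
           (\<forall>x. gradient (conv r (ext \<Omega> (?\<psi> n))) x = conv r (ext \<Omega> (?g n)) x))"
      by (intro eventually_conj conv_test_function[OF \<Omega>(1) wg S S\<Omega> Sz])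
    then obtain r where r: "r > 0" and r1: "(LINT x|?M. norm (?\<psi> n x - conv r (ext \<Omega> (?\<psi> n)) x) powr p)
        + (LINT x|?M. norm (?g n x - conv r (ext \<Omega> (?g n)) x) powr p) < \<eta>"
      and t: "test_function \<Omega> (conv r (ext \<Omega> (?\<psi> n)))" "gradient (conv r (ext \<Omega> (?\<psi> n))) = conv r (ext \<Omega> (?g n))"
      using eventually_happens[of _ "at_right (0::real)"] by (auto simp: fun_eq_iff)
    let ?\<phi> = "conv r (ext \<Omega> (?\<psi> n))" and ?F = "conv r (ext \<Omega> (?g n))"
    have C1: "C1_grad ?\<phi> ?F" using C1_grad_test_function[OF t(1)] t(2) by simp
    have m3: "?\<phi> \<in> borel_measurable ?M" "?F \<in> borel_measurable ?M"
      by (rule continuous_on_lebesgue_on_measurable[OF \<Omega>(1) C1_gradD(3)[OF C1]],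
          rule continuous_on_lebesgue_on_measurable[OF \<Omega>(1) C1_gradD(4)[OF C1]])
    have p0: "p \<ge> 0" using p by simp
    have I1: "(LINT x|?M. norm (w x - ?\<phi> x) powr p) \<le> 2 powr p * ((LINT x|?M. norm (w x - ?\<psi> n x) powr p) + (LINT x|?M. norm (?\<psi> n x - ?\<phi> x) powr p))"
      by (rule integrable_diff_powr_trans(2)[OF _ m3(1) p0 integrable_diff_powr[OF _ m1 p0 iw(1) ip] c1(1)[OF r]]) measurable
    have I2: "(LINT x|?M. norm (G x - ?F x) powr p) \<le> 2 powr p * ((LINT x|?M. norm (G x - ?g n x) powr p) + (LINT x|?M. norm (?g n x - ?F x) powr p))"
      by (rule integrable_diff_powr_trans(2)[OF _ m3(2) p0 integrable_diff_powr[OF _ m2 p0 iw(2) ig] c2(1)[OF r]]) measurable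
    have E0: "p_energy \<Omega> p (\<lambda>x. w x - ?\<phi> x) = (LINT x|?M. norm (G x - ?F x) powr p)"
      by (rule p_energy_eq[OF \<Omega>(1) has_weak_gradient_diff[OF \<Omega>(1) w(1) has_weak_gradient_C1[OF \<Omega>(1) C1]]]) (use m3 in measurable)
    have "(LINT x|?M. norm (w x - ?\<phi> x) powr p) + (LINT x|?M. norm (G x - ?F x) powr p)
       \<le> 2 powr p * (((LINT x|?M. norm (w x - ?\<psi> n x) powr p) + (LINT x|?M. norm (G x - ?g n x) powr p))
          + ((LINT x|?M. norm (?\<psi> n x - ?\<phi> x) powr p) + (LINT x|?M. norm (?g n x - ?F x) powr p)))"
      using add_mono[OF I1 I2] by (simp add: algebra_simps)
    also have "\<dots> < 2 powr p * (\<eta> + \<eta>)" using add_strict_mono[OF n r1] by (intro mult_strict_left_mono) auto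
    also have "2 powr p * (\<eta> + \<eta>) = e powr p" by (simp add: \<eta>_def)
    finally have lt: "(LINT x|?M. \<bar>w x - ?\<phi> x\<bar> powr p) + p_energy \<Omega> p (\<lambda>x. w x - ?\<phi> x) < e powr p"
      unfolding E0 real_norm_def .
    have nn: "0 \<le> (LINT x|?M. \<bar>w x - ?\<phi> x\<bar> powr p) + p_energy \<Omega> p (\<lambda>x. w x - ?\<phi> x)"
      unfolding p_energy_def by (intro add_nonneg_nonneg Bochner_Integration.integral_nonneg) auto
    have "W1p_norm \<Omega> p (\<lambda>x. w x - ?\<phi> x) < (e powr p) powr (1 / p)"
      unfolding W1p_norm_def using p by (intro powr_less_mono2[OF _ nn lt]) auto
    also have "\<dots> = e" using p e by (simp add: powr_powr)
    finally show ?thesis using t(1) by blast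
  qed
  then show ?thesis unfolding in_W1p0_def using W by blast
qed

subsection \<open>Energy minimality\<close>

text \<open>Minimality in the form used for comparison: perturbations are continuous up to the
  boundary and zero there, gradients are explicit data, and \<open>g\<close> and
  \<open>in_W1p0\<close> have disappeared. Unlike the original problem it is visibly invariant under
  change of sign.\<close>

definition p_minimizer :: "'a::euclidean_space set \<Rightarrow> real \<Rightarrow> ('a \<Rightarrow> real) \<Rightarrow> ('a \<Rightarrow> 'a) \<Rightarrow> bool" where
  "p_minimizer \<Omega> p u G \<longleftrightarrow> has_weak_gradient \<Omega> u G \<and> in_Lp \<Omega> p G \<and> continuous_on (closure \<Omega>) u \<and>
    (\<forall>\<Psi> H. has_weak_gradient \<Omega> \<Psi> H \<and> in_Lp \<Omega> p H \<and> continuous_on (closure \<Omega>) \<Psi> \<and> (\<forall>x\<in>frontier \<Omega>. \<Psi> x = 0) \<longrightarrow>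
      (LINT x|lebesgue_on \<Omega>. norm (G x) powr p) \<le> (LINT x|lebesgue_on \<Omega>. norm (G x + H x) powr p))"

lemma p_minimizer_minus:
  assumes "p_minimizer \<Omega> p u G"
  shows "p_minimizer \<Omega> p (\<lambda>x. - u x) (\<lambda>x. - G x)"
  unfolding p_minimizer_def
proof (intro conjI allI impI)
  show "has_weak_gradient \<Omega> (\<lambda>x. - u x) (\<lambda>x. - G x)" "in_Lp \<Omega> p (\<lambda>x. - G x)" "continuous_on (closure \<Omega>) (\<lambda>x. - u x)"
    using assms by (auto simp: p_minimizer_def intro: has_weak_gradient_minus in_Lp_minus continuous_on_minus)
  fix \<Psi> H assume a: "has_weak_gradient \<Omega> \<Psi> H \<and> in_Lp \<Omega> p H \<and> continuous_on (closure \<Omega>) \<Psi> \<and> (\<forall>x\<in>frontier \<Omega>. \<Psi> x = 0)"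
  then have "has_weak_gradient \<Omega> (\<lambda>x. - \<Psi> x) (\<lambda>x. - H x) \<and> in_Lp \<Omega> p (\<lambda>x. - H x) \<and>
      continuous_on (closure \<Omega>) (\<lambda>x. - \<Psi> x) \<and> (\<forall>x\<in>frontier \<Omega>. - \<Psi> x = 0)"
    by (auto intro: has_weak_gradient_minus in_Lp_minus continuous_on_minus)
  then have "(LINT x|lebesgue_on \<Omega>. norm (G x) powr p) \<le> (LINT x|lebesgue_on \<Omega>. norm (G x + - H x) powr p)"
    using assms unfolding p_minimizer_def by blast
  moreover have "norm (- G x + H x) = norm (G x + - H x)" for x
    using norm_minus_cancel[of "G x + - H x"] by (simp add: algebra_simps)
  ultimately show "(LINT x|lebesgue_on \<Omega>. norm (- G x) powr p) \<le> (LINT x|lebesgue_on \<Omega>. norm (- G x + H x) powr p)"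
    by simp
qed

text \<open>The competitor is \<open>u + \<Psi>\<close>. Since \<open>u = g\<close> on the frontier,
  its difference from \<open>g\<close> is continuous and vanishes there, which suffices for
  \<open>in_W1p0\<close>.\<close>

theorem solves_p_laplace_imp_p_minimizer:
  assumes \<Omega>: "open \<Omega>" "bounded \<Omega>" and p: "p \<ge> 1"
    and g: "in_W1p \<Omega> p g" "continuous_on (closure \<Omega>) g" and u: "solves_p_laplace \<Omega> p g u"
  shows "\<exists>G. p_minimizer \<Omega> p u G"
proof -
  obtain G where G: "has_weak_gradient \<Omega> u G" "in_Lp \<Omega> p G" and cu: "continuous_on (closure \<Omega>) u"
    and bu: "\<And>x. x \<in> frontier \<Omega> \<Longrightarrow> u x = g x"
    and min: "\<And>v. in_W1p \<Omega> p v \<Longrightarrow> in_W1p0 \<Omega> p (\<lambda>x. v x - g x) \<Longrightarrow> p_energy \<Omega> p u \<le> p_energy \<Omega> p v"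
    using u unfolding solves_p_laplace_def in_W1p_def by blast
  obtain Gg where Gg: "has_weak_gradient \<Omega> g Gg" "in_Lp \<Omega> p Gg" using g(1) unfolding in_W1p_def by blast
  have "(LINT x|lebesgue_on \<Omega>. norm (G x) powr p) \<le> (LINT x|lebesgue_on \<Omega>. norm (G x + H x) powr p)"
    if H: "has_weak_gradient \<Omega> \<Psi> H" "in_Lp \<Omega> p H" and \<Psi>: "continuous_on (closure \<Omega>) \<Psi>" "\<forall>x\<in>frontier \<Omega>. \<Psi> x = 0" for \<Psi> H
  proof -
    have v: "has_weak_gradient \<Omega> (\<lambda>x. u x + \<Psi> x) (\<lambda>x. G x + H x)" by (rule has_weak_gradient_add[OF \<Omega>(1) G(1) H(1)])
    have Lv: "in_Lp \<Omega> p (\<lambda>x. G x + H x)" using p by (intro in_Lp_add G H) auto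
    have cv: "continuous_on (closure \<Omega>) (\<lambda>x. u x + \<Psi> x)" by (intro continuous_intros cu \<Psi>)
    have "in_W1p0 \<Omega> p (\<lambda>x. (u x + \<Psi> x) - g x)"
    proof (rule in_W1p0_of_zero_boundary[OF \<Omega> p has_weak_gradient_diff[OF \<Omega>(1) v Gg(1)]])
      show "in_Lp \<Omega> p (\<lambda>x. (G x + H x) - Gg x)" using p by (intro in_Lp_diff Lv Gg) auto
      show "continuous_on (closure \<Omega>) (\<lambda>x. (u x + \<Psi> x) - g x)" by (intro continuous_intros cv cu \<Psi> g)
    qed (use bu \<Psi> in auto)
    moreover have "in_W1p \<Omega> p (\<lambda>x. u x + \<Psi> x)"
      unfolding in_W1p_def using v Lv in_Lp_continuous[OF \<Omega>(2,1) _ cv] p by auto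
    ultimately have "p_energy \<Omega> p u \<le> p_energy \<Omega> p (\<lambda>x. u x + \<Psi> x)" by (rule min[rotated])
    moreover have "p_energy \<Omega> p u = (LINT x|lebesgue_on \<Omega>. norm (G x) powr p)"
      using G by (intro p_energy_eq[OF \<Omega>(1)]) (auto simp: in_Lp_def)
    moreover have "p_energy \<Omega> p (\<lambda>x. u x + \<Psi> x) = (LINT x|lebesgue_on \<Omega>. norm (G x + H x) powr p)"
      using Lv by (intro p_energy_eq[OF \<Omega>(1) v]) (auto simp: in_Lp_def)
    ultimately show ?thesis by simp
  qed
  then show ?thesis using G cu unfolding p_minimizer_def by blast
qed

subsection \<open>Comparison with fundamental solutions of the \<open>p\<close>-Laplacian\<close>

lemma DERIV_glue:
  fixes f g :: "real \<Rightarrow> real"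
  assumes "(f has_real_derivative D) (at a)" "(g has_real_derivative D) (at a)" "f a = g a"
  shows "((\<lambda>s. if s < a then f s else g s) has_real_derivative D) (at a)"
proof -
  let ?k = "\<lambda>s. if s < a then f s else g s"
  have "((\<lambda>h. (f (a + h) - f a) / h) \<longlongrightarrow> D) (at_left 0)" "((\<lambda>h. (g (a + h) - g a) / h) \<longlongrightarrow> D) (at_right 0)"
    using assms(1,2) unfolding DERIV_def by (auto intro: filterlim_mono[OF _ order_refl at_le])
  then have lr: "((\<lambda>h. (f (a + h) - f a) / h) \<longlongrightarrow> D) (at_left 0)" "((\<lambda>h. (g (a + h) - g a) / h) \<longlongrightarrow> D) (at_right 0)" by auto
  have l: "((\<lambda>h. (?k (a + h) - ?k a) / h) \<longlongrightarrow> D) (at_left 0)"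
    by (rule Lim_transform_eventually[OF lr(1)])
       (auto simp: eventually_at_left_field assms(3) intro!: exI[of _ "-1"])
  have r: "((\<lambda>h. (?k (a + h) - ?k a) / h) \<longlongrightarrow> D) (at_right 0)"
    by (rule Lim_transform_eventually[OF lr(2)])
       (auto simp: eventually_at_right_field intro!: exI[of _ 1])
  show ?thesis unfolding DERIV_def by (rule filterlim_split_at[OF l r])
qed

text \<open>The power with exponent \<open>\<theta>\<close>, continued below \<open>a\<close> by its
  tangent line. Composed with the squared distance to a point it gives a function that is C^1 across
  that point and equals a power of the distance away from it.\<close>

definition plin :: "real \<Rightarrow> real \<Rightarrow> real \<Rightarrow> real" where
  "plin \<theta> a s = (if s < a then a powr \<theta> + \<theta> * a powr (\<theta> - 1) * (s - a) else s powr \<theta>)"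

lemma plin_deriv:
  assumes "a > 0"
  shows "(plin \<theta> a has_real_derivative \<theta> * (max a s) powr (\<theta> - 1)) (at s)"
proof -
  have lin: "((\<lambda>s. a powr \<theta> + \<theta> * a powr (\<theta> - 1) * (s - a)) has_real_derivative \<theta> * a powr (\<theta> - 1)) (at s)" for s
    by (auto intro!: derivative_eq_intros)
  have pw: "((\<lambda>s. s powr \<theta>) has_real_derivative \<theta> * s powr (\<theta> - 1)) (at s)" if "s > 0" for s
    using that by (rule has_real_derivative_powr)
  consider "s < a" | "s > a" | "s = a" by linarith
  then show ?thesis
  proof cases
    case 1
    have "((\<lambda>s. a powr \<theta> + \<theta> * a powr (\<theta> - 1) * (s - a)) has_real_derivative \<theta> * (max a s) powr (\<theta> - 1)) (at s)"
      using lin[of s] 1 by (simp add: max_absorb1)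
    then show ?thesis
      by (rule has_field_derivative_transform_within_open[where S="{..<a}"]) (use 1 in \<open>auto simp: plin_def\<close>)
  next
    case 2
    have "((\<lambda>s. s powr \<theta>) has_real_derivative \<theta> * (max a s) powr (\<theta> - 1)) (at s)"
      using pw[of s] 2 assms by (simp add: max_absorb2)
    then show ?thesis
      by (rule has_field_derivative_transform_within_open[where S="{a<..}"]) (use 2 in \<open>auto simp: plin_def\<close>)
  next
    case 3
    then show ?thesis using DERIV_glue[OF lin pw[OF assms]] by (simp add: plin_def[abs_def])
  qed
qed

lemma plin_eq: "a \<le> s \<Longrightarrow> plin \<theta> a s = s powr \<theta>" by (simp add: plin_def)

lemma plin_nonneg:
  assumes "a > 0" "0 \<le> \<theta>" "\<theta> \<le> 1" "s \<ge> 0" shows "plin \<theta> a s \<ge> 0"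
proof (cases "s < a")
  case True
  have "a powr (\<theta> - 1) * a = a powr \<theta>" using powr_mult_base[of a "\<theta> - 1"] assms(1) by (simp add: mult.commute)
  then have "plin \<theta> a s = (1 - \<theta>) * a powr \<theta> + \<theta> * a powr (\<theta> - 1) * s" using True by (simp add: plin_def algebra_simps)
  also have "\<dots> \<ge> 0" using assms by (intro add_nonneg_nonneg mult_nonneg_nonneg) auto
  finally show ?thesis .
qed (simp add: plin_def)

lemma powr_convex_comb:
  fixes x y t p :: real
  assumes "0 \<le> x" "0 \<le> y" "0 \<le> t" "t \<le> 1" "p \<ge> 1"
  shows "((1 - t) * x + t * y) powr p \<le> (1 - t) * x powr p + t * y powr p"
proof -
  define s where "s = (1 - t) * x + t * y"
  show ?thesis
  proof (cases "s > 0")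
    case True
    define c where "c = p * s powr (p - 1)"
    have "s powr p + c * (x - s) \<le> x powr p" "s powr p + c * (y - s) \<le> y powr p"
      unfolding c_def using powr_above_tangent[OF True _ assms(5)] assms by auto
    then have "(1 - t) * (s powr p + c * (x - s)) + t * (s powr p + c * (y - s)) \<le> (1 - t) * x powr p + t * y powr p"
      using assms by (intro add_mono mult_left_mono) auto
    moreover have "(1 - t) * (s powr p + c * (x - s)) + t * (s powr p + c * (y - s)) = s powr p + c * ((1 - t) * x + t * y - s)"
      by (simp add: algebra_simps)
    ultimately show ?thesis by (simp add: s_def)
  next
    case False
    have "s \<ge> 0" unfolding s_def using assms by simp
    then have "s = 0" using False by simp
    then show ?thesis using assms by (simp add: s_def[symmetric])
  qed
qed

text \<open>Convexity of \<open>norm v powr p\<close> at a nonzero point, where its gradient is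
  \<open>p * norm x powr (p - 2)\<close> times \<open>x\<close>. Cauchy-Schwarz reduces it to the
  scalar tangent inequality.\<close>

lemma norm_powr_above_tangent:
  fixes v x :: "'a::euclidean_space"
  assumes "x \<noteq> 0" "p \<ge> 1"
  shows "norm v powr p \<ge> norm x powr p + p * norm x powr (p - 2) * (x \<bullet> (v - x))"
proof -
  have pos: "norm x > 0" using assms by simp
  have e: "norm x powr (p - 1) = norm x powr (p - 2) * norm x"
    using powr_mult_base[of "norm x" "p - 2"] by (simp add: mult.commute)
  have "x \<bullet> (v - x) \<le> norm x * (norm v - norm x)"
    using norm_cauchy_schwarz[of x v] by (simp add: inner_diff_right algebra_simps dot_square_norm power2_eq_square)
  then have "norm x powr p + (p * norm x powr (p - 2)) * (x \<bullet> (v - x)) \<le> norm x powr p + (p * norm x powr (p - 2)) * (norm x * (norm v - norm x))"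
    using assms by (intro add_left_mono mult_left_mono) auto
  also have "\<dots> = norm x powr p + p * norm x powr (p - 1) * (norm v - norm x)" by (simp add: e)
  also have "\<dots> \<le> norm v powr p" using pos assms by (intro powr_above_tangent) auto
  finally show ?thesis .
qed

lemma radial_projection:
  fixes x0 y :: "'a::euclidean_space"
  assumes "R \<ge> 0" "dist x0 y \<ge> R" "dist x0 y > 0"
  obtains z where "dist x0 z = R" "dist z y = dist x0 y - R"
proof
  let ?z = "x0 + (R / dist x0 y) *\<^sub>R (y - x0)"
  have n: "norm (y - x0) = dist x0 y" by (simp add: dist_norm norm_minus_commute)
  show "dist x0 ?z = R" using assms by (simp add: dist_norm n[unfolded dist_norm] norm_minus_commute)
  have "y - ?z = (1 - R / dist x0 y) *\<^sub>R (y - x0)" by (simp add: algebra_simps)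
  then have "dist ?z y = \<bar>1 - R / dist x0 y\<bar> * dist x0 y" by (simp add: dist_norm norm_minus_commute)
  also have "\<dots> = dist x0 y - R" using assms by (simp add: abs_of_nonneg field_simps)
  finally show "dist ?z y = dist x0 y - R" .
qed

lemma cball_enlarge:
  fixes x0 :: "'a::euclidean_space"
  assumes "open \<Omega>" "cball x0 R \<subseteq> \<Omega>" "R \<ge> 0"
  obtains s where "s > 0" "cball x0 (R + s) \<subseteq> \<Omega>"
proof -
  obtain K s where K: "s > 0" "compact K" "K \<subseteq> \<Omega>" "cball x0 R \<subseteq> K" "\<And>x. x \<in> cball x0 R \<Longrightarrow> cball x s \<subseteq> K"
    by (rule compact_neighbourhood_obtain[OF compact_cball assms(1,2)]) (rule that)
  show ?thesis
  proof (rule that[OF K(1)])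
    show "cball x0 (R + s) \<subseteq> \<Omega>"
    proof
      fix y assume y: "y \<in> cball x0 (R + s)"
      show "y \<in> \<Omega>"
      proof (cases "dist x0 y \<le> R")
        case True
        then show ?thesis using assms(2) by auto
      next
        case False
        obtain z where z: "dist x0 z = R" "dist z y = dist x0 y - R"
          by (rule radial_projection[of R x0 y]) (use False assms(3) in auto)
        then have "y \<in> cball z s" using y by simp
        moreover have "z \<in> cball x0 R" using z(1) by simp
        ultimately show ?thesis using K(3,5) by blast
      qed
    qed
  qed
qed

text \<open>Integration by parts against the radial field
  \<open>k (\<sigma> x) *\<^sub>R (x - x0)\<close>, whose divergence is the bracket multiplying
  \<open>\<Psi>\<close>. Each component of the field serves as a C^1 test function; the trace over
  the basis gives the scalar identity.\<close>

lemma weak_divergence_radial: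
  fixes \<Psi> :: "'a::euclidean_space \<Rightarrow> real"
  assumes \<Omega>: "open \<Omega>" and \<Psi>: "has_weak_gradient \<Omega> \<Psi> H" "continuous_on \<Omega> \<Psi>"
    and k: "\<And>s. (k has_real_derivative k' s) (at s)" "continuous_on UNIV k'"
    and R: "cball x0 R \<subseteq> \<Omega>" "\<And>x. x \<notin> cball x0 R \<Longrightarrow> k ((x - x0) \<bullet> (x - x0)) = 0"
  defines "\<sigma> \<equiv> \<lambda>x. (x - x0) \<bullet> (x - x0)"
  shows "integrable (lebesgue_on \<Omega>) (\<lambda>x. k (\<sigma> x) * ((x - x0) \<bullet> H x))"
    "integrable (lebesgue_on \<Omega>) (\<lambda>x. \<Psi> x * (real DIM('a) * k (\<sigma> x) + 2 * \<sigma> x * k' (\<sigma> x)))"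
    "(LINT x|lebesgue_on \<Omega>. \<Psi> x * (real DIM('a) * k (\<sigma> x) + 2 * \<sigma> x * k' (\<sigma> x))) = - (LINT x|lebesgue_on \<Omega>. k (\<sigma> x) * ((x - x0) \<bullet> H x))"
proof -
  have l: "locally_integrable \<Omega> \<Psi>" "locally_integrable \<Omega> H" using \<Psi> by (auto simp: has_weak_gradient_def)
  define \<zeta> where "\<zeta> i x = k (\<sigma> x) * ((x - x0) \<bullet> i)" for i x
  define X where "X i x = k (\<sigma> x) *\<^sub>R i + ((x - x0) \<bullet> i) *\<^sub>R (k' (\<sigma> x) *\<^sub>R (2 *\<^sub>R (x - x0)))" for i x
  have C: "C1_grad (\<zeta> i) (X i)" for i
    unfolding \<zeta>_def X_def \<sigma>_def by (intro C1_grad_mult C1_grad_compose[OF C1_grad_norm_sq k] C1_grad_inner)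
  have z: "\<zeta> i x = 0" if "x \<notin> cball x0 R" for i x using R(2)[OF that] by (simp add: \<zeta>_def \<sigma>_def)
  have X0: "X i x = 0" if "x \<notin> cball x0 R" for i x
    by (rule gradient_zero_off_closed[OF C closed_cball z that])
  have i1: "integrable (lebesgue_on \<Omega>) (\<lambda>x. \<Psi> x *\<^sub>R X i x)" for i
    by (rule integrable_test_pairing_vector[OF l(1) \<Omega> compact_cball R(1) C1_gradD(4)[OF C] X0])
  have i2: "integrable (lebesgue_on \<Omega>) (\<lambda>x. \<zeta> i x *\<^sub>R H x)" for i
    by (rule integrable_test_pairing[OF l(2) \<Omega> compact_cball R(1) C1_gradD(3)[OF C] z])
  have eq: "(LINT x|lebesgue_on \<Omega>. \<Psi> x *\<^sub>R X i x) = - (LINT x|lebesgue_on \<Omega>. \<zeta> i x *\<^sub>R H x)" for i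
    by (rule weak_gradient_C1_test[OF \<Omega> \<Psi> C compact_cball R(1) z])
  have s1: "(\<Sum>i\<in>Basis. i \<bullet> (\<Psi> x *\<^sub>R X i x)) = \<Psi> x * (real DIM('a) * k (\<sigma> x) + 2 * \<sigma> x * k' (\<sigma> x))" for x
  proof -
    have "(\<Sum>i\<in>Basis. i \<bullet> (\<Psi> x *\<^sub>R X i x)) = (\<Sum>i\<in>Basis. \<Psi> x * k (\<sigma> x) + (2 * \<Psi> x * k' (\<sigma> x)) * (((x - x0) \<bullet> i) * ((x - x0) \<bullet> i)))"
      by (intro sum.cong) (auto simp: X_def inner_add_right inner_commute algebra_simps)
    also have "\<dots> = real DIM('a) * (\<Psi> x * k (\<sigma> x)) + (2 * \<Psi> x * k' (\<sigma> x)) * \<sigma> x"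
      unfolding sum.distrib sum_distrib_left[symmetric] \<sigma>_def euclidean_inner[symmetric] by simp
    finally show ?thesis by (simp add: algebra_simps)
  qed
  have s2: "(\<Sum>i\<in>Basis. i \<bullet> (\<zeta> i x *\<^sub>R H x)) = k (\<sigma> x) * ((x - x0) \<bullet> H x)" for x
    unfolding \<zeta>_def euclidean_inner[of "x - x0" "H x"] sum_distrib_left
    by (intro sum.cong) (auto simp: inner_commute)
  show "integrable (lebesgue_on \<Omega>) (\<lambda>x. \<Psi> x * (real DIM('a) * k (\<sigma> x) + 2 * \<sigma> x * k' (\<sigma> x)))"
    unfolding s1[symmetric] by (intro Bochner_Integration.integrable_sum integrable_inner_right i1)
  show "integrable (lebesgue_on \<Omega>) (\<lambda>x. k (\<sigma> x) * ((x - x0) \<bullet> H x))"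
    unfolding s2[symmetric] by (intro Bochner_Integration.integrable_sum integrable_inner_right i2)
  have "(LINT x|lebesgue_on \<Omega>. \<Psi> x * (real DIM('a) * k (\<sigma> x) + 2 * \<sigma> x * k' (\<sigma> x))) = (\<Sum>i\<in>Basis. i \<bullet> (LINT x|lebesgue_on \<Omega>. \<Psi> x *\<^sub>R X i x))"
    unfolding s1[symmetric] Bochner_Integration.integral_sum[OF integrable_inner_right[OF i1]]
    by (intro sum.cong refl integral_inner_right i1)
  also have "\<dots> = - (\<Sum>i\<in>Basis. i \<bullet> (LINT x|lebesgue_on \<Omega>. \<zeta> i x *\<^sub>R H x))"
    by (simp add: eq sum_negf)
  also have "(\<Sum>i\<in>Basis. i \<bullet> (LINT x|lebesgue_on \<Omega>. \<zeta> i x *\<^sub>R H x)) = (LINT x|lebesgue_on \<Omega>. k (\<sigma> x) * ((x - x0) \<bullet> H x))"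
    unfolding s2[symmetric] Bochner_Integration.integral_sum[OF integrable_inner_right[OF i2]]
    by (intro sum.cong refl integral_inner_right[symmetric] i2)
  finally show "(LINT x|lebesgue_on \<Omega>. \<Psi> x * (real DIM('a) * k (\<sigma> x) + 2 * \<sigma> x * k' (\<sigma> x))) = - (LINT x|lebesgue_on \<Omega>. k (\<sigma> x) * ((x - x0) \<bullet> H x))" .
qed

text \<open>The competitor is \<open>u - soft d (u - \<phi>)\<close>, with gradient
  \<open>(1 - T') G + T' \<Phi>\<close>, a pointwise convex combination. Convexity of the energy
  density then turns minimality into the last inequality, in which only the region
  \<open>u - \<phi> > d\<close> counts.\<close>

lemma p_minimizer_truncation:
  fixes u :: "'a::euclidean_space \<Rightarrow> real"
  assumes \<Omega>: "open \<Omega>" "bounded \<Omega>" and p: "p \<ge> 1" and u: "p_minimizer \<Omega> p u G"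
    and \<phi>: "C1_grad \<phi> \<Phi>" and d: "d > 0" and fr: "\<And>x. x \<in> frontier \<Omega> \<Longrightarrow> u x - \<phi> x \<le> d"
  defines "T' \<equiv> \<lambda>x. soft' d (u x - \<phi> x)"
  shows "has_weak_gradient \<Omega> (\<lambda>x. soft d (u x - \<phi> x)) (\<lambda>x. T' x *\<^sub>R (G x - \<Phi> x))"
    "integrable (lebesgue_on \<Omega>) (\<lambda>x. T' x * norm (G x) powr p)"
    "integrable (lebesgue_on \<Omega>) (\<lambda>x. T' x * norm (\<Phi> x) powr p)"
    "(LINT x|lebesgue_on \<Omega>. T' x * norm (G x) powr p) \<le> (LINT x|lebesgue_on \<Omega>. T' x * norm (\<Phi> x) powr p)"
proof -
  have G: "has_weak_gradient \<Omega> u G" "in_Lp \<Omega> p G" and cu: "continuous_on (closure \<Omega>) u"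
    using u by (auto simp: p_minimizer_def)
  have cw: "continuous_on (closure \<Omega>) (\<lambda>x. u x - \<phi> x)" by (intro continuous_intros cu C1_gradD(3)[OF \<phi>])
  have cw': "continuous_on \<Omega> (\<lambda>x. u x - \<phi> x)" using cw closure_subset by (rule continuous_on_subset)
  have csoft: "continuous_on UNIV (soft d)" using soft_deriv[OF d] by (meson DERIV_isCont continuous_at_imp_continuous_on)
  have ww: "has_weak_gradient \<Omega> (\<lambda>x. u x - \<phi> x) (\<lambda>x. G x - \<Phi> x)"
    by (rule has_weak_gradient_diff[OF \<Omega>(1) G(1) has_weak_gradient_C1[OF \<Omega>(1) \<phi>]])
  show wg: "has_weak_gradient \<Omega> (\<lambda>x. soft d (u x - \<phi> x)) (\<lambda>x. T' x *\<^sub>R (G x - \<Phi> x))"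
    unfolding T'_def by (rule has_weak_gradient_compose[OF \<Omega>(1) ww cw' soft_deriv[OF d] soft'_continuous[OF d]])
  have L\<Phi>: "in_Lp \<Omega> p \<Phi>" using p by (intro in_Lp_continuous \<Omega> C1_gradD(4)[OF \<phi>]) auto
  let ?M = "lebesgue_on \<Omega>"
  have cT': "continuous_on \<Omega> T'" unfolding T'_def by (rule continuous_on_compose2[OF soft'_continuous[OF d, of UNIV] cw']) simp
  have [measurable]: "T' \<in> borel_measurable ?M" using \<Omega>(1) cT' by (rule continuous_on_lebesgue_on_measurable)
  have [measurable]: "G \<in> borel_measurable ?M" "\<Phi> \<in> borel_measurable ?M" using G L\<Phi> by (auto simp: in_Lp_def)
  have iG: "integrable ?M (\<lambda>x. norm (G x) powr p)" and i\<Phi>: "integrable ?M (\<lambda>x. norm (\<Phi> x) powr p)" using G L\<Phi> by (auto simp: in_Lp_def)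
  have T'b: "0 \<le> T' x" "T' x \<le> 1" for x unfolding T'_def by (rule soft'_bounds[OF d])+
  have LGP: "in_Lp \<Omega> p (\<lambda>x. G x - \<Phi> x)" using p by (intro in_Lp_diff G L\<Phi>) auto
  show iTG: "integrable ?M (\<lambda>x. T' x * norm (G x) powr p)"
    by (rule Bochner_Integration.integrable_bound[OF iG]) (measurable, use T'b in \<open>auto intro!: AE_I2 mult_left_le_one_le simp: abs_mult\<close>)
  show iT\<Phi>: "integrable ?M (\<lambda>x. T' x * norm (\<Phi> x) powr p)"
    by (rule Bochner_Integration.integrable_bound[OF i\<Phi>]) (measurable, use T'b in \<open>auto intro!: AE_I2 mult_left_le_one_le simp: abs_mult\<close>)
  have LH: "in_Lp \<Omega> p (\<lambda>x. - (T' x *\<^sub>R (G x - \<Phi> x)))"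
    unfolding in_Lp_def
  proof
    show m: "(\<lambda>x. - (T' x *\<^sub>R (G x - \<Phi> x))) \<in> borel_measurable ?M" by measurable
    show "integrable ?M (\<lambda>x. norm (- (T' x *\<^sub>R (G x - \<Phi> x))) powr p)"
    proof (rule Bochner_Integration.integrable_bound)
      show "integrable ?M (\<lambda>x. norm (G x - \<Phi> x) powr p)" using LGP by (simp add: in_Lp_def)
      show "AE x in ?M. norm (norm (- (T' x *\<^sub>R (G x - \<Phi> x))) powr p) \<le> norm (norm (G x - \<Phi> x) powr p)"
        using T'b p by (auto intro!: AE_I2 powr_mono2 mult_left_le_one_le)
    qed (use m in measurable)
  qed
  have "(LINT x|?M. norm (G x) powr p) \<le> (LINT x|?M. norm (G x + - (T' x *\<^sub>R (G x - \<Phi> x))) powr p)"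
  proof -
    have "has_weak_gradient \<Omega> (\<lambda>x. - soft d (u x - \<phi> x)) (\<lambda>x. - (T' x *\<^sub>R (G x - \<Phi> x)))" by (rule has_weak_gradient_minus[OF wg])
    moreover have "continuous_on (closure \<Omega>) (\<lambda>x. - soft d (u x - \<phi> x))"
      by (intro continuous_on_minus continuous_on_compose2[OF csoft cw]) simp
    moreover have "\<forall>x\<in>frontier \<Omega>. - soft d (u x - \<phi> x) = 0" using fr soft_zero(1)[OF d] by auto
    ultimately show ?thesis using u LH unfolding p_minimizer_def by blast
  qed
  also have "\<dots> \<le> (LINT x|?M. (1 - T' x) * norm (G x) powr p + T' x * norm (\<Phi> x) powr p)"
  proof (rule integral_mono)
    show "integrable ?M (\<lambda>x. norm (G x + - (T' x *\<^sub>R (G x - \<Phi> x))) powr p)"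
      using in_Lp_add[OF _ G(2) LH] p by (simp add: in_Lp_def)
    show "integrable ?M (\<lambda>x. (1 - T' x) * norm (G x) powr p + T' x * norm (\<Phi> x) powr p)"
      using iTG iT\<Phi> iG by (simp add: left_diff_distrib)
    fix x
    have "G x + - (T' x *\<^sub>R (G x - \<Phi> x)) = (1 - T' x) *\<^sub>R G x + T' x *\<^sub>R \<Phi> x" by (simp add: algebra_simps)
    then have "norm (G x + - (T' x *\<^sub>R (G x - \<Phi> x))) \<le> (1 - T' x) * norm (G x) + T' x * norm (\<Phi> x)"
      using norm_triangle_ineq[of "(1 - T' x) *\<^sub>R G x" "T' x *\<^sub>R \<Phi> x"] T'b[of x] by simp
    then have "norm (G x + - (T' x *\<^sub>R (G x - \<Phi> x))) powr p \<le> ((1 - T' x) * norm (G x) + T' x * norm (\<Phi> x)) powr p"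
      using p by (intro powr_mono2) auto
    also have "\<dots> \<le> (1 - T' x) * norm (G x) powr p + T' x * norm (\<Phi> x) powr p"
      using p T'b[of x] by (intro powr_convex_comb) auto
    finally show "norm (G x + - (T' x *\<^sub>R (G x - \<Phi> x))) powr p \<le> (1 - T' x) * norm (G x) powr p + T' x * norm (\<Phi> x) powr p" .
  qed
  also have "\<dots> = (LINT x|?M. norm (G x) powr p) - (LINT x|?M. T' x * norm (G x) powr p) + (LINT x|?M. T' x * norm (\<Phi> x) powr p)"
    using iTG iT\<Phi> iG by (simp add: left_diff_distrib)
  finally show "(LINT x|?M. T' x * norm (G x) powr p) \<le> (LINT x|?M. T' x * norm (\<Phi> x) powr p)" by simp
qed

text \<open>For exponents below \<open>(p - d) / (p - 1)\<close> the function \<open>|x|\<^sup>\<beta>\<close> is a strict supersolution away from the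
  origin, so no uniqueness argument for the gradients is needed.\<close>

lemma p_minimizer_strict_comparison:
  fixes u :: "'a::euclidean_space \<Rightarrow> real"
  assumes \<Omega>: "open \<Omega>" "bounded \<Omega>" and p: "p > 1" and u: "p_minimizer \<Omega> p u G"
    and R: "R > 0" "cball x0 R \<subseteq> \<Omega>" and b: "b > 0" and \<beta>: "0 < \<beta>" "\<beta> \<le> 1"
    and strict: "real DIM('a) - 1 < (1 - \<beta>) * (p - 1)"
    and bd: "\<And>y. dist x0 y = R \<Longrightarrow> u y \<le> u x0 + b * R powr \<beta>"
    and y1: "y1 \<in> cball x0 R"
  shows "u y1 \<le> u x0 + b * dist x0 y1 powr \<beta>"
proof (rule ccontr)
  assume neg: "\<not> u y1 \<le> u x0 + b * dist x0 y1 powr \<beta>"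
  let ?\<alpha> = "u x0"
  \<comment> \<open>Half of the supposed excess at \<open>y1\<close>. The truncation at level
    \<open>d\<close> then still sees \<open>y1\<close>, where the excess is \<open>2 * d\<close>,
    while an error \<open>d\<close> remains free for the inner and outer adjustments.\<close>
  define d where "d = (u y1 - ?\<alpha> - b * dist x0 y1 powr \<beta>) / 2"
  have d: "d > 0" using neg by (simp add: d_def)
  have uy1: "u y1 = ?\<alpha> + b * dist x0 y1 powr \<beta> + 2 * d" by (simp add: d_def field_simps)
  have cu: "continuous_on (closure \<Omega>) u" and G: "has_weak_gradient \<Omega> u G" using u by (auto simp: p_minimizer_def)
  have cu': "continuous_on \<Omega> u" using cu closure_subset by (rule continuous_on_subset)
  have x0: "x0 \<in> \<Omega>" using R by auto
  define \<sigma> where "\<sigma> x = (x - x0) \<bullet> (x - x0)" for x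
  have \<sigma>: "\<sigma> x = (dist x0 x)\<^sup>2" for x by (simp add: \<sigma>_def dot_square_norm dist_norm norm_minus_commute)
  have \<sigma>powr: "\<sigma> x powr t = dist x0 x powr (2 * t)" if "dist x0 x > 0" for x t
  proof -
    have "\<sigma> x = dist x0 x powr 2" unfolding \<sigma> using that by (simp add: powr_numeral)
    then show ?thesis by (simp only: powr_powr)
  qed
  \<comment> \<open>Inside this radius \<open>u\<close> exceeds its central value by less than
    \<open>d\<close>, and the barrier never falls below that value. The linearised part of
    \<open>plin\<close> near the centre therefore does not matter.\<close>
  obtain r0 where r0: "r0 > 0" "r0 < R" "\<And>y. dist x0 y < r0 \<Longrightarrow> u y < ?\<alpha> + d"
  proof -
    have "isCont u x0" using cu' \<Omega>(1) x0 by (simp add: continuous_on_eq_continuous_at)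
    then obtain e where e: "e > 0" "\<And>y. dist y x0 < e \<Longrightarrow> dist (u y) (u x0) < d"
      using d unfolding continuous_at_eps_delta by (auto simp: dist_real_def dist_norm)
    show thesis
    proof (rule that[of "min e (R/2)"])
      fix y assume "dist x0 y < min e (R/2)"
      then show "u y < ?\<alpha> + d" using e(2)[of y] by (simp add: dist_commute dist_real_def abs_less_iff)
    qed (use e(1) R(1) in auto)
  qed
  obtain s where s: "s > 0" "cball x0 (R + s) \<subseteq> \<Omega>" using cball_enlarge[OF \<Omega>(1) R(2)] R(1) by (auto intro: less_imp_le)
  \<comment> \<open>The sphere bound is relaxed by \<open>d\<close> on a slightly larger ball, to
    leave a layer in which the barrier can grow and the test field be cut off.\<close>
  obtain R' where R': "R' > R" "cball x0 R' \<subseteq> \<Omega>" "\<And>y. R \<le> dist x0 y \<Longrightarrow> dist x0 y \<le> R' \<Longrightarrow> u y \<le> ?\<alpha> + b * dist x0 y powr \<beta> + d"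
  proof -
    let ?v = "\<lambda>y. u y - ?\<alpha> - b * dist x0 y powr \<beta>"
    have "continuous_on (cball x0 (R + s)) ?v"
      using s(2) \<beta> by (intro continuous_intros continuous_on_powr' continuous_on_subset[OF cu']) auto
    then have "uniformly_continuous_on (cball x0 (R + s)) ?v" by (intro compact_uniformly_continuous) auto
    then obtain e where e: "e > 0" "\<And>y z. y \<in> cball x0 (R + s) \<Longrightarrow> z \<in> cball x0 (R + s) \<Longrightarrow> dist z y < e \<Longrightarrow> dist (?v z) (?v y) < d"
      unfolding uniformly_continuous_on_def using d by blast
    show thesis
    proof (rule that[of "R + min s (e/2)"])
      show "cball x0 (R + min s (e/2)) \<subseteq> \<Omega>" using s(2) by (meson add_left_mono min.cobounded1 order_trans subset_cball)
      fix y assume y: "R \<le> dist x0 y" "dist x0 y \<le> R + min s (e/2)"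
      obtain z where z: "dist x0 z = R" "dist z y = dist x0 y - R"
        by (rule radial_projection[of R x0 y]) (use y R(1) in auto)
      have "dist (?v z) (?v y) < d" using y z s(1) e(1) by (intro e(2)) auto
      then have "?v y < ?v z + d" by (simp add: dist_real_def abs_less_iff)
      then show "u y \<le> ?\<alpha> + b * dist x0 y powr \<beta> + d" using bd[OF z(1)] z(1) by simp
    qed (use s e in auto)
  qed
  define a where "a = r0\<^sup>2"
  have a: "a > 0" using r0 by (simp add: a_def)
  define D where "D = R'\<^sup>2 - R\<^sup>2"
  have D: "D > 0" unfolding D_def using R'(1) R(1) by (simp add: power_strict_mono)
  have "compact (u ` closure \<Omega>)" using cu \<Omega>(2) by (intro compact_continuous_image) auto
  then obtain B where B: "B > 0" "\<forall>y\<in>u ` closure \<Omega>. norm y \<le> B" using compact_imp_bounded bounded_pos by blast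
  \<comment> \<open>Makes the quadratic term alone exceed \<open>u - u x0\<close> from radius
    \<open>R'\<close> on, as it is at least \<open>M * D\<^sup>2\<close> there. The barrier thus
    dominates on all of the closure and in particular on the frontier.\<close>
  define M where "M = (B + \<bar>?\<alpha>\<bar>) / D\<^sup>2"
  have M: "M > 0" "M * D\<^sup>2 = B + \<bar>?\<alpha>\<bar>" using B(1) D by (auto simp: M_def add_pos_nonneg)
  define \<theta> where "\<theta> = \<beta> / 2"
  define h where "h s = ?\<alpha> + b * plin \<theta> a s + M * sqp (s - R\<^sup>2)" for s
  define h' where "h' s = b * (\<theta> * max a s powr (\<theta> - 1)) + M * (2 * max 0 (s - R\<^sup>2))" for s
  have sqpc: "((\<lambda>s. sqp (s - c)) has_real_derivative 2 * max 0 (s - c)) (at s)" for c s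
    by (rule DERIV_cong[OF DERIV_chain2[where f=sqp and g="\<lambda>s. s - c" and x=s, OF sqp_deriv]])
       (auto intro!: derivative_eq_intros)
  have h: "(h has_real_derivative h' s) (at s)" for s
    unfolding h_def h'_def
    using DERIV_add[OF DERIV_add[OF DERIV_const DERIV_cmult[OF plin_deriv[OF a]]] DERIV_cmult[OF sqpc]] by simp
  have ch': "continuous_on UNIV h'"
    unfolding h'_def using a by (intro continuous_intros continuous_on_powr) (auto simp: max_def)
  define \<phi> where "\<phi> x = h (\<sigma> x)" for x
  define \<Phi> where "\<Phi> x = h' (\<sigma> x) *\<^sub>R (2 *\<^sub>R (x - x0))" for x
  have \<phi>: "C1_grad \<phi> \<Phi>" unfolding \<phi>_def \<Phi>_def \<sigma>_def by (rule C1_grad_compose[OF C1_grad_norm_sq h ch'])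
  have \<phi>ge: "?\<alpha> \<le> \<phi> x" for x
    unfolding \<phi>_def h_def using b M a \<beta> plin_nonneg[of a \<theta> "\<sigma> x"] sqp_nonneg[of "\<sigma> x - R\<^sup>2"]
    by (simp add: \<theta>_def \<sigma>)
  have \<phi>r: "\<phi> x = ?\<alpha> + b * dist x0 x powr \<beta> + M * sqp (\<sigma> x - R\<^sup>2)" if "r0 \<le> dist x0 x" for x
  proof -
    have "a \<le> \<sigma> x" unfolding a_def \<sigma> using that r0(1) by (intro power_mono) auto
    moreover have "dist x0 x > 0" using that r0(1) by linarith
    ultimately show ?thesis by (simp add: \<phi>_def h_def plin_eq \<sigma>powr \<theta>_def)
  qed
  \<comment> \<open>Truncation is active only in this annulus, where \<open>\<phi>\<close> is
    exactly \<open>u x0\<close> plus the pure power and the cut-off equals 1.\<close>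
  have ann: "r0 \<le> dist x0 x \<and> dist x0 x < R" if x: "x \<in> closure \<Omega>" "u x - \<phi> x > d" for x
  proof (rule ccontr)
    assume "\<not> (r0 \<le> dist x0 x \<and> dist x0 x < R)"
    then consider "dist x0 x < r0" | "R \<le> dist x0 x" "dist x0 x \<le> R'" | "R' < dist x0 x" by linarith
    then show False
    proof cases
      case 1
      then show False using r0(3)[OF 1] \<phi>ge[of x] x(2) by linarith
    next
      case 2
      then have "r0 \<le> dist x0 x" using r0(2) by linarith
      moreover have "M * sqp (\<sigma> x - R\<^sup>2) \<ge> 0" using M(1) sqp_nonneg[of "\<sigma> x - R\<^sup>2"] by simp
      ultimately show False using \<phi>r[of x] R'(3)[OF 2] x(2) by linarith
    next
      case 3
      then have r: "r0 \<le> dist x0 x" using r0(2) R'(1) by linarith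
      have "R'\<^sup>2 \<le> \<sigma> x" unfolding \<sigma> using 3 R'(1) R(1) by (intro power_mono) auto
      then have DD: "D \<le> \<sigma> x - R\<^sup>2" by (simp add: D_def)
      then have "D\<^sup>2 \<le> sqp (\<sigma> x - R\<^sup>2)" unfolding sqp_def using D by (intro power_mono) auto
      then have "M * D\<^sup>2 \<le> M * sqp (\<sigma> x - R\<^sup>2)" using M(1) by (intro mult_left_mono) auto
      moreover have "\<bar>u x\<bar> \<le> B" using B(2) x(1) by auto
      moreover have "b * dist x0 x powr \<beta> \<ge> 0" using b by simp
      ultimately show False using \<phi>r[OF r] M(2) x(2) d by linarith
    qed
  qed
  have fr: "u x - \<phi> x \<le> d" if "x \<in> frontier \<Omega>" for x
  proof (rule ccontr)
    assume "\<not> u x - \<phi> x \<le> d"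
    then have "r0 \<le> dist x0 x \<and> dist x0 x < R" using that by (intro ann) (auto simp: frontier_def)
    then have "x \<in> \<Omega>" using R(2) by (auto simp: subset_eq)
    then show False using that \<Omega>(1) by (simp add: frontier_def interior_open)
  qed
  let ?M = "lebesgue_on \<Omega>"
  let ?T = "\<lambda>x. soft d (u x - \<phi> x)" let ?T' = "\<lambda>x. soft' d (u x - \<phi> x)"
  let ?H = "\<lambda>x. ?T' x *\<^sub>R (G x - \<Phi> x)"
  have p1: "p \<ge> 1" using p by simp
  note tr = p_minimizer_truncation[OF \<Omega> p1 u \<phi> d fr]
  \<comment> \<open>The exponent for which \<open>\<sigma> powr q\<close> times
    \<open>x - x0\<close> is, up to the factor \<open>c\<close>, the flux |\<Phi>|^(p-2) \<Phi> of
    the pure power: \<open>2 * q = (\<beta> - 1) * (p - 2) + (\<beta> - 2)\<close>.\<close>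
  define q where "q = ((\<beta> - 1) * (p - 1) - 1) / 2"
  \<comment> \<open>Equal to 1 up to \<open>R\<^sup>2\<close> and to 0 from
    \<open>R'\<^sup>2\<close> on, so that the radial field is supported in
    \<open>cball x0 R'\<close>.\<close>
  define cut where "cut s = sqp (1 - sqp (s - R\<^sup>2) / D\<^sup>2)" for s
  define cut' where "cut' s = 2 * max 0 (1 - sqp (s - R\<^sup>2) / D\<^sup>2) * (- (2 * max 0 (s - R\<^sup>2) / D\<^sup>2))" for s
  have cut: "(cut has_real_derivative cut' s) (at s)" for s
  proof -
    have "((\<lambda>s. 1 - sqp (s - R\<^sup>2) / D\<^sup>2) has_real_derivative (0 - 2 * max 0 (s - R\<^sup>2) / D\<^sup>2)) (at s)"
      by (intro DERIV_diff DERIV_const DERIV_cdivide sqpc)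
    from DERIV_chain2[where f=sqp, OF sqp_deriv this] show ?thesis unfolding cut_def cut'_def by simp
  qed
  have cut1: "cut s = 1" "cut' s = 0" if "s \<le> R\<^sup>2" for s using that by (simp_all add: cut_def cut'_def sqp_def)
  define k where "k s = plin q a s * cut s" for s
  define k' where "k' s = (q * max a s powr (q - 1)) * cut s + cut' s * plin q a s" for s
  have k: "(k has_real_derivative k' s) (at s)" for s
    unfolding k_def k'_def by (rule DERIV_mult[OF plin_deriv[OF a] cut])
  have "continuous_on UNIV (plin q a)" "continuous_on UNIV cut"
    using plin_deriv[OF a] cut by (meson DERIV_isCont continuous_at_imp_continuous_on)+
  then have ck': "continuous_on UNIV k'"
    unfolding k'_def cut'_def using a D by (intro continuous_intros continuous_on_powr continuous_on_sqp) (auto simp: max_def)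
  have k0: "k (\<sigma> x) = 0" if "x \<notin> cball x0 R'" for x
  proof -
    have "R'\<^sup>2 \<le> \<sigma> x" unfolding \<sigma> using that R'(1) R(1) by (intro power_mono) auto
    then have "D \<le> \<sigma> x - R\<^sup>2" by (simp add: D_def)
    then have "D\<^sup>2 \<le> sqp (\<sigma> x - R\<^sup>2)" unfolding sqp_def using D by (intro power_mono) auto
    then have "1 - sqp (\<sigma> x - R\<^sup>2) / D\<^sup>2 \<le> 0" using D by simp
    then show ?thesis by (simp add: k_def cut_def sqp_def)
  qed
  have cT: "continuous_on \<Omega> ?T"
  proof -
    have "continuous_on UNIV (soft d)" using soft_deriv[OF d] by (meson DERIV_isCont continuous_at_imp_continuous_on)
    then show ?thesis by (rule continuous_on_compose2) (auto intro!: continuous_intros cu' C1_gradD(3)[OF \<phi>])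
  qed
  note wd = weak_divergence_radial[OF \<Omega>(1) tr(1) cT k ck' R'(2) k0[unfolded \<sigma>_def], folded \<sigma>_def]
  define dv where "dv x = real DIM('a) * k (\<sigma> x) + 2 * \<sigma> x * k' (\<sigma> x)" for x
  define c where "c = (b * \<beta>) powr (p - 1)"
  have c: "c > 0" using b \<beta> by (simp add: c_def)
  have onann: "k (\<sigma> x) = \<sigma> x powr q" "dv x < 0"
      "p * c * (k (\<sigma> x) * ((x - x0) \<bullet> (G x - \<Phi> x))) \<le> norm (G x) powr p - norm (\<Phi> x) powr p"
    if x: "r0 \<le> dist x0 x" "dist x0 x < R" for x
  proof -
    have pos: "dist x0 x > 0" using x r0(1) by linarith
    have "a \<le> \<sigma> x" unfolding a_def \<sigma> using x r0(1) by (intro power_mono) auto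
    moreover have "\<sigma> x < R\<^sup>2" unfolding \<sigma> using x by (intro power_strict_mono) auto
    ultimately have \<sigma>x: "a \<le> \<sigma> x" "\<sigma> x \<le> R\<^sup>2" "\<sigma> x > 0" "max a (\<sigma> x) = \<sigma> x" "max 0 (\<sigma> x - R\<^sup>2) = 0" using a by auto
    show kq: "k (\<sigma> x) = \<sigma> x powr q" by (simp add: k_def plin_eq \<sigma>x cut1)
    have k'q: "k' (\<sigma> x) = q * \<sigma> x powr (q - 1)" by (simp add: k'_def \<sigma>x cut1)
    have "\<sigma> x * \<sigma> x powr (q - 1) = \<sigma> x powr q" using powr_mult_base[of "\<sigma> x" "q - 1"] \<sigma>x by simp
    then have "dv x = (real DIM('a) + 2 * q) * \<sigma> x powr q" unfolding dv_def kq k'q by (simp add: algebra_simps)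
    \<comment> \<open>This is precisely the hypothesis \<open>strict\<close>: the flux of a
      subcritical power has negative divergence.\<close>
    moreover have "real DIM('a) + 2 * q < 0" using strict by (simp add: q_def field_simps)
    ultimately show "dv x < 0" using \<sigma>x by (simp add: mult_neg_pos)
    have \<Phi>x: "\<Phi> x = (b * \<beta> * dist x0 x powr (\<beta> - 2)) *\<^sub>R (x - x0)"
      using \<sigma>powr[OF pos, of "\<theta> - 1"] by (simp add: \<Phi>_def h'_def \<sigma>x \<theta>_def)
    have n\<Phi>: "norm (\<Phi> x) = b * \<beta> * dist x0 x powr (\<beta> - 1)"
    proof -
      have "dist x0 x * dist x0 x powr (\<beta> - 2) = dist x0 x powr (\<beta> - 1)" using powr_mult_base[of "dist x0 x" "\<beta> - 2"] by simp
      then show ?thesis using b \<beta> unfolding \<Phi>x norm_scaleR by (simp add: dist_norm norm_minus_commute abs_mult mult_ac)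
    qed
    have "\<Phi> x \<noteq> 0" using n\<Phi> b \<beta> pos by auto
    from norm_powr_above_tangent[OF this p1, of "G x"]
    have "p * norm (\<Phi> x) powr (p - 2) * (\<Phi> x \<bullet> (G x - \<Phi> x)) \<le> norm (G x) powr p - norm (\<Phi> x) powr p" by simp
    moreover have "norm (\<Phi> x) powr (p - 2) * (\<Phi> x \<bullet> v) = c * (k (\<sigma> x) * ((x - x0) \<bullet> v))" for v
    proof -
      have bb: "(b * \<beta>) powr (p - 2) * (b * \<beta>) = c"
        unfolding c_def using powr_mult_base[of "b * \<beta>" "p - 2"] b \<beta> by (simp add: mult.commute)
      have "norm (\<Phi> x) powr (p - 2) = (b * \<beta>) powr (p - 2) * dist x0 x powr ((\<beta> - 1) * (p - 2))"
        unfolding n\<Phi> using b \<beta> by (simp add: powr_mult powr_powr)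
      then have "norm (\<Phi> x) powr (p - 2) * (\<Phi> x \<bullet> v) =
          ((b * \<beta>) powr (p - 2) * (b * \<beta>)) * (dist x0 x powr ((\<beta> - 1) * (p - 2)) * dist x0 x powr (\<beta> - 2)) * ((x - x0) \<bullet> v)"
        unfolding \<Phi>x by simp
      also have "dist x0 x powr ((\<beta> - 1) * (p - 2)) * dist x0 x powr (\<beta> - 2) = dist x0 x powr (2 * q)"
        unfolding powr_add[symmetric] by (rule arg_cong[where f="\<lambda>t. dist x0 x powr t"]) (simp add: q_def algebra_simps)
      also have "\<dots> = k (\<sigma> x)" unfolding kq \<sigma>powr[OF pos] ..
      finally show ?thesis unfolding bb by simp
    qed
    ultimately show "p * c * (k (\<sigma> x) * ((x - x0) \<bullet> (G x - \<Phi> x))) \<le> norm (G x) powr p - norm (\<Phi> x) powr p"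
      by (simp add: mult.assoc)
  qed
  have offann: "?T x = 0" "?T' x = 0" if "x \<in> \<Omega>" "\<not> (r0 \<le> dist x0 x \<and> dist x0 x < R)" for x
  proof -
    have "u x - \<phi> x \<le> d" using ann[of x] that closure_subset by (force simp: not_le[symmetric])
    then show "?T x = 0" "?T' x = 0" by (simp_all add: soft_zero[OF d])
  qed
  have "p * c * (LINT x|?M. k (\<sigma> x) * ((x - x0) \<bullet> ?H x)) = (LINT x|?M. p * c * (k (\<sigma> x) * ((x - x0) \<bullet> ?H x)))"
    by simp
  also have "\<dots> \<le> (LINT x|?M. ?T' x * norm (G x) powr p - ?T' x * norm (\<Phi> x) powr p)"
  proof (rule integral_mono)
    show "integrable ?M (\<lambda>x. p * c * (k (\<sigma> x) * ((x - x0) \<bullet> ?H x)))" by (rule integrable_mult_right[OF wd(1)])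
    show "integrable ?M (\<lambda>x. ?T' x * norm (G x) powr p - ?T' x * norm (\<Phi> x) powr p)"
      by (rule Bochner_Integration.integrable_diff[OF tr(2,3)])
    fix x assume "x \<in> space ?M"
    then have x: "x \<in> \<Omega>" by simp
    show "p * c * (k (\<sigma> x) * ((x - x0) \<bullet> ?H x)) \<le> ?T' x * norm (G x) powr p - ?T' x * norm (\<Phi> x) powr p"
    proof (cases "r0 \<le> dist x0 x \<and> dist x0 x < R")
      case True
      then have "?T' x * (p * c * (k (\<sigma> x) * ((x - x0) \<bullet> (G x - \<Phi> x)))) \<le> ?T' x * (norm (G x) powr p - norm (\<Phi> x) powr p)"
        by (intro mult_left_mono onann(3) soft'_bounds(1)[OF d]) auto
      then show ?thesis by (simp add: algebra_simps)
    next
      case False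
      then show ?thesis by (simp add: offann(2)[OF x])
    qed
  qed
  also have "\<dots> \<le> 0" using tr(4) by (simp add: Bochner_Integration.integral_diff[OF tr(2,3)])
  finally have "(LINT x|?M. k (\<sigma> x) * ((x - x0) \<bullet> ?H x)) \<le> 0" using c p by (simp add: mult_le_0_iff not_le)
  moreover have "(LINT x|?M. ?T x * dv x) = - (LINT x|?M. k (\<sigma> x) * ((x - x0) \<bullet> ?H x))"
    unfolding dv_def by (rule wd(3))
  ultimately have ge: "(LINT x|?M. ?T x * dv x) \<ge> 0" by linarith
  have neg: "- (?T x * dv x) \<ge> 0" if "x \<in> \<Omega>" for x
  proof (cases "r0 \<le> dist x0 x \<and> dist x0 x < R")
    case True
    then show ?thesis using onann(2)[of x] soft_nonneg[OF d, of "u x - \<phi> x"] by (simp add: mult_nonneg_nonpos)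
  next
    case False
    then show ?thesis by (simp add: offann(1)[OF that])
  qed
  have idv: "integrable ?M (\<lambda>x. - (?T x * dv x))" unfolding dv_def by (rule Bochner_Integration.integrable_minus[OF wd(2)])
  have "(LINT x|?M. - (?T x * dv x)) \<ge> 0" by (intro Bochner_Integration.integral_nonneg neg) simp
  then have "(LINT x|?M. - (?T x * dv x)) = 0" using ge by simp
  then have "AE x in ?M. - (?T x * dv x) = 0"
    by (subst (asm) integral_nonneg_eq_0_iff_AE[OF idv]) (intro AE_I2 neg, simp_all)
  then have ngl: "negligible {x. x \<in> \<Omega> \<and> - (?T x * dv x) \<noteq> 0}" using \<Omega>(1) by (simp add: AE_lebesgue_on_iff_negligible)
  \<comment> \<open>Minimality makes the integral of \<open>?T x * dv x\<close> nonnegative, though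
    \<open>dv\<close> is negative wherever \<open>?T\<close> is positive. Hence this set is null;
    being open, it must be empty, yet it contains \<open>y1\<close>.\<close>
  let ?N = "{x \<in> \<Omega>. u x - \<phi> x > d}"
  have "?N \<subseteq> {x. x \<in> \<Omega> \<and> - (?T x * dv x) \<noteq> 0}"
  proof
    fix x assume x: "x \<in> ?N"
    then have "r0 \<le> dist x0 x \<and> dist x0 x < R" using closure_subset by (intro ann) auto
    then have "dv x < 0" by (intro onann(2)) auto
    moreover have "?T x > 0" using x by (intro soft_pos[OF d]) auto
    ultimately show "x \<in> {x. x \<in> \<Omega> \<and> - (?T x * dv x) \<noteq> 0}" using x by auto
  qed
  then have nN: "negligible ?N" using ngl by (rule negligible_subset[rotated])
  have "open ?N"
  proof -
    have "continuous_on \<Omega> (\<lambda>x. u x - \<phi> x)" by (intro continuous_intros cu' C1_gradD(3)[OF \<phi>])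
    from continuous_open_preimage[OF this \<Omega>(1) open_greaterThan[of d]] show ?thesis by (simp add: vimage_def Int_def)
  qed
  moreover have "y1 \<in> ?N"
  proof -
    have r: "r0 \<le> dist x0 y1"
    proof (rule ccontr)
      assume "\<not> r0 \<le> dist x0 y1"
      then have "u y1 < ?\<alpha> + d" by (intro r0(3)) simp
      moreover have "b * dist x0 y1 powr \<beta> \<ge> 0" using b by simp
      ultimately show False using uy1 d by linarith
    qed
    have "\<sigma> y1 \<le> R\<^sup>2" unfolding \<sigma> using y1 by (intro power_mono) auto
    then have "sqp (\<sigma> y1 - R\<^sup>2) = 0" by (simp add: sqp_def)
    then show ?thesis using \<phi>r[OF r] uy1 d y1 R(2) by auto
  qed
  ultimately show False using nN open_not_negligible by blast
qed

text \<open>The critical exponent is reached as a limit of smaller ones, for which the comparison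
  function is a strict supersolution.\<close>

theorem p_minimizer_comparison:
  fixes u :: "'a::euclidean_space \<Rightarrow> real"
  assumes \<Omega>: "open \<Omega>" "bounded \<Omega>" and p: "p > real DIM('a)" and u: "p_minimizer \<Omega> p u G"
    and R: "R > 0" "cball x0 R \<subseteq> \<Omega>" and M: "\<And>y. y \<in> cball x0 R \<Longrightarrow> u y \<le> M" and y: "y \<in> cball x0 R"
  shows "u y \<le> u x0 + (M - u x0) * (dist x0 y / R) powr ((p - real DIM('a)) / (p - 1))"
proof (cases "dist x0 y = 0")
  case True
  then show ?thesis using M[of x0] R(1) by simp
next
  case False
  then have pos: "dist x0 y / R > 0" using R(1) by simp
  have D1: "real DIM('a) \<ge> 1" by (simp add: DIM_ge_Suc0)
  with p have p1: "p > 1" by linarith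
  let ?\<beta> = "(p - real DIM('a)) / (p - 1)"
  have \<beta>: "0 < ?\<beta>" "?\<beta> \<le> 1"
  proof -
    have "p - real DIM('a) > 0" "p - 1 > 0" "p - real DIM('a) \<le> p - 1" using p p1 D1 by linarith+
    then show "0 < ?\<beta>" "?\<beta> \<le> 1" by (simp_all only: divide_pos_pos divide_le_eq_1_pos)
  qed
  \<comment> \<open>The exponent is lowered for strictness, and \<open>M\<close> is raised so that
    the coefficient \<open>b\<close> is positive even if \<open>M = u x0\<close>. The denominator
    \<open>n + 2\<close> keeps the exponent positive at \<open>n = 0\<close>.\<close>
  define X where "X n = u x0 + (M - u x0 + 1 / real (Suc n)) * (dist x0 y / R) powr (?\<beta> * (1 - 1 / real (n + 2)))" for n
  have lim: "(\<lambda>n. 1 / real (Suc n)) \<longlonglongrightarrow> 0" "(\<lambda>n. 1 / real (n + 2)) \<longlonglongrightarrow> 0" by real_asymp+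
  have "X \<longlonglongrightarrow> u x0 + (M - u x0 + 0) * (dist x0 y / R) powr (?\<beta> * (1 - 0))"
    unfolding X_def using pos by (intro tendsto_intros lim) auto
  then have lX: "X \<longlonglongrightarrow> u x0 + (M - u x0) * (dist x0 y / R) powr ?\<beta>" by simp
  have "u y \<le> X n" for n
  proof -
    let ?b = "?\<beta> * (1 - 1 / real (n + 2))"
    define b where "b = (M - u x0 + 1 / real (Suc n)) / R powr ?b"
    have "M - u x0 \<ge> 0" using M[of x0] R(1) by simp
    then have b: "b > 0" "b * R powr ?b = M - u x0 + 1 / real (Suc n)" unfolding b_def using R(1) by (auto simp: add_nonneg_pos)
    have n1: "0 < 1 - 1 / real (n + 2)" "1 - 1 / real (n + 2) < 1" by auto
    have b1: "0 < ?b" "?b < ?\<beta>" using mult_pos_pos[OF \<beta>(1) n1(1)] mult_strict_left_mono[OF n1(2) \<beta>(1)] by simp_all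
    have "real DIM('a) - 1 = (1 - ?\<beta>) * (p - 1)" using p1 by (simp add: field_simps)
    also have "\<dots> < (1 - ?b) * (p - 1)" using b1(2) p1 by (intro mult_strict_right_mono) auto
    finally have strict: "real DIM('a) - 1 < (1 - ?b) * (p - 1)" .
    have "u y \<le> u x0 + b * dist x0 y powr ?b"
    proof (rule p_minimizer_strict_comparison[OF \<Omega> p1 u R b(1) b1(1) _ strict _ y])
      show "?b \<le> 1" using b1 \<beta> by linarith
      fix z assume "dist x0 z = R"
      then have "u z \<le> M" by (intro M) auto
      moreover have "1 / real (Suc n) \<ge> 0" by simp
      ultimately show "u z \<le> u x0 + b * R powr ?b" unfolding b(2) by linarith
    qed
    also have "b * dist x0 y powr ?b = (M - u x0 + 1 / real (Suc n)) * (dist x0 y / R) powr ?b"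
      using R(1) False by (simp add: b_def powr_divide)
    finally show ?thesis by (simp add: X_def)
  qed
  then show ?thesis by (intro LIMSEQ_le_const[OF lX]) auto
qed

subsection \<open>Comparison with cones for infinity-harmonic functions\<close>

definition quad :: "'a::euclidean_space \<Rightarrow> 'a \<Rightarrow> real \<Rightarrow> real \<Rightarrow> real \<Rightarrow> real \<Rightarrow> 'a \<Rightarrow> real" where
  "quad e z A B C D y = A + B * ((y - z) \<bullet> e) + C * (((y - z) \<bullet> e) * ((y - z) \<bullet> e)) + D * ((y - z) \<bullet> (y - z))"

lemma Ck_on_quad: "Ck_on k UNIV (quad e z A B C D)"
  unfolding quad_def[abs_def] by (intro Ck_on_add Ck_on_mult Ck_on_const Ck_on_inner Ck_on_norm_sq)

lemma gradient_quad: "gradient (quad e z A B C D) = (\<lambda>y. (B + 2 * C * ((y - z) \<bullet> e)) *\<^sub>R e + (2 * D) *\<^sub>R (y - z))"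
proof -
  have "C1_grad (\<lambda>y. A + B * ((y - z) \<bullet> e) + C * (((y - z) \<bullet> e) * ((y - z) \<bullet> e)) + D * ((y - z) \<bullet> (y - z)))
     (\<lambda>y. 0 + (B *\<^sub>R e + ((y - z) \<bullet> e) *\<^sub>R 0)
         + (C *\<^sub>R (((y - z) \<bullet> e) *\<^sub>R e + ((y - z) \<bullet> e) *\<^sub>R e) + (((y - z) \<bullet> e) * ((y - z) \<bullet> e)) *\<^sub>R 0)
         + (D *\<^sub>R (2 *\<^sub>R (y - z)) + ((y - z) \<bullet> (y - z)) *\<^sub>R 0))"
    by (intro C1_grad_add C1_grad_mult C1_grad_const C1_grad_inner C1_grad_norm_sq)
  note eq = C1_gradD(2)[OF this]
  have two: "t *\<^sub>R e + t *\<^sub>R e = (2 * t) *\<^sub>R e" for t by (simp flip: scaleR_add_left)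
  have "0 + (B *\<^sub>R e + t *\<^sub>R 0) + (C *\<^sub>R (t *\<^sub>R e + t *\<^sub>R e) + (t * t) *\<^sub>R 0) + (D *\<^sub>R (2 *\<^sub>R w) + c *\<^sub>R 0)
      = (B + 2 * C * t) *\<^sub>R e + (2 * D) *\<^sub>R w" for t w c
    unfolding two by (simp add: scaleR_add_left mult_ac)
  then show ?thesis unfolding quad_def[abs_def] eq by simp
qed

lemma inf_laplacian_quad:
  assumes "norm e = 1" "x - z = r *\<^sub>R e"
  shows "inf_laplacian (quad e z A B C D) x = (B + 2 * C * r + 2 * D * r)\<^sup>2 * (2 * C + 2 * D)"
proof -
  let ?m = "B + 2 * C * r + 2 * D * r"
  have ee: "e \<bullet> e = 1" using assms(1) by (simp add: dot_square_norm)
  have g: "gradient (quad e z A B C D) x = ?m *\<^sub>R e"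
    unfolding gradient_quad assms(2) using ee by (simp add: algebra_simps)
  have "((\<lambda>y. (B + 2 * C * ((y - z) \<bullet> e)) *\<^sub>R e + (2 * D) *\<^sub>R (y - z)) has_derivative
     (\<lambda>h. (2 * C * (h \<bullet> e)) *\<^sub>R e + (2 * D) *\<^sub>R h)) (at x)"
    by (auto intro!: derivative_eq_intros)
  from frechet_derivative_at[OF this]
  have "frechet_derivative (gradient (quad e z A B C D)) (at x) = (\<lambda>h. (2 * C * (h \<bullet> e)) *\<^sub>R e + (2 * D) *\<^sub>R h)"
    unfolding gradient_quad by simp
  then show ?thesis unfolding inf_laplacian_def g using ee
    by (simp add: inner_add_right power2_eq_square algebra_simps)
qed

text \<open>The viscosity condition restricted to the functions \<open>quad\<close>, tested on the
  line through \<open>z\<close> with direction \<open>e\<close>; the final expression is their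
  infinity-Laplacian there. The class is closed under negation, so subsolutions and negated
  supersolutions fall under the same notion.\<close>

definition quad_subsolution :: "'a::euclidean_space set \<Rightarrow> ('a \<Rightarrow> real) \<Rightarrow> bool" where
  "quad_subsolution \<Omega> u \<longleftrightarrow>
     (\<forall>e z A B C D r x. x \<in> \<Omega> \<and> norm e = 1 \<and> x - z = r *\<^sub>R e \<and>
        (\<forall>\<^sub>F y in nhds x. u y - quad e z A B C D y \<le> u x - quad e z A B C D x)
       \<longrightarrow> (B + 2 * C * r + 2 * D * r)\<^sup>2 * (2 * C + 2 * D) \<ge> 0)"

lemma viscosity_subsolution_imp_quad:
  assumes "viscosity_subsolution \<Omega> u" shows "quad_subsolution \<Omega> u"
  unfolding quad_subsolution_def
proof (intro allI impI)
  fix e z :: 'a and A B C D r x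
  assume a: "x \<in> \<Omega> \<and> norm e = 1 \<and> x - z = r *\<^sub>R e \<and>
        (\<forall>\<^sub>F y in nhds x. u y - quad e z A B C D y \<le> u x - quad e z A B C D x)"
  have "Ck_on 2 \<Omega> (quad e z A B C D)" by (rule Ck_on_subset[OF Ck_on_quad]) simp
  then have "inf_laplacian (quad e z A B C D) x \<ge> 0" using assms a unfolding viscosity_subsolution_def by blast
  moreover have "inf_laplacian (quad e z A B C D) x = (B + 2 * C * r + 2 * D * r)\<^sup>2 * (2 * C + 2 * D)"
    using a by (intro inf_laplacian_quad) auto
  ultimately show "(B + 2 * C * r + 2 * D * r)\<^sup>2 * (2 * C + 2 * D) \<ge> 0" by simp
qed

lemma viscosity_supersolution_imp_quad:
  assumes "viscosity_supersolution \<Omega> u" shows "quad_subsolution \<Omega> (\<lambda>x. - u x)"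
  unfolding quad_subsolution_def
proof (intro allI impI)
  fix e z :: 'a and A B C D r x
  assume a: "x \<in> \<Omega> \<and> norm e = 1 \<and> x - z = r *\<^sub>R e \<and>
        (\<forall>\<^sub>F y in nhds x. - u y - quad e z A B C D y \<le> - u x - quad e z A B C D x)"
  have q: "quad e z (- A) (- B) (- C) (- D) y = - quad e z A B C D y" for y by (simp add: quad_def)
  have "Ck_on 2 \<Omega> (quad e z (- A) (- B) (- C) (- D))" by (rule Ck_on_subset[OF Ck_on_quad]) simp
  moreover have "\<forall>\<^sub>F y in nhds x. u y - quad e z (- A) (- B) (- C) (- D) y \<ge> u x - quad e z (- A) (- B) (- C) (- D) x"
    using conjunct2[OF conjunct2[OF conjunct2[OF a]]] unfolding q by eventually_elim simp
  ultimately have "inf_laplacian (quad e z (- A) (- B) (- C) (- D)) x \<le> 0"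
    using assms a unfolding viscosity_supersolution_def by blast
  moreover have "inf_laplacian (quad e z (- A) (- B) (- C) (- D)) x
      = (- B + 2 * (- C) * r + 2 * (- D) * r)\<^sup>2 * (2 * (- C) + 2 * (- D))"
    using a by (intro inf_laplacian_quad) auto
  ultimately have "(- B + 2 * (- C) * r + 2 * (- D) * r)\<^sup>2 * (2 * (- C) + 2 * (- D)) \<le> 0" by simp
  moreover have "(- B + 2 * (- C) * r + 2 * (- D) * r)\<^sup>2 * (2 * (- C) + 2 * (- D)) = - ((B + 2 * C * r + 2 * D * r)\<^sup>2 * (2 * C + 2 * D))"
    by (simp add: power2_eq_square algebra_simps)
  ultimately show "(B + 2 * C * r + 2 * D * r)\<^sup>2 * (2 * C + 2 * D) \<ge> 0" by linarith
qed

text \<open>The cone, bent down by \<open>- c |y|\<^sup>2\<close>, is dominated near a contact point by a quadratic polynomial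
  touching it there, whose infinity-Laplacian is negative.\<close>

lemma cone_comparison:
  fixes u :: "'a::euclidean_space \<Rightarrow> real"
  assumes u: "quad_subsolution \<Omega> u" and V: "open V" "bounded V" "V \<subseteq> \<Omega>" "z \<notin> V"
    and cu: "continuous_on (closure V) u" and b: "b > 0"
    and fr: "\<And>x. x \<in> frontier V \<Longrightarrow> u x \<le> a + b * dist z x" and x1: "x1 \<in> V"
  shows "u x1 \<le> a + b * dist z x1"
proof (rule ccontr)
  assume "\<not> u x1 \<le> a + b * dist z x1"
  then have pos: "0 < u x1 - (a + b * dist z x1)" by simp
  obtain \<eta> where \<eta>: "\<eta> > 0" "u x1 > a + b * dist z x1 + \<eta>"
    by (rule that[of "(u x1 - (a + b * dist z x1)) / 2"]) (use pos in \<open>simp_all add: field_simps\<close>)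
  obtain Dm where Dm: "Dm > 0" "\<And>x. x \<in> closure V \<Longrightarrow> dist z x \<le> Dm"
  proof -
    obtain D where D: "\<forall>x\<in>closure V. dist z x \<le> D" using bounded_closure[OF V(2)] bounded_any_center by blast
    show thesis
    proof (rule that[of "\<bar>D\<bar> + 1"])
      fix x assume "x \<in> closure V"
      then have "dist z x \<le> D" using D by blast
      then show "dist z x \<le> \<bar>D\<bar> + 1" by linarith
    qed simp
  qed
  \<comment> \<open>The first bound lets the bending use up at most half of the excess
    \<open>\<eta>\<close>, so the maximum cannot sit on the frontier. The second keeps the radial
    slope \<open>b - 2 * c * r\<close> positive throughout the closure of \<open>V\<close>.\<close>
  define c where "c = min (\<eta> / (2 * Dm\<^sup>2)) (b / (4 * Dm))"
  have c: "c > 0" using \<eta> Dm b by (simp add: c_def)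
  have c1: "c * Dm\<^sup>2 < \<eta>"
  proof -
    have "c * Dm\<^sup>2 \<le> \<eta> / (2 * Dm\<^sup>2) * Dm\<^sup>2" unfolding c_def by (intro mult_right_mono) auto
    also have "\<dots> < \<eta>" using \<eta> Dm by simp
    finally show ?thesis .
  qed
  have c2: "2 * c * Dm < b"
  proof -
    have "2 * c * Dm \<le> 2 * (b / (4 * Dm)) * Dm" unfolding c_def using Dm by (intro mult_right_mono mult_left_mono) auto
    also have "\<dots> < b" using b Dm by simp
    finally show ?thesis .
  qed
  define \<phi> where "\<phi> x = a + b * dist z x - c * (dist z x)\<^sup>2" for x
  have cV: "compact (closure V)" using V(2) by simp
  have "continuous_on (closure V) (\<lambda>x. u x - \<phi> x)" unfolding \<phi>_def by (intro continuous_intros cu)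
  moreover have "closure V \<noteq> {}" using x1 closure_subset by blast
  ultimately obtain xh where xh: "xh \<in> closure V" "\<And>y. y \<in> closure V \<Longrightarrow> u y - \<phi> y \<le> u xh - \<phi> xh"
    using continuous_attains_sup[OF cV] by blast
  have "\<phi> x1 \<le> a + b * dist z x1" unfolding \<phi>_def using c by simp
  then have big: "u xh - \<phi> xh > \<eta>" using xh(2)[of x1] x1 closure_subset \<eta>(2) by force
  have "xh \<notin> frontier V"
  proof
    assume f: "xh \<in> frontier V"
    have "c * (dist z xh)\<^sup>2 \<le> c * Dm\<^sup>2" using Dm(2)[OF xh(1)] c by (intro mult_left_mono power_mono) auto
    then show False using fr[OF f] big c1 by (simp add: \<phi>_def)
  qed
  then have xV: "xh \<in> V" using xh(1) V(1) by (simp add: frontier_def interior_open)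
  define r where "r = dist z xh"
  have r: "r > 0" using xV V(4) by (auto simp: r_def)
  define e where "e = (1 / r) *\<^sub>R (xh - z)"
  have e: "norm e = 1" "xh - z = r *\<^sub>R e" using r by (auto simp: e_def r_def dist_norm norm_minus_commute)
  \<comment> \<open>With \<open>q = (y - z) \<bullet> e\<close> and \<open>n = dist z y\<close>, it
    replaces the distance \<open>n\<close> in the bent cone by
    \<open>q + (n\<^sup>2 - q\<^sup>2) / r\<close>. This is an upper bound as long as
    \<open>q > r / 2\<close>, with equality on the ray, and the second derivative along
    \<open>e\<close> is just \<open>- 2 * c\<close>.\<close>
  let ?Q = "quad e z a b (- b / r) (b / r - c)"
  have ee: "e \<bullet> e = 1" using e(1) by (simp add: dot_square_norm)
  have Qx: "?Q xh = \<phi> xh"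
  proof -
    have "?Q xh = a + b * r + (- b / r) * (r * r) + (b / r - c) * (r * r)" unfolding quad_def e(2) using ee by simp
    also have "\<dots> = \<phi> xh" using r by (simp add: \<phi>_def r_def[symmetric] power2_eq_square field_simps)
    finally show ?thesis .
  qed
  have Qy: "\<phi> y \<le> ?Q y" if "(y - z) \<bullet> e > r / 2" for y
  proof -
    define q where "q = (y - z) \<bullet> e"
    define n where "n = dist z y"
    have q: "q > r / 2" "q > 0" using that r by (auto simp: q_def)
    have nn: "(y - z) \<bullet> (y - z) = n\<^sup>2" by (simp add: n_def dot_square_norm dist_norm norm_minus_commute)
    have "\<bar>q\<bar> \<le> norm (y - z) * norm e" unfolding q_def by (rule Cauchy_Schwarz_ineq2)
    then have qn: "q \<le> n" using e(1) by (simp add: n_def dist_norm norm_minus_commute)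
    have "0 \<le> (n - q)\<^sup>2" by simp
    then have "n * (2 * q) \<le> q * (2 * q) + (n\<^sup>2 - q\<^sup>2)" by (simp add: power2_eq_square algebra_simps)
    then have "n \<le> q + (n\<^sup>2 - q\<^sup>2) / (2 * q)" using q by (simp add: field_simps)
    also have "(n\<^sup>2 - q\<^sup>2) / (2 * q) \<le> (n\<^sup>2 - q\<^sup>2) / r"
      using q r qn by (intro divide_left_mono) (auto simp: power_mono)
    finally have "b * n \<le> b * (q + (n\<^sup>2 - q\<^sup>2) / r)" using b by (intro mult_left_mono) auto
    moreover have "?Q y = a + b * (q + (n\<^sup>2 - q\<^sup>2) / r) - c * n\<^sup>2"
      unfolding quad_def q_def[symmetric] nn
      by (simp add: power2_eq_square algebra_simps diff_divide_distrib)
    ultimately show ?thesis by (simp add: \<phi>_def n_def)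
  qed
  have "\<forall>\<^sub>F y in nhds xh. y \<in> V" using V(1) xV by (rule eventually_nhds_in_open)
  moreover have "\<forall>\<^sub>F y in nhds xh. y \<in> {y. r / 2 < (y - z) \<bullet> e}"
  proof (rule eventually_nhds_in_open)
    show "open {y. r / 2 < (y - z) \<bullet> e}" by (intro open_Collect_less continuous_intros)
    show "xh \<in> {y. r / 2 < (y - z) \<bullet> e}" using e r ee by simp
  qed
  ultimately have "\<forall>\<^sub>F y in nhds xh. u y - ?Q y \<le> u xh - ?Q xh"
  proof eventually_elim
    case (elim y)
    then have "y \<in> closure V" using closure_subset by blast
    then have "u y - \<phi> y \<le> u xh - \<phi> xh" by (rule xh(2))
    then show ?case using Qy[of y] elim(2) Qx by simp
  qed
  then have h0: "0 \<le> (b + 2 * (- b / r) * r + 2 * (b / r - c) * r)\<^sup>2 * (2 * (- b / r) + 2 * (b / r - c))"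
    using u xV V(3) e unfolding quad_subsolution_def by blast
  have h1: "b + 2 * (- b / r) * r + 2 * (b / r - c) * r = b - 2 * c * r" using r by (simp add: field_simps)
  have h2: "2 * (- b / r) + 2 * (b / r - c) = - (2 * c)" by simp
  have "0 \<le> (b - 2 * c * r)\<^sup>2 * (- (2 * c))" using h0 unfolding h1 h2 .
  moreover have "b - 2 * c * r > 0"
  proof -
    have "2 * c * r \<le> 2 * c * Dm" using Dm(2)[OF xh(1)] c by (intro mult_left_mono) (auto simp: r_def)
    then show ?thesis using c2 by linarith
  qed
  ultimately show False using c by (simp add: mult_le_0_iff zero_le_mult_iff)
qed

text \<open>All that the discrete argument needs from either equation: exponent
  \<open>(p - d) / (p - 1)\<close> for p-minimizers, with \<open>d\<close> the dimension, and
  exponent 1 for infinity-harmonic functions and their negatives.\<close>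

definition cone_above :: "real \<Rightarrow> 'a::euclidean_space set \<Rightarrow> ('a \<Rightarrow> real) \<Rightarrow> bool" where
  "cone_above \<beta> \<Omega> u \<longleftrightarrow> (\<forall>x R M y. R > 0 \<longrightarrow> cball x R \<subseteq> \<Omega> \<longrightarrow> (\<forall>y\<in>cball x R. u y \<le> M) \<longrightarrow> y \<in> cball x R \<longrightarrow>
     u y \<le> u x + (M - u x) * (dist x y / R) powr \<beta>)"

lemma quad_subsolution_cone_above:
  assumes u: "quad_subsolution \<Omega> u" and cu: "continuous_on \<Omega> u"
  shows "cone_above 1 \<Omega> u"
  unfolding cone_above_def
proof (intro allI impI)
  fix x y :: 'a and R M :: real
  assume R: "R > 0" "cball x R \<subseteq> \<Omega>" and M: "\<forall>y\<in>cball x R. u y \<le> M" and y: "y \<in> cball x R"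
  have Mx: "M \<ge> u x" using M R(1) by simp
  have "u y \<le> u x + (M - u x) * (dist x y / R) + \<epsilon>" if \<epsilon>: "\<epsilon> > 0" for \<epsilon>
  proof -
    \<comment> \<open>Comparison with cones asks for a positive slope, which could fail for
      \<open>M = u x\<close>; the extra \<open>\<epsilon>\<close> is removed at the end.\<close>
    define b where "b = (M - u x) / R + \<epsilon> / R"
    have b: "b > 0" "b * R = M - u x + \<epsilon>" using Mx R(1) \<epsilon> by (auto simp: b_def add_nonneg_pos field_simps)
    have "u y \<le> u x + b * dist x y"
    proof (cases "y \<in> ball x R - {x}")
      case True
      show ?thesis
      proof (rule cone_comparison[OF u _ _ _ _ _ b(1) _ True])
        have cl: "closure (ball x R - {x}) \<subseteq> cball x R"
          by (rule closure_minimal) auto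
        then show "continuous_on (closure (ball x R - {x})) u" using cu R(2) continuous_on_subset by blast
        show "ball x R - {x} \<subseteq> \<Omega>" using R(2) ball_subset_cball[of x R] by blast
        show "bounded (ball x R - {x})" by (rule bounded_subset[OF bounded_ball]) auto
        fix w assume w: "w \<in> frontier (ball x R - {x})"
        then have "w \<in> cball x R" using cl by (auto simp: frontier_def)
        moreover have "w \<notin> ball x R - {x}" using w by (simp add: frontier_def interior_open open_Diff)
        ultimately consider "w = x" | "dist x w = R" by force
        then show "u w \<le> u x + b * dist x w"
        proof cases
          case 2
          have "u w \<le> M" using M \<open>w \<in> cball x R\<close> by blast
          then show ?thesis using 2 b(2) \<epsilon> by simp
        qed simp
      qed auto
    next
      case False
      then consider "y = x" | "dist x y = R" using y by force
      then show ?thesis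
      proof cases
        case 2
        have "u y \<le> M" using M y by blast
        then show ?thesis using 2 b(2) \<epsilon> by simp
      qed simp
    qed
    also have "b * dist x y = (M - u x) * (dist x y / R) + \<epsilon> * (dist x y / R)"
      using R(1) by (simp add: b_def algebra_simps add_divide_distrib diff_divide_distrib)
    also have "\<epsilon> * (dist x y / R) \<le> \<epsilon> * 1" using y R(1) \<epsilon> by (intro mult_left_mono) auto
    finally show ?thesis by simp
  qed
  then have "u y \<le> u x + (M - u x) * (dist x y / R)" by (rule field_le_epsilon)
  moreover have "(dist x y / R) powr 1 = dist x y / R" using R(1) by (intro powr_one) auto
  ultimately show "u y \<le> u x + (M - u x) * (dist x y / R) powr 1" by (simp only:)
qed

section \<open>Lipschitz bounds and lower slope bounds obtained from cones\<close>

lemma frontier_Diff_point: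
  fixes \<Omega> :: "'a::euclidean_space set"
  assumes "open \<Omega>" shows "frontier (\<Omega> - {x}) \<subseteq> frontier \<Omega> \<union> {x}"
proof
  fix y assume y: "y \<in> frontier (\<Omega> - {x})"
  then have "y \<in> closure \<Omega>" using closure_mono[of "\<Omega> - {x}" \<Omega>] by (auto simp: frontier_def)
  moreover have "y \<notin> \<Omega> - {x}" using y assms by (simp add: frontier_def interior_open open_Diff)
  ultimately show "y \<in> frontier \<Omega> \<union> {x}" using assms by (auto simp: frontier_def interior_open)
qed

lemma quad_subsolution_boundary_cone:
  assumes \<Omega>: "open \<Omega>" "bounded \<Omega>" and u: "quad_subsolution \<Omega> u" "continuous_on (closure \<Omega>) u"
    and K: "K > 0" "\<And>x y. x \<in> frontier \<Omega> \<Longrightarrow> y \<in> frontier \<Omega> \<Longrightarrow> u x \<le> u y + K * dist y x"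
    and z: "z \<in> frontier \<Omega>" and x: "x \<in> closure \<Omega>"
  shows "u x \<le> u z + K * dist z x"
proof (cases "x \<in> \<Omega>")
  case True
  have "z \<notin> \<Omega>" using z \<Omega>(1) by (simp add: frontier_def interior_open)
  then show ?thesis by (intro cone_comparison[OF u(1) \<Omega> order_refl _ u(2) K(1) _ True] K(2) z)
next
  case False
  then show ?thesis using x z \<Omega>(1) by (intro K(2)) (simp_all add: frontier_def interior_open)
qed

text \<open>Cones with vertex on the frontier carry the Lipschitz bound of the data to pairs with
  one frontier point; cones with an interior vertex \<open>x\<close>, on \<Omega> without
  \<open>x\<close>, then treat pairs of interior points. The distance is Euclidean although segments
  may leave \<Omega>, so the norm in the constants is finite.\<close>

lemma inf_laplace_Lipschitz:
  assumes \<Omega>: "open \<Omega>" "bounded \<Omega>" and u: "solves_inf_laplace \<Omega> g u" and L: "L-lipschitz_on (frontier \<Omega>) g"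
  obtains K where "K > 0" "\<And>x y. x \<in> closure \<Omega> \<Longrightarrow> y \<in> closure \<Omega> \<Longrightarrow> \<bar>u x - u y\<bar> \<le> K * dist x y"
proof -
  define K where "K = L + 1"
  have K: "K > 0" using lipschitz_on_nonneg[OF L] by (simp add: K_def)
  have cu: "continuous_on (closure \<Omega>) u" and bu: "\<And>x. x \<in> frontier \<Omega> \<Longrightarrow> u x = g x" and
    qu: "quad_subsolution \<Omega> u" "quad_subsolution \<Omega> (\<lambda>x. - u x)"
    using u by (auto simp: solves_inf_laplace_def intro: viscosity_subsolution_imp_quad viscosity_supersolution_imp_quad)
  have cu': "continuous_on (closure \<Omega>) (\<lambda>x. - u x)" using cu by (rule continuous_on_minus)
  have gL: "\<bar>g x - g y\<bar> \<le> K * dist x y" if "x \<in> frontier \<Omega>" "y \<in> frontier \<Omega>" for x y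
  proof -
    have "\<bar>g x - g y\<bar> \<le> L * dist x y" using lipschitz_onD[OF L that] by (simp add: dist_real_def)
    also have "\<dots> \<le> K * dist x y" by (intro mult_right_mono) (auto simp: K_def)
    finally show ?thesis .
  qed
  have f1: "u x \<le> u z + K * dist z x" if z: "z \<in> frontier \<Omega>" and x: "x \<in> closure \<Omega>" for x z
    by (rule quad_subsolution_boundary_cone[OF \<Omega> qu(1) cu K _ z x])
       (use gL in \<open>force simp: bu abs_le_iff dist_commute\<close>)
  have f2: "- u x \<le> - u z + K * dist z x" if z: "z \<in> frontier \<Omega>" and x: "x \<in> closure \<Omega>" for x z
    by (rule quad_subsolution_boundary_cone[OF \<Omega> qu(2) cu' K _ z x])
       (use gL in \<open>force simp: bu abs_le_iff dist_commute\<close>)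
  have le: "u y \<le> u x + K * dist x y" if x: "x \<in> closure \<Omega>" and y: "y \<in> closure \<Omega>" for x y
  proof -
    consider "x \<in> frontier \<Omega>" | "y \<in> frontier \<Omega>" | "x = y" | "x \<in> \<Omega>" "y \<in> \<Omega>" "x \<noteq> y"
      using x y \<Omega>(1) by (auto simp: frontier_def interior_open)
    then show ?thesis
    proof cases
      case 1 then show ?thesis using f1 y by blast
    next
      case 2 then show ?thesis using f2[OF 2 x] by (simp add: dist_commute)
    next
      case 3 then show ?thesis by simp
    next
      case 4
      show ?thesis
      proof (rule cone_comparison[OF qu(1), where V="\<Omega> - {x}"])
        show "open (\<Omega> - {x})" using \<Omega>(1) by (simp add: open_Diff)
        show "bounded (\<Omega> - {x})" using \<Omega>(2) by (rule bounded_subset) auto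
        show "continuous_on (closure (\<Omega> - {x})) u" using cu by (rule continuous_on_subset) (intro closure_mono, auto)
        fix w assume "w \<in> frontier (\<Omega> - {x})"
        then have "w \<in> frontier \<Omega> \<union> {x}" using frontier_Diff_point[OF \<Omega>(1)] by blast
        then show "u w \<le> u x + K * dist x w" using f2[of w x] x by (auto simp: dist_commute)
      qed (use 4 K in auto)
    qed
  qed
  show ?thesis
  proof (rule that[OF K])
    fix x y assume "x \<in> closure \<Omega>" "y \<in> closure \<Omega>"
    then show "\<bar>u x - u y\<bar> \<le> K * dist x y" using le[of x y] le[of y x] by (simp add: abs_le_iff dist_commute)
  qed
qed

lemma cball_translate:
  fixes x :: "'a::euclidean_space"
  assumes "y \<in> cball x R" shows "y + (x' - x) \<in> cball x' R"
  using assms by (simp add: dist_norm algebra_simps)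

text \<open>A slope below \<open>\<gamma>\<close> at \<open>x\<close> persists nearby and makes \<open>u\<close> Lipschitz with a constant below \<open>\<gamma>\<close> there.\<close>

lemma ess_inf_gradient_slope:
  fixes u :: "'a::euclidean_space \<Rightarrow> real"
  assumes \<Omega>: "open \<Omega>" and cu: "continuous_on \<Omega> u" and cone: "cone_above 1 \<Omega> (\<lambda>x. - u x)"
    and G: "has_weak_gradient \<Omega> u G" "AE x in lebesgue_on \<Omega>. norm (G x) \<ge> \<gamma>"
    and \<epsilon>: "\<epsilon> > 0" "cball x \<epsilon> \<subseteq> \<Omega>"
  shows "\<exists>z\<in>cball x \<epsilon>. u x - u z \<ge> \<gamma> * \<epsilon>"
proof (rule ccontr)
  assume neg: "\<not> (\<exists>z\<in>cball x \<epsilon>. u x - u z \<ge> \<gamma> * \<epsilon>)"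
  obtain z where z: "z \<in> cball x \<epsilon>" "\<And>y. y \<in> cball x \<epsilon> \<Longrightarrow> u z \<le> u y"
    using continuous_attains_inf[OF compact_cball _ continuous_on_subset[OF cu \<epsilon>(2)]] \<epsilon>(1) by auto
  have lt: "u x - u z < \<gamma> * \<epsilon>" using neg z(1) by (force simp: not_le)
  \<comment> \<open>A quarter of the gap. One \<open>\<kappa>\<close> pays for moving the centre and
    one for moving the ball over which the minimum is taken; the remaining two keep
    \<open>\<gamma>'\<close> strictly below \<open>\<gamma>\<close>.\<close>
  define \<kappa> where "\<kappa> = (\<gamma> * \<epsilon> - (u x - u z)) / 4"
  have \<kappa>: "\<kappa> > 0" using lt by (simp add: \<kappa>_def)
  define \<gamma>' where "\<gamma>' = (u x - u z + 2 * \<kappa>) / \<epsilon>"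
  have \<gamma>': "\<gamma>' < \<gamma>" "\<gamma>' * \<epsilon> = u x - u z + 2 * \<kappa>" using \<kappa> \<epsilon>(1) by (auto simp: \<gamma>'_def \<kappa>_def field_simps)
  obtain s0 where s0: "s0 > 0" "cball x (\<epsilon> + s0) \<subseteq> \<Omega>" using cball_enlarge[OF \<Omega> \<epsilon>(2)] \<epsilon>(1) by (auto intro: less_imp_le)
  have "uniformly_continuous_on (cball x (\<epsilon> + s0)) u"
    by (intro compact_uniformly_continuous continuous_on_subset[OF cu s0(2)]) auto
  then obtain e where e: "e > 0" "\<And>y y'. y \<in> cball x (\<epsilon> + s0) \<Longrightarrow> y' \<in> cball x (\<epsilon> + s0) \<Longrightarrow> dist y' y < e \<Longrightarrow> dist (u y') (u y) < \<kappa>"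
    unfolding uniformly_continuous_on_def using \<kappa> by blast
  \<comment> \<open>Any two points of \<open>cball x (3 * s)\<close> are within
    \<open>\<epsilon>\<close> of each other, and an \<epsilon>-ball about such a point is a
    translate of the one about \<open>x\<close> by less than the continuity radius
    \<open>e\<close>.\<close>
  define s where "s = min (min s0 (e / 2)) (\<epsilon> / 2) / 3"
  have s: "s > 0" "3 * s \<le> s0" "3 * s < e" "6 * s \<le> \<epsilon>" using s0 e \<epsilon> by (auto simp: s_def)
  have sub: "cball y \<epsilon> \<subseteq> cball x (\<epsilon> + s0)" if "y \<in> cball x (3 * s)" for y
  proof
    fix v assume "v \<in> cball y \<epsilon>"
    then show "v \<in> cball x (\<epsilon> + s0)" using that dist_triangle[of x v y] s by auto
  qed
  have lip: "u y - u y' \<le> \<gamma>' * norm (y - y')" if y: "y \<in> cball x (3 * s)" "y' \<in> cball x (3 * s)" for y y'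
  proof -
    have yy: "dist y y' \<le> \<epsilon>" using y dist_triangle2[of y y' x] s(4) by (auto simp: dist_commute)
    have yin: "y \<in> cball x (\<epsilon> + s0)" using subsetD[OF sub[OF y(1)], of y] \<epsilon>(1) by simp
    have M: "- u v \<le> - (u z - \<kappa>)" if v: "v \<in> cball y \<epsilon>" for v
    proof -
      have "v + (x - y) \<in> cball x \<epsilon>" by (rule cball_translate[OF v])
      moreover from this have "v + (x - y) \<in> cball x (\<epsilon> + s0)" using s0(1) by auto
      moreover have "dist (v + (x - y)) v < e" using y(1) s(3) by (simp add: dist_norm)
      ultimately have "u z \<le> u (v + (x - y))" "dist (u (v + (x - y))) (u v) < \<kappa>"
        using z(2) e(2) sub[OF y(1)] v by blast+
      then show ?thesis by (simp add: dist_real_def abs_less_iff)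
    qed
    have "x \<in> cball x (\<epsilon> + s0)" using \<epsilon>(1) s0(1) by simp
    then have "dist (u x) (u y) < \<kappa>" using e(2)[OF yin, of x] y(1) s(3) by simp
    then have uy: "u y - (u z - \<kappa>) \<le> \<gamma>' * \<epsilon>" using \<gamma>'(2) by (simp add: dist_real_def abs_less_iff)
    have "- u y' \<le> - u y + (- (u z - \<kappa>) - (- u y)) * (dist y y' / \<epsilon>) powr 1"
      using cone[unfolded cone_above_def, rule_format, of \<epsilon> y "- (u z - \<kappa>)" y'] \<epsilon>(1) sub[OF y(1)] s0(2) M yy by auto
    also have "(dist y y' / \<epsilon>) powr 1 = dist y y' / \<epsilon>" using \<epsilon>(1) by (intro powr_one) auto
    also have "(- (u z - \<kappa>) - (- u y)) * (dist y y' / \<epsilon>) \<le> (\<gamma>' * \<epsilon>) * (dist y y' / \<epsilon>)"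
      using uy \<epsilon>(1) by (intro mult_right_mono) auto
    also have "(\<gamma>' * \<epsilon>) * (dist y y' / \<epsilon>) = \<gamma>' * norm (y - y')" using \<epsilon>(1) by (simp add: dist_norm)
    finally show ?thesis by simp
  qed
  have s3: "cball x (3 * s) \<subseteq> \<Omega>" using s0 s(2) \<epsilon>(1) by (auto simp: subset_eq)
  have "AE y in lebesgue. y \<in> ball x s \<longrightarrow> norm (G y) \<le> \<gamma>'"
  proof (rule weak_gradient_Lipschitz_bound[OF \<Omega> G(1) s(1) s3])
    fix y y' assume "y \<in> cball x (3 * s)" "y' \<in> cball x (3 * s)"
    then show "\<bar>u y - u y'\<bar> \<le> \<gamma>' * norm (y - y')" using lip[of y y'] lip[of y' y] by (simp add: abs_le_iff norm_minus_commute)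
  qed
  moreover have "AE y in lebesgue. y \<in> \<Omega> \<longrightarrow> norm (G y) \<ge> \<gamma>" using G(2) \<Omega> by (simp add: AE_restrict_space_iff)
  ultimately have "AE y in lebesgue. y \<notin> ball x s"
  proof eventually_elim
    case (elim y)
    then show ?case using \<gamma>'(1) s3 s(1) by (force simp: subset_eq)
  qed
  then have "negligible (ball x s)" by (simp add: AE_lebesgue_iff_negligible ball_def)
  then show False using open_not_negligible[OF open_ball, of x s] s(1) by simp
qed

subsection \<open>Discrete comparison\<close>

text \<open>At a point where \<open>U - W\<close> is almost maximal, take \<open>y\<close> from the
  condition on \<open>U\<close> and \<open>z\<close> from the one on \<open>W\<close>. The
  quantifier order lets both inequalities hold for this same pair, and their difference pushes
  \<open>U - W\<close> above its supremum at \<open>y\<close> or \<open>z\<close>. Near-maximality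
  suffices, as no continuity is available.\<close>

lemma discrete_comparison:
  fixes U W :: "'a \<Rightarrow> real"
  assumes N: "\<And>x. x \<in> D \<Longrightarrow> N x \<subseteq> X" and DX: "D \<subseteq> X"
    and bdd: "\<And>x. x \<in> X \<Longrightarrow> U x - W x \<le> B"
    and U: "\<And>x. x \<in> D \<Longrightarrow> \<exists>y\<in>N x. \<forall>z\<in>N x. U y + U z - 2 * U x \<ge> - \<eta>"
    and W: "\<And>x. x \<in> D \<Longrightarrow> \<exists>z\<in>N x. \<forall>y\<in>N x. W y + W z - 2 * W x \<le> - \<eta>'"
    and \<eta>: "\<eta> < \<eta>'" and off: "\<And>x. x \<in> X \<Longrightarrow> x \<notin> D \<Longrightarrow> U x - W x \<le> m" and x: "x \<in> X"
  shows "U x - W x \<le> m"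
proof (rule ccontr)
  assume neg: "\<not> U x - W x \<le> m"
  define S where "S = Sup ((\<lambda>x. U x - W x) ` X)"
  have bA: "bdd_above ((\<lambda>x. U x - W x) ` X)" using bdd by (auto simp: bdd_above_def)
  have le: "U y - W y \<le> S" if "y \<in> X" for y unfolding S_def by (rule cSUP_upper[OF that bA])
  define \<kappa> where "\<kappa> = min ((\<eta>' - \<eta>) / 2) (S - m)"
  have \<kappa>: "\<kappa> > 0" using \<eta> neg le[OF x] by (simp add: \<kappa>_def)
  have "S - \<kappa> < Sup ((\<lambda>x. U x - W x) ` X)" using \<kappa> by (simp add: S_def)
  then obtain x1 where x1: "x1 \<in> X" "S - \<kappa> < U x1 - W x1" using less_cSUP_iff[OF _ bA] x by blast
  then have "x1 \<in> D" using off[of x1] by (force simp: \<kappa>_def)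
  obtain y where y: "y \<in> N x1" "\<And>z. z \<in> N x1 \<Longrightarrow> U y + U z - 2 * U x1 \<ge> - \<eta>" using U[OF \<open>x1 \<in> D\<close>] by blast
  obtain z where z: "z \<in> N x1" "\<And>y. y \<in> N x1 \<Longrightarrow> W y + W z - 2 * W x1 \<le> - \<eta>'" using W[OF \<open>x1 \<in> D\<close>] by blast
  have "U y - W y \<le> S" "U z - W z \<le> S" using le y(1) z(1) N[OF \<open>x1 \<in> D\<close>] by blast+
  moreover have "\<kappa> \<le> (\<eta>' - \<eta>) / 2" unfolding \<kappa>_def by (rule min.cobounded1)
  ultimately show False using y(2)[OF z(1)] z(2)[OF y(1)] x1(2) by (simp add: field_simps)
qed

text \<open>The slack \<open>\<kappa>\<close> accommodates values defined as infima that need not be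
  attained. A single \<open>z\<close> witnesses both the slope and the discrete supersolution
  inequality.\<close>

definition slope_super :: "'a set \<Rightarrow> ('a \<Rightarrow> 'a set) \<Rightarrow> real \<Rightarrow> ('a \<Rightarrow> real) \<Rightarrow> bool" where
  "slope_super D N s V \<longleftrightarrow> (\<forall>\<kappa>>0. \<forall>x\<in>D. \<exists>z\<in>N x. V x - V z \<ge> s - \<kappa> \<and> (\<forall>y\<in>N x. V y + V z \<le> 2 * V x + \<kappa>))"

text \<open>With \<open>a = V y - V x\<close> and \<open>b = V x - V z\<close> the second difference
  of \<open>W\<close> is \<open>(1 - 2 * \<delta> * V x) * (a - b) - \<delta> * (a\<^sup>2 +
  b\<^sup>2)\<close>. The condition \<open>2 * \<delta> * B \<le> 1\<close> keeps the first
  coefficient between 0 and 2, and the slope makes \<open>\<delta> * b\<^sup>2\<close> at least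
  \<open>\<delta> * s\<^sup>2\<close> up to slack.\<close>

lemma slope_super_strict:
  fixes V :: "'a \<Rightarrow> real"
  assumes V: "slope_super D N s V" and s: "s > 0" and \<delta>: "\<delta> > 0" "2 * \<delta> * B \<le> 1" and B: "\<And>x. x \<in> D \<Longrightarrow> \<bar>V x\<bar> \<le> B"
    and \<eta>: "\<eta> < \<delta> * s\<^sup>2"
  defines "W \<equiv> \<lambda>x. V x - \<delta> * (V x)\<^sup>2"
  shows "\<exists>\<eta>'>\<eta>. \<forall>x\<in>D. \<exists>z\<in>N x. \<forall>y\<in>N x. W y + W z - 2 * W x \<le> - \<eta>'"
proof -
  define c where "c = 2 + 2 * \<delta> * s"
  \<comment> \<open>\<open>\<kappa> \<le> s\<close> permits squaring
    \<open>b \<ge> s - \<kappa>\<close>. The constant \<open>c\<close> collects the losses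
    \<open>2 * \<kappa>\<close> and \<open>2 * \<delta> * s * \<kappa>\<close>, which together
    consume at most half of the gap between \<open>\<eta>\<close> and
    \<open>\<delta> * s\<^sup>2\<close>.\<close>
  define \<kappa> where "\<kappa> = min s ((\<delta> * s\<^sup>2 - \<eta>) / (2 * c))"
  have pos: "c > 0" using \<delta> s by (simp add: c_def add_pos_pos)
  have \<kappa>: "\<kappa> > 0" "\<kappa> \<le> s" using s \<eta> pos by (auto simp: \<kappa>_def)
  have "\<kappa> * c \<le> ((\<delta> * s\<^sup>2 - \<eta>) / (2 * c)) * c"
    unfolding \<kappa>_def using pos by (intro mult_right_mono) auto
  also have "\<dots> = (\<delta> * s\<^sup>2 - \<eta>) / 2" using pos by simp
  finally have \<kappa>2: "\<kappa> * (2 + 2 * \<delta> * s) \<le> (\<delta> * s\<^sup>2 - \<eta>) / 2" by (simp only: c_def)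
  show ?thesis
  proof (intro exI[of _ "(\<eta> + \<delta> * s\<^sup>2) / 2"] conjI ballI)
    show "\<eta> < (\<eta> + \<delta> * s\<^sup>2) / 2" using \<eta> by simp
    fix x assume x: "x \<in> D"
    obtain z where z: "z \<in> N x" "V x - V z \<ge> s - \<kappa>" "\<And>y. y \<in> N x \<Longrightarrow> V y + V z \<le> 2 * V x + \<kappa>"
      using V \<kappa>(1) x unfolding slope_super_def by blast
    show "\<exists>z\<in>N x. \<forall>y\<in>N x. W y + W z - 2 * W x \<le> - ((\<eta> + \<delta> * s\<^sup>2) / 2)"
    proof (intro bexI[OF _ z(1)] ballI)
      fix y assume y: "y \<in> N x"
      define a where "a = V y - V x"
      define b where "b = V x - V z"
      have ab: "a - b \<le> \<kappa>" "b \<ge> s - \<kappa>" using z(2) z(3)[OF y] by (auto simp: a_def b_def)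
      have "2 * \<delta> * \<bar>V x\<bar> \<le> 2 * \<delta> * B" using B[OF x] \<delta>(1) by (intro mult_left_mono) auto
      moreover have "\<bar>2 * \<delta> * V x\<bar> = 2 * \<delta> * \<bar>V x\<bar>" using \<delta>(1) by (simp add: abs_mult)
      ultimately have vb: "\<bar>2 * \<delta> * V x\<bar> \<le> 1" using \<delta>(2) by linarith
      have "(1 - 2 * \<delta> * V x) * (a - b) \<le> (1 - 2 * \<delta> * V x) * \<kappa>" using ab(1) vb by (intro mult_left_mono) auto
      also have "\<dots> \<le> 2 * \<kappa>" using vb \<kappa>(1) by (intro mult_right_mono) auto
      finally have 1: "(1 - 2 * \<delta> * V x) * (a - b) \<le> 2 * \<kappa>" .
      have "(s - \<kappa>)\<^sup>2 \<le> b\<^sup>2" using ab(2) \<kappa>(2) by (intro power_mono) auto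
      then have "\<delta> * (s - \<kappa>)\<^sup>2 \<le> \<delta> * b\<^sup>2" using \<delta>(1) by (intro mult_left_mono) auto
      moreover have "\<delta> * (s - \<kappa>)\<^sup>2 = \<delta> * s\<^sup>2 - \<kappa> * (2 * \<delta> * s) + \<delta> * \<kappa>\<^sup>2" by (simp add: power2_eq_square algebra_simps)
      moreover have "\<delta> * \<kappa>\<^sup>2 \<ge> 0" "\<delta> * a\<^sup>2 \<ge> 0" using \<delta>(1) by auto
      moreover have "W y + W z - 2 * W x = (1 - 2 * \<delta> * V x) * (a - b) - (\<delta> * a\<^sup>2 + \<delta> * b\<^sup>2)"
        by (simp add: W_def a_def b_def power2_eq_square algebra_simps)
      moreover have "\<kappa> * (2 + 2 * \<delta> * s) = 2 * \<kappa> + \<kappa> * (2 * \<delta> * s)" by (simp add: algebra_simps)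
      ultimately show "W y + W z - 2 * W x \<le> - ((\<eta> + \<delta> * s\<^sup>2) / 2)" using 1 \<kappa>2 by (simp add: field_simps)
    qed
  qed
qed

text \<open>A path running in \<open>E\<close> up to its last point \<open>w\<close>, the first one
  outside; \<open>k\<close> counts its steps. A point outside \<open>E\<close> has only the trivial
  chain, so the patched function is unchanged there.\<close>

inductive exit_chain :: "'a set \<Rightarrow> ('a \<Rightarrow> 'a set) \<Rightarrow> nat \<Rightarrow> 'a \<Rightarrow> 'a \<Rightarrow> bool" for E N where
  stop: "x \<notin> E \<Longrightarrow> exit_chain E N 0 x x"
| step: "x \<in> E \<Longrightarrow> x' \<in> N x \<Longrightarrow> exit_chain E N k x' w \<Longrightarrow> exit_chain E N (Suc k) x w"

lemma exit_chain_of_path: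
  assumes "\<And>i. i < k \<Longrightarrow> p i \<in> E \<and> p (Suc i) \<in> N (p i)" "p k \<notin> E"
  shows "exit_chain E N k (p 0) (p k)"
  using assms
proof (induction k arbitrary: p)
  case 0
  then show ?case by (auto intro: stop)
next
  case (Suc k)
  have "exit_chain E N k (p (Suc 0)) (p (Suc k))"
    using Suc.IH[of "\<lambda>i. p (Suc i)"] Suc.prems by auto
  moreover have "p 0 \<in> E" "p (Suc 0) \<in> N (p 0)" using Suc.prems(1)[of 0] by auto
  ultimately show ?case by (rule step[rotated 2])
qed

text \<open>Where the slope of \<open>V\<close> is below \<open>s\<close>, replace \<open>V\<close> by the cheapest way of leaving that region at cost
  \<open>s\<close> per step.\<close>

lemma slope_patching:
  fixes V :: "'a \<Rightarrow> real"
  assumes N: "\<And>x. x \<in> D \<Longrightarrow> N x \<subseteq> X" and DX: "D \<subseteq> X" and sym: "\<And>x y. x \<in> D \<Longrightarrow> y \<in> N x \<Longrightarrow> x \<in> N y"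
    and V: "\<And>x. x \<in> D \<Longrightarrow> \<exists>z\<in>N x. \<forall>y\<in>N x. V z \<le> V y \<and> V y + V z \<le> 2 * V x"
    and path: "\<And>x. x \<in> D \<Longrightarrow> \<exists>p. p 0 = x \<and> (\<forall>i. p i \<in> D \<longrightarrow> p (Suc i) \<in> N (p i)) \<and> (\<exists>k\<le>n. p k \<notin> D)"
    and s: "s > 0"
  obtains V' where "\<And>x. x \<in> X \<Longrightarrow> x \<notin> D \<Longrightarrow> V' x = V x" "\<And>x. x \<in> X \<Longrightarrow> V x \<le> V' x"
    "\<And>x. x \<in> X \<Longrightarrow> V' x \<le> V x + 2 * real n * s" "slope_super D N s V'"
proof -
  define E where "E = {x \<in> D. \<forall>z\<in>N x. V x - V z < s}"
  let ?ch = "exit_chain E N"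
  define vals where "vals x = {V w + real k * s | k w. ?ch k x w}" for x
  define V' where "V' x = Inf (vals x)" for x
  have ED: "E \<subseteq> D" by (auto simp: E_def)
  \<comment> \<open>In \<open>E\<close> every descent is below \<open>s\<close>, and the
    supersolution inequality bounds ascents by the descent to \<open>z\<close>. So \<open>V\<close>
    changes by at most \<open>s\<close> per chain step, which squeezes \<open>V'\<close> between
    \<open>V\<close> and \<open>V + 2 * n * s\<close>.\<close>
  have near: "V y \<le> V x + s" "V x \<le> V y + s" if x: "x \<in> E" and y: "y \<in> N x" for x y
  proof -
    obtain z where z: "z \<in> N x" "V y + V z \<le> 2 * V x" using V[of x] x y ED by blast
    have "V x - V z < s" "V x - V y < s" using x y z(1) by (auto simp: E_def)
    then show "V y \<le> V x + s" "V x \<le> V y + s" using z(2) by linarith+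
  qed
  have chain: "\<bar>V x - V w\<bar> \<le> real k * s" if "?ch k x w" for k x w
    using that
  proof induction
    case (step x x' k w)
    then show ?case using near[OF step.hyps(1,2)] by (simp add: algebra_simps abs_le_iff)
  qed simp
  have lower: "V x \<le> r" if "r \<in> vals x" for r x using that chain by (force simp: vals_def abs_le_iff)
  then have bb: "bdd_below (vals x)" for x by (auto simp: bdd_below_def)
  have ex: "\<exists>k w. k \<le> n \<and> ?ch k x w" if x: "x \<in> X" for x
  proof (cases "x \<in> D")
    case True
    obtain p k where p: "p 0 = x" "\<And>i. p i \<in> D \<Longrightarrow> p (Suc i) \<in> N (p i)" "k \<le> n" "p k \<notin> D" using path[OF True] by blast
    have pk: "p k \<notin> E" using p(4) ED by blast
    \<comment> \<open>The given path leaves \<open>D\<close> within \<open>n\<close> steps but may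
      leave and re-enter the smaller set \<open>E\<close> earlier; a chain has to stop at the first
      exit from \<open>E\<close>.\<close>
    have le: "p (LEAST k. p k \<notin> E) \<notin> E" "(LEAST k. p k \<notin> E) \<le> k"
      using LeastI[of "\<lambda>k. p k \<notin> E", OF pk] Least_le[of "\<lambda>k. p k \<notin> E", OF pk] .
    have "p i \<in> E \<and> p (Suc i) \<in> N (p i)" if "i < (LEAST k. p k \<notin> E)" for i
      using not_less_Least[OF that] p(2)[of i] ED by blast
    from exit_chain_of_path[OF this le(1)] show ?thesis using p(1,3) le(2) by (metis order_trans)
  next
    case False
    then have "?ch 0 x x" using ED by (auto intro: stop)
    then show ?thesis by blast
  qed
  have ne: "vals x \<noteq> {}" if "x \<in> X" for x using ex[OF that] by (auto simp: vals_def)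
  have le': "V' x \<le> V w + real k * s" if "?ch k x w" for k x w
    unfolding V'_def by (rule cInf_lower[OF _ bb]) (use that in \<open>auto simp: vals_def\<close>)
  have V'E: "V' x = V x" if "x \<notin> E" for x
  proof -
    have c0: "?ch 0 x x" using that by (rule stop)
    have only: "k = 0 \<and> w = x" if "?ch k x w" for k w
      using that \<open>x \<notin> E\<close> by (cases rule: exit_chain.cases) auto
    have "V x \<in> vals x"
      unfolding vals_def by (intro CollectI exI[of _ 0] exI[of _ x]) (simp add: c0)
    moreover have "vals x \<subseteq> {V x}"
    proof
      fix r assume "r \<in> vals x"
      then obtain k w where "r = V w + real k * s" "?ch k x w" by (auto simp: vals_def)
      then show "r \<in> {V x}" using only[of k w] by auto
    qed
    ultimately have "vals x = {V x}" by blast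
    then show ?thesis by (simp add: V'_def)
  qed
  have VV': "V x \<le> V' x" if "x \<in> X" for x
    unfolding V'_def by (rule cInf_greatest[OF ne[OF that] lower])
  have V'V: "V' x \<le> V x + 2 * real n * s" if x: "x \<in> X" for x
  proof -
    obtain k w where k: "k \<le> n" "?ch k x w" using ex[OF x] by blast
    have "V' x \<le> V x + 2 * (real k * s)" using le'[OF k(2)] chain[OF k(2)] by (simp add: abs_le_iff)
    also have "\<dots> \<le> V x + 2 * (real n * s)" using k(1) s by (intro add_left_mono mult_left_mono mult_right_mono) auto
    finally show ?thesis by simp
  qed
  \<comment> \<open>By symmetry of the neighbourhoods, \<open>y\<close> can be put in front of any
    chain from \<open>x\<close>, at the price of one more \<open>s\<close>.\<close>
  have up: "V' y \<le> V' x + s" if x: "x \<in> E" and y: "y \<in> N x" for x y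
  proof (cases "y \<in> E")
    case True
    have xX: "x \<in> X" using x ED DX by blast
    have "V' y - s \<le> V' x"
      unfolding V'_def[of x]
    proof (rule cInf_greatest[OF ne[OF xX]])
      fix r assume "r \<in> vals x"
      then obtain k w where k: "r = V w + real k * s" "?ch k x w" by (auto simp: vals_def)
      have "?ch (Suc k) y w" by (rule step[OF True _ k(2)]) (use sym y x ED in blast)
      from le'[OF this] show "V' y - s \<le> r" by (simp add: k(1) algebra_simps)
    qed
    then show ?thesis by simp
  next
    case False
    then show ?thesis using near(1)[OF x y] VV'[of x] x ED DX V'E[OF False] by force
  qed
  have ss: "slope_super D N s V'"
    unfolding slope_super_def
  proof (intro allI impI ballI)
    fix \<kappa> :: real and x assume \<kappa>: "\<kappa> > 0" and x: "x \<in> D"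
    have xX: "x \<in> X" using x DX by blast
    show "\<exists>z\<in>N x. V' x - V' z \<ge> s - \<kappa> \<and> (\<forall>y\<in>N x. V' y + V' z \<le> 2 * V' x + \<kappa>)"
    proof (cases "x \<in> E")
      case True
      have "Inf (vals x) < V' x + \<kappa>" using \<kappa> by (simp add: V'_def)
      then obtain r where "r \<in> vals x" "r < V' x + \<kappa>" using cInf_lessD[OF ne[OF xX]] by blast
      then obtain k w where k: "V w + real k * s < V' x + \<kappa>" "?ch k x w" by (auto simp: vals_def)
      from k(2) True obtain k' z where z: "k = Suc k'" "z \<in> N x" "?ch k' z w" by (cases rule: exit_chain.cases) auto
      have zz: "V' z + s \<le> V' x + \<kappa>" using le'[OF z(3)] k(1) by (simp add: z(1) algebra_simps)
      have "V' y + V' z \<le> 2 * V' x + \<kappa>" if "y \<in> N x" for y using up[OF True that] zz by linarith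
      then show ?thesis using z(2) zz by (intro bexI[of _ z]) auto
    next
      case False
      obtain z where z: "z \<in> N x" "\<And>y. y \<in> N x \<Longrightarrow> V z \<le> V y" "\<And>y. y \<in> N x \<Longrightarrow> V y + V z \<le> 2 * V x" using V[OF x] by blast
      obtain z' where "z' \<in> N x" "V x - V z' \<ge> s" using False x by (auto simp: E_def not_less)
      then have sl: "V x - V z \<ge> s" using z(2) by force
      \<comment> \<open>Slopes do not decrease along descent: applied at \<open>z\<close> with
        \<open>x\<close> as the upper neighbour, the supersolution inequality gives a further drop
        of at least \<open>s\<close>. Hence \<open>z\<close> lies outside \<open>E\<close>, where
        \<open>V'\<close> agrees with \<open>V\<close>.\<close>
      have zE: "z \<notin> E"
      proof
        assume zE: "z \<in> E"
        have "x \<in> N z" using sym[OF x z(1)] .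
        moreover obtain z2 where z2: "z2 \<in> N z" "\<And>y. y \<in> N z \<Longrightarrow> V y + V z2 \<le> 2 * V z" using V[of z] zE ED by blast
        ultimately have "V x + V z2 \<le> 2 * V z" by blast
        moreover have "V z - V z2 < s" using zE z2(1) by (auto simp: E_def)
        ultimately show False using sl by linarith
      qed
      have "V' y + V' z \<le> 2 * V' x + \<kappa>" if y: "y \<in> N x" for y
      proof (cases "y \<in> E")
        case yE: True
        have "?ch (Suc 0) y x" by (rule step[where N=N, OF yE sym[OF x y] stop[OF False]])
        from le'[OF this] show ?thesis using sl \<kappa> V'E[OF zE] V'E[OF False] by simp
      next
        case yE: False
        then show ?thesis using z(3)[OF y] \<kappa> V'E[OF zE] V'E[OF False] V'E[OF yE] by simp
      qed
      then show ?thesis using z(1) sl \<kappa> V'E[OF zE] V'E[OF False] by (intro bexI[of _ z]) auto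
    qed
  qed
  show ?thesis by (rule that[of V']) (use V'E ED VV' V'V ss in auto)
qed

lemma cone_aboveD:
  assumes "cone_above \<beta> \<Omega> u" "R > 0" "cball x R \<subseteq> \<Omega>" "\<And>y. y \<in> cball x R \<Longrightarrow> u y \<le> M" "y \<in> cball x R"
  shows "u y \<le> u x + (M - u x) * (dist x y / R) powr \<beta>"
  using assms unfolding cone_above_def by simp

subsection \<open>The estimate at scale \<open>\<epsilon>\<close>\<close>

text \<open>The situation for one sign and one scale. \<open>L\<close> bounds both \<open>v\<close>
  and its Lipschitz constant, so the single norm of u_inf can play both parts, and \<open>A\<close>
  is the Hoelder constant of \<open>u\<close>. The opposite estimate comes from instantiating with
  \<open>- u\<close> and \<open>- v\<close>.\<close>

locale two_scale =
  fixes \<Omega> :: "'a::euclidean_space set" and u v :: "'a \<Rightarrow> real" and \<beta> \<tau> \<alpha> A L \<epsilon> m :: real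
  assumes \<Omega>: "open \<Omega>" "bounded \<Omega>" "\<Omega> \<noteq> {}"
    and cu: "continuous_on (closure \<Omega>) u" and cv: "continuous_on (closure \<Omega>) v"
    and cone_u: "cone_above \<beta> \<Omega> u" and cone_v: "cone_above 1 \<Omega> (\<lambda>x. - v x)"
    and \<beta>: "0 < \<beta>" "\<beta> = 1 - \<tau>" and \<tau>: "\<tau> \<ge> 0"
    and \<alpha>: "0 < \<alpha>" "\<alpha> \<le> 1" and A: "A \<ge> 0" and L: "L \<ge> 0" and \<epsilon>: "0 < \<epsilon>" "\<epsilon> \<le> 1"
    and hu: "\<And>x y. x \<in> closure \<Omega> \<Longrightarrow> y \<in> closure \<Omega> \<Longrightarrow> \<bar>u x - u y\<bar> \<le> A * dist x y powr \<alpha>"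
    and hv: "\<And>x y. x \<in> closure \<Omega> \<Longrightarrow> y \<in> closure \<Omega> \<Longrightarrow> \<bar>v x - v y\<bar> \<le> L * dist x y"
    and bd: "\<And>x. x \<in> frontier \<Omega> \<Longrightarrow> u x - v x \<le> m"
    and vL: "\<And>x. x \<in> closure \<Omega> \<Longrightarrow> \<bar>v x\<bar> \<le> L"
begin

definition "X = closure \<Omega>"
definition "N x = cball x \<epsilon> \<inter> X"
text \<open>The margin is twice \<epsilon>, because \<open>U\<close> and \<open>V\<close> at a
  neighbour of \<open>x\<close> read values up to distance 2 \<epsilon> from
  \<open>x\<close>.\<close>

definition "D = {x. cball x (2 * \<epsilon>) \<subseteq> \<Omega>}"
definition "U x = Sup (u ` N x)"
definition "V x = Inf (v ` N x)"

lemma D_sub: "x \<in> D \<Longrightarrow> cball x (2 * \<epsilon>) \<subseteq> \<Omega>" by (simp add: D_def)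

lemma \<Omega>X: "\<Omega> \<subseteq> X" by (simp add: X_def closure_subset)

lemma cball_half: "y \<in> cball x \<epsilon> \<Longrightarrow> cball y \<epsilon> \<subseteq> cball x (2 * \<epsilon>)"
proof
  fix z assume "y \<in> cball x \<epsilon>" "z \<in> cball y \<epsilon>"
  then show "z \<in> cball x (2 * \<epsilon>)" using dist_triangle[of x z y] by auto
qed

lemma N_D: assumes "x \<in> D" shows "N x = cball x \<epsilon>" "x \<in> \<Omega>" "N x \<subseteq> \<Omega>"
proof -
  have "cball x \<epsilon> \<subseteq> cball x (2 * \<epsilon>)" using \<epsilon> by (intro subset_cball) auto
  then have s: "cball x \<epsilon> \<subseteq> \<Omega>" using D_sub[OF assms] by blast
  then show "N x = cball x \<epsilon>" using \<Omega>X by (auto simp: N_def)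
  then show "N x \<subseteq> \<Omega>" using s by simp
  show "x \<in> \<Omega>" using s \<epsilon> by auto
qed

lemma N_N_D: assumes "x \<in> D" "y \<in> N x" shows "N y = cball y \<epsilon>" "N y \<subseteq> cball x (2 * \<epsilon>)" "x \<in> N y"
proof -
  have y: "y \<in> cball x \<epsilon>" using assms N_D(1) by auto
  have s: "cball y \<epsilon> \<subseteq> cball x (2 * \<epsilon>)" using cball_half[OF y] .
  then show "N y = cball y \<epsilon>" using D_sub[OF assms(1)] \<Omega>X by (auto simp: N_def)
  then show "N y \<subseteq> cball x (2 * \<epsilon>)" "x \<in> N y" using s y by (auto simp: dist_commute)
qed

lemma N_X: "N x \<subseteq> X" by (simp add: N_def)

lemma self_N: "x \<in> X \<Longrightarrow> x \<in> N x" using \<epsilon> by (simp add: N_def)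

lemma compact_N: "compact (N x)"
  unfolding N_def X_def by (intro compact_Int_closed) auto

lemma U_attained: assumes "x \<in> X" obtains w where "w \<in> N x" "U x = u w" "\<And>y. y \<in> N x \<Longrightarrow> u y \<le> u w"
proof -
  have "continuous_on (N x) u" using cu N_X by (auto simp: X_def intro: continuous_on_subset)
  then obtain w where w: "w \<in> N x" "\<And>y. y \<in> N x \<Longrightarrow> u y \<le> u w"
    using continuous_attains_sup[OF compact_N] self_N[OF assms] by blast
  have "U x = u w" unfolding U_def using w by (intro cSup_eq_maximum) auto
  then show ?thesis using w that by blast
qed

lemma V_attained: assumes "x \<in> X" obtains w where "w \<in> N x" "V x = v w" "\<And>y. y \<in> N x \<Longrightarrow> v w \<le> v y"
proof -
  have "continuous_on (N x) v" using cv N_X by (auto simp: X_def intro: continuous_on_subset)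
  then obtain w where w: "w \<in> N x" "\<And>y. y \<in> N x \<Longrightarrow> v w \<le> v y"
    using continuous_attains_inf[OF compact_N] self_N[OF assms] by blast
  have "V x = v w" unfolding V_def using w by (intro cInf_eq_minimum) auto
  then show ?thesis using w that by blast
qed

lemma U_ge: "x \<in> X \<Longrightarrow> y \<in> N x \<Longrightarrow> u y \<le> U x" by (rule U_attained[of x]) auto

lemma V_le: "x \<in> X \<Longrightarrow> y \<in> N x \<Longrightarrow> V x \<le> v y" by (rule V_attained[of x]) auto

lemma V_bound: "x \<in> X \<Longrightarrow> \<bar>V x\<bar> \<le> L"
proof -
  assume x: "x \<in> X"
  obtain w where "w \<in> N x" "V x = v w" by (rule V_attained[OF x]) (rule that)
  then show ?thesis using vL[of w] N_X by (auto simp: X_def)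
qed

lemma midpoint_N:
  assumes "x \<in> D" "z \<in> cball x (2 * \<epsilon>)" obtains y where "y \<in> N x" "z \<in> N y"
proof -
  let ?y = "x + (1/2) *\<^sub>R (z - x)"
  have "norm (z - x) \<le> 2 * \<epsilon>" using assms(2) by (simp add: dist_norm norm_minus_commute)
  then have y: "?y \<in> cball x \<epsilon>" by (simp add: dist_norm)
  then have yN: "?y \<in> N x" using N_D(1)[OF assms(1)] by simp
  have "?y - z = (x - z) - (1/2) *\<^sub>R (x - z)" by (simp add: scaleR_diff_right)
  also have "\<dots> = (1 - 1/2) *\<^sub>R (x - z)" by (simp only: scaleR_diff_left scaleR_one)
  finally have "?y - z = (1/2) *\<^sub>R (x - z)" by simp
  then have "z \<in> cball ?y \<epsilon>" using assms(2) by (simp add: dist_norm)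
  then show ?thesis using that[OF yN] N_N_D(1)[OF assms(1) yN] by simp
qed

lemma dist_half_powr:
  assumes "w \<in> cball x \<epsilon>" "b \<ge> 0" shows "(dist x w / (2 * \<epsilon>)) powr b \<le> 2 powr (- b)"
proof -
  have "dist x w / (2 * \<epsilon>) \<le> 1 / 2" using assms(1) \<epsilon> by (simp add: field_simps)
  then have "(dist x w / (2 * \<epsilon>)) powr b \<le> (1 / 2) powr b" using assms \<epsilon> by (intro powr_mono2) auto
  also have "\<dots> = 2 powr (- b)" by (simp add: powr_divide powr_minus_divide)
  finally show ?thesis .
qed

text \<open>Take \<open>ys\<close> maximising \<open>u\<close> on the ball of radius 2 \<epsilon>
  and \<open>y\<close> halfway to it. Then \<open>U y \<ge> u ys\<close>, and
  \<open>U z \<ge> u x\<close> for each neighbour \<open>z\<close>. Comparison at half the radius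
  gives \<open>U x - u x \<le> (u ys - u x) * 2 powr (- \<beta>)\<close>, so the defect is at most
  \<open>2 - 2 powr \<beta>\<close> times \<open>U x - u x\<close>, itself a Hoelder
  increment.\<close>

lemma U_sub:
  assumes x: "x \<in> D" shows "\<exists>y\<in>N x. \<forall>z\<in>N x. U y + U z - 2 * U x \<ge> - (2 * \<tau> * A * \<epsilon> powr \<alpha>)"
proof -
  have xX: "x \<in> X" using N_D(2)[OF x] \<Omega>X by blast
  have sub: "cball x (2 * \<epsilon>) \<subseteq> X" using D_sub[OF x] \<Omega>X by blast
  have "continuous_on (cball x (2 * \<epsilon>)) u" using cu sub by (auto simp: X_def intro: continuous_on_subset)
  then obtain ys where ys: "ys \<in> cball x (2 * \<epsilon>)" "\<And>y. y \<in> cball x (2 * \<epsilon>) \<Longrightarrow> u y \<le> u ys"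
    using continuous_attains_sup[of "cball x (2 * \<epsilon>)" u] \<epsilon> by auto
  obtain y where y: "y \<in> N x" "ys \<in> N y" by (rule midpoint_N[OF x ys(1)]) (rule that)
  have Uy: "u ys \<le> U y" using y N_X by (intro U_ge) auto
  obtain w where w: "w \<in> N x" "U x = u w" by (rule U_attained[OF xX]) (rule that)
  have wb: "w \<in> cball x \<epsilon>" using w N_D(1)[OF x] by simp
  then have w2: "w \<in> cball x (2 * \<epsilon>)" using \<epsilon> by auto
  have "u w \<le> u x + (u ys - u x) * (dist x w / (2 * \<epsilon>)) powr \<beta>"
    by (rule cone_aboveD[OF cone_u _ D_sub[OF x] ys(2) w2]) (use \<epsilon> in auto)
  also have "\<dots> \<le> u x + (u ys - u x) * 2 powr (- \<beta>)"
    using ys(2)[of x] \<epsilon> \<beta> dist_half_powr[OF wb, of \<beta>] by (intro add_left_mono mult_left_mono) auto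
  finally have t1: "U x - u x \<le> (u ys - u x) * 2 powr (- \<beta>)" using w by simp
  define t where "t = U x - u x"
  have t0: "0 \<le> t" using U_ge[OF xX self_N[OF xX]] by (simp add: t_def)
  have "dist w x powr \<alpha> \<le> \<epsilon> powr \<alpha>" using wb \<alpha> by (intro powr_mono2) (auto simp: dist_commute)
  then have "A * dist w x powr \<alpha> \<le> A * \<epsilon> powr \<alpha>" using A by (rule mult_left_mono)
  moreover have "w \<in> X" using w(1) N_X by blast
  ultimately have tA: "t \<le> A * \<epsilon> powr \<alpha>" using hu[of w x] xX w(2) by (simp add: t_def X_def abs_le_iff)
  have "t * 2 powr \<beta> \<le> (u ys - u x) * 2 powr (- \<beta>) * 2 powr \<beta>" using t1 by (intro mult_right_mono) (auto simp: t_def)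
  also have "\<dots> = u ys - u x" by (simp add: powr_minus field_simps)
  finally have t2: "t * 2 powr \<beta> \<le> u ys - u x" .
  \<comment> \<open>As \<open>\<beta> = 1 - \<tau>\<close>, this is
    \<open>1 - exp (- (\<tau> * ln 2)) \<le> \<tau> * ln 2 \<le> \<tau>\<close>, doubled.\<close>
  have "2 - 2 powr \<beta> \<le> 2 * \<tau>"
  proof -
    have "1 + - (\<tau> * ln 2) \<le> exp (- (\<tau> * ln 2))" by (rule exp_ge_add_one_self)
    moreover have "2 powr \<beta> = 2 * exp (- (\<tau> * ln 2))" 
    proof -
      have "2 powr \<beta> = 2 / 2 powr \<tau>" unfolding \<beta>(2) by (simp add: powr_diff)
      also have "2 powr \<tau> = exp (\<tau> * ln 2)" by (simp add: powr_def)
      finally show ?thesis by (simp add: exp_minus divide_inverse)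
    qed
    moreover have "\<tau> * ln 2 \<le> \<tau> * 1" using \<tau> ln_le_minus_one[of 2] by (intro mult_left_mono) auto
    ultimately show ?thesis by linarith
  qed
  then have "t * (2 - 2 powr \<beta>) \<le> t * (2 * \<tau>)" using t0 by (rule mult_left_mono)
  also have "\<dots> \<le> (A * \<epsilon> powr \<alpha>) * (2 * \<tau>)" using tA \<tau> by (intro mult_right_mono) auto
  finally have t3: "t * (2 - 2 powr \<beta>) \<le> 2 * \<tau> * A * \<epsilon> powr \<alpha>" by (simp add: mult_ac)
  show ?thesis
  proof (intro bexI[OF _ y(1)] ballI)
    fix z assume z: "z \<in> N x"
    have "u x \<le> U z" using z N_X N_N_D(3)[OF x z] by (intro U_ge) auto
    then have "U y + U z - 2 * U x \<ge> u ys + u x - 2 * U x" using Uy by simp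
    moreover have "u ys + u x - 2 * U x = (u ys - u x) - 2 * t" by (simp add: t_def)
    moreover have "t * (2 - 2 powr \<beta>) = 2 * t - t * 2 powr \<beta>" by (simp add: algebra_simps)
    ultimately show "U y + U z - 2 * U x \<ge> - (2 * \<tau> * A * \<epsilon> powr \<alpha>)" using t2 t3 by linarith
  qed
qed

text \<open>The mirror image of \<open>U_sub\<close> with exponent 1, where halving the radius
  exactly halves the increment and no error arises. The last conjunct passes a drop of
  \<open>v\<close> over an \<epsilon>-ball on to a drop of \<open>V\<close>.\<close>

lemma V_super:
  assumes x: "x \<in> D"
  shows "\<exists>z\<in>N x. (\<forall>y\<in>N x. V z \<le> V y \<and> V y + V z \<le> 2 * V x) \<and> v x - V x \<le> V x - V z"
proof -
  have xX: "x \<in> X" using N_D(2)[OF x] \<Omega>X by blast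
  have sub: "cball x (2 * \<epsilon>) \<subseteq> X" using D_sub[OF x] \<Omega>X by blast
  have "continuous_on (cball x (2 * \<epsilon>)) v" using cv sub by (auto simp: X_def intro: continuous_on_subset)
  then obtain zs where zs: "zs \<in> cball x (2 * \<epsilon>)" "\<And>y. y \<in> cball x (2 * \<epsilon>) \<Longrightarrow> v zs \<le> v y"
    using continuous_attains_inf[of "cball x (2 * \<epsilon>)" v] \<epsilon> by auto
  obtain z where z: "z \<in> N x" "zs \<in> N z" by (rule midpoint_N[OF x zs(1)]) (rule that)
  have zz: "V z \<le> v zs" using z N_X by (intro V_le) auto
  have yz: "v zs \<le> V y" if y: "y \<in> N x" for y
  proof -
    obtain w where "w \<in> N y" "V y = v w" by (rule V_attained[of y]) (use y N_X that in auto)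
    then show ?thesis using N_N_D(2)[OF x y] zs(2)[of w] by auto
  qed
  have yx: "V y \<le> v x" if y: "y \<in> N x" for y using y N_X N_N_D(3)[OF x y] by (intro V_le) auto
  obtain w where w: "w \<in> N x" "V x = v w" by (rule V_attained[OF xX]) (rule that)
  have wb: "w \<in> cball x \<epsilon>" using w N_D(1)[OF x] by simp
  then have w2: "w \<in> cball x (2 * \<epsilon>)" using \<epsilon> by auto
  have "- v w \<le> - v x + (- v zs - - v x) * (dist x w / (2 * \<epsilon>)) powr 1"
    by (rule cone_aboveD[OF cone_v _ D_sub[OF x] _ w2]) (use \<epsilon> zs(2) in auto)
  also have "\<dots> \<le> - v x + (- v zs - - v x) * 2 powr (- 1)"
    using zs(2)[of x] \<epsilon> dist_half_powr[OF wb, of 1] by (intro add_left_mono mult_left_mono) auto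
  also have "\<dots> = - v x + (v x - v zs) / 2" by (simp add: powr_minus_divide)
  finally have Vx: "v x + v zs \<le> 2 * V x" using w(2) by (simp add: field_simps)
  show ?thesis
  proof (intro bexI[OF _ z(1)] conjI ballI)
    fix y assume y: "y \<in> N x"
    show "V z \<le> V y" using zz yz[OF y] by simp
    show "V y + V z \<le> 2 * V x" using zz yx[OF y] Vx by simp
  next
    show "v x - V x \<le> V x - V z" using zz Vx by simp
  qed
qed

lemma boundary_near: assumes x: "x \<in> X" "x \<notin> D" obtains z where "z \<in> frontier \<Omega>" "dist x z \<le> 2 * \<epsilon>"
proof (cases "x \<in> \<Omega>")
  case True
  have "cball x (2 * \<epsilon>) \<inter> frontier \<Omega> \<noteq> {}"
  proof (rule connected_Int_frontier)
    show "connected (cball x (2 * \<epsilon>))" by (simp add: convex_connected)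
    show "cball x (2 * \<epsilon>) \<inter> \<Omega> \<noteq> {}" using True \<epsilon> by (auto simp: disjoint_iff intro!: exI[of _ x])
    show "cball x (2 * \<epsilon>) - \<Omega> \<noteq> {}" using x(2) by (auto simp: D_def)
  qed
  then show ?thesis using that by auto
next
  case False
  then have "x \<in> frontier \<Omega>" using x(1) \<Omega>(1) by (simp add: frontier_def X_def interior_open)
  then show ?thesis using that[of x] \<epsilon> by simp
qed

lemma eps_powr: "\<epsilon> \<le> \<epsilon> powr \<alpha>" "(3 * \<epsilon>) powr \<alpha> \<le> 3 * \<epsilon> powr \<alpha>"
proof -
  have "\<epsilon> powr 1 \<le> \<epsilon> powr \<alpha>" using \<alpha> \<epsilon> by (intro powr_mono') auto
  then show "\<epsilon> \<le> \<epsilon> powr \<alpha>" using \<epsilon> by simp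
  have "3 powr \<alpha> \<le> 3 powr (1::real)" using \<alpha> by (intro powr_mono) auto
  then show "(3 * \<epsilon>) powr \<alpha> \<le> 3 * \<epsilon> powr \<alpha>" using \<epsilon> by (simp add: powr_mult mult_right_mono)
qed

text \<open>A point outside \<open>D\<close> is within 2 \<epsilon> of the frontier, so the points
  realising \<open>U\<close> and \<open>V\<close> are within 3 \<epsilon> of one common frontier
  point. The factor 3 is both the Lipschitz factor and a bound for
  \<open>3 powr \<alpha>\<close>.\<close>

lemma boundary_layer: assumes x: "x \<in> X" "x \<notin> D" shows "U x - V x \<le> m + 3 * (A + L) * \<epsilon> powr \<alpha>"
proof -
  obtain z where z: "z \<in> frontier \<Omega>" "dist x z \<le> 2 * \<epsilon>" by (rule boundary_near[OF x]) (rule that)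
  have zX: "z \<in> X" using z(1) by (simp add: X_def frontier_def)
  obtain w where w: "w \<in> N x" "U x = u w" by (rule U_attained[OF x(1)]) (rule that)
  obtain w' where w': "w' \<in> N x" "V x = v w'" by (rule V_attained[OF x(1)]) (rule that)
  have d: "dist y z \<le> 3 * \<epsilon>" "y \<in> X" if "y \<in> N x" for y
    using that dist_triangle[of y z x] z(2) by (auto simp: N_def dist_commute)
  have "dist w z powr \<alpha> \<le> (3 * \<epsilon>) powr \<alpha>" using d[OF w(1)] \<alpha> by (intro powr_mono2) auto
  then have "dist w z powr \<alpha> \<le> 3 * \<epsilon> powr \<alpha>" using eps_powr(2) by linarith
  then have "A * dist w z powr \<alpha> \<le> A * (3 * \<epsilon> powr \<alpha>)" using A by (rule mult_left_mono)
  then have 1: "u w \<le> u z + A * (3 * \<epsilon> powr \<alpha>)" using hu[of w z] d(2)[OF w(1)] zX by (simp add: X_def abs_le_iff)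
  have "dist w' z \<le> 3 * \<epsilon> powr \<alpha>" using d(1)[OF w'(1)] eps_powr(1) by linarith
  then have "L * dist w' z \<le> L * (3 * \<epsilon> powr \<alpha>)" using L by (rule mult_left_mono)
  then have 2: "v w' \<ge> v z - L * (3 * \<epsilon> powr \<alpha>)" using hv[of w' z] d(2)[OF w'(1)] zX by (simp add: X_def abs_le_iff)
  show ?thesis using 1 2 bd[OF z(1)] w(2) w'(2) by (simp add: algebra_simps)
qed

text \<open>\<open>V'\<close> is any supersolution with slope \<open>s\<close> that agrees with
  \<open>V\<close> off \<open>D\<close>. The three losses are the boundary layer, the concave
  correction (at most \<open>\<delta> * B\<^sup>2\<close>) and the distance \<open>e1\<close> of
  \<open>V'\<close> above \<open>V\<close>; the last condition on \<open>\<delta>\<close> says that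
  the margin beats the error of \<open>U\<close>.\<close>

lemma estimate:
  assumes V': "slope_super D N s V'" "s > 0" "\<And>x. x \<in> X \<Longrightarrow> x \<notin> D \<Longrightarrow> V' x = V x"
      "\<And>x. x \<in> X \<Longrightarrow> V' x \<le> V x + e1" "\<And>x. x \<in> X \<Longrightarrow> \<bar>V' x\<bar> \<le> B"
    and \<delta>: "\<delta> > 0" "2 * \<delta> * B \<le> 1" "2 * \<tau> * A * \<epsilon> powr \<alpha> < \<delta> * s\<^sup>2" and x: "x \<in> X"
  shows "u x - v x \<le> m + 3 * (A + L) * \<epsilon> powr \<alpha> + \<delta> * B\<^sup>2 + e1"
proof -
  have DX: "D \<subseteq> X" using N_D(2) \<Omega>X by blast
  define W where "W x = V' x - \<delta> * (V' x)\<^sup>2" for x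
  obtain \<eta>' where \<eta>': "\<eta>' > 2 * \<tau> * A * \<epsilon> powr \<alpha>" "\<And>x. x \<in> D \<Longrightarrow> \<exists>z\<in>N x. \<forall>y\<in>N x. W y + W z - 2 * W x \<le> - \<eta>'"
    using slope_super_strict[OF V'(1,2) \<delta>(1,2) _ \<delta>(3)] V'(5) DX unfolding W_def by blast
  have sq: "0 \<le> \<delta> * (V' y)\<^sup>2" "\<delta> * (V' y)\<^sup>2 \<le> \<delta> * B\<^sup>2" if "y \<in> X" for y
  proof -
    have "\<bar>V' y\<bar>\<^sup>2 \<le> B\<^sup>2" using V'(5)[OF that] by (intro power_mono) auto
    then show "0 \<le> \<delta> * (V' y)\<^sup>2" "\<delta> * (V' y)\<^sup>2 \<le> \<delta> * B\<^sup>2" using \<delta>(1) by auto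
  qed
  have "compact (u ` X)" unfolding X_def using cu \<Omega>(2) by (intro compact_continuous_image) auto
  then obtain Bu where Bu: "\<forall>y\<in>u ` X. norm y \<le> Bu" using compact_imp_bounded bounded_iff by blast
  have Ub: "U y \<le> Bu" if y: "y \<in> X" for y
  proof -
    obtain w where "w \<in> N y" "U y = u w" by (rule U_attained[OF y]) (rule that)
    then show ?thesis using Bu N_X by (force simp: abs_le_iff)
  qed
  have "U x - W x \<le> m + 3 * (A + L) * \<epsilon> powr \<alpha> + \<delta> * B\<^sup>2"
  proof (rule discrete_comparison[where D=D and N=N and X=X, OF _ DX _ U_sub \<eta>'(2) \<eta>'(1) _ x])
    show "N y \<subseteq> X" for y by (rule N_X)
    fix y assume y: "y \<in> X"
    show "U y - W y \<le> Bu + B + \<delta> * B\<^sup>2" using Ub[OF y] sq[OF y] V'(5)[OF y] by (simp add: W_def abs_le_iff)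
    assume "y \<notin> D"
    then show "U y - W y \<le> m + 3 * (A + L) * \<epsilon> powr \<alpha> + \<delta> * B\<^sup>2"
      using boundary_layer[OF y] V'(3)[OF y] sq[OF y] by (simp add: W_def)
  qed
  moreover have "u x \<le> U x" "V x \<le> v x" using U_ge[OF x self_N[OF x]] V_le[OF x self_N[OF x]] .
  ultimately show ?thesis using V'(4)[OF x] sq(1)[OF x] by (simp add: W_def)
qed

text \<open>Walks straight along a basis vector in steps of length \<epsilon>; once the displacement
  exceeds the diameter the path has left \<Omega>, hence \<open>D\<close>.\<close>

lemma exit_path:
  assumes x: "x \<in> D" and n: "diameter \<Omega> < real n * \<epsilon>"
  shows "\<exists>p. p 0 = x \<and> (\<forall>i. p i \<in> D \<longrightarrow> p (Suc i) \<in> N (p i)) \<and> (\<exists>k\<le>n. p k \<notin> D)"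
proof -
  obtain b :: 'a where b: "b \<in> Basis" by (meson nonempty_Basis ex_in_conv)
  let ?p = "\<lambda>i. x + (real i * \<epsilon>) *\<^sub>R b"
  have "?p n \<notin> D"
  proof
    assume "?p n \<in> D"
    then have "dist (?p n) x \<le> diameter \<Omega>" using N_D(2) x by (intro diameter_bounded_bound \<Omega>(2)) auto
    then show False using n \<epsilon> b by (simp add: dist_norm)
  qed
  moreover have "?p (Suc i) \<in> N (?p i)" if "?p i \<in> D" for i
  proof -
    have "?p i - ?p (Suc i) = (- \<epsilon>) *\<^sub>R b" by (simp add: algebra_simps)
    then have "dist (?p i) (?p (Suc i)) = \<epsilon>" unfolding dist_norm using \<epsilon> b by simp
    then show ?thesis using N_D(1)[OF that] by simp
  qed
  ultimately show ?thesis by (intro exI[of _ ?p]) auto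
qed

text \<open>Uses \<open>s = \<epsilon> powr \<alpha> * \<epsilon>\<close> and
  \<open>\<delta> = 4 * A * \<epsilon> powr \<alpha>\<close>. Then
  \<open>s\<^sup>2 \<ge> \<tau>\<close> is the hypothesis on \<epsilon>, the factor 4 against 2
  makes the margin strict, and about diameter / \<epsilon> patching steps cost a multiple of
  \<epsilon>^\<alpha>. \<open>A1\<close> keeps \<open>\<delta>\<close> positive.\<close>

lemma estimate_general:
  assumes \<epsilon>\<tau>: "\<epsilon> powr (2 * \<alpha> + 2) \<ge> \<tau>" and A1: "A \<ge> 1"
    and small: "8 * A * \<epsilon> powr \<alpha> * (L + 2 * (diameter \<Omega> + 2)) \<le> 1" and x: "x \<in> X"
  shows "u x - v x \<le> m + (3 * (A + L) + 4 * A * (L + 2 * (diameter \<Omega> + 2))\<^sup>2 + 2 * (diameter \<Omega> + 2)) * \<epsilon> powr \<alpha>"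
proof -
  define n where "n = nat \<lfloor>diameter \<Omega> / \<epsilon>\<rfloor> + 1"
  have d0: "diameter \<Omega> \<ge> 0" using \<Omega>(2) by (rule diameter_ge_0)
  have fl: "real (nat \<lfloor>diameter \<Omega> / \<epsilon>\<rfloor>) \<le> diameter \<Omega> / \<epsilon>" "diameter \<Omega> / \<epsilon> < real (nat \<lfloor>diameter \<Omega> / \<epsilon>\<rfloor>) + 1"
  proof -
    have "real (nat \<lfloor>diameter \<Omega> / \<epsilon>\<rfloor>) = of_int \<lfloor>diameter \<Omega> / \<epsilon>\<rfloor>" using d0 \<epsilon> by simp
    then show "real (nat \<lfloor>diameter \<Omega> / \<epsilon>\<rfloor>) \<le> diameter \<Omega> / \<epsilon>" "diameter \<Omega> / \<epsilon> < real (nat \<lfloor>diameter \<Omega> / \<epsilon>\<rfloor>) + 1"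
      by linarith+
  qed
  have n1: "diameter \<Omega> < real n * \<epsilon>" using fl(2) \<epsilon> by (simp add: n_def field_simps)
  have n2: "real n * \<epsilon> \<le> diameter \<Omega> + 2"
  proof -
    have "real n * \<epsilon> \<le> (diameter \<Omega> / \<epsilon> + 1) * \<epsilon>" unfolding n_def using fl(1) \<epsilon> by (intro mult_right_mono) auto
    also have "\<dots> = diameter \<Omega> + \<epsilon>" using \<epsilon> by (simp add: field_simps)
    finally show ?thesis using \<epsilon> by linarith
  qed
  define g where "g = \<epsilon> powr \<alpha>"
  have g: "0 < g" "g \<le> 1" unfolding g_def using \<epsilon> \<alpha> by (auto intro: powr_le1)
  define s where "s = g * \<epsilon>"
  have s: "s > 0" using g \<epsilon> by (simp add: s_def)
  have DX: "D \<subseteq> X" using N_D(2) \<Omega>X by blast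
  have sup: "\<exists>z\<in>N y. \<forall>w\<in>N y. V z \<le> V w \<and> V w + V z \<le> 2 * V y" if "y \<in> D" for y using V_super[OF that] by blast
  obtain V' where V': "\<And>x. x \<in> X \<Longrightarrow> x \<notin> D \<Longrightarrow> V' x = V x" "\<And>x. x \<in> X \<Longrightarrow> V x \<le> V' x"
    "\<And>x. x \<in> X \<Longrightarrow> V' x \<le> V x + 2 * real n * s" "slope_super D N s V'"
    by (rule slope_patching[OF N_X DX N_N_D(3) sup exit_path[OF _ n1] s]) (assumption+, rule that)
  have e1: "2 * real n * s \<le> g * (2 * (diameter \<Omega> + 2))"
  proof -
    have "g * (2 * (real n * \<epsilon>)) \<le> g * (2 * (diameter \<Omega> + 2))" using n2 g by (intro mult_left_mono) auto
    then show ?thesis by (simp add: s_def mult_ac)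
  qed
  let ?B = "L + 2 * (diameter \<Omega> + 2)"
  have "g * (2 * (diameter \<Omega> + 2)) \<le> 1 * (2 * (diameter \<Omega> + 2))" using g d0 by (intro mult_right_mono) auto
  then have e2: "2 * real n * s \<le> 2 * (diameter \<Omega> + 2)" using e1 by linarith
  have B: "\<bar>V' y\<bar> \<le> ?B" if y: "y \<in> X" for y
    using V'(2,3)[OF y] V_bound[OF y] e2 d0 by (simp only: abs_le_iff) linarith
  have "2 * \<tau> * A * g < 4 * A * g * s\<^sup>2"
  proof -
    have "\<epsilon> powr (2 * \<alpha> + 2) = s\<^sup>2"
      unfolding s_def g_def using \<epsilon> by (simp add: powr_add power_mult_distrib powr_powr mult.commute flip: powr_numeral)
    then have "\<tau> \<le> s\<^sup>2" using \<epsilon>\<tau> by simp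
    then have "2 * A * g * \<tau> \<le> 2 * A * g * s\<^sup>2" using A1 g by (intro mult_left_mono) auto
    also have "\<dots> < 4 * A * g * s\<^sup>2" using A1 g s by simp
    finally show ?thesis by (simp add: mult_ac)
  qed
  then have "u x - v x \<le> m + 3 * (A + L) * \<epsilon> powr \<alpha> + (4 * A * g) * ?B\<^sup>2 + 2 * real n * s"
    using A1 g small by (intro estimate[OF V'(4) s V'(1,3) B _ _ _ x]) (auto simp: g_def)
  also have "\<dots> \<le> m + 3 * (A + L) * \<epsilon> powr \<alpha> + (4 * A * g) * ?B\<^sup>2 + g * (2 * (diameter \<Omega> + 2))" using e1 by simp
  finally show ?thesis by (simp add: g_def algebra_simps)
qed

text \<open>\<open>V\<close> itself has slope \<open>\<gamma> * \<epsilon>\<close>, so no patching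
  is required. With \<open>\<delta> = 4 * A * \<epsilon> powr \<alpha> / \<gamma>\<^sup>2\<close>
  the margin no longer involves \<open>\<gamma>\<close>, and the balance improves to
  \<open>\<epsilon>\<^sup>2 \<ge> \<tau>\<close>.\<close>

lemma estimate_slope:
  assumes \<epsilon>\<tau>: "\<epsilon>\<^sup>2 \<ge> \<tau>" and A1: "A \<ge> 1" and \<gamma>: "\<gamma> > 0"
    and slope: "\<And>y. cball y \<epsilon> \<subseteq> \<Omega> \<Longrightarrow> \<exists>z\<in>cball y \<epsilon>. v y - v z \<ge> \<gamma> * \<epsilon>"
    and small: "8 * A * \<epsilon> powr \<alpha> * L \<le> \<gamma>\<^sup>2" and x: "x \<in> X"
  shows "u x - v x \<le> m + (3 * (A + L) + 4 * A * L\<^sup>2 / \<gamma>\<^sup>2) * \<epsilon> powr \<alpha>"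
proof -
  define g where "g = \<epsilon> powr \<alpha>"
  have g: "0 < g" unfolding g_def using \<epsilon> by simp
  have ss: "slope_super D N (\<gamma> * \<epsilon>) V" unfolding slope_super_def
  proof (intro allI impI ballI)
    fix \<kappa> :: real and y assume \<kappa>: "\<kappa> > 0" and y: "y \<in> D"
    have yX: "y \<in> X" using N_D(2)[OF y] \<Omega>X by blast
    obtain z where z: "z \<in> N y" "\<And>w. w \<in> N y \<Longrightarrow> V w + V z \<le> 2 * V y" "v y - V y \<le> V y - V z" using V_super[OF y] by blast
    obtain z' where "z' \<in> N y" "v y - v z' \<ge> \<gamma> * \<epsilon>" using slope[of y] N_D(1,3)[OF y] by auto
    then have "v y - V y \<ge> \<gamma> * \<epsilon>" using V_le[OF yX, of z'] by linarith
    then show "\<exists>z\<in>N y. V y - V z \<ge> \<gamma> * \<epsilon> - \<kappa> \<and> (\<forall>w\<in>N y. V w + V z \<le> 2 * V y + \<kappa>)"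
      using z \<kappa> by (intro bexI[of _ z]) force+
  qed
  have 1: "2 * \<tau> * A * \<epsilon> powr \<alpha> < (4 * A * g / \<gamma>\<^sup>2) * (\<gamma> * \<epsilon>)\<^sup>2"
  proof -
    have "2 * A * g * \<tau> \<le> 2 * A * g * \<epsilon>\<^sup>2" using A1 g \<epsilon>\<tau> by (intro mult_left_mono) auto
    also have "\<dots> < 4 * A * g * \<epsilon>\<^sup>2" using A1 g \<epsilon> by simp
    finally show ?thesis using \<gamma> by (simp add: power_mult_distrib mult_ac g_def)
  qed
  have 2: "2 * (4 * A * g / \<gamma>\<^sup>2) * L \<le> 1" using small \<gamma> by (simp add: g_def pos_divide_le_eq)
  have "u x - v x \<le> m + 3 * (A + L) * \<epsilon> powr \<alpha> + (4 * A * g / \<gamma>\<^sup>2) * L\<^sup>2 + 0"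
    by (rule estimate[OF ss _ _ _ V_bound _ 2 1 x]) (use A1 g \<gamma> \<epsilon> in auto)
  then show ?thesis by (simp add: g_def algebra_simps)
qed

end

subsection \<open>Choice of the scale\<close>

text \<open>In dimension one \<tau> is zero and the optimal scale would be \<epsilon> = 0, which is
  not allowed. The estimate is then proved for all small positive parameters and the limit is
  taken.\<close>

lemma le_by_small_parameter:
  fixes a m C g0 g1 :: real
  assumes "\<And>g. 0 < g \<Longrightarrow> g0 \<le> g \<Longrightarrow> g \<le> g1 \<Longrightarrow> a \<le> m + C * g" "0 \<le> g0" "g0 \<le> g1" "0 < g1" "0 \<le> C"
  shows "a \<le> m + C * g0"
proof (cases "g0 = 0")
  case True
  have "a \<le> m + e" if e: "e > 0" for e
  proof -
    have "min g1 (e / (C + 1)) > 0" using assms e by simp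
    then have "a \<le> m + C * min g1 (e / (C + 1))" using assms(1) True by simp
    also have "C * min g1 (e / (C + 1)) \<le> C * (e / (C + 1))" using assms(5) by (intro mult_left_mono) auto
    also have "\<dots> \<le> e" using assms(5) e by (simp add: field_simps)
    finally show ?thesis by simp
  qed
  then have "a \<le> m" by (rule field_le_epsilon)
  then show ?thesis using True by simp
next
  case False
  then show ?thesis using assms by simp
qed

text \<open>The scale is parametrised by \<open>g\<close>, the value of \<epsilon>^\<alpha> and thus
  the order of the final error. The exponent \<open>\<kappa>\<close> is
  \<open>2 * \<alpha> + 2\<close> in general and 2 under a gradient bound.\<close>

lemma powr_scale:
  fixes g \<alpha> \<kappa> \<tau> :: real
  assumes "0 < g" "g \<le> 1" "0 < \<alpha>" "0 < \<kappa>" "0 \<le> \<tau>" "\<tau> powr (\<alpha> / \<kappa>) \<le> g"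
  shows "0 < g powr (1 / \<alpha>)" "g powr (1 / \<alpha>) \<le> 1" "(g powr (1 / \<alpha>)) powr \<alpha> = g" "\<tau> \<le> (g powr (1 / \<alpha>)) powr \<kappa>"
proof -
  show "0 < g powr (1 / \<alpha>)" "g powr (1 / \<alpha>) \<le> 1" "(g powr (1 / \<alpha>)) powr \<alpha> = g"
    using assms by (auto simp: powr_powr intro: powr_le1)
  have "(\<tau> powr (\<alpha> / \<kappa>)) powr (\<kappa> / \<alpha>) \<le> g powr (\<kappa> / \<alpha>)" using assms by (intro powr_mono2) auto
  moreover have "(\<tau> powr (\<alpha> / \<kappa>)) powr (\<kappa> / \<alpha>) = \<tau>" using assms by (simp add: powr_powr)
  ultimately show "\<tau> \<le> (g powr (1 / \<alpha>)) powr \<kappa>" using assms by (simp add: powr_powr)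
qed

lemma p_minimizer_cone_above:
  fixes u :: "'a::euclidean_space \<Rightarrow> real"
  assumes "open \<Omega>" "bounded \<Omega>" "p > real DIM('a)" "p_minimizer \<Omega> p u G"
  shows "cone_above ((p - real DIM('a)) / (p - 1)) \<Omega> u"
  unfolding cone_above_def using p_minimizer_comparison[OF assms] by blast

lemma one_sided_estimates:
  fixes u v :: "'a::euclidean_space \<Rightarrow> real"
  assumes \<Omega>: "open \<Omega>" "bounded \<Omega>" "\<Omega> \<noteq> {}" and p: "p > real DIM('a)" and u: "p_minimizer \<Omega> p u G"
    and v: "continuous_on (closure \<Omega>) v" "cone_above 1 \<Omega> (\<lambda>x. - v x)"
    and \<alpha>: "0 < \<alpha>" "\<alpha> \<le> 1" and A: "A \<ge> 1" and L: "L \<ge> 0"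
    and hu: "\<And>x y. x \<in> closure \<Omega> \<Longrightarrow> y \<in> closure \<Omega> \<Longrightarrow> \<bar>u x - u y\<bar> \<le> A * dist x y powr \<alpha>"
    and hv: "\<And>x y. x \<in> closure \<Omega> \<Longrightarrow> y \<in> closure \<Omega> \<Longrightarrow> \<bar>v x - v y\<bar> \<le> L * dist x y"
    and vL: "\<And>x. x \<in> closure \<Omega> \<Longrightarrow> \<bar>v x\<bar> \<le> L"
    and bd: "\<And>x. x \<in> frontier \<Omega> \<Longrightarrow> u x - v x \<le> m"
    and x: "x \<in> closure \<Omega>"
  defines "\<tau> \<equiv> (real DIM('a) - 1) / (p - 1)" and "B \<equiv> L + 2 * (diameter \<Omega> + 2)"
  shows "\<tau> powr (\<alpha> / (2 * \<alpha> + 2)) \<le> min 1 (1 / (8 * A * B)) \<Longrightarrow>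
      u x - v x \<le> m + (3 * (A + L) + 4 * A * B\<^sup>2 + 2 * (diameter \<Omega> + 2)) * \<tau> powr (\<alpha> / (2 * \<alpha> + 2))"
    and "\<gamma> > 0 \<Longrightarrow> (\<And>y \<epsilon>. \<epsilon> > 0 \<Longrightarrow> cball y \<epsilon> \<subseteq> \<Omega> \<Longrightarrow> \<exists>z\<in>cball y \<epsilon>. v y - v z \<ge> \<gamma> * \<epsilon>) \<Longrightarrow>
      \<tau> powr (\<alpha> / 2) \<le> min 1 (\<gamma>\<^sup>2 / (8 * A * (L + 1))) \<Longrightarrow>
      u x - v x \<le> m + (3 * (A + L) + 4 * A * L\<^sup>2 / \<gamma>\<^sup>2) * \<tau> powr (\<alpha> / 2)"
proof -
  have D1: "real DIM('a) \<ge> 1" by (simp add: DIM_ge_Suc0)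
  with p have p1: "p > 1" by linarith
  have \<tau>: "\<tau> \<ge> 0" unfolding \<tau>_def using D1 p1 by (intro divide_nonneg_pos) auto
  have \<beta>: "(p - real DIM('a)) / (p - 1) = 1 - \<tau>" "0 < (p - real DIM('a)) / (p - 1)"
    using p p1 by (simp_all add: \<tau>_def field_simps)
  have d0: "diameter \<Omega> \<ge> 0" using \<Omega>(2) by (rule diameter_ge_0)
  have cu: "continuous_on (closure \<Omega>) u" using u by (simp add: p_minimizer_def)
  have B: "B > 0" using L d0 by (simp add: B_def)
  note A1 = A and L1 = L
  have ts: "two_scale \<Omega> u v ((p - real DIM('a)) / (p - 1)) \<tau> \<alpha> A L \<epsilon> m" if "0 < \<epsilon>" "\<epsilon> \<le> 1" for \<epsilon>
    by unfold_locales (use \<Omega> cu v p_minimizer_cone_above[OF \<Omega>(1,2) p u] \<beta> \<tau> \<alpha> A L that hu hv bd vL in auto)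
  show "u x - v x \<le> m + (3 * (A + L) + 4 * A * B\<^sup>2 + 2 * (diameter \<Omega> + 2)) * \<tau> powr (\<alpha> / (2 * \<alpha> + 2))"
    if small: "\<tau> powr (\<alpha> / (2 * \<alpha> + 2)) \<le> min 1 (1 / (8 * A * B))"
  proof (rule le_by_small_parameter[OF _ _ small])
    fix g assume g: "0 < g" "\<tau> powr (\<alpha> / (2 * \<alpha> + 2)) \<le> g" "g \<le> min 1 (1 / (8 * A * B))"
    have g1: "g \<le> 1" "g \<le> 1 / (8 * A * B)" using g(3) by simp_all
    note e = powr_scale[OF g(1) g1(1) \<alpha>(1) _ \<tau> g(2)]
    interpret two_scale \<Omega> u v "(p - real DIM('a)) / (p - 1)" \<tau> \<alpha> A L "g powr (1 / \<alpha>)" m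
      by (rule ts) (use e \<alpha> in auto)
    have "8 * A * B > 0" using A1 B by (intro mult_pos_pos) auto
    then have "g * (8 * A * B) \<le> 1" using g1(2) by (simp only: pos_le_divide_eq)
    then have "8 * A * g * B \<le> 1" by (simp add: mult_ac)
    then show "u x - v x \<le> m + (3 * (A + L) + 4 * A * B\<^sup>2 + 2 * (diameter \<Omega> + 2)) * g"
      using estimate_general[OF _ A1 _, of x] e \<alpha> x by (simp add: X_def B_def)
  qed (use A B L d0 in auto)
  show "u x - v x \<le> m + (3 * (A + L) + 4 * A * L\<^sup>2 / \<gamma>\<^sup>2) * \<tau> powr (\<alpha> / 2)"
    if \<gamma>: "\<gamma> > 0" and slope: "\<And>y \<epsilon>. \<epsilon> > 0 \<Longrightarrow> cball y \<epsilon> \<subseteq> \<Omega> \<Longrightarrow> \<exists>z\<in>cball y \<epsilon>. v y - v z \<ge> \<gamma> * \<epsilon>"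
      and small: "\<tau> powr (\<alpha> / 2) \<le> min 1 (\<gamma>\<^sup>2 / (8 * A * (L + 1)))"
  proof (rule le_by_small_parameter[OF _ _ small])
    fix g assume g: "0 < g" "\<tau> powr (\<alpha> / 2) \<le> g" "g \<le> min 1 (\<gamma>\<^sup>2 / (8 * A * (L + 1)))"
    have g1: "g \<le> 1" "g \<le> \<gamma>\<^sup>2 / (8 * A * (L + 1))" using g(3) by simp_all
    note e = powr_scale[OF g(1) g1(1) \<alpha>(1) _ \<tau> g(2)]
    interpret two_scale \<Omega> u v "(p - real DIM('a)) / (p - 1)" \<tau> \<alpha> A L "g powr (1 / \<alpha>)" m
      by (rule ts) (use e \<alpha> in auto)
    have "8 * A * (L + 1) > 0" using A1 L1 by (intro mult_pos_pos) auto
    then have "g * (8 * A * (L + 1)) \<le> \<gamma>\<^sup>2" using g1(2) by (simp only: pos_le_divide_eq)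
    moreover have "8 * A * g * L \<le> g * (8 * A * (L + 1))" using A g(1) by (simp add: algebra_simps)
    ultimately have s: "8 * A * (g powr (1 / \<alpha>)) powr \<alpha> * L \<le> \<gamma>\<^sup>2" using e(3) by simp
    have t: "\<tau> \<le> (g powr (1 / \<alpha>))\<^sup>2" using e(4) e(1) by (simp add: powr_numeral)
    have "u x - v x \<le> m + (3 * (A + L) + 4 * A * L\<^sup>2 / \<gamma>\<^sup>2) * (g powr (1 / \<alpha>)) powr \<alpha>"
      by (rule estimate_slope[OF t A1 \<gamma> slope s]) (use e(1) x in \<open>auto simp: X_def\<close>)
    then show "u x - v x \<le> m + (3 * (A + L) + 4 * A * L\<^sup>2 / \<gamma>\<^sup>2) * g" using e(3) by simp
  qed (use A L \<gamma> in auto)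
qed

section \<open>From extended-real norms to real bounds, and the two final estimates\<close>

lemma holder_seminorm_bound:
  assumes "holder_seminorm S \<alpha> u \<le> ereal A" "x \<in> S" "y \<in> S"
  shows "\<bar>u x - u y\<bar> \<le> A * dist x y powr \<alpha>"
proof (cases "x = y")
  case False
  have "ereal (\<bar>u x - u y\<bar> / norm (x - y) powr \<alpha>) \<le> holder_seminorm S \<alpha> u"
    unfolding holder_seminorm_def by (rule SUP_upper2[of "(x, y)"]) (use assms False in auto)
  then have "\<bar>u x - u y\<bar> / norm (x - y) powr \<alpha> \<le> A" using assms(1) by (metis ereal_less_eq(3) order_trans)
  then show ?thesis using False by (simp add: pos_divide_le_eq dist_norm)
qed simp

text \<open>Shows that the norm fed to the constants is a genuine real number, so that
  \<open>real_of_ereal\<close> recovers it, and that this number bounds both the values and the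
  Lipschitz quotients.\<close>

lemma holder_norm_Lipschitz:
  fixes \<Omega> :: "'a::euclidean_space set"
  assumes \<Omega>: "open \<Omega>" "bounded \<Omega>" "\<Omega> \<noteq> {}" and cu: "continuous_on (closure \<Omega>) u"
    and K: "\<And>x y. x \<in> closure \<Omega> \<Longrightarrow> y \<in> closure \<Omega> \<Longrightarrow> \<bar>u x - u y\<bar> \<le> K * dist x y"
  obtains l where "l \<ge> 0" "holder_norm (closure \<Omega>) 1 u = ereal l" "\<And>x. x \<in> closure \<Omega> \<Longrightarrow> \<bar>u x\<bar> \<le> l"
    "\<And>x y. x \<in> closure \<Omega> \<Longrightarrow> y \<in> closure \<Omega> \<Longrightarrow> \<bar>u x - u y\<bar> \<le> l * dist x y"
proof -
  let ?S = "closure \<Omega>"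
  obtain x0 where x0: "x0 \<in> \<Omega>" using \<Omega>(3) by blast
  obtain e where e: "e > 0" "cball x0 e \<subseteq> \<Omega>" using \<Omega>(1) x0 open_contains_cball by blast
  obtain b :: 'a where b: "norm b = e" using vector_choose_size[of e] e(1) by auto
  \<comment> \<open>A second point of \<Omega> is required because the seminorm over an empty set of
    pairs would be minus infinity.\<close>
  have x1: "x0 + b \<in> \<Omega>" "x0 + b \<noteq> x0" using b e by (auto simp: subset_eq dist_norm)
  have S: "x0 \<in> ?S" "x0 + b \<in> ?S" using x0 x1(1) closure_subset by blast+
  have "compact (u ` ?S)" using cu \<Omega>(2) by (intro compact_continuous_image) auto
  then obtain B where B: "\<forall>y\<in>u ` ?S. norm y \<le> B" using compact_imp_bounded bounded_iff by blast
  have s1: "sup_norm_on ?S u \<le> ereal B" unfolding sup_norm_on_def using B by (intro SUP_least) auto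
  have s2: "holder_seminorm ?S 1 u \<le> ereal K" unfolding holder_seminorm_def
  proof (intro SUP_least, clarify)
    fix x y assume a: "x \<in> ?S" "y \<in> ?S" "x \<noteq> y"
    then show "ereal (\<bar>u x - u y\<bar> / norm (x - y) powr 1) \<le> ereal K"
      using K[OF a(1,2)] by (simp add: pos_divide_le_eq dist_norm)
  qed
  have n1: "0 \<le> sup_norm_on ?S u" unfolding sup_norm_on_def by (rule SUP_upper2[OF S(1)]) simp
  have n2: "0 \<le> holder_seminorm ?S 1 u" unfolding holder_seminorm_def
    by (rule SUP_upper2[of "(x0 + b, x0)"]) (use S x1 in auto)
  obtain a c where ac: "sup_norm_on ?S u = ereal a" "holder_seminorm ?S 1 u = ereal c"
    using s1 s2 n1 n2 by (cases "sup_norm_on ?S u"; cases "holder_seminorm ?S 1 u") auto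
  have nn: "0 \<le> a" "0 \<le> c" using n1 n2 ac by auto
  show ?thesis
  proof (rule that[of "a + c"])
    show "0 \<le> a + c" using nn by simp
    show "holder_norm ?S 1 u = ereal (a + c)" by (simp add: holder_norm_def ac)
    show "\<bar>u x\<bar> \<le> a + c" if "x \<in> ?S" for x
    proof -
      have "ereal \<bar>u x\<bar> \<le> sup_norm_on ?S u" unfolding sup_norm_on_def by (rule SUP_upper[OF that])
      then show ?thesis using ac nn by simp
    qed
    show "\<bar>u x - u y\<bar> \<le> (a + c) * dist x y" if "x \<in> ?S" "y \<in> ?S" for x y
    proof -
      have "\<bar>u x - u y\<bar> \<le> c * dist x y powr 1" by (rule holder_seminorm_bound[OF _ that]) (simp add: ac)
      also have "\<dots> = c * dist x y" by simp
      also have "\<dots> \<le> (a + c) * dist x y" using nn by (intro mult_right_mono) auto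
      finally show ?thesis .
    qed
  qed
qed

lemma ess_inf_on_AE:
  assumes "ess_inf_on \<Omega> f = ereal \<gamma>"
  shows "AE x in lebesgue_on \<Omega>. f x \<ge> \<gamma>"
proof -
  have "esssup (lebesgue_on \<Omega>) (\<lambda>x. - ereal (f x)) = - ereal \<gamma>"
    using assms unfolding ess_inf_on_def by (metis ereal_uminus_uminus)
  moreover have "AE x in lebesgue_on \<Omega>. - ereal (f x) \<le> esssup (lebesgue_on \<Omega>) (\<lambda>x. - ereal (f x))" by (rule esssup_AE)
  ultimately show ?thesis by simp
qed

text \<open>The exponents vary with \<open>p\<close> but stay above 1/2 once
  \<open>p \<ge> 2 * d\<close>. A base of at most 1 makes a power with a larger exponent smaller, so
  the fixed exponent \<open>c\<close> gives a uniform bound.\<close>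

lemma eventually_rate_small:
  fixes \<alpha> :: "real \<Rightarrow> real" and d c e :: real
  assumes d: "d \<ge> 1" and \<alpha>: "\<And>p. p > d \<Longrightarrow> 1 - d / p \<le> \<alpha> p" and e: "e > 0" and c: "c > 0"
    and w: "\<And>a. a \<ge> 1 / 2 \<Longrightarrow> w a \<ge> c"
  shows "\<forall>\<^sub>F p in at_top. ((d - 1) / (p - 1)) powr w (\<alpha> p) \<le> e"
proof -
  have "((\<lambda>p. (d - 1) / (p - 1)) \<longlongrightarrow> 0) at_top" by real_asymp
  then have "((\<lambda>p. ((d - 1) / (p - 1)) powr c) \<longlongrightarrow> 0 powr c) at_top"
  proof (rule tendsto_powr2)
    show "\<forall>\<^sub>F p in at_top. 0 \<le> (d - 1) / (p - 1)"
      using eventually_gt_at_top[of 1] by eventually_elim (use d in auto)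
  qed (use c in auto)
  then have "\<forall>\<^sub>F p in at_top. ((d - 1) / (p - 1)) powr c < e" using e c by (intro order_tendstoD(2)) auto
  moreover have "\<forall>\<^sub>F p in at_top. p \<ge> 2 * d" by (rule eventually_ge_at_top)
  ultimately show ?thesis
  proof eventually_elim
    case (elim p)
    have "d / p \<le> 1 / 2" using elim(2) d by (simp add: field_simps)
    then have "\<alpha> p \<ge> 1 / 2" using \<alpha>[of p] elim(2) d by linarith
    then have "((d - 1) / (p - 1)) powr w (\<alpha> p) \<le> ((d - 1) / (p - 1)) powr c"
      using elim(2) d by (intro powr_mono' w) (auto simp: field_simps)
    then show ?case using elim(1) by linarith
  qed
qed

lemma two_sided_estimates:
  fixes u v :: "'a::euclidean_space \<Rightarrow> real"
  assumes \<Omega>: "open \<Omega>" "bounded \<Omega>" "\<Omega> \<noteq> {}" and p: "p > real DIM('a)" and u: "p_minimizer \<Omega> p u G"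
    and v: "continuous_on (closure \<Omega>) v" "cone_above 1 \<Omega> v" "cone_above 1 \<Omega> (\<lambda>x. - v x)"
    and \<alpha>: "0 < \<alpha>" "\<alpha> \<le> 1" and A: "A \<ge> 1" and L: "L \<ge> 0"
    and hu: "\<And>x y. x \<in> closure \<Omega> \<Longrightarrow> y \<in> closure \<Omega> \<Longrightarrow> \<bar>u x - u y\<bar> \<le> A * dist x y powr \<alpha>"
    and hv: "\<And>x y. x \<in> closure \<Omega> \<Longrightarrow> y \<in> closure \<Omega> \<Longrightarrow> \<bar>v x - v y\<bar> \<le> L * dist x y"
    and vL: "\<And>x. x \<in> closure \<Omega> \<Longrightarrow> \<bar>v x\<bar> \<le> L"
    and bd: "\<And>x. x \<in> frontier \<Omega> \<Longrightarrow> \<bar>u x - v x\<bar> \<le> m"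
    and x: "x \<in> closure \<Omega>"
  defines "\<tau> \<equiv> (real DIM('a) - 1) / (p - 1)" and "B \<equiv> L + 2 * (diameter \<Omega> + 2)"
  shows "\<tau> powr (\<alpha> / (2 * \<alpha> + 2)) \<le> min 1 (1 / (8 * A * B)) \<Longrightarrow>
      \<bar>u x - v x\<bar> \<le> m + (3 * (A + L) + 4 * A * B\<^sup>2 + 2 * (diameter \<Omega> + 2)) * \<tau> powr (\<alpha> / (2 * \<alpha> + 2))"
    and "\<gamma> > 0 \<Longrightarrow> has_weak_gradient \<Omega> v F \<Longrightarrow> (AE y in lebesgue_on \<Omega>. norm (F y) \<ge> \<gamma>) \<Longrightarrow>
      \<tau> powr (\<alpha> / 2) \<le> min 1 (\<gamma>\<^sup>2 / (8 * A * (L + 1))) \<Longrightarrow>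
      \<bar>u x - v x\<bar> \<le> m + (3 * (A + L) * L\<^sup>2 + 4 * A * L\<^sup>2 + 1) / \<gamma>\<^sup>2 * \<tau> powr (\<alpha> / 2)"
proof -
  have v': "continuous_on (closure \<Omega>) (\<lambda>x. - v x)" "cone_above 1 \<Omega> (\<lambda>x. - (- v x))" using v by (auto intro: continuous_on_minus)
  have hu': "\<bar>- u x - - u y\<bar> \<le> A * dist x y powr \<alpha>" if "x \<in> closure \<Omega>" "y \<in> closure \<Omega>" for x y
    using hu[OF that] by (simp add: abs_minus_commute)
  have hv': "\<bar>- v x - - v y\<bar> \<le> L * dist x y" if "x \<in> closure \<Omega>" "y \<in> closure \<Omega>" for x y
    using hv[OF that] by (simp add: abs_minus_commute)
  have vL': "\<bar>- v x\<bar> \<le> L" if "x \<in> closure \<Omega>" for x using vL[OF that] by simp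
  have b1: "u x - v x \<le> m" "- u x - - v x \<le> m" if "x \<in> frontier \<Omega>" for x using bd[OF that] by (simp_all add: abs_le_iff)
  show "\<bar>u x - v x\<bar> \<le> m + (3 * (A + L) + 4 * A * B\<^sup>2 + 2 * (diameter \<Omega> + 2)) * \<tau> powr (\<alpha> / (2 * \<alpha> + 2))"
    if small: "\<tau> powr (\<alpha> / (2 * \<alpha> + 2)) \<le> min 1 (1 / (8 * A * B))"
  proof -
    have "u x - v x \<le> m + (3 * (A + L) + 4 * A * B\<^sup>2 + 2 * (diameter \<Omega> + 2)) * \<tau> powr (\<alpha> / (2 * \<alpha> + 2))"
      unfolding \<tau>_def B_def
      by (rule one_sided_estimates(1)[OF \<Omega> p u v(1,3) \<alpha> A L hu hv vL b1(1) x small[unfolded \<tau>_def B_def]])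
    moreover have "- u x - - v x \<le> m + (3 * (A + L) + 4 * A * B\<^sup>2 + 2 * (diameter \<Omega> + 2)) * \<tau> powr (\<alpha> / (2 * \<alpha> + 2))"
      unfolding \<tau>_def B_def
      by (rule one_sided_estimates(1)[OF \<Omega> p p_minimizer_minus[OF u] v' \<alpha> A L hu' hv' vL' b1(2) x small[unfolded \<tau>_def B_def]])
    ultimately show ?thesis by linarith
  qed
  show "\<bar>u x - v x\<bar> \<le> m + (3 * (A + L) * L\<^sup>2 + 4 * A * L\<^sup>2 + 1) / \<gamma>\<^sup>2 * \<tau> powr (\<alpha> / 2)"
    if \<gamma>: "\<gamma> > 0" and F: "has_weak_gradient \<Omega> v F" "AE y in lebesgue_on \<Omega>. norm (F y) \<ge> \<gamma>"
      and small: "\<tau> powr (\<alpha> / 2) \<le> min 1 (\<gamma>\<^sup>2 / (8 * A * (L + 1)))"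
  proof -
    have cv: "continuous_on \<Omega> v" "continuous_on \<Omega> (\<lambda>x. - v x)"
      using v(1) v'(1) closure_subset by (blast intro: continuous_on_subset)+
    have sl: "\<exists>z\<in>cball y \<epsilon>. v y - v z \<ge> \<gamma> * \<epsilon>" if "\<epsilon> > 0" "cball y \<epsilon> \<subseteq> \<Omega>" for y \<epsilon>
      by (rule ess_inf_gradient_slope[OF \<Omega>(1) cv(1) v(3) F that])
    have sl': "\<exists>z\<in>cball y \<epsilon>. - v y - - v z \<ge> \<gamma> * \<epsilon>" if "\<epsilon> > 0" "cball y \<epsilon> \<subseteq> \<Omega>" for y \<epsilon>
      by (rule ess_inf_gradient_slope[OF \<Omega>(1) cv(2) v'(2) has_weak_gradient_minus[OF F(1)] _ that]) (use F(2) in simp)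
    \<comment> \<open>This bound moves the part of the error without \<open>\<gamma>\<close> under
      the common denominator \<open>\<gamma>\<^sup>2\<close>, with a numerator free of
      \<open>\<gamma>\<close>:
      \<open>3 * (A + L) * \<gamma>\<^sup>2 \<le> 3 * (A + L) * L\<^sup>2\<close>.\<close>
    have \<gamma>L: "\<gamma> \<le> L"
    proof -
      obtain x0 where x0: "x0 \<in> \<Omega>" using \<Omega>(3) by blast
      obtain e where e: "e > 0" "cball x0 e \<subseteq> \<Omega>" using \<Omega>(1) x0 open_contains_cball by blast
      obtain z where z: "z \<in> cball x0 e" "v x0 - v z \<ge> \<gamma> * e" using sl[OF e] by blast
      have "x0 \<in> closure \<Omega>" "z \<in> closure \<Omega>" using x0 z(1) e(2) closure_subset by blast+
      from hv[OF this] have "v x0 - v z \<le> L * dist x0 z" by (simp add: abs_le_iff)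
      also have "\<dots> \<le> L * e" using z(1) L by (intro mult_left_mono) auto
      finally have "\<gamma> * e \<le> L * e" using z(2) by linarith
      then show ?thesis using e(1) by simp
    qed
    let ?g = "\<tau> powr (\<alpha> / 2)"
    have "3 * (A + L) * \<gamma>\<^sup>2 \<le> 3 * (A + L) * L\<^sup>2" using \<gamma>L \<gamma> A L by (intro mult_left_mono power_mono) auto
    then have "(3 * (A + L) * \<gamma>\<^sup>2 + 4 * A * L\<^sup>2) / \<gamma>\<^sup>2 \<le> (3 * (A + L) * L\<^sup>2 + 4 * A * L\<^sup>2 + 1) / \<gamma>\<^sup>2"
      by (intro divide_right_mono) auto
    moreover have "3 * (A + L) + 4 * A * L\<^sup>2 / \<gamma>\<^sup>2 = (3 * (A + L) * \<gamma>\<^sup>2 + 4 * A * L\<^sup>2) / \<gamma>\<^sup>2"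
      using \<gamma> by (simp add: add_divide_distrib)
    ultimately have "3 * (A + L) + 4 * A * L\<^sup>2 / \<gamma>\<^sup>2 \<le> (3 * (A + L) * L\<^sup>2 + 4 * A * L\<^sup>2 + 1) / \<gamma>\<^sup>2" by simp
    then have "(3 * (A + L) + 4 * A * L\<^sup>2 / \<gamma>\<^sup>2) * ?g \<le> (3 * (A + L) * L\<^sup>2 + 4 * A * L\<^sup>2 + 1) / \<gamma>\<^sup>2 * ?g"
      by (rule mult_right_mono) simp
    moreover have "u x - v x \<le> m + (3 * (A + L) + 4 * A * L\<^sup>2 / \<gamma>\<^sup>2) * ?g"
      unfolding \<tau>_def
      by (rule one_sided_estimates(2)[OF \<Omega> p u v(1,3) \<alpha> A L hu hv vL b1(1) x \<gamma> sl small[unfolded \<tau>_def]])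
    moreover have "- u x - - v x \<le> m + (3 * (A + L) + 4 * A * L\<^sup>2 / \<gamma>\<^sup>2) * ?g"
      unfolding \<tau>_def
      by (rule one_sided_estimates(2)[OF \<Omega> p p_minimizer_minus[OF u] v' \<alpha> A L hu' hv' vL' b1(2) x \<gamma> sl' small[unfolded \<tau>_def]])
    ultimately show ?thesis by linarith
  qed
qed

theorem theorem1:
  fixes \<Omega> :: "'a::euclidean_space set"
  assumes "open \<Omega>" "bounded \<Omega>" "connected \<Omega>" "\<Omega> \<noteq> {}"
  shows "\<exists>C1 C2 :: ereal \<Rightarrow> ereal \<Rightarrow> real.
    (\<forall>h l. C1 h l > 0 \<and> C2 h l > 0) \<and>
    (\<forall>(g :: real \<Rightarrow> 'a \<Rightarrow> real) (u :: real \<Rightarrow> 'a \<Rightarrow> real) (\<alpha> :: real \<Rightarrow> real)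
      (ginf :: 'a \<Rightarrow> real) (uinf :: 'a \<Rightarrow> real) (H :: ereal).
      (\<forall>p>real DIM('a). in_W1p \<Omega> p (g p) \<and> continuous_on (closure \<Omega>) (g p)) \<longrightarrow>
      (\<forall>p>real DIM('a). solves_p_laplace \<Omega> p (g p) (u p)) \<longrightarrow>
      in_W1infty \<Omega> ginf \<and> continuous_on (closure \<Omega>) ginf \<and>
        (\<exists>K. K-lipschitz_on (frontier \<Omega>) ginf) \<longrightarrow>
      in_W1infty \<Omega> uinf \<and> solves_inf_laplace \<Omega> ginf uinf \<longrightarrow>
      (\<forall>p>real DIM('a). \<alpha> p \<in> {1 - real DIM('a) / p..1} \<and> in_holder_space (closure \<Omega>) (\<alpha> p) (u p)) \<longrightarrow>
      H = Limsup at_top (\<lambda>p::real. holder_seminorm (closure \<Omega>) (\<alpha> p) (u p)) \<longrightarrow>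
      H < \<infinity> \<longrightarrow>
      (\<forall>\<^sub>F p::real in at_top. p > real DIM('a) \<and>
         sup_norm_on (closure \<Omega>) (\<lambda>x. u p x - uinf x)
         \<le> ereal (C1 H (holder_norm (closure \<Omega>) 1 uinf)
                    * ((real DIM('a) - 1) / (p - 1)) powr (\<alpha> p / (2 * \<alpha> p + 2)))
           + sup_norm_on (frontier \<Omega>) (\<lambda>x. g p x - ginf x)) \<and>
      (\<forall>\<gamma>::real. ess_inf_on \<Omega> (\<lambda>x. norm (weak_gradient \<Omega> uinf x)) = ereal \<gamma> \<and> \<gamma> > 0 \<longrightarrow>
        (\<forall>\<^sub>F p::real in at_top. p > real DIM('a) \<and>
           sup_norm_on (closure \<Omega>) (\<lambda>x. u p x - uinf x)
           \<le> ereal (C2 H (holder_norm (closure \<Omega>) 1 uinf) / \<gamma>\<^sup>2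
                      * ((real DIM('a) - 1) / (p - 1)) powr (\<alpha> p / 2))
             + sup_norm_on (frontier \<Omega>) (\<lambda>x. g p x - ginf x))))"
proof -
  have \<Omega>: "open \<Omega>" "bounded \<Omega>" "\<Omega> \<noteq> {}" using assms by auto
  let ?d = "real DIM('a)" and ?S = "closure \<Omega>"
  have d1: "?d \<ge> 1" by (simp add: DIM_ge_Suc0)
  have dm: "diameter \<Omega> \<ge> 0" using \<Omega>(2) by (rule diameter_ge_0)
  \<comment> \<open>Since the limes superior \<open>H\<close> lies strictly below this number, the
    seminorms do so too for all large \<open>p\<close>. The absolute value makes it at least 1 for
    every argument, and infinite arguments are read as 0.\<close>
  define Ah where "Ah h = \<bar>real_of_ereal h\<bar> + 1" for h
  define Ll where "Ll l = \<bar>real_of_ereal l\<bar>" for l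
  define C1 where "C1 h l = 3 * (Ah h + Ll l) + 4 * Ah h * (Ll l + 2 * (diameter \<Omega> + 2))\<^sup>2 + 2 * (diameter \<Omega> + 2)" for h l
  \<comment> \<open>The final 1 only secures positivity, since the other terms vanish when
    \<open>Ll l = 0\<close>.\<close>
  define C2 where "C2 h l = 3 * (Ah h + Ll l) * (Ll l)\<^sup>2 + 4 * Ah h * (Ll l)\<^sup>2 + 1" for h l
  have Ah1: "Ah h \<ge> 1" and Ll0: "Ll l \<ge> 0" for h l unfolding Ah_def Ll_def by linarith+
  have pos: "C1 h l > 0" "C2 h l > 0" for h l
  proof -
    have 1: "3 * (Ah h + Ll l) + 4 * Ah h * (Ll l + 2 * (diameter \<Omega> + 2))\<^sup>2 \<ge> 0"
      and 2: "3 * (Ah h + Ll l) * (Ll l)\<^sup>2 + 4 * Ah h * (Ll l)\<^sup>2 \<ge> 0"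
      using Ah1[of h] Ll0[of l] by (intro add_nonneg_nonneg mult_nonneg_nonneg; simp)+
    show "C1 h l > 0" unfolding C1_def by (rule add_nonneg_pos[OF 1]) (use dm in simp)
    show "C2 h l > 0" unfolding C2_def by (rule add_nonneg_pos[OF 2]) simp
  qed
  show ?thesis
  proof (rule exI[of _ C1], rule exI[of _ C2], intro conjI allI impI)
    show "C1 h l > 0" "C2 h l > 0" for h l by (rule pos)+
  next
    fix g u :: "real \<Rightarrow> 'a \<Rightarrow> real" and \<alpha> :: "real \<Rightarrow> real" and ginf uinf :: "'a \<Rightarrow> real" and H :: ereal
    assume g: "\<forall>p>?d. in_W1p \<Omega> p (g p) \<and> continuous_on ?S (g p)"
      and u: "\<forall>p>?d. solves_p_laplace \<Omega> p (g p) (u p)"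
      and ginf: "in_W1infty \<Omega> ginf \<and> continuous_on ?S ginf \<and> (\<exists>K. K-lipschitz_on (frontier \<Omega>) ginf)"
      and uinf: "in_W1infty \<Omega> uinf \<and> solves_inf_laplace \<Omega> ginf uinf"
      and \<alpha>: "\<forall>p>?d. \<alpha> p \<in> {1 - ?d / p..1} \<and> in_holder_space ?S (\<alpha> p) (u p)"
      and H: "H = Limsup at_top (\<lambda>p. holder_seminorm ?S (\<alpha> p) (u p))" "H < \<infinity>"
    have vinf: "solves_inf_laplace \<Omega> ginf uinf" using uinf by blast
    have cv: "continuous_on ?S uinf" and bv: "\<And>x. x \<in> frontier \<Omega> \<Longrightarrow> uinf x = ginf x"
      and qv: "quad_subsolution \<Omega> uinf" "quad_subsolution \<Omega> (\<lambda>x. - uinf x)"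
      using vinf by (auto simp: solves_inf_laplace_def intro: viscosity_subsolution_imp_quad viscosity_supersolution_imp_quad)
    have cv': "continuous_on \<Omega> uinf" using cv closure_subset by (rule continuous_on_subset)
    have cone: "cone_above 1 \<Omega> uinf" "cone_above 1 \<Omega> (\<lambda>x. - uinf x)"
      using quad_subsolution_cone_above[OF qv(1) cv'] quad_subsolution_cone_above[OF qv(2) continuous_on_minus[OF cv']] by auto
    obtain K0 where K0: "K0-lipschitz_on (frontier \<Omega>) ginf" using ginf by blast
    obtain K where K: "\<And>x y. x \<in> ?S \<Longrightarrow> y \<in> ?S \<Longrightarrow> \<bar>uinf x - uinf y\<bar> \<le> K * dist x y"
      by (rule inf_laplace_Lipschitz[OF \<Omega>(1,2) vinf K0]) (rule that)
    obtain l where l: "l \<ge> 0" "holder_norm ?S 1 uinf = ereal l" "\<And>x. x \<in> ?S \<Longrightarrow> \<bar>uinf x\<bar> \<le> l"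
      "\<And>x y. x \<in> ?S \<Longrightarrow> y \<in> ?S \<Longrightarrow> \<bar>uinf x - uinf y\<bar> \<le> l * dist x y"
      by (rule holder_norm_Lipschitz[OF \<Omega> cv K]) (assumption+, rule that)
    have Ll: "Ll (holder_norm ?S 1 uinf) = l" using l by (simp add: Ll_def)
    define A where "A = Ah H"
    have A: "A \<ge> 1" using Ah1 by (simp add: A_def)
    have HA: "H < ereal A" using H(2) by (cases H) (auto simp: A_def Ah_def)
    have ev: "\<forall>\<^sub>F p in at_top. p > ?d \<and> holder_seminorm ?S (\<alpha> p) (u p) < ereal A"
      using Limsup_lessD[OF HA[unfolded H(1)]] eventually_gt_at_top[of ?d] by eventually_elim simp
    have fne: "frontier \<Omega> \<noteq> {}" using \<Omega> by (auto simp: frontier_eq_empty)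
    \<comment> \<open>An infinite boundary term makes the inequality trivial, and minus infinity is
      excluded because a nonempty bounded open set has a nonempty frontier. There remains a real
      bound \<open>m\<close>, to which the pointwise estimate applies.\<close>
    have key: "sup_norm_on ?S (\<lambda>x. u p x - uinf x) \<le> ereal c + sup_norm_on (frontier \<Omega>) (\<lambda>x. g p x - ginf x)"
      if p: "p > ?d" and est: "\<And>m x. (\<And>x. x \<in> frontier \<Omega> \<Longrightarrow> \<bar>u p x - uinf x\<bar> \<le> m) \<Longrightarrow> x \<in> ?S \<Longrightarrow> \<bar>u p x - uinf x\<bar> \<le> m + c" for p c
    proof (cases "sup_norm_on (frontier \<Omega>) (\<lambda>x. g p x - ginf x)")
      case (real m)
      have "\<bar>u p x - uinf x\<bar> \<le> m" if x: "x \<in> frontier \<Omega>" for x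
      proof -
        have "ereal \<bar>g p x - ginf x\<bar> \<le> ereal m"
          unfolding real[symmetric] sup_norm_on_def by (rule SUP_upper[OF x])
        moreover have "u p x = g p x" using u p x unfolding solves_p_laplace_def by blast
        ultimately show ?thesis using bv[OF x] by simp
      qed
      then have "\<bar>u p x - uinf x\<bar> \<le> m + c" if "x \<in> ?S" for x using est that by blast
      then show ?thesis unfolding real sup_norm_on_def[of ?S] by (intro SUP_least) (simp add: add.commute)
    next
      case MInf
      obtain x where x: "x \<in> frontier \<Omega>" using fne by blast
      have "ereal \<bar>g p x - ginf x\<bar> \<le> sup_norm_on (frontier \<Omega>) (\<lambda>x. g p x - ginf x)"
        unfolding sup_norm_on_def by (rule SUP_upper[OF x])
      then show ?thesis using MInf by simp
    qed simp
    have min: "\<exists>G. p_minimizer \<Omega> p (u p) G" if p: "p > ?d" for p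
    proof -
      have p1: "p \<ge> 1" using p d1 by linarith
      show ?thesis using solves_p_laplace_imp_p_minimizer[OF \<Omega>(1,2) p1] g u p by blast
    qed
    have \<alpha>p: "0 < \<alpha> p" "\<alpha> p \<le> 1" if p: "p > ?d" for p
    proof -
      have "?d / p < 1" using p d1 by simp
      moreover have "1 - ?d / p \<le> \<alpha> p" "\<alpha> p \<le> 1" using \<alpha> p by auto
      ultimately show "0 < \<alpha> p" "\<alpha> p \<le> 1" by linarith+
    qed
    have \<alpha>lo: "1 - ?d / p \<le> \<alpha> p" if "p > ?d" for p using \<alpha> that by auto
    have B: "8 * A * (l + 2 * (diameter \<Omega> + 2)) > 0" using A l(1) dm by (intro mult_pos_pos) auto
    have sm1: "\<forall>\<^sub>F p in at_top. ((?d - 1) / (p - 1)) powr (\<alpha> p / (2 * \<alpha> p + 2)) \<le> min 1 (1 / (8 * A * (l + 2 * (diameter \<Omega> + 2))))"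
    proof (rule eventually_rate_small[OF d1 \<alpha>lo])
      show "1 / 6 \<le> a / (2 * a + 2)" if "1 / 2 \<le> a" for a :: real using that by (simp add: field_simps)
    qed (use B in auto)
    show "\<forall>\<^sub>F p in at_top. p > ?d \<and> sup_norm_on ?S (\<lambda>x. u p x - uinf x)
         \<le> ereal (C1 H (holder_norm ?S 1 uinf) * ((?d - 1) / (p - 1)) powr (\<alpha> p / (2 * \<alpha> p + 2)))
           + sup_norm_on (frontier \<Omega>) (\<lambda>x. g p x - ginf x)"
      using ev sm1
    proof eventually_elim
      case (elim p)
      then have p: "p > ?d" and hs: "holder_seminorm ?S (\<alpha> p) (u p) \<le> ereal A" by auto
      obtain G where G: "p_minimizer \<Omega> p (u p) G" using min[OF p] by blast
      have "\<bar>u p x - uinf x\<bar> \<le> m + C1 H (holder_norm ?S 1 uinf) * ((?d - 1) / (p - 1)) powr (\<alpha> p / (2 * \<alpha> p + 2))"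
        if m: "\<And>x. x \<in> frontier \<Omega> \<Longrightarrow> \<bar>u p x - uinf x\<bar> \<le> m" and x: "x \<in> ?S" for m x
        unfolding C1_def Ll A_def[symmetric]
        by (rule two_sided_estimates(1)[OF \<Omega> p G cv cone \<alpha>p[OF p] A l(1) holder_seminorm_bound[OF hs] l(4,3) m x elim(2)])
      then show ?case using key[OF p] p by blast
    qed
    fix \<gamma> :: real
    assume \<gamma>: "ess_inf_on \<Omega> (\<lambda>x. norm (weak_gradient \<Omega> uinf x)) = ereal \<gamma> \<and> \<gamma> > 0"
    have wg: "has_weak_gradient \<Omega> uinf (weak_gradient \<Omega> uinf)"
      using uinf weak_gradient_AE(1)[OF \<Omega>(1)] unfolding in_W1infty_def by blast
    have AE: "AE y in lebesgue_on \<Omega>. norm (weak_gradient \<Omega> uinf y) \<ge> \<gamma>" using \<gamma> by (intro ess_inf_on_AE) blast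
    have B2: "8 * A * (l + 1) > 0" using A l(1) by (intro mult_pos_pos) auto
    have sm2: "\<forall>\<^sub>F p in at_top. ((?d - 1) / (p - 1)) powr (\<alpha> p / 2) \<le> min 1 (\<gamma>\<^sup>2 / (8 * A * (l + 1)))"
    proof (rule eventually_rate_small[OF d1 \<alpha>lo])
      show "1 / 4 \<le> a / 2" if "1 / 2 \<le> a" for a :: real using that by simp
    qed (use B2 \<gamma> in auto)
    show "\<forall>\<^sub>F p in at_top. p > ?d \<and> sup_norm_on ?S (\<lambda>x. u p x - uinf x)
           \<le> ereal (C2 H (holder_norm ?S 1 uinf) / \<gamma>\<^sup>2 * ((?d - 1) / (p - 1)) powr (\<alpha> p / 2))
             + sup_norm_on (frontier \<Omega>) (\<lambda>x. g p x - ginf x)"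
      using ev sm2
    proof eventually_elim
      case (elim p)
      then have p: "p > ?d" and hs: "holder_seminorm ?S (\<alpha> p) (u p) \<le> ereal A" by auto
      obtain G where G: "p_minimizer \<Omega> p (u p) G" using min[OF p] by blast
      have "\<bar>u p x - uinf x\<bar> \<le> m + C2 H (holder_norm ?S 1 uinf) / \<gamma>\<^sup>2 * ((?d - 1) / (p - 1)) powr (\<alpha> p / 2)"
        if m: "\<And>x. x \<in> frontier \<Omega> \<Longrightarrow> \<bar>u p x - uinf x\<bar> \<le> m" and x: "x \<in> ?S" for m x
        unfolding C2_def Ll A_def[symmetric]
        by (rule two_sided_estimates(2)[OF \<Omega> p G cv cone \<alpha>p[OF p] A l(1) holder_seminorm_bound[OF hs] l(4,3) m x _ wg AE elim(2)])
          (use \<gamma> in auto)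
      then show ?case using key[OF p] p by blast
    qed
  qed
qed

end
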